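(* Let $\mathcal{M}\subset\mathbb{R}^3$ be a two-dimensional (embedded) minimal tube with axis $Ox_3$ whose Gauss map $\gamma:\mathcal{M}\to S^2$ is univalent (injective), and let $\alpha(\mathcal{M})$ be the angle between its flow vector $J(\mathcal{M})$ and $e_3$. If $\alpha(\mathcal{M})>0$, then $\mathcal{M}$ has finite life-time, i.e. $|t(\mathcal{M})|<\infty$.
   Context: Let $M$ be an orientable Riemannian $2$-manifold and $x:M\to\mathbb{R}^3$ an embedding (the metric of $M$ being the induced one) whose image is the surface $\mathcal{M}$; $M$ is identified with $\mathcal{M}=x(M)$. Let $e_1,e_2,e_3$ be the standard orthonormal basis and $\Pi_t=\{x\in\mathbb{R}^3: x_3=t\}$. Tube: $\mathcal{M}$ is a tube with axis $Ox_3$ and projection interval $t(\mathcal{M})$ (an open interval of $\mathbb{R}$) if (1) for all $t\in t(\mathcal{M})$ the cross-section $\Sigma_t=\mathcal{M}\cap\Pi_t$ is a nonempty compact set lying in the interior of $\mathcal{M}$ (i.e. $x^{-1}(\Sigma_t)$ is a compact subset of $M$); and (2) for all $t_1,t_2\in t(\mathcal{M})$ any portion of $\mathcal{M}$ situated between $\Pi_{t_1}$ and $\Pi_{t_2}$ is compact. The length $|t(\mathcal{M})|$ of the projection interval is called the life-time of $\mathcal{M}$. The tube is minimal if it has zero mean curvature. Flow vector: for a regular value $t\in t(\mathcal{M})$ of $x_3|_{\mathcal{M}}$, let $\nu$ be the unit normal to $\Sigma_t$, tangent to $\mathcal{M}$, exterior to $\mathcal{M}\cap\{x_3<t\}$ (so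 $\langle\nu,e_3\rangle>0$ on $\Sigma_t$). The flow vector $J(\mathcal{M})=J(\Sigma_t)\in\mathbb{R}^3$ is defined by $\langle e,J(\Sigma_t)\rangle=\int_{\Sigma_t}\langle e,\nu\rangle$ for all $e\in\mathbb{R}^3$ (integration with respect to arc length); it does not depend on the choice of the regular value $t$, and $\langle J(\mathcal{M}),e_3\rangle>0$. Gauss map: $\gamma(m)\in S^{2}$ is the unit normal to $\mathcal{M}$ at $m$ (a continuous choice given by the orientation). *)

theory Defs
  imports "HOL-Analysis.Analysis"
begin

section \<open>Smooth maps and embedded surfaces in three-space\<close>

primrec Ck_on :: "nat \<Rightarrow> ('a::euclidean_space \<Rightarrow> 'b::euclidean_space) \<Rightarrow> 'a set \<Rightarrow> bool" where
  "Ck_on 0 f U \<longleftrightarrow> continuous_on U f"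
| "Ck_on (Suc k) f U \<longleftrightarrow>
     f differentiable_on U \<and> (\<forall>v. Ck_on k (\<lambda>x. frechet_derivative f (at x) v) U)"

text \<open>This is only meaningful for open \<open>U\<close>, and it is only used for such.\<close>

definition smooth_on :: "('a::euclidean_space \<Rightarrow> 'b::euclidean_space) \<Rightarrow> 'a set \<Rightarrow> bool" where
  "smooth_on f U \<longleftrightarrow> (\<forall>k. Ck_on k f U)"

text \<open>A local parametrization of the surface \<open>S\<close> is a smooth immersion of an open plane set
  which is a homeomorphism onto a relatively open part of \<open>S\<close>.\<close>

definition local_param :: "(real^3) set \<Rightarrow> (real^2 \<Rightarrow> real^3) \<Rightarrow> (real^2) set \<Rightarrow> bool" where
  "local_param S \<phi> W \<longleftrightarrow>
     open W \<and> smooth_on \<phi> W \<and>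
     (\<forall>w\<in>W. inj (frechet_derivative \<phi> (at w))) \<and>
     (\<exists>\<psi>. homeomorphism W (\<phi> ` W) \<phi> \<psi>) \<and>
     openin (top_of_set S) (\<phi> ` W)"

text \<open>The image of an embedding of a surface without boundary, with the induced structure;
  it need be neither closed in space nor connected.\<close>

definition embedded_surface :: "(real^3) set \<Rightarrow> bool" where
  "embedded_surface S \<longleftrightarrow> (\<forall>p\<in>S. \<exists>\<phi> W. local_param S \<phi> W \<and> p \<in> \<phi> ` W)"

definition tangent_space :: "(real^3) set \<Rightarrow> real^3 \<Rightarrow> (real^3) set" where
  "tangent_space S p =
     {v. \<exists>\<phi> W w. local_param S \<phi> W \<and> w \<in> W \<and> \<phi> w = p \<and> v \<in> range (frechet_derivative \<phi> (at w))}"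

text \<open>For an embedded surface \<open>S\<close>, an orientation is a choice of such a map; \<open>S\<close> is orientable
  iff one exists.\<close>

definition gauss_map :: "(real^3) set \<Rightarrow> (real^3 \<Rightarrow> real^3) \<Rightarrow> bool" where
  "gauss_map S \<gamma> \<longleftrightarrow>
     continuous_on S \<gamma> \<and> (\<forall>p\<in>S. norm (\<gamma> p) = 1 \<and> (\<forall>v\<in>tangent_space S p. \<gamma> p \<bullet> v = 0))"

section \<open>Mean curvature\<close>

definition pd :: "2 \<Rightarrow> (real^2 \<Rightarrow> real^3) \<Rightarrow> real^2 \<Rightarrow> real^3" where
  "pd i \<phi> w = frechet_derivative \<phi> (at w) (axis i 1)"

definition param_normal :: "(real^2 \<Rightarrow> real^3) \<Rightarrow> real^2 \<Rightarrow> real^3" where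
  "param_normal \<phi> w = sgn (cross3 (pd 1 \<phi> w) (pd 2 \<phi> w))"

definition first_form :: "(real^2 \<Rightarrow> real^3) \<Rightarrow> real^2 \<Rightarrow> 2 \<Rightarrow> 2 \<Rightarrow> real" where
  "first_form \<phi> w i j = pd i \<phi> w \<bullet> pd j \<phi> w"

definition second_form :: "(real^2 \<Rightarrow> real^3) \<Rightarrow> real^2 \<Rightarrow> 2 \<Rightarrow> 2 \<Rightarrow> real" where
  "second_form \<phi> w i j = pd j (pd i \<phi>) w \<bullet> param_normal \<phi> w"

text \<open>Half the trace of the second fundamental form with respect to the first one,
  \<open>(e G - 2 f F + g E) / (2 (E G - F\<^sup>2))\<close> in Gauss's notation.\<close>

definition mean_curvature :: "(real^2 \<Rightarrow> real^3) \<Rightarrow> real^2 \<Rightarrow> real" where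
  "mean_curvature \<phi> w =
     (second_form \<phi> w 1 1 * first_form \<phi> w 2 2
       - 2 * second_form \<phi> w 1 2 * first_form \<phi> w 1 2
       + second_form \<phi> w 2 2 * first_form \<phi> w 1 1)
     / (2 * (first_form \<phi> w 1 1 * first_form \<phi> w 2 2 - (first_form \<phi> w 1 2)\<^sup>2))"

definition minimal_surface :: "(real^3) set \<Rightarrow> bool" where
  "minimal_surface S \<longleftrightarrow>
     embedded_surface S \<and> (\<forall>\<phi> W. local_param S \<phi> W \<longrightarrow> (\<forall>w\<in>W. mean_curvature \<phi> w = 0))"

section \<open>Tubes\<close>

definition e3 :: "real^3" where
  "e3 = axis 3 1"

definition height_plane :: "real \<Rightarrow> (real^3) set" where
  "height_plane t = {p. p $ 3 = t}"

definition cross_section :: "(real^3) set \<Rightarrow> real \<Rightarrow> (real^3) set" where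
  "cross_section S t = S \<inter> height_plane t"

text \<open>\<open>S\<close> is a tube with axis the third coordinate axis and projection interval \<open>I\<close>.
  An embedded surface has no boundary points, so every cross-section lies in its interior.
  The surface is allowed to continue outside the slab over \<open>I\<close>.\<close>

definition tube :: "(real^3) set \<Rightarrow> real set \<Rightarrow> bool" where
  "tube S I \<longleftrightarrow>
     embedded_surface S \<and>
     open I \<and> is_interval I \<and> I \<noteq> {} \<and>
     (\<forall>t\<in>I. cross_section S t \<noteq> {} \<and> compact (cross_section S t)) \<and>
     (\<forall>t1\<in>I. \<forall>t2\<in>I. compact (S \<inter> {p. t1 \<le> p $ 3 \<and> p $ 3 \<le> t2}))"

definition life_time :: "real set \<Rightarrow> ennreal" where
  "life_time I = emeasure lborel I"

section \<open>The flow vector\<close>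

definition regular_value :: "(real^3) set \<Rightarrow> real \<Rightarrow> bool" where
  "regular_value S t \<longleftrightarrow> (\<forall>p\<in>cross_section S t. \<exists>v\<in>tangent_space S p. v $ 3 \<noteq> 0)"

text \<open>At a point of the cross-section over a regular value, the tangent line of the
  cross-section consists of the horizontal tangent vectors of \<open>S\<close>. The condition
  \<open>n \<bullet> e3 > 0\<close> says that the normal points out of the part of \<open>S\<close> below the section.\<close>

definition conormal :: "(real^3) set \<Rightarrow> real^3 \<Rightarrow> real^3" where
  "conormal S p =
     (THE n. n \<in> tangent_space S p \<and> norm n = 1 \<and>
             (\<forall>v\<in>tangent_space S p. v $ 3 = 0 \<longrightarrow> n \<bullet> v = 0) \<and> n \<bullet> e3 > 0)"

definition regular_arc :: "(real \<Rightarrow> real^3) \<Rightarrow> real \<Rightarrow> real \<Rightarrow> bool" where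
  "regular_arc c a b \<longleftrightarrow>
     c C1_differentiable_on {a<..<b} \<and> inj_on c {a<..<b} \<and>
     (\<forall>s\<in>{a<..<b}. vector_derivative c (at s) \<noteq> 0)"

text \<open>Arc length as a Borel measure on a one-dimensional submanifold \<open>\<Sigma>\<close>: it is determined by
  its values on parametrized pieces, since countably many regular arcs cover \<open>\<Sigma>\<close>.\<close>

definition arc_length_measure :: "(real^3) set \<Rightarrow> (real^3) measure" where
  "arc_length_measure \<Sigma> =
     (THE \<mu>. sets \<mu> = sets (restrict_space borel \<Sigma>) \<and>
        (\<forall>c a b A. regular_arc c a b \<and> c ` {a<..<b} \<subseteq> \<Sigma> \<and> A \<in> sets borel \<and> A \<subseteq> {a<..<b} \<longrightarrow>
           emeasure \<mu> (c ` A) =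
             (\<integral>\<^sup>+ s. ennreal (norm (vector_derivative c (at s))) * indicator A s \<partial>lborel)))"

text \<open>Vector-valued integral, so that \<open>e \<bullet> section_flow S t\<close> is the integral of
  \<open>e \<bullet> conormal S p\<close> for every vector \<open>e\<close>.\<close>

definition section_flow :: "(real^3) set \<Rightarrow> real \<Rightarrow> real^3" where
  "section_flow S t = (\<integral>p. conormal S p \<partial>arc_length_measure (cross_section S t))"

text \<open>For a minimal tube, regular values exist in \<open>I\<close> and the choice of one is immaterial.\<close>

definition flow_vector :: "(real^3) set \<Rightarrow> real set \<Rightarrow> real^3" where
  "flow_vector S I = section_flow S (SOME t. t \<in> I \<and> regular_value S t)"

definition angle_between :: "real^3 \<Rightarrow> real^3 \<Rightarrow> real" where
  "angle_between u v = arccos (u \<bullet> v / (norm u * norm v))"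

end

theory Submission
  imports Defs "HOL-Complex_Analysis.Complex_Analysis" "HOL-Probability.Sinc_Integral"
begin

text \<open>
  For a minimal surface the stereographic projection of the Gauss map is conformal, and if the Gauss
  map \<open>n\<close> is injective, it is a global conformal coordinate \<open>w\<close>. In it the inverse \<open>X\<close> has derivative
  \<open>h \<mapsto> Re h E + Im h (n \<times> E)\<close>, and the coordinate functions \<open>X\<^sub>j\<close> are the real parts of local primitives
  of the holomorphic functions \<open>f\<^sub>j = E\<^sub>j - i (n \<times> E)\<^sub>j\<close>. The Dirichlet products
  \<open>\<integral> h (X\<^sub>3) Re (f\<^sub>j cnj f\<^sub>3) dw\<close> equal the \<open>j\<close>-th component of the flow vector times \<open>\<integral> h\<close>.

  Let \<open>j \<in> {1, 2}\<close> and let \<open>i\<close> be the other horizontal index. At a maximum of \<open>X\<^sub>i\<close> on a component of a level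
  curve of \<open>X\<^sub>3\<close> one has \<open>n\<^sub>j = 0\<close>. Since the spherical image has finite area, a length-area argument over
  an infinitely long projection interval then makes \<open>n\<^sub>1\<close> and \<open>n\<^sub>2\<close> at most \<open>\<epsilon>\<close> on a whole level curve, hence
  on a thin slab around it. There \<open>n\<^sub>3\<close> has a constant sign \<open>s\<close> on each component. With \<open>\<lambda> = \<bar>E\<bar>\<^sup>2\<close>, the
  integral of \<open>h (X\<^sub>3) \<lambda> n\<^sub>j\<close>, the Jacobian of \<open>(X\<^sub>3, X\<^sub>i)\<close> up to sign, vanishes over \<open>{s n\<^sub>3 > 0}\<close>, so in the
  Dirichlet product \<open>- \<integral> h (X\<^sub>3) \<lambda> n\<^sub>j n\<^sub>3\<close> one may replace \<open>n\<^sub>3\<close> by \<open>n\<^sub>3 - s\<close>. As \<open>\<bar>n\<^sub>3 - s\<bar> \<le> 1 - n\<^sub>3\<^sup>2\<close>, it is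
  at most \<open>\<epsilon>\<close> times the vertical one. The flux is the same on all levels, so its horizontal part is zero.
\<close>

unbundle no fps_syntax

section \<open>Calculus in the plane\<close>

text \<open>Fluxes are tested against functions of the height instead of being integrated over level
  curves. Slabs are compact, so integration by parts leaves no boundary terms, and levels through
  critical points of the height need no description as curves. Curves appear at a single regular
  level only, where the flow vector as defined, with its arc-length measure, is recovered from the
  tested flux by continuity in the level. The length-area step is a comparison of growth. The
  vertical flux over heights of length \<open>L\<close> is linear in \<open>L\<close>, and so is the
  lower bound \<delta> L for the area swept by \<open>(n\<^sub>j, X\<^sub>3)\<close>. A weight
  \<open>s\<close> in the inequality between the means bounds this area by a multiple of
  \<open>s\<close> plus a term whose slope in \<open>L\<close> is of order 1/s; a large
  \<open>s\<close> pushes the slope below \<delta>, and a large \<open>L\<close> gives a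
  contradiction. The coordinate lives in the plane because the Gauss map omits a value: otherwise
  the surface would be a union of two compact sets over opposite hemispheres, but its heights are
  unbounded.\<close>

lemma mixed_partials_commute:
  fixes f p q pv qu :: "complex \<Rightarrow> real"
  assumes "open B" "z \<in> B"
    and f: "\<And>z. z \<in> B \<Longrightarrow> (f has_derivative (\<lambda>h. Re h * p z + Im h * q z)) (at z)"
    and p: "\<And>z. z \<in> B \<Longrightarrow> (p has_derivative (\<lambda>h. Re h * pu z + Im h * pv z)) (at z)"
    and q: "\<And>z. z \<in> B \<Longrightarrow> (q has_derivative (\<lambda>h. Re h * qu z + Im h * qv z)) (at z)"
    and cont: "continuous_on B pv" "continuous_on B qu"
  shows "pv z = qu z"
proof (rule ccontr)
  assume ne: "pv z \<noteq> qu z"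
  define e where "e = \<bar>pv z - qu z\<bar> / 2"
  have e: "e > 0" using ne by (simp add: e_def)
  have "isCont pv z" "isCont qu z"
    using cont assms(1,2) by (auto simp: continuous_on_eq_continuous_at)
  then obtain d1 d2 where d12: "d1 > 0" "d2 > 0"
      "\<And>x. dist x z < d1 \<Longrightarrow> dist (pv x) (pv z) < e"
      "\<And>x. dist x z < d2 \<Longrightarrow> dist (qu x) (qu z) < e"
    using e unfolding continuous_at_eps_delta by metis
  obtain d3 where d3: "d3 > 0" "ball z d3 \<subseteq> B"
    using assms(1,2) openE by blast
  define h where "h = min d1 (min d2 d3) / 3"
  have h: "h > 0" using d12 d3 by (simp add: h_def)
  have near: "dist (z + Complex s t) z < min d1 (min d2 d3)" if "0 \<le> s" "s \<le> h" "0 \<le> t" "t \<le> h" for s t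
  proof -
    have "cmod (Complex s t) \<le> \<bar>s\<bar> + \<bar>t\<bar>" using cmod_le[of "Complex s t"] by simp
    also have "\<dots> \<le> 2 * h" using that by simp
    also have "\<dots> < min d1 (min d2 d3)" using h unfolding h_def by linarith
    finally show ?thesis by (simp add: dist_norm)
  qed
  have inB: "z + Complex s t \<in> B" if "0 \<le> s" "s \<le> h" "0 \<le> t" "t \<le> h" for s t
    using near[OF that] d3(2) by (auto simp: dist_commute subset_iff)
  have path1: "((\<lambda>s. F (z + Complex s t)) has_real_derivative Fu (z + Complex s t)) (at s)"
    if "(F has_derivative (\<lambda>h. Re h * Fu (z + Complex s t) + Im h * Fv (z + Complex s t))) (at (z + Complex s t))"
    for F Fu Fv :: "complex \<Rightarrow> real" and s t
  proof -
    have "((\<lambda>s. z + Complex s t) has_derivative (\<lambda>h. Complex h 0)) (at s)"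
      unfolding Complex_eq by (auto intro!: derivative_eq_intros)
    from has_derivative_compose[OF this that] show ?thesis
      by (simp add: has_field_derivative_def mult_commute_abs)
  qed
  have path2: "((\<lambda>t. F (z + Complex s t)) has_real_derivative Fv (z + Complex s t)) (at t)"
    if "(F has_derivative (\<lambda>h. Re h * Fu (z + Complex s t) + Im h * Fv (z + Complex s t))) (at (z + Complex s t))"
    for F Fu Fv :: "complex \<Rightarrow> real" and s t
  proof -
    have "((\<lambda>t. z + Complex s t) has_derivative (\<lambda>h. Complex 0 h)) (at t)"
      unfolding Complex_eq by (auto intro!: derivative_eq_intros)
    from has_derivative_compose[OF this that] show ?thesis
      by (simp add: has_field_derivative_def mult_commute_abs)
  qed
  \<comment> \<open>The second difference of \<open>f\<close> over the square of side
    \<open>h\<close>. The mean value theorem, applied in either order of the variables, makes it h^2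
    times a value of \<open>pv\<close> and h^2 times a value of \<open>qu\<close>, both taken at
    points within the continuity bounds around \<open>z\<close>.\<close>
  let ?D = "f (z + Complex h h) - f (z + Complex h 0) - f (z + Complex 0 h) + f (z + Complex 0 0)"
  have "\<exists>s>0. s < h \<and> (f (z + Complex h h) - f (z + Complex h 0)) - (f (z + Complex 0 h) - f (z + Complex 0 0))
          = (h - 0) * (p (z + Complex s h) - p (z + Complex s 0))"
    by (rule MVT2) (use h in \<open>auto intro!: DERIV_diff path1[where F=f and Fu=p and Fv=q] f inB\<close>)
  then obtain s where s: "0 < s" "s < h" "?D = h * (p (z + Complex s h) - p (z + Complex s 0))" by auto
  have "\<exists>t>0. t < h \<and> p (z + Complex s h) - p (z + Complex s 0) = (h - 0) * pv (z + Complex s t)"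
    by (rule MVT2) (use h s in \<open>auto intro!: path2[where F=p and Fu=pu and Fv=pv] p inB\<close>)
  then obtain t where t: "0 < t" "t < h" "?D = h * (h * pv (z + Complex s t))" using s by auto
  have "\<exists>s>0. s < h \<and> (f (z + Complex h h) - f (z + Complex 0 h)) - (f (z + Complex h 0) - f (z + Complex 0 0))
          = (h - 0) * (q (z + Complex h s) - q (z + Complex 0 s))"
    by (rule MVT2) (use h in \<open>auto intro!: DERIV_diff path2[where F=f and Fu=p and Fv=q] f inB\<close>)
  then obtain t' where t': "0 < t'" "t' < h" "?D = h * (q (z + Complex h t') - q (z + Complex 0 t'))" by auto
  have "\<exists>t>0. t < h \<and> q (z + Complex h t') - q (z + Complex 0 t') = (h - 0) * qu (z + Complex t t')"
    by (rule MVT2) (use h t' in \<open>auto intro!: path1[where F=q and Fu=qu and Fv=qv] q inB\<close>)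
  then obtain s' where s': "0 < s'" "s' < h" "?D = h * (h * qu (z + Complex s' t'))" using t' by auto
  have "pv (z + Complex s t) = qu (z + Complex s' t')"
    using t(3) s'(3) h by simp
  moreover have "dist (pv (z + Complex s t)) (pv z) < e" "dist (qu (z + Complex s' t')) (qu z) < e"
    using d12(3,4) near[of s t] near[of s' t'] s t s' t' by auto
  ultimately have "\<bar>pv z - qu z\<bar> < 2 * e" by (simp add: dist_real_def)
  then show False by (simp add: e_def)
qed

text \<open>Poincare's lemma by radial integration from the centre: the primitive at
  \<open>z\<close> is the integral of \<open>f z t\<close> along the segment from \<open>c\<close>
  to \<open>z\<close>. The derivative under the integral is handled with bounded linear functionals,
  \<open>R\<close> and \<open>I\<close> being real and imaginary part.\<close>

lemma closed_form_has_primitive: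
  fixes P Q Pu Pv Qu Qv :: "complex \<Rightarrow> real"
  assumes P: "\<And>z. z \<in> ball c r \<Longrightarrow> (P has_derivative (\<lambda>h. Re h * Pu z + Im h * Pv z)) (at z)"
    and Q: "\<And>z. z \<in> ball c r \<Longrightarrow> (Q has_derivative (\<lambda>h. Re h * Qu z + Im h * Qv z)) (at z)"
    and cont: "continuous_on (ball c r) Pu" "continuous_on (ball c r) Pv"
      "continuous_on (ball c r) Qu" "continuous_on (ball c r) Qv"
    and closed: "\<And>z. z \<in> ball c r \<Longrightarrow> Pv z = Qu z"
  obtains F where "\<And>z. z \<in> ball c r \<Longrightarrow> (F has_derivative (\<lambda>h. Re h * P z + Im h * Q z)) (at z)"
proof -
  let ?B = "ball c r"
  define R I where "R = Blinfun Re" and "I = Blinfun Im"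
  have R: "blinfun_apply R = Re" and I: "blinfun_apply I = Im"
    by (simp_all add: R_def I_def bounded_linear_Blinfun_apply bounded_linear_Re bounded_linear_Im)
  define g where "g z t = c + of_real t * (z - c)" for z :: complex and t :: real
  have g: "g z t \<in> ?B" if "z \<in> ?B" "t \<in> {0..1}" for z t
  proof -
    have "cmod (of_real t * (z - c)) \<le> 1 * cmod (z - c)"
      unfolding norm_mult using that by (intro mult_right_mono) auto
    then show ?thesis using that by (simp add: g_def dist_norm norm_minus_commute)
  qed
  define f where "f z t = Re (z - c) * P (g z t) + Im (z - c) * Q (g z t)" for z t
  define \<alpha> where "\<alpha> z t = P (g z t) + t * (Re (z - c) * Pu (g z t) + Im (z - c) * Qu (g z t))" for z t
  define \<beta> where "\<beta> z t = Q (g z t) + t * (Re (z - c) * Pv (g z t) + Im (z - c) * Qv (g z t))" for z t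
  define fx where "fx z t = \<alpha> z t *\<^sub>R R + \<beta> z t *\<^sub>R I" for z t
  have contPQ: "continuous_on ?B P" "continuous_on ?B Q"
    using P Q by (auto intro!: continuous_at_imp_continuous_on has_derivative_continuous)
  have contg: "continuous_on A (\<lambda>x. g (fst x) (snd x))" for A
    unfolding g_def by (intro continuous_intros)
  have contg': "continuous_on A (\<lambda>t. g z t)" for A z
    unfolding g_def by (intro continuous_intros)
  have deriv: "((\<lambda>z. f z t) has_derivative blinfun_apply (fx z t)) (at z within ?B)"
    if "z \<in> ?B" "t \<in> cbox 0 1" for z t
  proof -
    have gz: "g z t \<in> ?B" using g that by auto
    have dg: "((\<lambda>z. g z t) has_derivative (\<lambda>h. of_real t * h)) (at z)"
      unfolding g_def by (auto intro!: derivative_eq_intros)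
    have "((\<lambda>z. f z t) has_derivative blinfun_apply (fx z t)) (at z)"
      unfolding f_def fx_def \<alpha>_def \<beta>_def
      by (rule derivative_eq_intros has_derivative_compose[OF dg P[OF gz]] has_derivative_compose[OF dg Q[OF gz]] refl)+
        (auto simp: R I blinfun.bilinear_simps algebra_simps)
    then show ?thesis by (rule has_derivative_at_withinI)
  qed
  have main: "(fx z has_integral P z *\<^sub>R R + Q z *\<^sub>R I) {0..1}" if z: "z \<in> ?B" for z
  proof -
    \<comment> \<open>Closedness identifies the \<open>z\<close>-derivative of the integrand with
      the \<open>t\<close>-derivative of t (P, Q) along the segment, so the fundamental theorem
      evaluates its integral.\<close>
    have "((\<lambda>t. (t * P (g z t)) *\<^sub>R R + (t * Q (g z t)) *\<^sub>R I) has_vector_derivative fx z t) (at t within {0..1})"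
      if t: "t \<in> {0..1}" for t
    proof -
      have gz: "g z t \<in> ?B" using g that z by auto
      have dg: "((\<lambda>t. g z t) has_derivative (\<lambda>h. of_real h * (z - c))) (at t)"
        unfolding g_def by (auto intro!: derivative_eq_intros)
      have "((\<lambda>t. (t * P (g z t)) *\<^sub>R R + (t * Q (g z t)) *\<^sub>R I) has_derivative (\<lambda>h. h *\<^sub>R fx z t)) (at t)"
        unfolding fx_def \<alpha>_def \<beta>_def
        by (rule derivative_eq_intros has_derivative_compose[OF dg P[OF gz]] has_derivative_compose[OF dg Q[OF gz]] refl)+
          (auto simp: algebra_simps closed[OF gz])
      then show ?thesis
        unfolding has_vector_derivative_def by (rule has_derivative_at_withinI)
    qed
    from fundamental_theorem_of_calculus[OF zero_le_one this]
    show ?thesis by (simp add: g_def)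
  qed
  have D: "((\<lambda>z. integral (cbox 0 1) (f z)) has_derivative integral (cbox 0 1) (fx z)) (at z within ?B)"
    if "z \<in> ?B" for z
  proof (rule leibniz_rule[OF deriv])
    show "f z integrable_on cbox 0 1" if "z \<in> ?B" for z
      unfolding f_def
      by (intro integrable_continuous continuous_intros continuous_on_compose2[OF contPQ(1) contg']
          continuous_on_compose2[OF contPQ(2) contg']) (use g that in auto)
    have sub: "(\<lambda>x. g (fst x) (snd x)) ` (?B \<times> cbox 0 1) \<subseteq> ?B" using g by auto
    show "continuous_on (?B \<times> cbox 0 1) (\<lambda>(x, t). fx x t)"
      unfolding fx_def \<alpha>_def \<beta>_def split_beta
      by (intro continuous_intros continuous_on_compose2[OF contPQ(1) contg sub]
         continuous_on_compose2[OF contPQ(2) contg sub] continuous_on_compose2[OF cont(1) contg sub]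
         continuous_on_compose2[OF cont(2) contg sub] continuous_on_compose2[OF cont(3) contg sub]
         continuous_on_compose2[OF cont(4) contg sub])
  qed (use that in auto)
  have "((\<lambda>z. integral (cbox 0 1) (f z)) has_derivative (\<lambda>h. Re h * P z + Im h * Q z)) (at z)"
    if "z \<in> ?B" for z
  proof -
    have "integral (cbox 0 1) (fx z) = P z *\<^sub>R R + Q z *\<^sub>R I"
      using main[OF that] by (auto intro: integral_unique)
    then have "blinfun_apply (integral (cbox 0 1) (fx z)) = (\<lambda>h. Re h * P z + Im h * Q z)"
      by (auto simp: blinfun.bilinear_simps R I algebra_simps)
    with D[OF that] show ?thesis using that by (simp add: at_within_open[OF _ open_ball])
  qed
  then show thesis by (rule that)
qed

text \<open>The derivative of the inverse is given by the equation that it solves. This equation is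
  what later identifies the differential of a reparametrized surface, so no inverse matrix has to be
  carried along.\<close>

lemma planar_local_inverse:
  fixes f \<alpha> \<beta> :: "complex \<Rightarrow> complex"
  assumes "open U" "z0 \<in> U"
    and f: "\<And>z. z \<in> U \<Longrightarrow> (f has_derivative (\<lambda>h. Re h *\<^sub>R \<alpha> z + Im h *\<^sub>R \<beta> z)) (at z)"
    and cont: "continuous_on U \<alpha>" "continuous_on U \<beta>"
    and det: "Re (\<alpha> z0) * Im (\<beta> z0) - Im (\<alpha> z0) * Re (\<beta> z0) \<noteq> 0"
  obtains U' V g g' where "open U'" "U' \<subseteq> U" "z0 \<in> U'" "open V" "f z0 \<in> V" "homeomorphism U' V f g"
    "\<And>y. y \<in> V \<Longrightarrow> (g has_derivative g' y) (at y)"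
    "\<And>y h. y \<in> V \<Longrightarrow> Re (g' y h) *\<^sub>R \<alpha> (g y) + Im (g' y h) *\<^sub>R \<beta> (g y) = h"
proof -
  define f' where "f' z = Blinfun (\<lambda>h. Re h *\<^sub>R \<alpha> z + Im h *\<^sub>R \<beta> z)" for z
  have bl: "bounded_linear (\<lambda>h. Re h *\<^sub>R x + Im h *\<^sub>R y)" for x y :: complex
    by (intro bounded_linear_add bounded_linear_compose[OF bounded_linear_scaleR_left bounded_linear_Re]
        bounded_linear_compose[OF bounded_linear_scaleR_left bounded_linear_Im])
  have f': "blinfun_apply (f' z) = (\<lambda>h. Re h *\<^sub>R \<alpha> z + Im h *\<^sub>R \<beta> z)" for z
    unfolding f'_def by (rule bounded_linear_Blinfun_apply[OF bl])
  define \<delta> where "\<delta> = Re (\<alpha> z0) * Im (\<beta> z0) - Im (\<alpha> z0) * Re (\<beta> z0)"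
  have \<delta>: "\<delta> \<noteq> 0" using det by (simp add: \<delta>_def)
  \<comment> \<open>The columns of the inverse matrix at \<open>z0\<close>, by Cramer's
    rule.\<close>
  define x y where "x = Complex (Im (\<beta> z0) / \<delta>) (- Im (\<alpha> z0) / \<delta>)"
     and "y = Complex (- Re (\<beta> z0) / \<delta>) (Re (\<alpha> z0) / \<delta>)"
  define J where "J = Blinfun (\<lambda>h. Re h *\<^sub>R x + Im h *\<^sub>R y)"
  have J: "blinfun_apply J = (\<lambda>h. Re h *\<^sub>R x + Im h *\<^sub>R y)"
    unfolding J_def by (rule bounded_linear_Blinfun_apply[OF bl])
  have comp: "J o\<^sub>L f' z0 = id_blinfun"
  proof (rule blinfun_eqI)
    fix h :: complex
    have "Re (J (f' z0 h)) = Re h"  "Im (J (f' z0 h)) = Im h"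
      using \<delta> by (simp_all add: J f' x_def y_def field_simps) (simp_all add: \<delta>_def algebra_simps)
    then show "blinfun_apply (J o\<^sub>L f' z0) h = blinfun_apply id_blinfun h"
      by (simp add: complex_eq_iff)
  qed
  have cf: "continuous_on U f'"
    by (rule continuous_on_blinfun_componentwise) (auto simp: f' intro!: continuous_intros cont)
  have f2: "(f has_derivative blinfun_apply (f' z)) (at z)" if "z \<in> U" for z
    using f[OF that] by (simp add: f')
  show thesis
  proof (rule inverse_function_theorem[OF assms(1) f2 cf assms(2) comp])
    fix U' V g g'
    assume *: "open U'" "U' \<subseteq> U" "z0 \<in> U'" "open V" "f z0 \<in> V" "homeomorphism U' V f g"
      "\<And>y. y \<in> V \<Longrightarrow> (g has_derivative (g' y)) (at y)"
      "\<And>y. y \<in> V \<Longrightarrow> g' y = inv (blinfun_apply (f'(g y)))"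
      "\<And>y. y \<in> V \<Longrightarrow> bij (blinfun_apply (f'(g y)))"
    show thesis
    proof (rule that[OF *(1-7)])
    fix y h assume y: "y \<in> V"
    have "blinfun_apply (f' (g y)) (g' y h) = h"
      using *(8,9)[OF y] by (simp add: bij_is_surj surj_f_inv_f)
    then show "Re (g' y h) *\<^sub>R \<alpha> (g y) + Im (g' y h) *\<^sub>R \<beta> (g y) = h" by (simp add: f')
    qed
  qed
qed

section \<open>The complex plane as \<open>real^2\<close>, and Lebesgue integrals over it\<close>

definition plane_point :: "complex \<Rightarrow> real^2" where
  "plane_point z = Re z *\<^sub>R axis 1 1 + Im z *\<^sub>R axis 2 1"

lemma bounded_linear_plane_point: "bounded_linear plane_point"
  unfolding plane_point_def
  by (intro bounded_linear_add bounded_linear_compose[OF bounded_linear_scaleR_left bounded_linear_Re]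
      bounded_linear_compose[OF bounded_linear_scaleR_left bounded_linear_Im])

lemma plane_point_nth [simp]: "plane_point z $ 1 = Re z" "plane_point z $ 2 = Im z"
  by (simp_all add: plane_point_def axis_def)

lemma plane_point_surj: "plane_point (Complex (w $ 1) (w $ 2)) = w"
  by (simp add: vec_eq_iff forall_2)

lemma plane_point_inj: "inj plane_point"
  by (rule injI) (simp add: vec_eq_iff forall_2 complex_eq_iff)

lemma norm_plane_point [simp]: "norm (plane_point z) = cmod z"
  by (simp add: norm_vec_def L2_set_def sum_2 cmod_def)

lemma measurable_plane_point [measurable]: "plane_point \<in> borel_measurable borel"
  by (intro borel_measurable_continuous_onI linear_continuous_on bounded_linear_plane_point)

lemma set_integrable_compact_support:
  fixes g :: "'a::euclidean_space \<Rightarrow> real"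
  assumes "continuous_on \<Omega> g" "compact K" "K \<subseteq> \<Omega>" "\<And>x. x \<in> \<Omega> - K \<Longrightarrow> g x = 0"
  shows "set_integrable lborel \<Omega> g"
proof -
  have "integrable lborel (\<lambda>x. indicator K x *\<^sub>R g x)"
    using assms(1-3) by (intro borel_integrable_compact) (auto intro: continuous_on_subset)
  moreover have "(\<lambda>x. indicator K x *\<^sub>R g x) = (\<lambda>x. indicator \<Omega> x *\<^sub>R g x)"
    using assms(3,4) by (auto simp: fun_eq_iff indicator_def)
  ultimately show ?thesis by (simp add: set_integrable_def)
qed

text \<open>By translation invariance the difference quotients have integral zero.\<close>

lemma set_integral_directional_derivative:
  fixes p :: "'a::euclidean_space \<Rightarrow> real"
  assumes "open \<Omega>" and K: "compact K" "K \<subseteq> \<Omega>" and p0: "\<And>x. x \<in> \<Omega> - K \<Longrightarrow> p x = 0"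
    and p: "\<And>x. x \<in> \<Omega> \<Longrightarrow> (p has_derivative p' x) (at x)"
    and cont: "continuous_on \<Omega> (\<lambda>x. p' x e)"
  shows "set_integrable lborel \<Omega> (\<lambda>x. p' x e)" "(LINT x:\<Omega>|lborel. p' x e) = 0"
proof -
  \<comment> \<open>Extension by zero. It remains differentiable along \<open>e\<close> everywhere
    because \<open>p\<close> vanishes on \<Omega> outside a compact subset.\<close>
  define P where "P x = (if x \<in> \<Omega> then p x else 0)" for x
  define D where "D x = (if x \<in> \<Omega> then p' x e else 0)" for x
  have oK: "open (- K)" using K(1) compact_imp_closed open_Compl by blast
  have P0: "P x = 0" if "x \<notin> K" for x using p0 that by (auto simp: P_def)
  have D0: "D x = 0" if "x \<notin> K" for x
  proof (cases "x \<in> \<Omega>")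
    case True
    have "(p has_derivative (\<lambda>_. 0)) (at x)"
    proof (rule has_derivative_transform_within_open[of "\<lambda>_. 0" _ _ _ "\<Omega> - K"])
      show "open (\<Omega> - K)" using assms(1) oK by (simp add: Diff_eq open_Int)
    qed (use True that p0 in auto)
    then have "p' x = (\<lambda>_. 0)" using p[OF True] has_derivative_unique by blast
    then show ?thesis by (simp add: D_def)
  qed (simp add: D_def)
  have PD: "((\<lambda>s. P (x + s *\<^sub>R e)) has_real_derivative D (x + s *\<^sub>R e)) (at s)" for x s
  proof (cases "x + s *\<^sub>R e \<in> \<Omega>")
    case True
    have "(P has_derivative p' (x + s *\<^sub>R e)) (at (x + s *\<^sub>R e))"
      by (rule has_derivative_transform_within_open[OF p[OF True] assms(1) True]) (simp add: P_def)
    moreover have "((\<lambda>s. x + s *\<^sub>R e) has_derivative (\<lambda>h. h *\<^sub>R e)) (at s)"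
      by (auto intro!: derivative_eq_intros)
    ultimately have "((\<lambda>s. P (x + s *\<^sub>R e)) has_derivative (\<lambda>h. p' (x + s *\<^sub>R e) (h *\<^sub>R e))) (at s)"
      by (rule has_derivative_compose[rotated])
    moreover have "linear (p' (x + s *\<^sub>R e))" using p[OF True] has_derivative_linear by blast
    ultimately show ?thesis using True by (simp add: has_field_derivative_def D_def linear_scale mult_commute_abs)
  next
    case False
    then have notK: "x + s *\<^sub>R e \<in> - K" using K by auto
    have "open ((\<lambda>s. x + s *\<^sub>R e) -` (- K))"
      by (intro open_vimage oK continuous_intros)
    moreover have "((\<lambda>_. 0) has_real_derivative 0) (at s)" by simp
    ultimately have "((\<lambda>s. P (x + s *\<^sub>R e)) has_real_derivative 0) (at s)"
      using notK P0 by (elim has_field_derivative_transform_within_open) auto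
    then show ?thesis using False by (simp add: D_def)
  qed
  have "continuous_on K (\<lambda>x. p' x e)" using cont K continuous_on_subset by blast
  then have "bounded ((\<lambda>x. p' x e) ` K)" using K(1) compact_continuous_image compact_imp_bounded by blast
  then obtain M where M: "M > 0" "\<And>x. x \<in> K \<Longrightarrow> norm (p' x e) \<le> M" by (auto simp: bounded_pos)
  have DM: "\<bar>D x\<bar> \<le> M" for x using M D0[of x] K by (cases "x \<in> K") (auto simp: D_def)
  define q where "q n x = real (Suc n) * (P (x + (1 / real (Suc n)) *\<^sub>R e) - P x)" for n x
  \<comment> \<open>Contains the support of every difference quotient, since the steps are at most
    1; with the bound \<open>M\<close> it provides the dominating function.\<close>
  define K' where "K' = (\<lambda>(x, s). x - s *\<^sub>R e) ` (K \<times> {0..1})"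
  have K': "compact K'" unfolding K'_def
    by (intro compact_continuous_image compact_Times K) (auto intro!: continuous_intros simp: split_beta)
  have contP: "continuous_on UNIV P"
  proof (intro continuous_at_imp_continuous_on ballI)
    fix x
    show "isCont P x"
    proof (cases "x \<in> \<Omega>")
      case True
      have "(P has_derivative p' x) (at x)"
        by (rule has_derivative_transform_within_open[OF p[OF True] assms(1) True]) (simp add: P_def)
      then show ?thesis by (rule has_derivative_continuous)
    next
      case False
      then have "x \<in> - K" using K by auto
      then have "eventually (\<lambda>y. P y = 0) (nhds x)"
        using P0 oK by (auto simp: eventually_nhds)
      then show ?thesis using isCont_cong[of P "\<lambda>_. 0"] by auto
    qed
  qed
  have [measurable]: "P \<in> borel_measurable borel" by (rule borel_measurable_continuous_onI[OF contP])
  have suppP: "set_integrable lborel UNIV P"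
    by (rule set_integrable_compact_support[OF contP K(1)]) (use P0 in auto)
  then have intP: "integrable lborel P" by (simp add: set_integrable_def)
  have shift: "integrable lborel (\<lambda>x. P (x + c))" "integral\<^sup>L lborel (\<lambda>x. P (x + c)) = integral\<^sup>L lborel P" for c
  proof -
    have d: "distr lborel borel (\<lambda>x. x + c) = (lborel :: 'a measure)"
      using lborel_distr_plus[of c] by (simp add: add.commute[of _ c])
    show "integrable lborel (\<lambda>x. P (x + c))"
      using intP integrable_distr_eq[of "\<lambda>x. x + c" lborel borel P] by (simp add: d)
    show "integral\<^sup>L lborel (\<lambda>x. P (x + c)) = integral\<^sup>L lborel P"
      using integral_distr[of "\<lambda>x. x + c" lborel borel P] by (simp add: d)
  qed
  have q0: "integral\<^sup>L lborel (q n) = 0" for n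
    unfolding q_def using intP shift by (simp add: Bochner_Integration.integral_diff)
  have [measurable]: "q n \<in> borel_measurable borel" for n unfolding q_def by measurable
  have lim: "(\<lambda>n. q n x) \<longlonglongrightarrow> D x" for x
  proof -
    have "((\<lambda>s. (P (x + s *\<^sub>R e) - P x) / s) \<longlongrightarrow> D x) (at 0)"
      using PD[of x 0] by (simp add: has_field_derivative_iff)
    moreover have "filterlim (\<lambda>n. 1 / real (Suc n)) (at 0) sequentially"
      unfolding filterlim_at using LIMSEQ_inverse_real_of_nat by (auto simp: inverse_eq_divide)
    ultimately have "(\<lambda>n. (P (x + (1 / real (Suc n)) *\<^sub>R e) - P x) / (1 / real (Suc n))) \<longlonglongrightarrow> D x"
      by (rule filterlim_compose)
    then show ?thesis by (simp add: q_def mult.commute)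
  qed
  have bound: "norm (q n x) \<le> indicator K' x *\<^sub>R M" for n x
  proof -
    let ?s = "1 / real (Suc n)"
    have s: "0 < ?s" "?s \<le> 1" by auto
    obtain z where z: "z > 0" "z < ?s" "P (x + ?s *\<^sub>R e) - P (x + 0 *\<^sub>R e) = (?s - 0) * D (x + z *\<^sub>R e)"
      using MVT2[of 0 ?s "\<lambda>s. P (x + s *\<^sub>R e)" "\<lambda>s. D (x + s *\<^sub>R e)"] PD s by blast
    then have qz: "q n x = D (x + z *\<^sub>R e)" by (simp add: q_def)
    show ?thesis
    proof (cases "x \<in> K'")
      case True
      then show ?thesis using DM[of "x + z *\<^sub>R e"] by (simp add: qz)
    next
      case False
      have "x + z *\<^sub>R e \<notin> K"
      proof
        assume "x + z *\<^sub>R e \<in> K"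
        moreover have "z \<le> 1" using z(2) s(2) by linarith
        ultimately have "x \<in> K'" unfolding K'_def using z(1)
          by (intro image_eqI[of _ _ "(x + z *\<^sub>R e, z)"]) auto
        with False show False by simp
      qed
      then show ?thesis using D0 M(1) by (simp add: qz)
    qed
  qed
  have intM: "integrable lborel (\<lambda>x. indicator K' x *\<^sub>R M)"
    by (rule borel_integrable_compact[OF K']) auto
  have contD: "set_integrable lborel \<Omega> (\<lambda>x. p' x e)"
  proof (rule set_integrable_compact_support[OF cont K])
    show "p' x e = 0" if "x \<in> \<Omega> - K" for x using D0[of x] that by (simp add: D_def)
  qed
  then show "set_integrable lborel \<Omega> (\<lambda>x. p' x e)" .
  have Dind: "(\<lambda>x. indicator \<Omega> x *\<^sub>R p' x e) = D" by (auto simp: D_def fun_eq_iff)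
  have mD: "D \<in> borel_measurable lborel"
    using contD unfolding set_integrable_def Dind by (rule borel_measurable_integrable)
  have "(\<lambda>n. integral\<^sup>L lborel (q n)) \<longlonglongrightarrow> integral\<^sup>L lborel D"
    by (rule integral_dominated_convergence[where w="\<lambda>x. indicator K' x *\<^sub>R M"])
      (use lim bound intM mD in auto)
  then have "integral\<^sup>L lborel D = 0" by (simp add: q0 LIMSEQ_const_iff)
  then show "(LINT x:\<Omega>|lborel. p' x e) = 0" unfolding set_lebesgue_integral_def Dind .
qed

lemma distr_plane_point: "distr lborel borel plane_point = lborel"
proof (rule lborel_eqI[symmetric])
  fix l u :: "real^2" assume le: "\<And>b. b \<in> Basis \<Longrightarrow> l \<bullet> b \<le> u \<bullet> b"
  have le': "l $ i \<le> u $ i" for i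
    using le[of "axis i 1"] by (auto simp: Basis_vec_def inner_axis)
  have [measurable]: "plane_point \<in> borel_measurable lborel"
    by (intro borel_measurable_continuous_onI linear_continuous_on bounded_linear_plane_point | simp)+
  have "plane_point -` box l u = box (Complex (l $ 1) (l $ 2)) (Complex (u $ 1) (u $ 2))"
    by (auto simp: box_def Basis_complex_def Basis_vec_def inner_axis forall_2)
  then have "emeasure (distr lborel borel plane_point) (box l u) = ennreal ((u $ 1 - l $ 1) * (u $ 2 - l $ 2))"
    using le' by (simp add: emeasure_distr emeasure_lborel_box_eq Basis_complex_def mult.commute)
  also have "(u $ 1 - l $ 1) * (u $ 2 - l $ 2) = (\<Prod>b\<in>Basis. (u - l) \<bullet> b)"
  proof -
    have B: "(Basis :: (real^2) set) = {axis 1 1, axis 2 1}"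
      by (auto simp: Basis_vec_def UNIV_2)
    have "axis 1 1 \<noteq> (axis 2 1 :: real^2)" by (simp add: axis_eq_axis)
    then show ?thesis unfolding B by (simp add: inner_axis)
  qed
  finally show "emeasure (distr lborel borel plane_point) (box l u) = ennreal (\<Prod>b\<in>Basis. (u - l) \<bullet> b)" .
qed simp

lemma distr_Complex: "distr lborel borel (\<lambda>(x, y). Complex x y) = lborel"
proof (rule lborel_eqI[symmetric])
  fix l u :: complex assume le: "\<And>b. b \<in> Basis \<Longrightarrow> l \<bullet> b \<le> u \<bullet> b"
  have le': "Re l \<le> Re u" "Im l \<le> Im u" using le[of 1] le[of \<i>] by (auto simp: Basis_complex_def)
  have [measurable]: "(\<lambda>(x, y). Complex x y) \<in> borel_measurable lborel"
    unfolding Complex_eq split_beta by (auto intro!: borel_measurable_continuous_onI continuous_intros)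
  have "(\<lambda>(x, y). Complex x y) -` box l u = box (Re l) (Re u) \<times> box (Im l) (Im u)"
    by (auto simp: box_def Basis_complex_def)
  then have "emeasure (distr lborel borel (\<lambda>(x, y). Complex x y)) (box l u)
      = emeasure (lborel \<Otimes>\<^sub>M lborel) (box (Re l) (Re u) \<times> box (Im l) (Im u))"
    by (simp add: emeasure_distr lborel_prod)
  also have "\<dots> = ennreal (Re u - Re l) * ennreal (Im u - Im l)"
    using le' by (subst lborel.emeasure_pair_measure_Times) auto
  also have "\<dots> = ennreal (\<Prod>b\<in>Basis. (u - l) \<bullet> b)"
    using le' by (simp add: Basis_complex_def ennreal_mult)
  finally show "emeasure (distr lborel borel (\<lambda>(x, y). Complex x y)) (box l u) = ennreal (\<Prod>b\<in>Basis. (u - l) \<bullet> b)" .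
qed simp

lemma measurable_Complex [measurable]: "(\<lambda>(x, y). Complex x y) \<in> borel_measurable (lborel \<Otimes>\<^sub>M lborel)"
  unfolding lborel_prod Complex_eq split_beta by (auto intro!: borel_measurable_continuous_onI continuous_intros)

text \<open>The slices fix the imaginary part because that coordinate will carry the height in the
  length-area argument.\<close>

lemma emeasure_complex_slices:
  assumes "A \<in> sets (borel :: complex measure)"
  shows "emeasure lborel A = (\<integral>\<^sup>+ t. emeasure lborel {x. Complex x t \<in> A} \<partial>lborel)"
proof -
  let ?T = "\<lambda>(x, y). Complex x y"
  have "emeasure lborel A = emeasure (distr (lborel \<Otimes>\<^sub>M lborel) borel ?T) A"
    using distr_Complex by (simp add: lborel_prod)
  also have "\<dots> = emeasure (lborel \<Otimes>\<^sub>M lborel) (?T -` A \<inter> space (lborel \<Otimes>\<^sub>M lborel))"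
    using assms by (intro emeasure_distr) auto
  also have "\<dots> = (\<integral>\<^sup>+ t. emeasure lborel ((\<lambda>x. (x, t)) -` (?T -` A \<inter> space (lborel \<Otimes>\<^sub>M lborel))) \<partial>lborel)"
    by (rule lborel_pair.emeasure_pair_measure_alt2) (use assms in measurable)
  also have "(\<lambda>t. (\<lambda>x. (x, t)) -` (?T -` A \<inter> space (lborel \<Otimes>\<^sub>M lborel))) = (\<lambda>t. {x. Complex x t \<in> A})"
    by (auto simp: space_pair_measure)
  finally show ?thesis by simp
qed

lemma measurable_complex_slices:
  assumes "A \<in> sets (borel :: complex measure)"
  shows "(\<lambda>t. emeasure lborel {x. Complex x t \<in> A}) \<in> borel_measurable lborel"
proof -
  have "(\<lambda>p. case prod.swap p of (x, y) \<Rightarrow> Complex x y) \<in> borel_measurable (lborel \<Otimes>\<^sub>M lborel)"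
    unfolding lborel_prod split_beta Complex_eq by (simp, intro borel_measurable_continuous_onI continuous_intros)
  from measurable_sets[OF this assms]
  have "(\<lambda>p. case prod.swap p of (x, y) \<Rightarrow> Complex x y) -` A \<inter> space (lborel \<Otimes>\<^sub>M lborel) \<in> sets (lborel \<Otimes>\<^sub>M lborel)" .
  from lborel.measurable_emeasure_Pair[OF this]
  have "(\<lambda>t. emeasure lborel (Pair t -` ((\<lambda>p. case prod.swap p of (x, y) \<Rightarrow> Complex x y) -` A \<inter> space (lborel \<Otimes>\<^sub>M lborel)))) \<in> borel_measurable lborel" .
  also have "(\<lambda>t. Pair t -` ((\<lambda>p. case prod.swap p of (x, y) \<Rightarrow> Complex x y) -` A \<inter> space (lborel \<Otimes>\<^sub>M lborel))) = (\<lambda>t. {x. Complex x t \<in> A})"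
    by (auto simp: space_pair_measure)
  finally show ?thesis .
qed

text \<open>The integrand is a quarter of the area density of the unit sphere in stereographic
  coordinates. It is dominated by the product of 1/(1+x^2) and 1/(1+y^2), which is integrable by
  Fubini.\<close>

lemma integrable_spherical_density: "integrable lborel (\<lambda>w::complex. 1 / (1 + (cmod w)\<^sup>2)\<^sup>2)"
proof -
  have 1: "integrable lborel (\<lambda>x::real. inverse (1 + x\<^sup>2))"
    using integrable_inverse_1_plus_square by (simp add: set_integrable_def einterval_def)
  have "integrable (lborel \<Otimes>\<^sub>M lborel) (\<lambda>(x::real, y::real). inverse (1 + x\<^sup>2) * inverse (1 + y\<^sup>2))"
    using lborel_pair.integrable_product_swap
    by (intro lborel_pair.Fubini_integrable) (auto simp: 1 abs_mult)
  then have "integrable (lborel \<Otimes>\<^sub>M lborel) ((\<lambda>w. 1 / (1 + (cmod w)\<^sup>2)\<^sup>2) \<circ> (\<lambda>(x, y). Complex x y))"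
  proof (rule Bochner_Integration.integrable_bound)
    show "AE p in lborel \<Otimes>\<^sub>M lborel. norm (((\<lambda>w. 1 / (1 + (cmod w)\<^sup>2)\<^sup>2) \<circ> (\<lambda>(x, y). Complex x y)) p)
       \<le> norm (case p of (x::real, y::real) \<Rightarrow> inverse (1 + x\<^sup>2) * inverse (1 + y\<^sup>2))"
    proof (rule AE_I2, clarify)
      fix x y :: real
      have pos: "0 < 1 + x\<^sup>2" "0 < 1 + y\<^sup>2" by (simp_all add: add_pos_nonneg)
      have "(1 + a) * (1 + b) \<le> (1 + (a + b))\<^sup>2" if "a \<ge> 0" "b \<ge> 0" for a b :: real
      proof -
        have "0 \<le> a + b + a * a + a * b + b * b" using that by simp
        then show ?thesis by (simp add: power2_eq_square algebra_simps)
      qed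
      from this[of "x\<^sup>2" "y\<^sup>2"] have "(1 + x\<^sup>2) * (1 + y\<^sup>2) \<le> (1 + (x\<^sup>2 + y\<^sup>2))\<^sup>2" by simp
      then show "norm (((\<lambda>w. 1 / (1 + (cmod w)\<^sup>2)\<^sup>2) \<circ> (\<lambda>(x, y). Complex x y)) (x, y))
         \<le> norm (inverse (1 + x\<^sup>2) * inverse (1 + y\<^sup>2))"
        using pos by (simp add: cmod_power2 inverse_eq_divide frac_le)
    qed
  qed (simp add: comp_def measurable_compose[OF measurable_Complex])
  moreover have "(\<lambda>(x::real, y::real). Complex x y) \<in> borel_measurable borel"
    using measurable_Complex by (simp add: lborel_prod)
  ultimately show ?thesis
    using integrable_distr_eq[of "\<lambda>(x, y). Complex x y" "lborel \<Otimes>\<^sub>M lborel" borel "\<lambda>w. 1 / (1 + (cmod w)\<^sup>2)\<^sup>2"]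
      distr_Complex by (simp add: lborel_prod comp_def)
qed

text \<open>The image may cover points several times, hence an inequality. The Jacobian is written
  with the columns \<alpha> and \<beta>; after transport to \<open>real^2\<close> it is the
  determinant of a matrix.\<close>

lemma emeasure_image_le_integral:
  fixes F \<alpha> \<beta> :: "complex \<Rightarrow> complex"
  assumes K: "compact K"
    and F: "\<And>w. w \<in> K \<Longrightarrow> (F has_derivative (\<lambda>h. Re h *\<^sub>R \<alpha> w + Im h *\<^sub>R \<beta> w)) (at w)"
    and cont: "continuous_on K \<alpha>" "continuous_on K \<beta>"
  shows "emeasure lborel (F ` K) \<le> ennreal (LINT w:K|lborel. \<bar>Re (\<alpha> w) * Im (\<beta> w) - Im (\<alpha> w) * Re (\<beta> w)\<bar>)"
proof -
  let ?d = "\<lambda>w. \<bar>Re (\<alpha> w) * Im (\<beta> w) - Im (\<alpha> w) * Re (\<beta> w)\<bar>"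
  define \<iota> where "\<iota> v = Complex (v $ 1) (v $ 2)" for v :: "real^2"
  have \<iota>p: "\<iota> (plane_point w) = w" and p\<iota>: "plane_point (\<iota> v) = v" for w v
    by (simp_all add: \<iota>_def plane_point_surj)
  have lin\<iota>: "bounded_linear \<iota>"
    by (intro linear_conv_bounded_linear[THEN iffD1] linearI) (auto simp: \<iota>_def complex_eq_iff)
  define S where "S = plane_point ` K"
  define f where "f v = plane_point (F (\<iota> v))" for v
  define f' where "f' v h = plane_point (Re (\<iota> h) *\<^sub>R \<alpha> (\<iota> v) + Im (\<iota> h) *\<^sub>R \<beta> (\<iota> v))" for v h
  have cp: "continuous_on A plane_point" for A
    by (rule linear_continuous_on[OF bounded_linear_plane_point])
  have ci: "continuous_on A \<iota>" for A by (rule linear_continuous_on[OF lin\<iota>])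
  have S: "compact S" unfolding S_def by (intro compact_continuous_image cp K)
  have \<iota>S: "\<iota> v \<in> K \<longleftrightarrow> v \<in> S" for v
    unfolding S_def using \<iota>p p\<iota> by (metis image_iff)
  have det: "\<bar>det (matrix (f' v))\<bar> = ?d (\<iota> v)" for v
    by (simp add: det_2 matrix_def f'_def \<iota>_def axis_def algebra_simps)
  have df: "(f has_derivative f' v) (at v within S)" if "v \<in> S" for v
  proof -
    have "(\<iota> has_derivative \<iota>) (at v)" by (rule bounded_linear_imp_has_derivative[OF lin\<iota>])
    from has_derivative_compose[OF this F] that
    have "((\<lambda>v. F (\<iota> v)) has_derivative (\<lambda>h. Re (\<iota> h) *\<^sub>R \<alpha> (\<iota> v) + Im (\<iota> h) *\<^sub>R \<beta> (\<iota> v))) (at v)"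
      by (simp add: \<iota>S)
    from bounded_linear.has_derivative[OF bounded_linear_plane_point this]
    show ?thesis unfolding f_def[abs_def] f'_def[abs_def] by (rule has_derivative_at_withinI)
  qed
  have contd: "continuous_on S (\<lambda>v. ?d (\<iota> v))"
    by (intro continuous_intros continuous_on_compose2[OF cont(1) ci] continuous_on_compose2[OF cont(2) ci])
      (auto simp: \<iota>S)
  have int: "set_integrable lborel S (\<lambda>v. ?d (\<iota> v))"
    by (rule set_integrable_compact_support[OF contd S]) auto
  have Sleb: "S \<in> sets lebesgue" using S by (simp add: borel_compact)
  have int2: "(\<lambda>v. \<bar>det (matrix (f' v))\<bar>) integrable_on S"
    unfolding det using set_borel_integral_eq_integral(1)[OF int] .
  have eqint: "integral S (\<lambda>v. \<bar>det (matrix (f' v))\<bar>) = (LINT v:S|lborel. ?d (\<iota> v))"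
    unfolding det using set_borel_integral_eq_integral(2)[OF int] by simp
  have m1: "f ` S \<in> lmeasurable" and m2: "measure lebesgue (f ` S) \<le> (LINT v:S|lborel. ?d (\<iota> v))"
    using measurable_differentiable_image[OF Sleb df int2] measure_differentiable_image[OF Sleb df int2]
    by (simp_all add: eqint)
  have contF: "continuous_on K F"
    using F by (auto intro!: continuous_at_imp_continuous_on has_derivative_continuous)
  have FK: "compact (F ` K)" by (rule compact_continuous_image[OF contF K])
  have fS: "f ` S = plane_point ` (F ` K)" unfolding S_def f_def by (simp add: image_image \<iota>p)
  have cfS: "compact (f ` S)" unfolding fS by (rule compact_continuous_image[OF cp FK])
  have [measurable]: "plane_point \<in> borel_measurable lborel"
    using borel_measurable_continuous_onI[OF cp] by simp
  have "emeasure lborel (F ` K) = emeasure (distr lborel borel plane_point) (f ` S)"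
  proof -
    have "plane_point -` (f ` S) = F ` K"
      unfolding fS using plane_point_inj by (simp add: inj_vimage_image_eq)
    then show ?thesis using cfS by (simp add: emeasure_distr borel_compact)
  qed
  also have "\<dots> = emeasure lborel (f ` S)" by (simp add: distr_plane_point)
  also have "\<dots> = emeasure lebesgue (f ` S)" using cfS by (simp add: borel_compact)
  also have "\<dots> = ennreal (measure lebesgue (f ` S))"
    by (rule emeasure_eq_measure2[OF m1])
  also have "\<dots> \<le> ennreal (LINT v:S|lborel. ?d (\<iota> v))"
    using m2 by (rule ennreal_leI)
  also have "(LINT v:S|lborel. ?d (\<iota> v)) = (LINT w:K|lborel. ?d w)"
  proof -
    have "(LINT v:S|lborel. ?d (\<iota> v)) = (\<integral>v. indicator S v *\<^sub>R ?d (\<iota> v) \<partial>distr lborel borel plane_point)"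
      by (simp add: set_lebesgue_integral_def distr_plane_point)
    also have "\<dots> = (\<integral>w. indicator S (plane_point w) *\<^sub>R ?d (\<iota> (plane_point w)) \<partial>lborel)"
      using int by (intro integral_distr) (auto simp: set_integrable_def)
    also have "\<dots> = (LINT w:K|lborel. ?d w)"
    proof -
      have "indicator S (plane_point w) = (indicator K w :: real)" for w
        using \<iota>S[of "plane_point w"] by (simp add: \<iota>p indicator_def)
      then show ?thesis by (simp add: set_lebesgue_integral_def \<iota>p)
    qed
    finally show ?thesis .
  qed
  finally show ?thesis .
qed

section \<open>Conformal parametrization by the Gauss map\<close>

unbundle cross3_syntax

section \<open>The tangent plane and its rotation by the unit normal\<close>

lemma cross3_orthogonal_frame:
  fixes n E :: "real^3"
  assumes "norm n = 1" "n \<bullet> E = 0"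
  shows "(n \<times> E) \<times> n = E" "n \<times> (n \<times> E) = - E" "norm (n \<times> E) = norm E" "E \<bullet> (n \<times> E) = 0" "n \<bullet> (n \<times> E) = 0"
proof -
  have n: "n \<bullet> n = 1" using assms by (simp add: norm_eq_1)
  show *: "n \<times> (n \<times> E) = - E"
    using n assms by (simp add: Lagrange)
  then show "(n \<times> E) \<times> n = E" using cross_skew[of "n \<times> E" n] by simp
  show "E \<bullet> (n \<times> E) = 0" "n \<bullet> (n \<times> E) = 0" by (simp_all add: dot_cross_self)
  have "(norm (n \<times> E))\<^sup>2 = (norm E)\<^sup>2"
    using assms by (simp add: norm_cross)
  then show "norm (n \<times> E) = norm E" by (simp add: power2_eq_iff_nonneg)
qed

lemma cross3_in_orthogonal_plane:
  fixes n v w :: "real^3"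
  assumes "norm n = 1" "n \<bullet> v = 0" "n \<bullet> w = 0"
  shows "v \<times> w = ((v \<times> w) \<bullet> n) *\<^sub>R n"
proof -
  let ?d = "v \<times> w"
  have "n \<times> ?d = 0" using assms by (simp add: Lagrange)
  then have "n \<times> (n \<times> ?d) = 0" by simp
  then have "(n \<bullet> ?d) *\<^sub>R n - (n \<bullet> n) *\<^sub>R ?d = 0" by (simp only: Lagrange[of n n])
  moreover have "n \<bullet> n = 1" using assms by (simp add: norm_eq_1)
  ultimately show ?thesis by (simp add: inner_commute)
qed

lemma orthogonal_plane_decomposition:
  fixes n E v :: "real^3"
  assumes "norm n = 1" "n \<bullet> E = 0" "n \<bullet> v = 0" "E \<noteq> 0"
  obtains x y where "v = x *\<^sub>R E + y *\<^sub>R (n \<times> E)"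
proof -
  note f = cross3_orthogonal_frame[OF assms(1,2)]
  have "E \<times> (n \<times> E) = (E \<bullet> E) *\<^sub>R n"
    using assms by (simp add: Lagrange inner_commute)
  have "v \<times> E = ((v \<times> E) \<bullet> n) *\<^sub>R n" by (rule cross3_in_orthogonal_plane[OF assms(1,3,2)])
  then have "E \<times> (v \<times> E) = ((v \<times> E) \<bullet> n) *\<^sub>R (E \<times> n)" by (metis cross_mult_right)
  then have "(E \<bullet> E) *\<^sub>R v = (E \<bullet> v) *\<^sub>R E + (- ((v \<times> E) \<bullet> n)) *\<^sub>R (n \<times> E)"
    by (simp add: Lagrange cross_skew[of E n] algebra_simps)
  then have "(1 / (E \<bullet> E)) *\<^sub>R ((E \<bullet> E) *\<^sub>R v)
      = (1 / (E \<bullet> E)) *\<^sub>R ((E \<bullet> v) *\<^sub>R E + (- ((v \<times> E) \<bullet> n)) *\<^sub>R (n \<times> E))" by simp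
  then have "v = ((E \<bullet> v) / (E \<bullet> E)) *\<^sub>R E + (- ((v \<times> E) \<bullet> n) / (E \<bullet> E)) *\<^sub>R (n \<times> E)"
    using assms(4) by (simp add: scaleR_right_diff_distrib)
  then show thesis by (rule that)
qed

text \<open>The trace of the shape operator \<open>-dn\<close> appears as the normal component of
  \<open>p \<times> n\<^sub>v - q \<times> n\<^sub>u\<close>, so vanishing mean curvature says that \<open>d(dx \<times> n) = 0\<close>.\<close>

lemma minimal_imp_flux_form_closed:
  fixes n p q nu nv pu pv qv :: "real^3"
  assumes n: "norm n = 1" "n \<bullet> p = 0" "n \<bullet> q = 0" "n \<bullet> nu = 0" "n \<bullet> nv = 0"
    and w: "nu \<bullet> p = - (n \<bullet> pu)" "nu \<bullet> q = - (n \<bullet> pv)" "nv \<bullet> p = - (n \<bullet> pv)" "nv \<bullet> q = - (n \<bullet> qv)"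
    and H: "(n \<bullet> pu) * (q \<bullet> q) - 2 * (n \<bullet> pv) * (p \<bullet> q) + (n \<bullet> qv) * (p \<bullet> p) = 0"
    and ne: "p \<times> q \<noteq> 0"
  shows "p \<times> nv = q \<times> nu"
proof -
  have 1: "p \<times> nv = ((p \<times> nv) \<bullet> n) *\<^sub>R n" "q \<times> nu = ((q \<times> nu) \<bullet> n) *\<^sub>R n" "p \<times> q = ((p \<times> q) \<bullet> n) *\<^sub>R n"
    using cross3_in_orthogonal_plane n by auto
  \<comment> \<open>Both sides of the claim are multiples of \<open>n\<close>, so their products
    with p \<times> q decide. By the Binet-Cauchy identity the difference of these products is minus
    the numerator of the mean curvature.\<close>
  have A: "(p \<times> nv) \<bullet> (p \<times> q) - (q \<times> nu) \<bullet> (p \<times> q) = 0"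
    unfolding dot_cross w inner_commute[of q p] using H by (simp add: algebra_simps)
  have B: "(p \<times> nv) \<bullet> (p \<times> q) = ((p \<times> nv) \<bullet> n) * (n \<bullet> (p \<times> q))"
    using arg_cong[OF 1(1), of "\<lambda>x. x \<bullet> (p \<times> q)"] unfolding inner_scaleR_left .
  have C: "(q \<times> nu) \<bullet> (p \<times> q) = ((q \<times> nu) \<bullet> n) * (n \<bullet> (p \<times> q))"
    using arg_cong[OF 1(2), of "\<lambda>x. x \<bullet> (p \<times> q)"] unfolding inner_scaleR_left .
  have "((p \<times> nv) \<bullet> n - (q \<times> nu) \<bullet> n) * (n \<bullet> (p \<times> q)) = 0"
    using A unfolding B C left_diff_distrib .
  moreover have "n \<bullet> (p \<times> q) \<noteq> 0"
  proof
    assume "n \<bullet> (p \<times> q) = 0"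
    then have "(p \<times> q) \<bullet> n = 0" by (simp add: inner_commute)
    with 1(3) ne show False by simp
  qed
  ultimately have "(p \<times> nv) \<bullet> n = (q \<times> nu) \<bullet> n" by simp
  then have "((p \<times> nv) \<bullet> n) *\<^sub>R n = ((q \<times> nu) \<bullet> n) *\<^sub>R n" by (rule arg_cong)
  then show ?thesis unfolding 1(1,2)[symmetric] .
qed

section \<open>Charts of a minimal surface and local conformal parameters\<close>

lemma has_derivative_plane_point:
  fixes F :: "real^2 \<Rightarrow> real^3"
  assumes "F differentiable (at (plane_point z))"
  shows "((\<lambda>z. F (plane_point z)) has_derivative
    (\<lambda>h. Re h *\<^sub>R pd 1 F (plane_point z) + Im h *\<^sub>R pd 2 F (plane_point z))) (at z)"
proof -
  let ?D = "frechet_derivative F (at (plane_point z))"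
  have F: "(F has_derivative ?D) (at (plane_point z))"
    using assms frechet_derivative_works by blast
  have "(plane_point has_derivative plane_point) (at z)"
    by (rule bounded_linear_imp_has_derivative[OF bounded_linear_plane_point])
  from has_derivative_compose[OF this F]
  have "((\<lambda>z. F (plane_point z)) has_derivative (\<lambda>h. ?D (plane_point h))) (at z)" .
  moreover have "linear ?D" using F has_derivative_linear by blast
  ultimately show ?thesis
    by (simp add: plane_point_def pd_def linear_add linear_scale)
qed

lemma frechet_derivative_pd:
  fixes F :: "real^2 \<Rightarrow> real^3"
  assumes "F differentiable (at w)"
  shows "frechet_derivative F (at w) v = v $ 1 *\<^sub>R pd 1 F w + v $ 2 *\<^sub>R pd 2 F w"
proof -
  have "linear (frechet_derivative F (at w))"
    using assms linear_frechet_derivative by blast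
  then have "frechet_derivative F (at w) (v $ 1 *\<^sub>R axis 1 1 + v $ 2 *\<^sub>R axis 2 1)
      = v $ 1 *\<^sub>R pd 1 F w + v $ 2 *\<^sub>R pd 2 F w"
    by (simp add: linear_add linear_scale pd_def)
  moreover have "v $ 1 *\<^sub>R axis 1 1 + v $ 2 *\<^sub>R axis 2 1 = v"
    by (simp add: vec_eq_iff forall_2 axis_def)
  ultimately show ?thesis by simp
qed

lemma local_param_facts:
  assumes "local_param S \<phi> W" "w \<in> W"
  shows "\<phi> differentiable (at w)" "pd i \<phi> differentiable (at w)"
    "continuous_on W (pd i \<phi>)" "continuous_on W (pd j (pd i \<phi>))"
    "pd 1 \<phi> w \<times> pd 2 \<phi> w \<noteq> 0"
proof -
  have W: "open W" and sm: "smooth_on \<phi> W" and inj: "inj (frechet_derivative \<phi> (at w))"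
    using assms by (auto simp: local_param_def)
  have Ck: "Ck_on (Suc (Suc (Suc 0))) \<phi> W" using sm by (simp add: smooth_on_def)
  have *: "\<phi> differentiable_on W" "pd i \<phi> differentiable_on W" "pd j (pd i \<phi>) differentiable_on W" for i j
    using Ck unfolding Ck_on.simps pd_def[abs_def] by blast+
  show d: "\<phi> differentiable (at w)" "pd i \<phi> differentiable (at w)"
    using * W assms(2) by (auto simp: differentiable_on_eq_differentiable_at)
  show "continuous_on W (pd i \<phi>)" "continuous_on W (pd j (pd i \<phi>))"
    using * differentiable_imp_continuous_on by blast+
  show "pd 1 \<phi> w \<times> pd 2 \<phi> w \<noteq> 0"
  proof
    assume "pd 1 \<phi> w \<times> pd 2 \<phi> w = 0"
    then have "collinear {0, pd 1 \<phi> w, pd 2 \<phi> w}" by (simp add: cross_eq_0)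
    then have "\<exists>a b. (a \<noteq> 0 \<or> b \<noteq> 0) \<and> a *\<^sub>R pd 1 \<phi> w + b *\<^sub>R pd 2 \<phi> w = 0"
      unfolding collinear_lemma
    proof (elim disjE exE)
      fix k assume "pd 2 \<phi> w = k *\<^sub>R pd 1 \<phi> w"
      then show ?thesis by (intro exI[of _ k] exI[of _ "-1"]) simp
    qed (intro exI[of _ 1] exI[of _ 0], simp, intro exI[of _ 0] exI[of _ 1], simp)
    then obtain a b where ab: "a \<noteq> 0 \<or> b \<noteq> 0" "a *\<^sub>R pd 1 \<phi> w + b *\<^sub>R pd 2 \<phi> w = 0"
      by blast
    let ?v = "a *\<^sub>R axis 1 1 + b *\<^sub>R axis 2 1 :: real^2"
    have "frechet_derivative \<phi> (at w) ?v = frechet_derivative \<phi> (at w) 0"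
      using ab(2) by (simp add: frechet_derivative_pd[OF d(1)] axis_def)
    then have "?v = 0" using inj by (auto dest: injD)
    then have "?v $ 1 = 0" "?v $ 2 = 0" by simp_all
    then show False using ab(1) by (simp add: axis_def)
  qed
qed

text \<open>Shrinks a chart to a disc in the complex plane, merges the two mixed second derivatives
  into \<open>pv\<close>, and clears the mean curvature of its denominator and of the length of the
  normal. Minimality thereby becomes a polynomial identity in the derivatives.\<close>

lemma minimal_chart:
  assumes min: "minimal_surface S" and \<phi>: "local_param S \<phi> W" and w0: "w0 \<in> W"
  obtains c r \<psi> p q pu pv qv where "r > 0" "\<psi> c = \<phi> w0"
    "inj_on \<psi> (ball c r)" "\<psi> ` ball c r \<subseteq> S"
    "\<And>z. z \<in> ball c r \<Longrightarrow> (\<psi> has_derivative (\<lambda>h. Re h *\<^sub>R p z + Im h *\<^sub>R q z)) (at z)"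
    "\<And>z. z \<in> ball c r \<Longrightarrow> (p has_derivative (\<lambda>h. Re h *\<^sub>R pu z + Im h *\<^sub>R pv z)) (at z)"
    "\<And>z. z \<in> ball c r \<Longrightarrow> (q has_derivative (\<lambda>h. Re h *\<^sub>R pv z + Im h *\<^sub>R qv z)) (at z)"
    "continuous_on (ball c r) pu" "continuous_on (ball c r) pv" "continuous_on (ball c r) qv"
    "\<And>z. z \<in> ball c r \<Longrightarrow> p z \<times> q z \<noteq> 0"
    "\<And>z. z \<in> ball c r \<Longrightarrow> p z \<in> tangent_space S (\<psi> z) \<and> q z \<in> tangent_space S (\<psi> z)"
    "\<And>z. z \<in> ball c r \<Longrightarrow> ((p z \<times> q z) \<bullet> pu z) * (q z \<bullet> q z)
       - 2 * ((p z \<times> q z) \<bullet> pv z) * (p z \<bullet> q z) + ((p z \<times> q z) \<bullet> qv z) * (p z \<bullet> p z) = 0"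
proof -
  obtain \<psi>' where W: "open W" and hom: "homeomorphism W (\<phi> ` W) \<phi> \<psi>'"
      and im: "\<phi> ` W \<subseteq> S"
    using \<phi> unfolding local_param_def by (auto dest: openin_imp_subset)
  have inj: "inj_on \<phi> W"
    using hom by (intro inj_on_inverseI[of _ \<psi>']) (simp add: homeomorphism_apply1)
  define c where "c = Complex (w0 $ 1) (w0 $ 2)"
  have c: "plane_point c = w0" by (simp add: c_def plane_point_surj)
  obtain r where r: "r > 0" "ball w0 r \<subseteq> W" using W w0 openE by blast
  have inW: "plane_point z \<in> W" if "z \<in> ball c r" for z
  proof -
    have "dist w0 (plane_point z) = dist c z"
      unfolding c[symmetric] dist_norm
      by (metis norm_plane_point linear_diff bounded_linear.linear bounded_linear_plane_point)
    then show ?thesis using that r by auto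
  qed
  define \<psi> p q where "\<psi> z = \<phi> (plane_point z)" and "p z = pd 1 \<phi> (plane_point z)" and "q z = pd 2 \<phi> (plane_point z)" for z
  define pu pv qu qv where "pu z = pd 1 (pd 1 \<phi>) (plane_point z)" and "pv z = pd 2 (pd 1 \<phi>) (plane_point z)"
    and "qu z = pd 1 (pd 2 \<phi>) (plane_point z)" and "qv z = pd 2 (pd 2 \<phi>) (plane_point z)" for z
  note defs = \<psi>_def p_def q_def pu_def pv_def qu_def qv_def
  note facts = local_param_facts[OF \<phi> inW]
  have d\<psi>: "(\<psi> has_derivative (\<lambda>h. Re h *\<^sub>R p z + Im h *\<^sub>R q z)) (at z)" if "z \<in> ball c r" for z
    unfolding defs by (rule has_derivative_plane_point[OF facts(1)[OF that]])
  have dp: "(p has_derivative (\<lambda>h. Re h *\<^sub>R pu z + Im h *\<^sub>R pv z)) (at z)"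
   and dq: "(q has_derivative (\<lambda>h. Re h *\<^sub>R qu z + Im h *\<^sub>R qv z)) (at z)" if "z \<in> ball c r" for z
    unfolding defs by (rule has_derivative_plane_point[OF facts(2)[OF that]])+
  have cpp: "continuous_on (ball c r) plane_point"
    by (simp add: linear_continuous_on bounded_linear_plane_point)
  have cont: "continuous_on (ball c r) (\<lambda>z. pd j (pd i \<phi>) (plane_point z))" for i j
    by (rule continuous_on_compose2[OF local_param_facts(4)[OF \<phi> w0] cpp]) (use inW in auto)
  have comp: "((\<lambda>z. F z $ k) has_derivative (\<lambda>h. Re h * Fu z $ k + Im h * Fv z $ k)) (at z)"
    if "(F has_derivative (\<lambda>h. Re h *\<^sub>R Fu z + Im h *\<^sub>R Fv z)) (at z)" for F Fu Fv :: "complex \<Rightarrow> real^3" and z k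
    using bounded_linear.has_derivative[OF bounded_linear_vec_nth that] by simp
  have sym: "pv z = qu z" if z: "z \<in> ball c r" for z
  proof (rule vec_eq_iff[THEN iffD2, rule_format])
    fix k
    show "pv z $ k = qu z $ k"
    proof (rule mixed_partials_commute[OF open_ball z, where f="\<lambda>z. \<psi> z $ k" and p="\<lambda>z. p z $ k" and q="\<lambda>z. q z $ k"
            and pu="\<lambda>z. pu z $ k" and qv="\<lambda>z. qv z $ k"])
      show "continuous_on (ball c r) (\<lambda>z. pv z $ k)" "continuous_on (ball c r) (\<lambda>z. qu z $ k)"
        unfolding defs by (intro continuous_intros cont)+
    qed (use comp d\<psi> dp dq in auto)
  qed
  have min': "((p z \<times> q z) \<bullet> pu z) * (q z \<bullet> q z)
       - 2 * ((p z \<times> q z) \<bullet> pv z) * (p z \<bullet> q z) + ((p z \<times> q z) \<bullet> qv z) * (p z \<bullet> p z) = 0"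
    if z: "z \<in> ball c r" for z
  proof -
    have ne: "p z \<times> q z \<noteq> 0" using facts(5)[OF z] by (simp add: defs)
    have "mean_curvature \<phi> (plane_point z) = 0"
      using min \<phi> inW[OF z] by (auto simp: minimal_surface_def)
    moreover have "(norm (p z \<times> q z))\<^sup>2 \<noteq> 0" using ne by simp
    then have "(p z \<bullet> p z) * (q z \<bullet> q z) - (p z \<bullet> q z)\<^sup>2 \<noteq> 0"
      unfolding norm_cross[of "p z" "q z"] power2_norm_eq_inner[of "p z"] power2_norm_eq_inner[of "q z"] .
    moreover have "mean_curvature \<phi> (plane_point z) =
      ((pu z \<bullet> sgn (p z \<times> q z)) * (q z \<bullet> q z) - 2 * (pv z \<bullet> sgn (p z \<times> q z)) * (p z \<bullet> q z)
       + (qv z \<bullet> sgn (p z \<times> q z)) * (p z \<bullet> p z)) / (2 * ((p z \<bullet> p z) * (q z \<bullet> q z) - (p z \<bullet> q z)\<^sup>2))"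
      by (simp only: mean_curvature_def first_form_def second_form_def param_normal_def defs)
    ultimately have 0: "(pu z \<bullet> sgn (p z \<times> q z)) * (q z \<bullet> q z) - 2 * (pv z \<bullet> sgn (p z \<times> q z)) * (p z \<bullet> q z)
       + (qv z \<bullet> sgn (p z \<times> q z)) * (p z \<bullet> p z) = 0"
      by simp
    have "(p z \<times> q z) \<bullet> v = norm (p z \<times> q z) * (v \<bullet> sgn (p z \<times> q z))" for v
      using ne by (simp add: sgn_div_norm inner_commute)
    then show ?thesis using arg_cong[OF 0, of "\<lambda>x. norm (p z \<times> q z) * x"] by (simp add: algebra_simps)
  qed
  show thesis
  proof (rule that[of r \<psi> c p q pu pv qv])
    show "inj_on \<psi> (ball c r)"
      unfolding \<psi>_def using inj inW plane_point_inj by (auto simp: inj_on_def inj_def)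
    have range: "frechet_derivative \<phi> (at (plane_point z)) v \<in> tangent_space S (\<psi> z)"
      if "z \<in> ball c r" for z v
      unfolding tangent_space_def \<psi>_def using \<phi> inW[OF that] by blast
    show "p z \<in> tangent_space S (\<psi> z) \<and> q z \<in> tangent_space S (\<psi> z)" if "z \<in> ball c r" for z
      using range[OF that] by (simp add: p_def q_def pd_def)
    show "(q has_derivative (\<lambda>h. Re h *\<^sub>R pv z + Im h *\<^sub>R qv z)) (at z)" if "z \<in> ball c r" for z
      using dq[OF that] sym[OF that] by simp
    show "p z \<times> q z \<noteq> 0" if "z \<in> ball c r" for z
      using facts(5)[OF that] by (simp add: p_def q_def)
    show "continuous_on (ball c r) pu" "continuous_on (ball c r) pv" "continuous_on (ball c r) qv"
      unfolding defs by (rule cont)+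
    show "\<psi> ` ball c r \<subseteq> S" using im inW by (auto simp: \<psi>_def)
    show "\<psi> c = \<phi> w0" by (simp add: \<psi>_def c)
    show "r > 0" by (rule r(1))
    show "(\<psi> has_derivative (\<lambda>h. Re h *\<^sub>R p z + Im h *\<^sub>R q z)) (at z)" if "z \<in> ball c r" for z
      by (rule d\<psi>[OF that])
    show "(p has_derivative (\<lambda>h. Re h *\<^sub>R pu z + Im h *\<^sub>R pv z)) (at z)" if "z \<in> ball c r" for z
      by (rule dp[OF that])
  qed (rule min')
qed

text \<open>With \<open>L v = v\<^sub>k + i (v \<times> n)\<^sub>k\<close> one has \<open>L (n \<times> v) = i L v\<close>; the lemma inverts \<open>L\<close> at \<open>1\<close> and \<open>i\<close>.\<close>

lemma rotated_tangent_vector: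
  fixes n E E' :: "real^3"
  assumes n: "norm n = 1" "n \<bullet> E = 0" "n \<bullet> E' = 0"
    and "E $ k = 1" "(E \<times> n) $ k = 0" "E' $ k = 0" "(E' \<times> n) $ k = 1"
  shows "E' = n \<times> E"
proof -
  have "E \<noteq> 0" using assms(4) by auto
  then obtain x y where xy: "E' = x *\<^sub>R E + y *\<^sub>R (n \<times> E)"
    by (rule orthogonal_plane_decomposition[OF n])
  have nE: "(n \<times> E) $ k = 0" using assms(5) cross_skew[of n E] by simp
  have "E' $ k = x" using assms(4) nE by (simp add: xy)
  then have x: "x = 0" using assms(6) by simp
  have "E' \<times> n = y *\<^sub>R E"
    by (simp add: xy x cross_mult_left cross3_orthogonal_frame[OF n(1,2)])
  then have "y = 1" using assms(4,7) by simp
  then show ?thesis using xy x by simp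
qed

text \<open>The differential \<open>h \<mapsto> Re h E + Im h (n \<times> E)\<close> turns
  multiplication by i into rotation by \<open>n\<close>, and pairing a component of \<open>v\<close>
  with that of v \<times> n turns the rotation back into multiplication by i. The resulting complex
  linearity is the Cauchy-Riemann system for a coordinate and its conjugate.\<close>

lemma rotation_complex_linear:
  fixes n E :: "real^3"
  assumes "norm n = 1" "n \<bullet> E = 0" and v: "v = Re h *\<^sub>R E + Im h *\<^sub>R (n \<times> E)"
  shows "Complex (v $ j) ((v \<times> n) $ j) = Complex (E $ j) ((E \<times> n) $ j) * h"
proof -
  have a: "v \<times> n = Re h *\<^sub>R (E \<times> n) + Im h *\<^sub>R E"
    by (simp add: v cross_add_left cross_mult_left cross3_orthogonal_frame[OF assms(1,2)])
  have b: "v = Re h *\<^sub>R E - Im h *\<^sub>R (E \<times> n)"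
    unfolding v cross_skew[of n E] by simp
  show ?thesis unfolding a unfolding b by (simp add: complex_eq_iff algebra_simps)
qed

text \<open>The quotient \<open>f\<close> is continuous with values in {1, -1}, hence constant on a
  connected set. This upgrades a Gauss map, given only as continuous, to a signed normalized cross
  product of chart derivatives, which can be differentiated.\<close>

lemma continuous_on_unit_valued_parallel:
  fixes n m :: "complex \<Rightarrow> real^3"
  assumes "connected B" "continuous_on B n" "continuous_on B m"
    and "\<And>z. z \<in> B \<Longrightarrow> norm (n z) = 1" "\<And>z. z \<in> B \<Longrightarrow> m z \<noteq> 0"
    and par: "\<And>z. z \<in> B \<Longrightarrow> m z = (m z \<bullet> n z) *\<^sub>R n z"
  obtains s :: real where "\<bar>s\<bar> = 1" "\<And>z. z \<in> B \<Longrightarrow> n z = (s / norm (m z)) *\<^sub>R m z"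
proof -
  define f where "f z = (m z \<bullet> n z) / norm (m z)" for z
  have abs: "\<bar>f z\<bar> = 1" if z: "z \<in> B" for z
  proof -
    have "norm (m z) = \<bar>m z \<bullet> n z\<bar>" using arg_cong[OF par[OF z], of norm] assms(4)[OF z] by simp
    moreover have "norm (m z) \<noteq> 0" using assms(5)[OF z] by simp
    ultimately have "\<bar>m z \<bullet> n z\<bar> / norm (m z) = 1" by (metis divide_self)
    then show ?thesis by (simp only: f_def abs_divide abs_norm_cancel)
  qed
  have "continuous_on B f"
    unfolding f_def by (intro continuous_intros assms) (use assms(5) in auto)
  moreover have "f z = 1 \<or> f z = - 1" if "z \<in> B" for z using abs[OF that] by linarith
  then have "f ` B \<subseteq> {1, -1}" by blast
  then have "finite (f ` B)" by (rule finite_subset) simp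
  ultimately have "f constant_on B" using assms(1) continuous_finite_range_constant by blast
  then obtain s where s: "\<And>z. z \<in> B \<Longrightarrow> f z = s" unfolding constant_on_def by blast
  define s' where "s' = (if B = {} then 1 else s)"
  show thesis
  proof (rule that[of s'])
    show "\<bar>s'\<bar> = 1" using abs s by (auto simp: s'_def)
    fix z assume z: "z \<in> B"
    have "s' = f z" using s[OF z] z by (auto simp: s'_def)
    have "(s' / norm (m z)) *\<^sub>R m z = (f z / norm (m z)) *\<^sub>R ((m z \<bullet> n z) *\<^sub>R n z)"
      using par[OF z] \<open>s' = f z\<close> by simp
    also have "\<dots> = (f z * f z) *\<^sub>R n z" by (simp add: f_def)
    also have "f z * f z = 1" using abs[OF z] by (metis abs_mult_self_eq mult_1)
    finally show "n z = (s' / norm (m z)) *\<^sub>R m z" by simp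
  qed
qed

lemma has_derivative_normalized:
  fixes m :: "complex \<Rightarrow> real^3" and s :: real
  assumes m: "(m has_derivative (\<lambda>h. Re h *\<^sub>R mu + Im h *\<^sub>R mv)) (at z)" and "m z \<noteq> 0"
  defines "D \<equiv> \<lambda>v. (s / norm (m z)) *\<^sub>R v - (s * (m z \<bullet> v) / norm (m z) ^ 3) *\<^sub>R m z"
  shows "((\<lambda>z. (s / norm (m z)) *\<^sub>R m z) has_derivative (\<lambda>h. Re h *\<^sub>R D mu + Im h *\<^sub>R D mv)) (at z)"
proof -
  have nz: "norm (m z) \<noteq> 0" using assms(2) by simp
  have d: "((\<lambda>z. norm (m z)) has_derivative (\<lambda>h. (Re h *\<^sub>R mu + Im h *\<^sub>R mv) \<bullet> sgn (m z))) (at z)"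
    by (rule has_derivative_compose[OF m has_derivative_norm[OF assms(2)]])
  show ?thesis
    by (rule derivative_eq_intros d m refl nz)+
      (use nz in \<open>simp add: D_def sgn_div_norm inner_add_left inner_commute[of "m z"] power3_eq_cube fun_eq_iff vec_eq_iff field_simps\<close>)
qed

text \<open>\<open>D\<close> is the derivative of the normalized vector when \<open>m\<close> has
  derivative \<open>v\<close>. It differs from a multiple of \<open>v\<close> by a multiple of
  \<open>m\<close>, so a Weingarten equation against a vector \<open>w\<close> orthogonal to
  \<open>m\<close> passes from the unnormalized to the unit normal.\<close>

lemma normalized_derivative_orthogonal:
  fixes m n v w x :: "real^3" and s :: real
  assumes "n = (s / norm m) *\<^sub>R m" "\<bar>s\<bar> = 1" "m \<noteq> 0"
  defines "D \<equiv> (s / norm m) *\<^sub>R v - (s * (m \<bullet> v) / norm m ^ 3) *\<^sub>R m"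
  shows "n \<bullet> D = 0"
    and "m \<bullet> w = 0 \<Longrightarrow> v \<bullet> w = - (m \<bullet> x) \<Longrightarrow> D \<bullet> w = - (n \<bullet> x)"
proof -
  have nz: "norm m \<noteq> 0" using assms(3) by simp
  have "m \<bullet> m = norm m * norm m" by (simp add: power2_norm_eq_inner[symmetric] power2_eq_square)
  then show "n \<bullet> D = 0"
    unfolding assms(1) D_def using nz by (simp add: inner_diff_right power3_eq_cube field_simps)
  show "D \<bullet> w = - (n \<bullet> x)" if "m \<bullet> w = 0" "v \<bullet> w = - (m \<bullet> x)"
    using that nz unfolding assms(1) D_def by (simp add: inner_diff_left)
qed

lemma bounded_bilinear_cross3: "bounded_bilinear (\<times>)"
  using bilinear_cross bilinear_conv_bounded_bilinear by blast

text \<open>Conformal parameters come from conjugate functions instead of a Beltrami equation. Since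
  dx \<times> n is closed, each coordinate function has a local conjugate \<open>F j\<close>; the
  pair \<open>\<xi> j\<close> has differential \<open>L j\<close>, and some \<open>\<xi> k\<close>
  is a local diffeomorphism. In the coordinate \<open>\<xi> k\<close> the surface is conformal and
  all the other pairs are holomorphic.\<close>

lemma local_conformal_param:
  assumes min: "minimal_surface S" and gauss: "gauss_map S \<gamma>" and s: "s \<in> S"
  obtains V \<zeta>0 X E where "open V" "\<zeta>0 \<in> V" "X \<zeta>0 = s" "X ` V \<subseteq> S" "inj_on X V"
    "\<And>y. y \<in> V \<Longrightarrow> (X has_derivative (\<lambda>h. Re h *\<^sub>R E y + Im h *\<^sub>R (\<gamma> (X y) \<times> E y))) (at y)"
    "\<And>y. y \<in> V \<Longrightarrow> \<gamma> (X y) \<bullet> E y = 0" "\<And>y. y \<in> V \<Longrightarrow> E y \<noteq> 0"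
    "\<And>j. (\<lambda>y. Complex (E y $ j) (- ((\<gamma> (X y) \<times> E y) $ j))) holomorphic_on V"
proof -
  have "embedded_surface S" using min by (simp add: minimal_surface_def)
  then obtain \<phi> W w0 where \<phi>: "local_param S \<phi> W" and w0: "w0 \<in> W" "\<phi> w0 = s"
    using s by (force simp: embedded_surface_def)
  obtain c r \<psi> p q pu pv qv where r: "r > 0" and \<psi>c: "\<psi> c = \<phi> w0"
    and inj: "inj_on \<psi> (ball c r)" and im: "\<psi> ` ball c r \<subseteq> S"
    and d\<psi>: "\<And>z. z \<in> ball c r \<Longrightarrow> (\<psi> has_derivative (\<lambda>h. Re h *\<^sub>R p z + Im h *\<^sub>R q z)) (at z)"
    and dp: "\<And>z. z \<in> ball c r \<Longrightarrow> (p has_derivative (\<lambda>h. Re h *\<^sub>R pu z + Im h *\<^sub>R pv z)) (at z)"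
    and dq: "\<And>z. z \<in> ball c r \<Longrightarrow> (q has_derivative (\<lambda>h. Re h *\<^sub>R pv z + Im h *\<^sub>R qv z)) (at z)"
    and cont: "continuous_on (ball c r) pu" "continuous_on (ball c r) pv" "continuous_on (ball c r) qv"
    and ne: "\<And>z. z \<in> ball c r \<Longrightarrow> p z \<times> q z \<noteq> 0"
    and tan: "\<And>z. z \<in> ball c r \<Longrightarrow> p z \<in> tangent_space S (\<psi> z) \<and> q z \<in> tangent_space S (\<psi> z)"
    and H: "\<And>z. z \<in> ball c r \<Longrightarrow> ((p z \<times> q z) \<bullet> pu z) * (q z \<bullet> q z)
       - 2 * ((p z \<times> q z) \<bullet> pv z) * (p z \<bullet> q z) + ((p z \<times> q z) \<bullet> qv z) * (p z \<bullet> p z) = 0"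
    by (rule minimal_chart[OF min \<phi> w0(1)]) blast
  let ?B = "ball c r"
  define n where "n z = \<gamma> (\<psi> z)" for z
  define m where "m z = p z \<times> q z" for z
  have \<psi>S: "\<psi> z \<in> S" if "z \<in> ?B" for z using im that by auto
  have n1: "norm (n z) = 1" and np: "n z \<bullet> p z = 0" and nq: "n z \<bullet> q z = 0" if "z \<in> ?B" for z
    using gauss \<psi>S[OF that] tan[OF that] by (auto simp: gauss_map_def n_def)
  have c\<psi>: "continuous_on ?B \<psi>" and cp: "continuous_on ?B p" and cq: "continuous_on ?B q"
    using d\<psi> dp dq by (auto intro!: continuous_at_imp_continuous_on has_derivative_continuous)
  have cn: "continuous_on ?B n"
    unfolding n_def using gauss by (intro continuous_on_compose2[OF _ c\<psi> im]) (simp add: gauss_map_def)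
  have cm: "continuous_on ?B m"
    unfolding m_def by (intro continuous_on_cross cp cq)
  obtain \<sigma> where \<sigma>: "\<bar>\<sigma>\<bar> = 1" and nm: "\<And>z. z \<in> ?B \<Longrightarrow> n z = (\<sigma> / norm (m z)) *\<^sub>R m z"
  proof (rule continuous_on_unit_valued_parallel[OF _ cn cm])
    show "m z = (m z \<bullet> n z) *\<^sub>R n z" if "z \<in> ?B" for z
      unfolding m_def by (rule cross3_in_orthogonal_plane[OF n1 np nq]) (use that in auto)
    show "m z \<noteq> 0" if "z \<in> ?B" for z using ne[OF that] by (simp add: m_def)
  qed (use n1 in auto)
  define mu mv where "mu z = pu z \<times> q z + p z \<times> pv z" and "mv z = pv z \<times> q z + p z \<times> qv z" for z
  have dm: "(m has_derivative (\<lambda>h. Re h *\<^sub>R mu z + Im h *\<^sub>R mv z)) (at z)" if "z \<in> ?B" for z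
    unfolding m_def[abs_def]
    using bounded_bilinear.FDERIV[OF bounded_bilinear_cross3 dp[OF that] dq[OF that]]
    by (rule has_derivative_eq_rhs)
      (simp add: mu_def mv_def cross_add_left cross_add_right cross_mult_left cross_mult_right algebra_simps)
  define D where "D z v = (\<sigma> / norm (m z)) *\<^sub>R v - (\<sigma> * (m z \<bullet> v) / norm (m z) ^ 3) *\<^sub>R m z" for z and v :: "real^3"
  define nu nv where "nu z = D z (mu z)" and "nv z = D z (mv z)" for z
  have mz: "m z \<noteq> 0" if "z \<in> ?B" for z using ne[OF that] by (simp add: m_def)
  have dn: "(n has_derivative (\<lambda>h. Re h *\<^sub>R nu z + Im h *\<^sub>R nv z)) (at z)" if "z \<in> ?B" for z
    using has_derivative_normalized[OF dm[OF that] mz[OF that], of \<sigma>] that nm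
    unfolding nu_def nv_def D_def by (elim has_derivative_transform_within_open[OF _ open_ball]) auto
  have cD: "continuous_on ?B (\<lambda>z. D z (F z))" if "continuous_on ?B F" for F
    unfolding D_def using mz by (intro continuous_intros that cm) auto
  have cnu: "continuous_on ?B nu" and cnv: "continuous_on ?B nv"
    unfolding nu_def nv_def mu_def mv_def by (intro cD continuous_intros continuous_on_cross cp cq cont)+
  have flux: "p z \<times> nv z = q z \<times> nu z" if z: "z \<in> ?B" for z
  proof (rule minimal_imp_flux_form_closed[OF n1[OF z] np[OF z] nq[OF z], where pu="pu z" and pv="pv z" and qv="qv z"])
    note o = normalized_derivative_orthogonal[OF nm[OF z] \<sigma> mz[OF z], folded D_def]
    show "n z \<bullet> nu z = 0" "n z \<bullet> nv z = 0" unfolding nu_def nv_def by (rule o(1))+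
    have mp: "m z \<bullet> p z = 0" "m z \<bullet> q z = 0" by (simp_all add: m_def dot_cross_self)
    have cyc: "(a \<times> b) \<bullet> b = 0" "(a \<times> b) \<bullet> a = 0" "(a \<times> b) \<bullet> d = - ((d \<times> b) \<bullet> a)" "(a \<times> b) \<bullet> d = - ((a \<times> d) \<bullet> b)"
      for a b d :: "real^3"
      by (simp_all add: cross3_simps)
    show "nu z \<bullet> p z = - (n z \<bullet> pu z)" unfolding nu_def
      by (rule o(2)[OF mp(1)]) (simp add: mu_def m_def inner_add_left cyc(2) cyc(3)[of "pu z" "q z"])
    show "nu z \<bullet> q z = - (n z \<bullet> pv z)" unfolding nu_def
      by (rule o(2)[OF mp(2)]) (simp add: mu_def m_def inner_add_left cyc(1) cyc(4)[of "p z" "pv z" "q z"])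
    show "nv z \<bullet> p z = - (n z \<bullet> pv z)" unfolding nv_def
      by (rule o(2)[OF mp(1)]) (simp add: mv_def m_def inner_add_left cyc(2) cyc(3)[of "pv z" "q z"])
    show "nv z \<bullet> q z = - (n z \<bullet> qv z)" unfolding nv_def
      by (rule o(2)[OF mp(2)]) (simp add: mv_def m_def inner_add_left cyc(1) cyc(4)[of "p z" "qv z" "q z"])
    show "p z \<times> q z \<noteq> 0" by (rule ne[OF z])
    have "n z \<bullet> v = (\<sigma> / norm (m z)) * ((p z \<times> q z) \<bullet> v)" for v
      using nm[OF z] by (simp add: m_def)
    then show "n z \<bullet> pu z * (q z \<bullet> q z) - 2 * (n z \<bullet> pv z) * (p z \<bullet> q z) + n z \<bullet> qv z * (p z \<bullet> p z) = 0"
      using arg_cong[OF H[OF z], of "\<lambda>x. (\<sigma> / norm (m z)) * x"]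
      by (simp only:) (simp add: algebra_simps)
  qed
  have "\<exists>F. \<forall>z\<in>?B. (F has_derivative (\<lambda>h. Re h * (p z \<times> n z) $ j + Im h * (q z \<times> n z) $ j)) (at z)" for j
  proof -
    note FD = bounded_bilinear.FDERIV[OF bounded_bilinear_cross3]
    have dP: "((\<lambda>z. (p z \<times> n z) $ j) has_derivative (\<lambda>h. Re h * (pu z \<times> n z + p z \<times> nu z) $ j
          + Im h * (pv z \<times> n z + p z \<times> nv z) $ j)) (at z)" if "z \<in> ?B" for z
      using bounded_linear.has_derivative[OF bounded_linear_vec_nth FD[OF dp[OF that] dn[OF that]], of j]
      by (rule has_derivative_eq_rhs)
        (simp add: cross_add_left cross_add_right cross_mult_left cross_mult_right algebra_simps)
    have dQ: "((\<lambda>z. (q z \<times> n z) $ j) has_derivative (\<lambda>h. Re h * (pv z \<times> n z + q z \<times> nu z) $ j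
          + Im h * (qv z \<times> n z + q z \<times> nv z) $ j)) (at z)" if "z \<in> ?B" for z
      using bounded_linear.has_derivative[OF bounded_linear_vec_nth FD[OF dq[OF that] dn[OF that]], of j]
      by (rule has_derivative_eq_rhs)
        (simp add: cross_add_left cross_add_right cross_mult_left cross_mult_right algebra_simps)
    show ?thesis
    proof (rule closed_form_has_primitive[OF dP dQ])
      show "(pv z \<times> n z + p z \<times> nv z) $ j = (pv z \<times> n z + q z \<times> nu z) $ j" if "z \<in> ?B" for z
        by (simp add: flux[OF that])
      fix F assume "\<And>z. z \<in> ?B \<Longrightarrow> (F has_derivative (\<lambda>h. Re h * (p z \<times> n z) $ j + Im h * (q z \<times> n z) $ j)) (at z)"
      then show ?thesis by blast
    qed (auto intro!: continuous_intros continuous_on_cross cont cn cnu cnv cp cq)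
  qed
  then obtain F where F: "\<And>j z. z \<in> ?B \<Longrightarrow>
      (F j has_derivative (\<lambda>h. Re h * (p z \<times> n z) $ j + Im h * (q z \<times> n z) $ j)) (at z)" by metis
  define \<xi> where "\<xi> j z = Complex (\<psi> z $ j) (F j z)" for j z
  define L where "L j v z = Complex (v $ j) ((v \<times> n z) $ j)" for j z and v :: "real^3"
  have L_lin: "L j (a *\<^sub>R v + b *\<^sub>R w) z = a *\<^sub>R L j v z + b *\<^sub>R L j w z" for a b j v w z
    by (simp add: L_def complex_eq_iff cross_add_left cross_mult_left)
  have d\<xi>: "(\<xi> j has_derivative (\<lambda>h. Re h *\<^sub>R L j (p z) z + Im h *\<^sub>R L j (q z) z)) (at z)" if "z \<in> ?B" for j z
  proof -
    have "((\<lambda>z. of_real (\<psi> z $ j) + \<i> * of_real (F j z)) has_derivative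
        (\<lambda>h. of_real ((Re h *\<^sub>R p z + Im h *\<^sub>R q z) $ j)
           + \<i> * of_real (Re h * (p z \<times> n z) $ j + Im h * (q z \<times> n z) $ j))) (at z)"
      by (intro derivative_intros F[OF that] bounded_linear.has_derivative[OF bounded_linear_vec_nth d\<psi>[OF that]])
    then show ?thesis
      unfolding \<xi>_def Complex_eq by (rule has_derivative_eq_rhs) (simp add: L_def fun_eq_iff complex_eq_iff)
  qed
  have c0: "c \<in> ?B" using r by simp
  \<comment> \<open>The Jacobians of the three pairs add up to twice n \<bullet> (p \<times> q),
    which is not zero; hence one of them is not zero.\<close>
  have "(\<Sum>k\<in>UNIV. Re (L k (p c) c) * Im (L k (q c) c) - Im (L k (p c) c) * Re (L k (q c) c)) = 2 * (n c \<bullet> (p c \<times> q c))"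
    unfolding L_def by (simp add: sum_3 cross3_simps)
  also have "\<dots> \<noteq> 0"
  proof
    assume "2 * (n c \<bullet> (p c \<times> q c)) = 0"
    then have "(p c \<times> q c) \<bullet> n c = 0" by (simp add: inner_commute)
    with cross3_in_orthogonal_plane[OF n1[OF c0] np[OF c0] nq[OF c0]] ne[OF c0] show False by simp
  qed
  finally obtain k where k: "Re (L k (p c) c) * Im (L k (q c) c) - Im (L k (p c) c) * Re (L k (q c) c) \<noteq> 0"
    by (elim sum.not_neutral_contains_not_neutral) blast
  have cL: "continuous_on ?B (\<lambda>z. L k (f z) z)" if "continuous_on ?B f" for f
    unfolding L_def Complex_eq by (intro continuous_intros that continuous_on_cross cn)
  show thesis
  proof (rule planar_local_inverse[OF open_ball c0 d\<xi> cL[OF cp] cL[OF cq] k])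
    fix U' V g g'
    assume U': "open U'" "U' \<subseteq> ?B" "c \<in> U'" and V: "open V" "\<xi> k c \<in> V" and hom: "homeomorphism U' V (\<xi> k) g"
      and dg: "\<And>y. y \<in> V \<Longrightarrow> (g has_derivative g' y) (at y)"
      and g': "\<And>y h. y \<in> V \<Longrightarrow> Re (g' y h) *\<^sub>R L k (p (g y)) (g y) + Im (g' y h) *\<^sub>R L k (q (g y)) (g y) = h"
    have gB: "g y \<in> ?B" and gU: "g y \<in> U'" if "y \<in> V" for y
      using hom that U'(2) by (auto simp: homeomorphism_def)
    define X where "X y = \<psi> (g y)" for y
    define T where "T y h = Re (g' y h) *\<^sub>R p (g y) + Im (g' y h) *\<^sub>R q (g y)" for y h
    have L_T: "L j (T y h) (g y) = Re (g' y h) *\<^sub>R L j (p (g y)) (g y) + Im (g' y h) *\<^sub>R L j (q (g y)) (g y)" for j y h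
      unfolding T_def by (rule L_lin)
    have nT: "n (g y) \<bullet> T y h = 0" if "y \<in> V" for y h
      using np[OF gB[OF that]] nq[OF gB[OF that]] by (simp add: T_def inner_add_right)
    have Tlin: "T y h = Re h *\<^sub>R T y 1 + Im h *\<^sub>R T y \<i>" if "y \<in> V" for y h
    proof -
      have "linear (g' y)" using dg[OF that] has_derivative_linear by blast
      moreover have "Re h *\<^sub>R 1 + Im h *\<^sub>R \<i> = h" by (simp add: complex_eq_iff)
      ultimately have "g' y h = Re h *\<^sub>R g' y 1 + Im h *\<^sub>R g' y \<i>"
        by (metis linear_add linear_scale)
      then show ?thesis by (simp add: T_def algebra_simps)
    qed
    have Ti: "T y \<i> = n (g y) \<times> T y 1" if "y \<in> V" for y
    proof (rule rotated_tangent_vector[OF n1[OF gB[OF that]] nT[OF that] nT[OF that], of _ k])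
      have "L k (T y 1) (g y) = 1" "L k (T y \<i>) (g y) = \<i>" unfolding L_T using g'[OF that] by auto
      then show "T y 1 $ k = 1" "(T y 1 \<times> n (g y)) $ k = 0" "T y \<i> $ k = 0" "(T y \<i> \<times> n (g y)) $ k = 1"
        by (auto simp: L_def complex_eq_iff)
    qed
    have X1: "(X has_derivative T y) (at y)" if "y \<in> V" for y
      unfolding X_def[abs_def] T_def[abs_def]
      by (rule has_derivative_compose[OF dg[OF that] d\<psi>[OF gB[OF that]]])
    have L_mult: "L j (T y h) (g y) = L j (T y 1) (g y) * h" if "y \<in> V" for j y h
      unfolding L_def
      by (rule rotation_complex_linear[OF n1[OF gB[OF that]] nT[OF that] Tlin[OF that, of h, unfolded Ti[OF that]]])
    have hol: "((\<lambda>y. \<xi> j (g y)) has_field_derivative L j (T y 1) (g y)) (at y)" if "y \<in> V" for j y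
      unfolding has_field_derivative_def
      using has_derivative_compose[OF dg[OF that] d\<xi>[OF gB[OF that], of j]]
      by (rule has_derivative_eq_rhs) (rule ext, simp only: L_T[symmetric], rule L_mult[OF that])
    show thesis
    proof (rule that[of V "\<xi> k c" X "\<lambda>y. T y 1"])
      have "g (\<xi> k c) = c" using hom U'(3) by (simp add: homeomorphism_apply1)
      then show "X (\<xi> k c) = s" using \<psi>c w0 by (simp add: X_def)
      show "X ` V \<subseteq> S" using \<psi>S gB by (auto simp: X_def)
      have "inj_on g V" using hom by (intro inj_on_inverseI[of _ "\<xi> k"]) (simp add: homeomorphism_apply2)
      then show "inj_on X V"
        using inj gB by (auto simp: X_def inj_on_def)
      show "(X has_derivative (\<lambda>h. Re h *\<^sub>R T y 1 + Im h *\<^sub>R (\<gamma> (X y) \<times> T y 1))) (at y)" if "y \<in> V" for y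
      proof (rule has_derivative_eq_rhs[OF X1[OF that]])
        show "T y = (\<lambda>h. Re h *\<^sub>R T y 1 + Im h *\<^sub>R (\<gamma> (X y) \<times> T y 1))"
          unfolding X_def n_def[symmetric] by (rule ext) (rule Tlin[OF that, unfolded Ti[OF that]])
      qed
      show "\<gamma> (X y) \<bullet> T y 1 = 0" if "y \<in> V" for y
        using nT[OF that, of 1] by (simp add: X_def n_def)
      show "T y 1 \<noteq> 0" if "y \<in> V" for y
      proof
        assume "T y 1 = 0"
        then have "L k (T y 1) (g y) = 0" by (simp add: L_def complex_eq_iff)
        moreover have "L k (T y 1) (g y) = 1" unfolding L_T using g'[OF that] by auto
        ultimately show False by simp
      qed
      have "(\<lambda>y. \<xi> j (g y)) holomorphic_on V" for j
        using hol V(1) by (auto simp: holomorphic_on_open)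
      then have "deriv (\<lambda>y. \<xi> j (g y)) holomorphic_on V" for j
        using V(1) by (rule holomorphic_deriv)
      then show "(\<lambda>y. Complex (T y 1 $ j) (- ((\<gamma> (X y) \<times> T y 1) $ j))) holomorphic_on V" for j
      proof (rule holomorphic_transform)
        fix y assume "y \<in> V"
        have "T y 1 \<times> n (g y) = - (n (g y) \<times> T y 1)" by (rule cross_skew)
        then show "deriv (\<lambda>y. \<xi> j (g y)) y = Complex (T y 1 $ j) (- ((\<gamma> (X y) \<times> T y 1) $ j))"
          using DERIV_imp_deriv[OF hol[OF \<open>y \<in> V\<close>, of j]] by (simp add: L_def X_def n_def)
      qed
    qed (rule V)+
  qed
qed

section \<open>Stereographic projection, the Weierstrass formula and the Gauss map as a
  coordinate\<close>

definition oriented_frame :: "real^3 \<Rightarrow> real^3 \<Rightarrow> real^3 \<Rightarrow> bool" where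
  "oriented_frame a b c \<longleftrightarrow> norm a = 1 \<and> norm b = 1 \<and> a \<bullet> b = 0 \<and> c = a \<times> b"

lemma oriented_frame_inner:
  assumes "oriented_frame a b c"
  shows "a \<bullet> a = 1" "b \<bullet> b = 1" "c \<bullet> c = 1" "a \<bullet> b = 0" "b \<bullet> a = 0" "a \<bullet> c = 0" "c \<bullet> a = 0" "b \<bullet> c = 0" "c \<bullet> b = 0"
proof -
  show 1: "a \<bullet> a = 1" "b \<bullet> b = 1" "a \<bullet> b = 0" "b \<bullet> a = 0"
    using assms by (auto simp: oriented_frame_def norm_eq_1 inner_commute)
  have c: "c = a \<times> b" using assms by (simp add: oriented_frame_def)
  show "a \<bullet> c = 0" "c \<bullet> a = 0" "b \<bullet> c = 0" "c \<bullet> b = 0"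
    by (simp_all add: c dot_cross_self)
  show "c \<bullet> c = 1" by (simp add: c dot_cross 1)
qed

lemma oriented_frame_cross:
  assumes "oriented_frame a b c"
  shows "a \<times> b = c" "b \<times> c = a" "c \<times> a = b"
proof -
  note i = oriented_frame_inner[OF assms]
  show c: "a \<times> b = c" using assms by (simp add: oriented_frame_def)
  show "b \<times> c = a" unfolding c[symmetric] Lagrange by (simp add: i)
  have "a \<times> c = - b" unfolding c[symmetric] Lagrange by (simp add: i)
  then show "c \<times> a = b" using cross_skew[of c a] by simp
qed

lemma oriented_frame_swap: "oriented_frame a b c \<Longrightarrow> oriented_frame b a (- c)"
  unfolding oriented_frame_def cross_skew[of b a] inner_commute[of b a] by simp

lemma oriented_frame_expand:
  assumes "oriented_frame a b c"
  shows "v = (v \<bullet> a) *\<^sub>R a + (v \<bullet> b) *\<^sub>R b + (v \<bullet> c) *\<^sub>R c"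
proof -
  note i = oriented_frame_inner[OF assms]
  let ?d = "v - ((v \<bullet> a) *\<^sub>R a + (v \<bullet> b) *\<^sub>R b + (v \<bullet> c) *\<^sub>R c)"
  have a: "?d \<bullet> a = 0" and b: "?d \<bullet> b = 0" and c: "?d \<bullet> c = 0"
    by (simp_all add: inner_diff_left inner_add_left i)
  have "c \<times> ?d = 0"
    using a b unfolding oriented_frame_cross(1)[OF assms, symmetric] cross_skew[of "a \<times> b"] Lagrange
    by (simp add: inner_commute)
  then have "c \<times> (c \<times> ?d) = 0" by simp
  then have "(c \<bullet> ?d) *\<^sub>R c - (c \<bullet> c) *\<^sub>R ?d = 0" by (simp only: Lagrange[of c c ?d])
  moreover have "c \<bullet> ?d = 0" using c by (simp only: inner_commute)
  ultimately have "?d = 0" by (simp only: i) simp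
  then show ?thesis by simp
qed

lemma oriented_frame_inner_expand:
  assumes "oriented_frame a b c"
  shows "v \<bullet> w = (v \<bullet> a) * (w \<bullet> a) + (v \<bullet> b) * (w \<bullet> b) + (v \<bullet> c) * (w \<bullet> c)"
proof -
  have "v \<bullet> w = ((v \<bullet> a) *\<^sub>R a + (v \<bullet> b) *\<^sub>R b + (v \<bullet> c) *\<^sub>R c) \<bullet> w"
    using oriented_frame_expand[OF assms, of v] by (rule arg_cong)
  then show ?thesis
    by (simp only: inner_add_left inner_scaleR_left inner_commute[of a w] inner_commute[of b w] inner_commute[of c w])
qed

lemma oriented_frame_cross_inner:
  assumes "oriented_frame a b c"
  shows "(n \<times> v) \<bullet> a = (n \<bullet> b) * (v \<bullet> c) - (n \<bullet> c) * (v \<bullet> b)"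
    "(n \<times> v) \<bullet> b = (n \<bullet> c) * (v \<bullet> a) - (n \<bullet> a) * (v \<bullet> c)"
    "(n \<times> v) \<bullet> c = (n \<bullet> a) * (v \<bullet> b) - (n \<bullet> b) * (v \<bullet> a)"
proof -
  note x = oriented_frame_cross[OF assms]
  show "(n \<times> v) \<bullet> a = (n \<bullet> b) * (v \<bullet> c) - (n \<bullet> c) * (v \<bullet> b)"
    using dot_cross[of n v b c] unfolding x .
  show "(n \<times> v) \<bullet> b = (n \<bullet> c) * (v \<bullet> a) - (n \<bullet> a) * (v \<bullet> c)"
    using dot_cross[of n v c a] unfolding x .
  show "(n \<times> v) \<bullet> c = (n \<bullet> a) * (v \<bullet> b) - (n \<bullet> b) * (v \<bullet> a)"
    using dot_cross[of n v a b] unfolding x .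
qed

lemma oriented_frame_exists:
  assumes "norm c = 1"
  obtains a b where "oriented_frame a b c"
proof -
  obtain a :: "real^3" where a: "norm a = 1" "a \<bullet> c = 0"
  proof -
    obtain x :: "real^3" where x: "x \<noteq> 0" "orthogonal c x"
      using orthogonal_to_vector_exists[of c] by auto
    show thesis
      by (rule that[of "sgn x"]) (use x in \<open>auto simp: norm_sgn sgn_div_norm orthogonal_def inner_commute\<close>)
  qed
  have c: "c \<bullet> c = 1" "a \<bullet> a = 1" using assms a by (auto simp: norm_eq_1)
  show thesis
  proof (rule that[of a "c \<times> a"])
    have "norm (c \<times> a) = 1" "a \<bullet> (c \<times> a) = 0"
      using cross3_orthogonal_frame[of c a] assms a by (auto simp: inner_commute)
    moreover have "a \<times> (c \<times> a) = c" by (simp add: Lagrange c a)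
    ultimately show "oriented_frame a (c \<times> a) c" using a by (simp add: oriented_frame_def)
  qed
qed

definition stereo :: "real^3 \<Rightarrow> real^3 \<Rightarrow> real^3 \<Rightarrow> real^3 \<Rightarrow> complex" where
  "stereo a b c n = Complex (n \<bullet> a) (n \<bullet> b) / of_real (1 - n \<bullet> c)"

text \<open>The second intersection of the sphere with the line from the pole \<open>c\<close>
  through the plane point with coordinate \<open>w\<close>. The scale factor 2/(1+|w|^2) is the
  value of 1 - n \<bullet> c there.\<close>

definition inv_stereo :: "real^3 \<Rightarrow> real^3 \<Rightarrow> real^3 \<Rightarrow> complex \<Rightarrow> real^3" where
  "inv_stereo a b c w = c + (2 / (1 + (cmod w)\<^sup>2)) *\<^sub>R (Re w *\<^sub>R a + Im w *\<^sub>R b - c)"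

lemma unit_inner_eq_1:
  fixes n c :: "real^3"
  assumes "norm n = 1" "norm c = 1" "n \<bullet> c = 1"
  shows "n = c"
proof -
  have "(norm (n - c))\<^sup>2 = 0"
    using assms by (simp add: power2_norm_eq_inner inner_diff_left inner_diff_right inner_commute norm_eq_1)
  then show ?thesis by simp
qed

text \<open>The formula for the modulus shows that the closed hemisphere opposite to the pole
  corresponds to the closed unit disc.\<close>

lemma stereo_inverse:
  assumes fr: "oriented_frame a b c" and n: "norm n = 1" "n \<noteq> c"
  shows "inv_stereo a b c (stereo a b c n) = n"
    and "(cmod (stereo a b c n))\<^sup>2 = (1 + n \<bullet> c) / (1 - n \<bullet> c)"
proof -
  note i = oriented_frame_inner[OF fr]
  have "norm c = 1" using i by (simp add: norm_eq_1)
  then have nc: "1 - n \<bullet> c \<noteq> 0" using unit_inner_eq_1[of n c] n by auto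
  have sq: "(n \<bullet> a)\<^sup>2 + (n \<bullet> b)\<^sup>2 = (1 + n \<bullet> c) * (1 - n \<bullet> c)"
    using oriented_frame_inner_expand[OF fr, of n n] n(1)
    by (simp add: norm_eq_1 power2_eq_square algebra_simps)
  show c2: "(cmod (stereo a b c n))\<^sup>2 = (1 + n \<bullet> c) / (1 - n \<bullet> c)"
  proof -
    have "(cmod (stereo a b c n))\<^sup>2 = ((n \<bullet> a)\<^sup>2 + (n \<bullet> b)\<^sup>2) / (1 - n \<bullet> c)\<^sup>2"
      by (simp add: stereo_def norm_divide power_divide cmod_power2 del: of_real_diff)
    also have "\<dots> = (1 + n \<bullet> c) / (1 - n \<bullet> c)"
      unfolding sq using nc by (simp add: power2_eq_square)
    finally show ?thesis .
  qed
  have "2 / (1 + (cmod (stereo a b c n))\<^sup>2) = 1 - n \<bullet> c"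
    unfolding c2 using nc by (simp add: field_simps)
  then have "inv_stereo a b c (stereo a b c n) = (n \<bullet> a) *\<^sub>R a + (n \<bullet> b) *\<^sub>R b + (n \<bullet> c) *\<^sub>R c"
    using nc by (simp add: inv_stereo_def stereo_def Re_divide_of_real Im_divide_of_real scaleR_add_right scaleR_diff_right scaleR_diff_left
        del: of_real_diff)
  then show "inv_stereo a b c (stereo a b c n) = n"
    using oriented_frame_expand[OF fr, of n] by simp
qed

lemma inv_stereo_facts:
  assumes fr: "oriented_frame a b c"
  shows "norm (inv_stereo a b c w) = 1" "inv_stereo a b c w \<noteq> c" "stereo a b c (inv_stereo a b c w) = w"
proof -
  note i = oriented_frame_inner[OF fr]
  let ?n = "inv_stereo a b c w"
  define k where "k = 2 / (1 + (cmod w)\<^sup>2)"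
  have pos: "1 + (cmod w)\<^sup>2 > 0" by (simp add: add_pos_nonneg)
  have k: "k > 0" using pos by (simp add: k_def)
  have kr: "k * (cmod w)\<^sup>2 = 2 - k" using pos by (simp add: k_def field_simps)
  have na: "?n \<bullet> a = k * Re w" and nb: "?n \<bullet> b = k * Im w" and nc: "?n \<bullet> c = 1 - k"
    by (simp_all add: inv_stereo_def k_def[symmetric] inner_add_left inner_diff_left i)
  have "?n \<bullet> ?n = k * (k * (cmod w)\<^sup>2) + (1 - k)\<^sup>2"
    unfolding oriented_frame_inner_expand[OF fr, of ?n ?n] na nb nc cmod_power2
    by (simp add: power2_eq_square algebra_simps)
  also have "\<dots> = 1" unfolding kr by (simp add: power2_eq_square algebra_simps)
  finally show "norm ?n = 1" by (simp add: norm_eq_1)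
  show "?n \<noteq> c" using nc i(3) k by auto
  show "stereo a b c ?n = w"
    using k by (simp add: stereo_def na nb nc complex_eq_iff Re_divide_of_real Im_divide_of_real)
qed

text \<open>The Weierstrass expression of the Gauss map. It rests on the identity (n_a + i n_b)(f_a
  - i f_b) = f_c (1 - n_c), a consequence of |n| = 1 and n \<bullet> E = 0. If the denominator
  vanished, the identity would force f_c = 0 and then all components of \<open>E\<close> to
  vanish.\<close>

lemma weierstrass_gauss_map:
  fixes a b c n E :: "real^3"
  assumes fr: "oriented_frame a b c" and n: "norm n = 1" "n \<bullet> E = 0" "E \<noteq> 0" "n \<noteq> c"
  defines "f \<equiv> \<lambda>v. Complex (E \<bullet> v) (- ((n \<times> E) \<bullet> v))"
  shows "f a - \<i> * f b \<noteq> 0" "stereo a b c n = f c / (f a - \<i> * f b)"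
proof -
  note i = oriented_frame_inner[OF fr]
  note x = oriented_frame_cross_inner[OF fr, of n E]
  note e = oriented_frame_inner_expand[OF fr]
  define n1 n2 n3 where "n1 = n \<bullet> a" and "n2 = n \<bullet> b" and "n3 = n \<bullet> c"
  define E1 E2 E3 where "E1 = E \<bullet> a" and "E2 = E \<bullet> b" and "E3 = E \<bullet> c"
  note defs = n1_def[symmetric] n2_def[symmetric] n3_def[symmetric] E1_def[symmetric] E2_def[symmetric] E3_def[symmetric]
  have "norm c = 1" using i by (simp add: norm_eq_1)
  then have nc: "1 - n3 \<noteq> 0" using unit_inner_eq_1[of n c] n by (auto simp: n3_def)
  have nn: "n1 * n1 + n2 * n2 + n3 * n3 = 1"
    using e[of n n] n(1) by (simp add: norm_eq_1 defs)
  have nE: "n1 * E1 + n2 * E2 + n3 * E3 = 0"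
    using e[of n E] n(2) by (simp add: defs)
  have V: "(n \<times> E) \<bullet> a = n2 * E3 - n3 * E2" "(n \<times> E) \<bullet> b = n3 * E1 - n1 * E3" "(n \<times> E) \<bullet> c = n1 * E2 - n2 * E1"
    using x by (simp_all add: defs)
  have d: "f a - \<i> * f b = Complex (E1 - (n3 * E1 - n1 * E3)) (- (n2 * E3 - n3 * E2) - E2)"
    by (simp add: f_def V defs complex_eq_iff)
  have m: "Complex n1 n2 * (f a - \<i> * f b) = f c * of_real (1 - n3)"
    unfolding d using nn nE by (simp add: f_def V defs complex_eq_iff) algebra
  show nz: "f a - \<i> * f b \<noteq> 0"
  proof
    assume 0: "f a - \<i> * f b = 0"
    then have "f c = 0" using m nc by simp
    then have E3: "E3 = 0" by (simp add: f_def defs complex_eq_iff)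
    then have "(1 - n3) * E1 = 0" "(1 - n3) * E2 = 0" using 0 unfolding d by (simp_all add: complex_eq_iff algebra_simps)
    then have "E1 = 0" "E2 = 0" using nc by auto
    then have "E = 0" using oriented_frame_expand[OF fr, of E] E3 by (simp add: defs)
    then show False using n by simp
  qed
  show "stereo a b c n = f c / (f a - \<i> * f b)"
    using m nz nc by (simp add: stereo_def defs field_simps)
qed

text \<open>In a conformal parameter the projected Gauss map \<open>g\<close> is a quotient of
  holomorphic functions, and it is injective because \<gamma> and the parametrization are. An
  injective holomorphic map has a holomorphic inverse, so \<open>g\<close> itself serves as the
  parameter; no separate discussion of points of zero curvature arises.\<close>

lemma gauss_coordinate_local:
  assumes min: "minimal_surface S" and gauss: "gauss_map S \<gamma>" and inj: "inj_on \<gamma> S"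
    and fr: "oriented_frame a b c" and s: "s \<in> S" "\<gamma> s \<noteq> c"
  obtains U Y E where "open U" "stereo a b c (\<gamma> s) \<in> U"
    "\<And>w. w \<in> U \<Longrightarrow> Y w \<in> S \<and> \<gamma> (Y w) \<noteq> c \<and> stereo a b c (\<gamma> (Y w)) = w"
    "\<And>w. w \<in> U \<Longrightarrow> (Y has_derivative (\<lambda>h. Re h *\<^sub>R E w + Im h *\<^sub>R (\<gamma> (Y w) \<times> E w))) (at w)"
    "\<And>w. w \<in> U \<Longrightarrow> \<gamma> (Y w) \<bullet> E w = 0" "\<And>w. w \<in> U \<Longrightarrow> E w \<noteq> 0"
    "\<And>j. (\<lambda>w. Complex (E w $ j) (- ((\<gamma> (Y w) \<times> E w) $ j))) holomorphic_on U"
proof (rule local_conformal_param[OF min gauss s(1)])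
  fix V \<zeta>0 X E
  assume V: "open V" "\<zeta>0 \<in> V" and X0: "X \<zeta>0 = s" and XS: "X ` V \<subseteq> S" and injX: "inj_on X V"
    and dX: "\<And>y. y \<in> V \<Longrightarrow> (X has_derivative (\<lambda>h. Re h *\<^sub>R E y + Im h *\<^sub>R (\<gamma> (X y) \<times> E y))) (at y)"
    and nE: "\<And>y. y \<in> V \<Longrightarrow> \<gamma> (X y) \<bullet> E y = 0" and E: "\<And>y. y \<in> V \<Longrightarrow> E y \<noteq> 0"
    and hol: "\<And>j. (\<lambda>y. Complex (E y $ j) (- ((\<gamma> (X y) \<times> E y) $ j))) holomorphic_on V"
  define V' where "V' = {y \<in> V. \<gamma> (X y) \<noteq> c}"
  have cX: "continuous_on V X"
    using dX by (auto intro!: continuous_at_imp_continuous_on has_derivative_continuous)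
  have c\<gamma>: "continuous_on V (\<lambda>y. \<gamma> (X y))"
    using gauss by (intro continuous_on_compose2[OF _ cX XS]) (simp add: gauss_map_def)
  have V': "open V'" "V' \<subseteq> V" "\<zeta>0 \<in> V'"
  proof -
    have "V' = V \<inter> (\<lambda>y. \<gamma> (X y)) -` (- {c})" by (auto simp: V'_def)
    then show "open V'" using continuous_open_preimage[OF c\<gamma> V(1), of "- {c}"]
      by (simp add: open_Compl)
  qed (use V s X0 in \<open>auto simp: V'_def\<close>)
  have n1: "norm (\<gamma> (X y)) = 1" if "y \<in> V" for y
    using gauss XS that by (auto simp: gauss_map_def)
  define g where "g y = stereo a b c (\<gamma> (X y))" for y
  define f where "f v y = Complex (E y \<bullet> v) (- ((\<gamma> (X y) \<times> E y) \<bullet> v))" for v y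
  have fh: "f v holomorphic_on V'" for v
  proof -
    have "f v = (\<lambda>y. \<Sum>j\<in>UNIV. of_real (v $ j) * Complex (E y $ j) (- ((\<gamma> (X y) \<times> E y) $ j)))"
      by (auto simp: f_def fun_eq_iff complex_eq_iff inner_vec_def sum_negf mult.commute)
    moreover have "\<dots> holomorphic_on V'"
      by (intro holomorphic_intros holomorphic_on_subset[OF hol V'(2)])
    ultimately show ?thesis by simp
  qed
  have gW: "f a y - \<i> * f b y \<noteq> 0" "g y = f c y / (f a y - \<i> * f b y)" if "y \<in> V'" for y
  proof -
    have "y \<in> V" "\<gamma> (X y) \<noteq> c" using that by (auto simp: V'_def)
    from weierstrass_gauss_map[OF fr n1[OF this(1)] nE[OF this(1)] E[OF this(1)] this(2)]
    show "f a y - \<i> * f b y \<noteq> 0" "g y = f c y / (f a y - \<i> * f b y)" by (auto simp: f_def g_def)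
  qed
  have gh: "g holomorphic_on V'"
    by (rule holomorphic_transform[of "\<lambda>y. f c y / (f a y - \<i> * f b y)"])
      (use gW in \<open>auto intro!: holomorphic_intros fh\<close>)
  have ginj: "inj_on g V'"
  proof (rule inj_onI)
    fix y y' assume y: "y \<in> V'" "y' \<in> V'" "g y = g y'"
    then have "y \<in> V" "y' \<in> V" "\<gamma> (X y) \<noteq> c" "\<gamma> (X y') \<noteq> c" by (auto simp: V'_def)
    then have "\<gamma> (X y) = inv_stereo a b c (g y)" "\<gamma> (X y') = inv_stereo a b c (g y')"
      unfolding g_def by (simp_all only: stereo_inverse(1)[OF fr n1] not_False_eq_True)
    then have "\<gamma> (X y) = \<gamma> (X y')" unfolding y(3) by simp
    then show "y = y'"
      using inj injX XS \<open>y \<in> V\<close> \<open>y' \<in> V\<close> by (auto dest!: inj_onD)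
  qed
  obtain k where k: "k holomorphic_on g ` V'" "\<And>z. z \<in> V' \<Longrightarrow> k (g z) = z"
    using holomorphic_has_inverse[OF gh V'(1) ginj] by metis
  have Uo: "open (g ` V')" by (rule open_mapping_thm3[OF gh V'(1) ginj])
  have kV: "k w \<in> V'" "k w \<in> V" "g (k w) = w" if "w \<in> g ` V'" for w using k(2) that V' by auto
  define Y where "Y w = X (k w)" for w
  \<comment> \<open>The tangent vector \<open>E\<close> multiplied by the complex number
    \<open>deriv k w\<close>, where i acts as the rotation \<gamma> \<times> _ of the tangent
    plane.\<close>
  define F where "F w = Re (deriv k w) *\<^sub>R E (k w) + Im (deriv k w) *\<^sub>R (\<gamma> (Y w) \<times> E (k w))" for w
  have nF: "\<gamma> (Y w) \<times> F w = Re (deriv k w) *\<^sub>R (\<gamma> (Y w) \<times> E (k w)) - Im (deriv k w) *\<^sub>R E (k w)" if "w \<in> g ` V'" for w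
    using cross3_orthogonal_frame(2)[OF n1 nE, of "k w"] kV[OF that]
    by (simp add: F_def Y_def cross_add_right cross_mult_right)
  have dk: "(k has_field_derivative deriv k w) (at w)" if "w \<in> g ` V'" for w
    using k(1) Uo that by (rule holomorphic_derivI)
  have Fne: "F w \<noteq> 0" if w: "w \<in> g ` V'" for w
  proof
    assume F0: "F w = 0"
    have "inj_on k (g ` V')" using k(2) by (auto intro!: inj_onI)
    then have d0: "deriv k w \<noteq> 0" using holomorphic_injective_imp_regular[OF k(1) Uo _ w] by blast
    have "F w \<bullet> E (k w) = Re (deriv k w) * (E (k w) \<bullet> E (k w))"
      by (simp add: F_def inner_add_left dot_cross_self)
    then have "Re (deriv k w) = 0" using F0 E[OF kV(2)[OF w]] by simp
    moreover have "(\<gamma> (Y w) \<times> F w) \<bullet> E (k w) = - Im (deriv k w) * (E (k w) \<bullet> E (k w))"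
      unfolding nF[OF w] by (simp add: inner_diff_left dot_cross_self)
    then have "Im (deriv k w) = 0" using F0 E[OF kV(2)[OF w]] by simp
    ultimately show False using d0 by (simp add: complex_eq_iff)
  qed
  show thesis
  proof (rule that[of "g ` V'" Y F])
    show "open (g ` V')" by (rule Uo)
    show "stereo a b c (\<gamma> s) \<in> g ` V'" using V'(3) X0 by (auto simp: g_def)
    show "Y w \<in> S \<and> \<gamma> (Y w) \<noteq> c \<and> stereo a b c (\<gamma> (Y w)) = w" if "w \<in> g ` V'" for w
      using kV[OF that] XS by (auto simp: Y_def g_def V'_def)
    show "(Y has_derivative (\<lambda>h. Re h *\<^sub>R F w + Im h *\<^sub>R (\<gamma> (Y w) \<times> F w))) (at w)" if w: "w \<in> g ` V'" for w
    proof -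
      have "(k has_derivative (\<lambda>h. deriv k w * h)) (at w)"
        using dk[OF w] by (simp add: has_field_derivative_def)
      from has_derivative_compose[OF this dX[OF kV(2)[OF w]]]
      show ?thesis
        unfolding Y_def[symmetric, abs_def]
        by (rule has_derivative_eq_rhs) (simp add: nF[OF w] fun_eq_iff Y_def[symmetric], simp add: F_def algebra_simps)
    qed
    show "\<gamma> (Y w) \<bullet> F w = 0" if "w \<in> g ` V'" for w
      using nE[OF kV(2)[OF that]] by (simp add: F_def Y_def inner_add_right dot_cross_self)
    show "F w \<noteq> 0" if "w \<in> g ` V'" for w by (rule Fne[OF that])
    show "(\<lambda>w. Complex (F w $ j) (- ((\<gamma> (Y w) \<times> F w) $ j))) holomorphic_on g ` V'" for j
    proof (rule holomorphic_transform)
      have "(\<lambda>w. ((\<lambda>y. Complex (E y $ j) (- ((\<gamma> (X y) \<times> E y) $ j))) \<circ> k) w) holomorphic_on g ` V'"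
        using holomorphic_on_compose_gen[OF k(1) hol] kV by (auto simp: o_def)
      then show "(\<lambda>w. ((\<lambda>y. Complex (E y $ j) (- ((\<gamma> (X y) \<times> E y) $ j))) \<circ> k) w * deriv k w) holomorphic_on g ` V'"
        by (intro holomorphic_intros holomorphic_deriv k(1) Uo)
      show "((\<lambda>y. Complex (E y $ j) (- ((\<gamma> (X y) \<times> E y) $ j))) \<circ> k) w * deriv k w = Complex (F w $ j) (- ((\<gamma> (Y w) \<times> F w) $ j))"
        if "w \<in> g ` V'" for w
        unfolding nF[OF that] by (simp add: F_def Y_def complex_eq_iff algebra_simps)
    qed
  qed
qed

text \<open>Injectivity of \<gamma> makes all the local parametrizations restrictions of one map,
  the inverse \<open>X\<close> of the projected Gauss map, so nothing has to be glued.\<close>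

lemma gauss_coordinate:
  assumes min: "minimal_surface S" and gauss: "gauss_map S \<gamma>" and inj: "inj_on \<gamma> S"
    and fr: "oriented_frame a b c"
  defines "S' \<equiv> {s \<in> S. \<gamma> s \<noteq> c}"
  defines "\<Omega> \<equiv> (\<lambda>s. stereo a b c (\<gamma> s)) ` S'"
  obtains X E where "open \<Omega>" "homeomorphism \<Omega> S' X (\<lambda>s. stereo a b c (\<gamma> s))"
    "\<And>w. w \<in> \<Omega> \<Longrightarrow> \<gamma> (X w) = inv_stereo a b c w"
    "\<And>w. w \<in> \<Omega> \<Longrightarrow> (X has_derivative (\<lambda>h. Re h *\<^sub>R E w + Im h *\<^sub>R (inv_stereo a b c w \<times> E w))) (at w)"
    "\<And>w. w \<in> \<Omega> \<Longrightarrow> inv_stereo a b c w \<bullet> E w = 0" "\<And>w. w \<in> \<Omega> \<Longrightarrow> E w \<noteq> 0"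
    "\<And>j. (\<lambda>w. Complex (E w $ j) (- ((inv_stereo a b c w \<times> E w) $ j))) holomorphic_on \<Omega>"
proof -
  let ?\<sigma> = "\<lambda>s. stereo a b c (\<gamma> s)"
  let ?N = "inv_stereo a b c"
  have n1: "norm (\<gamma> s) = 1" if "s \<in> S" for s using gauss that by (auto simp: gauss_map_def)
  have N\<sigma>: "?N (?\<sigma> s) = \<gamma> s" if "s \<in> S'" for s
    using stereo_inverse(1)[OF fr n1] that by (simp add: S'_def)
  have inj\<sigma>: "inj_on ?\<sigma> S'"
  proof (rule inj_onI)
    fix s t assume st: "s \<in> S'" "t \<in> S'" "?\<sigma> s = ?\<sigma> t"
    have "\<gamma> s = ?N (?\<sigma> s)" by (rule N\<sigma>[OF st(1), symmetric])
    also have "\<dots> = ?N (?\<sigma> t)" by (simp only: st(3))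
    also have "\<dots> = \<gamma> t" by (rule N\<sigma>[OF st(2)])
    finally show "s = t" using inj st by (auto simp: S'_def dest: inj_onD)
  qed
  define X where "X = the_inv_into S' ?\<sigma>"
  have X\<sigma>: "X (?\<sigma> s) = s" if "s \<in> S'" for s
    unfolding X_def by (rule the_inv_into_f_f[OF inj\<sigma> that])
  have XS: "X w \<in> S'" and \<sigma>X: "?\<sigma> (X w) = w" if "w \<in> \<Omega>" for w
    using that X\<sigma> by (auto simp: \<Omega>_def)
  have \<gamma>X: "\<gamma> (X w) = ?N w" if "w \<in> \<Omega>" for w
    using N\<sigma>[OF XS[OF that]] \<sigma>X[OF that] by simp
  \<comment> \<open>Read off from \<open>X\<close> itself, hence independent of the local
    parametrization that provides its properties.\<close>
  define E where "E w = frechet_derivative X (at w) 1" for w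
  have loc: "\<exists>U. open U \<and> w0 \<in> U \<and> U \<subseteq> \<Omega> \<and>
     (\<forall>w\<in>U. (X has_derivative (\<lambda>h. Re h *\<^sub>R E w + Im h *\<^sub>R (?N w \<times> E w))) (at w) \<and> ?N w \<bullet> E w = 0 \<and> E w \<noteq> 0) \<and>
     (\<forall>j. (\<lambda>w. Complex (E w $ j) (- ((?N w \<times> E w) $ j))) holomorphic_on U)" if w0: "w0 \<in> \<Omega>" for w0
  proof -
    have s: "X w0 \<in> S" "\<gamma> (X w0) \<noteq> c" using XS[OF w0] by (auto simp: S'_def)
    show ?thesis
    proof (rule gauss_coordinate_local[OF min gauss inj fr s])
      fix U Y F
      assume U: "open U" "?\<sigma> (X w0) \<in> U"
        and Y: "\<And>w. w \<in> U \<Longrightarrow> Y w \<in> S \<and> \<gamma> (Y w) \<noteq> c \<and> ?\<sigma> (Y w) = w"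
        and dY: "\<And>w. w \<in> U \<Longrightarrow> (Y has_derivative (\<lambda>h. Re h *\<^sub>R F w + Im h *\<^sub>R (\<gamma> (Y w) \<times> F w))) (at w)"
        and nF: "\<And>w. w \<in> U \<Longrightarrow> \<gamma> (Y w) \<bullet> F w = 0" and F: "\<And>w. w \<in> U \<Longrightarrow> F w \<noteq> 0"
        and hol: "\<And>j. (\<lambda>w. Complex (F w $ j) (- ((\<gamma> (Y w) \<times> F w) $ j))) holomorphic_on U"
      have U\<Omega>: "U \<subseteq> \<Omega>"
        using Y unfolding \<Omega>_def S'_def by (intro subsetI image_eqI) auto
      have XY: "X w = Y w" if "w \<in> U" for w
        using X\<sigma>[of "Y w"] Y[OF that] by (simp add: S'_def)
      have dX: "(X has_derivative (\<lambda>h. Re h *\<^sub>R F w + Im h *\<^sub>R (?N w \<times> F w))) (at w)" if "w \<in> U" for w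
      proof (rule has_derivative_transform_within_open[OF _ U(1) that])
        show "(Y has_derivative (\<lambda>h. Re h *\<^sub>R F w + Im h *\<^sub>R (?N w \<times> F w))) (at w)"
          using dY[OF that] \<gamma>X[of w] XY[OF that] U\<Omega> that by auto
      qed (simp add: XY)
      have EF: "E w = F w" if "w \<in> U" for w
        using frechet_derivative_at[OF dX[OF that], symmetric] by (simp add: E_def)
      have \<gamma>Y: "\<gamma> (Y w) = ?N w" if "w \<in> U" for w using \<gamma>X[of w] XY[OF that] U\<Omega> that by auto
      show ?thesis
      proof (intro exI[of _ U] conjI ballI allI)
        show "(\<lambda>w. Complex (E w $ j) (- ((?N w \<times> E w) $ j))) holomorphic_on U" for j
          by (rule holomorphic_transform[OF hol]) (simp add: EF \<gamma>Y)
        show "(X has_derivative (\<lambda>h. Re h *\<^sub>R E w + Im h *\<^sub>R (?N w \<times> E w))) (at w)" if "w \<in> U" for w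
          using dX[OF that] by (simp add: EF[OF that])
        show "?N w \<bullet> E w = 0" "E w \<noteq> 0" if "w \<in> U" for w
          using nF[OF that] F[OF that] by (simp_all add: EF[OF that] \<gamma>Y[OF that])
      qed (use U U\<Omega> \<sigma>X[OF w0] in auto)
    qed
  qed
  have op: "open \<Omega>"
  proof (subst open_subopen, intro ballI)
    fix w assume "w \<in> \<Omega>"
    from loc[OF this] show "\<exists>T. open T \<and> w \<in> T \<and> T \<subseteq> \<Omega>" by blast
  qed
  have facts: "(X has_derivative (\<lambda>h. Re h *\<^sub>R E w + Im h *\<^sub>R (?N w \<times> E w))) (at w)" "?N w \<bullet> E w = 0" "E w \<noteq> 0"
    if "w \<in> \<Omega>" for w using loc[OF that] by auto
  show thesis
  proof (rule that[OF op, of X E])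
    have "continuous_on S' \<gamma>"
      using gauss by (auto simp: gauss_map_def S'_def intro: continuous_on_subset)
    moreover have "\<gamma> s \<bullet> c \<noteq> 1" if "s \<in> S'" for s
      using unit_inner_eq_1[OF n1] that oriented_frame_inner(3)[OF fr] by (auto simp: S'_def norm_eq_1)
    ultimately have "continuous_on S' ?\<sigma>"
      unfolding stereo_def Complex_eq by (intro continuous_intros) (auto simp del: of_real_diff)
    moreover have "continuous_on \<Omega> X"
      using facts(1) by (auto intro!: continuous_at_imp_continuous_on has_derivative_continuous)
    ultimately show "homeomorphism \<Omega> S' X ?\<sigma>"
      unfolding homeomorphism_def using XS \<sigma>X X\<sigma> by (auto simp: \<Omega>_def image_iff)
    show "(\<lambda>w. Complex (E w $ j) (- ((?N w \<times> E w) $ j))) holomorphic_on \<Omega>" for j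
    proof (subst holomorphic_on_open[OF op], intro ballI)
      fix w assume "w \<in> \<Omega>"
      then obtain U where "open U" "w \<in> U" "(\<lambda>w. Complex (E w $ j) (- ((?N w \<times> E w) $ j))) holomorphic_on U"
        using loc by blast
      then show "\<exists>f'. ((\<lambda>w. Complex (E w $ j) (- ((?N w \<times> E w) $ j))) has_field_derivative f') (at w)"
        by (auto simp: holomorphic_on_open)
    qed
  qed (use \<gamma>X facts in auto)
qed

text \<open>Were every direction a normal, the coordinate domain would contain the closed unit disc
  for each choice of pole. Its compact image contains all points whose normal lies in the hemisphere
  opposite to the pole; two opposite poles would exhaust the surface by two compact sets.\<close>

lemma gauss_map_not_onto:
  assumes min: "minimal_surface S" and gauss: "gauss_map S \<gamma>" and inj: "inj_on \<gamma> S"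
    and nc: "\<not> compact S"
  obtains c where "norm c = 1" "c \<notin> \<gamma> ` S"
proof (rule ccontr)
  assume "\<not> thesis"
  then have onto: "\<And>c. norm c = 1 \<Longrightarrow> c \<in> \<gamma> ` S" using that by blast
  have n1: "norm (\<gamma> s) = 1" if "s \<in> S" for s using gauss that by (auto simp: gauss_map_def)
  have half: "\<exists>K. compact K \<and> K \<subseteq> S \<and> {s \<in> S. \<gamma> s \<bullet> c \<le> 0} \<subseteq> K" if fr: "oriented_frame a b c" for a b c
  proof (rule gauss_coordinate[OF min gauss inj fr])
    fix X
    let ?\<sigma> = "\<lambda>s. stereo a b c (\<gamma> s)" and ?S' = "{s \<in> S. \<gamma> s \<noteq> c}"
    assume hom: "homeomorphism (?\<sigma> ` ?S') ?S' X ?\<sigma>"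
    have sub: "cball 0 1 \<subseteq> ?\<sigma> ` ?S'"
    proof
      fix w :: complex
      note N = inv_stereo_facts[OF fr, of w]
      obtain s where s: "s \<in> S" "inv_stereo a b c w = \<gamma> s" using onto[OF N(1)] by auto
      have "?\<sigma> s = w" "\<gamma> s \<noteq> c" using N(2,3) s(2) by auto
      then show "w \<in> ?\<sigma> ` ?S'" using s(1) by (intro image_eqI[of _ _ s]) auto
    qed
    have "compact (X ` cball 0 1)"
      using hom sub by (intro compact_continuous_image) (auto simp: homeomorphism_def intro: continuous_on_subset)
    moreover have "X ` cball 0 1 \<subseteq> S"
      using hom sub by (auto simp: homeomorphism_def)
    moreover have "{s \<in> S. \<gamma> s \<bullet> c \<le> 0} \<subseteq> X ` cball 0 1"
    proof safe
      fix s assume s: "s \<in> S" "\<gamma> s \<bullet> c \<le> 0"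
      have ne: "\<gamma> s \<noteq> c" using s(2) oriented_frame_inner(3)[OF fr] by auto
      have "(cmod (?\<sigma> s))\<^sup>2 \<le> 1"
        unfolding stereo_inverse(2)[OF fr n1[OF s(1)] ne] using s(2) by (simp add: field_simps)
      then have "cmod (?\<sigma> s) \<le> 1" by (simp add: power2_le_imp_le abs_square_le_1)
      moreover have "X (?\<sigma> s) = s" using hom s ne by (simp add: homeomorphism_def)
      ultimately show "s \<in> X ` cball 0 1" by (intro image_eqI[of _ _ "?\<sigma> s"]) auto
    qed
    ultimately show ?thesis by blast
  qed
  obtain a b where fr: "oriented_frame a b (axis 3 1)"
    using oriented_frame_exists[of "axis 3 1"] by auto
  \<comment> \<open>The swapped frame has the opposite pole, so the two hemispheres together cover
    the sphere.\<close>
  obtain K L where KL: "compact K" "K \<subseteq> S" "{s \<in> S. \<gamma> s \<bullet> axis 3 1 \<le> 0} \<subseteq> K"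
     "compact L" "L \<subseteq> S" "{s \<in> S. \<gamma> s \<bullet> (- axis 3 1) \<le> 0} \<subseteq> L"
    using half[OF fr] half[OF oriented_frame_swap[OF fr]] by blast
  have "S = K \<union> L"
  proof
    show "S \<subseteq> K \<union> L"
    proof
      fix s assume "s \<in> S"
      then show "s \<in> K \<union> L" using KL(3,6) by (cases "\<gamma> s \<bullet> axis 3 1 \<le> 0") auto
    qed
  qed (use KL in auto)
  then show False using nc KL by (metis compact_Un)
qed

section \<open>Vanishing of the horizontal flux\<close>

text \<open>The surface in its Gauss coordinate, reduced to what the analysis uses: \<open>N\<close>
  is the Gauss map, \<open>N1\<close> and \<open>N2\<close> are its partial derivatives. Of
  stereographic projection only the bound on these derivatives is kept; its square is integrable
  over the whole plane.\<close>

locale conformal_tube =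
  fixes \<Omega> :: "complex set" and X N E N1 N2 :: "complex \<Rightarrow> real^3" and I :: "real set"
  assumes open_\<Omega>: "open \<Omega>"
    and dX: "\<And>w. w \<in> \<Omega> \<Longrightarrow> (X has_derivative (\<lambda>h. Re h *\<^sub>R E w + Im h *\<^sub>R (N w \<times> E w))) (at w)"
    and norm_N: "\<And>w. w \<in> \<Omega> \<Longrightarrow> norm (N w) = 1"
    and N_orth: "\<And>w. w \<in> \<Omega> \<Longrightarrow> N w \<bullet> E w = 0"
    and E_ne: "\<And>w. w \<in> \<Omega> \<Longrightarrow> E w \<noteq> 0"
    and hol: "\<And>j. (\<lambda>w. Complex (E w $ j) (- ((N w \<times> E w) $ j))) holomorphic_on \<Omega>"
    and dN: "\<And>w. w \<in> \<Omega> \<Longrightarrow> (N has_derivative (\<lambda>h. Re h *\<^sub>R N1 w + Im h *\<^sub>R N2 w)) (at w)"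
    and cont_dN: "continuous_on \<Omega> N1" "continuous_on \<Omega> N2"
    and bound_dN: "\<And>w. w \<in> \<Omega> \<Longrightarrow> norm (N1 w) \<le> 10 / (1 + (cmod w)\<^sup>2)"
      "\<And>w. w \<in> \<Omega> \<Longrightarrow> norm (N2 w) \<le> 10 / (1 + (cmod w)\<^sup>2)"
    and open_I: "open I" "is_interval I"
    and compact_slab: "\<And>t1 t2. t1 \<in> I \<Longrightarrow> t2 \<in> I \<Longrightarrow> compact {w \<in> \<Omega>. t1 \<le> X w $ 3 \<and> X w $ 3 \<le> t2}"
begin

definition u :: "3 \<Rightarrow> complex \<Rightarrow> real" where "u j w = X w $ j"

text \<open>Twice the complex derivative of \<open>u j\<close> with respect to w, so that the
  differential of \<open>u j\<close> is \<open>h \<mapsto> Re (f j w * h)\<close>.\<close>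

definition f :: "3 \<Rightarrow> complex \<Rightarrow> complex" where
  "f j w = Complex (E w $ j) (- ((N w \<times> E w) $ j))"

definition slab :: "real \<Rightarrow> real \<Rightarrow> complex set" where
  "slab t1 t2 = {w \<in> \<Omega>. t1 \<le> u 3 w \<and> u 3 w \<le> t2}"

lemma slab: "t1 \<in> I \<Longrightarrow> t2 \<in> I \<Longrightarrow> compact (slab t1 t2)" "slab t1 t2 \<subseteq> \<Omega>"
  using compact_slab by (auto simp: slab_def u_def)

lemma Re_f [simp]: "Re (f j w) = E w $ j" and Im_f [simp]: "Im (f j w) = - ((N w \<times> E w) $ j)"
  by (simp_all add: f_def)

lemma f_holomorphic: "f j holomorphic_on \<Omega>"
  using hol[of j] by (simp add: f_def[abs_def])

lemma f_deriv: "w \<in> \<Omega> \<Longrightarrow> (f j has_field_derivative deriv (f j) w) (at w)"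
  using f_holomorphic open_\<Omega> by (rule holomorphic_derivI)

lemma u_deriv: "w \<in> \<Omega> \<Longrightarrow> (u j has_derivative (\<lambda>h. Re (f j w * h))) (at w)"
  unfolding u_def[abs_def]
  using bounded_linear.has_derivative[OF bounded_linear_vec_nth dX, of w j]
  by (rule has_derivative_eq_rhs) (simp_all add: fun_eq_iff algebra_simps)

lemma cont_u: "continuous_on \<Omega> (u j)"
  using u_deriv by (auto intro!: continuous_at_imp_continuous_on has_derivative_continuous)

lemma cont_f: "continuous_on \<Omega> (f j)"
  using f_holomorphic by (rule holomorphic_on_imp_continuous_on)

lemma cont_f': "continuous_on \<Omega> (deriv (f j))"
  using holomorphic_deriv[OF f_holomorphic open_\<Omega>] by (rule holomorphic_on_imp_continuous_on)

lemma cont_N: "continuous_on \<Omega> N"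
  using dN by (auto intro!: continuous_at_imp_continuous_on has_derivative_continuous)

lemma cont_E: "continuous_on \<Omega> (\<lambda>w. E w $ j)"
  using continuous_on_Re[OF cont_f, of j] by simp

lemma cont_NE: "continuous_on \<Omega> (\<lambda>w. (N w \<times> E w) $ j)"
  using continuous_on_minus[OF continuous_on_Im[OF cont_f, of j]] by simp

text \<open>The left side is the scalar product of the gradients of \<open>u j\<close> and
  \<open>u k\<close>. The formula is the expansion of two standard basis vectors in the orthonormal
  frame formed by \<open>N\<close> and the normalized vectors \<open>E\<close> and
  \<open>N \<times> E\<close>.\<close>

lemma Re_f_f:
  assumes w: "w \<in> \<Omega>"
  shows "Re (f j w * cnj (f k w)) = (E w \<bullet> E w) * ((if j = k then 1 else 0) - N w $ j * N w $ k)"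
proof -
  let ?l = "norm (E w)" and ?V = "N w \<times> E w"
  note o = cross3_orthogonal_frame[OF norm_N[OF w] N_orth[OF w]]
  have l: "?l \<noteq> 0" using E_ne[OF w] by simp
  have "E w \<times> ?V = (E w \<bullet> E w) *\<^sub>R N w"
    using N_orth[OF w] by (simp add: Lagrange inner_commute)
  then have "oriented_frame ((1 / ?l) *\<^sub>R E w) ((1 / ?l) *\<^sub>R ?V) (N w)"
    unfolding oriented_frame_def using l o(3) o(4)
    by (simp add: cross_mult_left cross_mult_right power2_norm_eq_inner[symmetric] power2_eq_square)
  note e = oriented_frame_inner_expand[OF this, of "axis j 1" "axis k 1"]
  have ax: "axis i 1 \<bullet> v = v $ i" for i and v :: "real^3" by (simp add: inner_axis')
  have "axis k 1 $ j = (if j = k then 1 else 0 :: real)" by (simp add: axis_def)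
  with e have "(if j = k then 1 else 0) = (E w $ j * E w $ k + ?V $ j * ?V $ k) / (?l * ?l) + N w $ j * N w $ k"
    unfolding ax by (simp add: add_divide_distrib)
  moreover have "?l * ?l = E w \<bullet> E w" by (simp add: power2_norm_eq_inner[symmetric] power2_eq_square)
  ultimately have "E w $ j * E w $ k + ?V $ j * ?V $ k
      = (E w \<bullet> E w) * ((if j = k then 1 else 0) - N w $ j * N w $ k)"
    using l by (simp add: field_simps)
  then show ?thesis by simp
qed

text \<open>Jacobians of pairs of coordinate functions are, up to sign, components of the vector
  area element E \<times> (N \<times> E) = |E|^2 N.\<close>

lemma Im_f_f:
  assumes w: "w \<in> \<Omega>"
  shows "Im (cnj (f 2 w) * f 3 w) = - (E w \<bullet> E w) * N w $ 1" "Im (cnj (f 3 w) * f 1 w) = - (E w \<bullet> E w) * N w $ 2"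
proof -
  have "E w \<times> (N w \<times> E w) = (E w \<bullet> E w) *\<^sub>R N w"
    using N_orth[OF w] by (simp add: Lagrange inner_commute)
  then have "(E w \<times> (N w \<times> E w)) $ 1 = (E w \<bullet> E w) * N w $ 1" "(E w \<times> (N w \<times> E w)) $ 2 = (E w \<bullet> E w) * N w $ 2"
    by simp_all
  then show "Im (cnj (f 2 w) * f 3 w) = - (E w \<bullet> E w) * N w $ 1" "Im (cnj (f 3 w) * f 1 w) = - (E w \<bullet> E w) * N w $ 2"
    unfolding cross_components(1)[of "E w"] cross_components(2)[of "E w"] by (simp_all add: algebra_simps)
qed

text \<open>The Dirichlet product of \<open>u j\<close> and \<open>u 3\<close> weighted by a
  function of the height. By the coarea formula it is the integral over t of \<open>h t\<close>
  times the j-th flux component through the level t, but it makes sense without any level being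
  regular.\<close>

definition flux :: "3 \<Rightarrow> (real \<Rightarrow> real) \<Rightarrow> real" where
  "flux j h = (LINT w:\<Omega>|lborel. h (u 3 w) * Re (f j w * cnj (f 3 w)))"

lemma integrable_height:
  fixes h :: "real \<Rightarrow> real" and g :: "complex \<Rightarrow> real"
  assumes "continuous_on UNIV h" "t1 \<in> I" "t2 \<in> I" "\<And>t. t \<notin> {t1..t2} \<Longrightarrow> h t = 0" "continuous_on \<Omega> g"
  shows "set_integrable lborel \<Omega> (\<lambda>w. h (u 3 w) * g w)"
  by (rule set_integrable_compact_support[OF _ slab(1)[OF assms(2,3)] slab(2)])
    (use assms(4) in \<open>auto intro!: continuous_intros continuous_on_compose2[OF assms(1) cont_u] assms(5) simp: slab_def\<close>)

text \<open>The primitive that vanishes to the left of the support vanishes to its right as well,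
  because the total integral is zero.\<close>

lemma continuous_has_antiderivative:
  fixes h :: "real \<Rightarrow> real"
  assumes h: "continuous_on UNIV h" "\<And>t. t \<notin> {t1..t2} \<Longrightarrow> h t = 0" and zero: "integral {t1..t2} h = 0"
  obtains \<theta> where "\<And>t. (\<theta> has_real_derivative h t) (at t)" "\<And>t. t \<notin> {t1..t2} \<Longrightarrow> \<theta> t = 0"
proof -
  \<comment> \<open>The lower limit \<open>t1 - 1\<close> makes t1 an interior point of the domain
    of integration, so that \<theta> has a two-sided derivative there.\<close>
  define \<theta> where "\<theta> t = integral {t1 - 1..t} h" for t
  have hi: "h integrable_on {a..b}" for a b
    by (rule integrable_continuous_interval, rule continuous_on_subset[OF h(1)]) auto
  have low: "\<theta> t = 0" if "t < t1" for t
  proof -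
    have "\<theta> t = integral {t1 - 1..t} (\<lambda>_. 0)"
      unfolding \<theta>_def by (rule integral_cong) (use that h(2) in auto)
    then show ?thesis by simp
  qed
  have high: "\<theta> t = 0" if t: "t > t2" for t
  proof (cases "t < t1")
    case False
    have "(h has_integral 0) {t1..t2}" using hi[of t1 t2] zero by (simp add: has_integral_iff)
    then have "(h has_integral 0) {t1 - 1..t}"
      by (rule has_integral_on_superset) (use t False h(2) in auto)
    then show ?thesis by (simp add: \<theta>_def integral_unique)
  qed (rule low)
  have "(\<theta> has_real_derivative h t) (at t)" for t
  proof (cases "t < t1")
    case True
    have "((\<lambda>_. 0) has_real_derivative 0) (at t)" by simp
    then have "(\<theta> has_real_derivative 0) (at t)"
      by (rule has_field_derivative_transform_within_open[of _ _ _ "{..<t1}"]) (use True low in auto)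
    then show ?thesis using True h(2) by simp
  next
    case False
    have "(\<theta> has_real_derivative h t) (at t within {t1 - 1..t + 1})"
      unfolding \<theta>_def using False
      by (intro integral_has_real_derivative continuous_on_subset[OF h(1)]) auto
    then show ?thesis using False by (simp add: at_within_Icc_at)
  qed
  with low high show thesis by (intro that[of \<theta>]) auto
qed

text \<open>With \<theta>' = h the integrand is the divergence of \<theta>(u_3) grad u_j: the term
  with second derivatives is the Laplacian of u_j, which vanishes because \<open>f j\<close> is
  holomorphic. As \<theta> vanishes off a compact slab, the integral is zero.\<close>

lemma flux_zero:
  assumes h: "continuous_on UNIV h" "t1 \<in> I" "t2 \<in> I" "\<And>t. t \<notin> {t1..t2} \<Longrightarrow> h t = 0"
    and zero: "integral {t1..t2} h = 0"
  shows "flux j h = 0"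
proof -
  obtain \<theta> where \<theta>: "\<And>t. (\<theta> has_real_derivative h t) (at t)" "\<And>t. t \<notin> {t1..t2} \<Longrightarrow> \<theta> t = 0"
    using continuous_has_antiderivative[OF h(1,4) zero] by blast
  have c\<theta>: "continuous_on UNIV \<theta>" using \<theta>(1) by (auto intro!: continuous_at_imp_continuous_on DERIV_isCont)
  have d\<theta>: "((\<lambda>w. \<theta> (u 3 w)) has_derivative (\<lambda>k. h (u 3 w) * Re (f 3 w * k))) (at w)" if "w \<in> \<Omega>" for w
    using has_derivative_compose[OF u_deriv[OF that] \<theta>(1)[unfolded has_field_derivative_def]] .
  have dRe: "((\<lambda>w. Re (f j w)) has_derivative (\<lambda>k. Re (deriv (f j) w * k))) (at w)"
    and dIm: "((\<lambda>w. Im (f j w)) has_derivative (\<lambda>k. Im (deriv (f j) w * k))) (at w)" if "w \<in> \<Omega>" for w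
    using bounded_linear.has_derivative[OF bounded_linear_Re f_deriv[OF that, unfolded has_field_derivative_def]]
      bounded_linear.has_derivative[OF bounded_linear_Im f_deriv[OF that, unfolded has_field_derivative_def]] .
  note K = slab(1)[OF h(2,3)] slab(2)
  have c: "continuous_on \<Omega> (\<lambda>w. h (u 3 w))" "continuous_on \<Omega> (\<lambda>w. \<theta> (u 3 w))"
    using continuous_on_compose2[OF h(1) cont_u] continuous_on_compose2[OF c\<theta> cont_u] by auto
  have z: "\<theta> (u 3 w) = 0" if "w \<in> \<Omega> - slab t1 t2" for w using that \<theta>(2) by (auto simp: slab_def)
  define P Q where "P w k = \<theta> (u 3 w) * Re (deriv (f j) w * k) + h (u 3 w) * Re (f 3 w * k) * Re (f j w)"
    and "Q w k = \<theta> (u 3 w) * Im (deriv (f j) w * k) + h (u 3 w) * Re (f 3 w * k) * Im (f j w)" for w k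
  have dP: "((\<lambda>w. \<theta> (u 3 w) * Re (f j w)) has_derivative P w) (at w)" if "w \<in> \<Omega>" for w
    unfolding P_def[abs_def] by (rule has_derivative_mult[OF d\<theta>[OF that] dRe[OF that]])
  have dQ: "((\<lambda>w. \<theta> (u 3 w) * Im (f j w)) has_derivative Q w) (at w)" if "w \<in> \<Omega>" for w
    unfolding Q_def[abs_def] by (rule has_derivative_mult[OF d\<theta>[OF that] dIm[OF that]])
  have cP: "continuous_on \<Omega> (\<lambda>w. P w k)" "continuous_on \<Omega> (\<lambda>w. Q w k)" for k
    unfolding P_def Q_def by (intro continuous_intros c cont_f cont_f')+
  have zP: "\<theta> (u 3 w) * Re (f j w) = 0" "\<theta> (u 3 w) * Im (f j w) = 0" if "w \<in> \<Omega> - slab t1 t2" for w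
    by (simp_all only: z[OF that] mult_zero_left)
  note 1 = set_integral_directional_derivative[OF open_\<Omega> K zP(1) dP cP(1)[of 1]]
  note 2 = set_integral_directional_derivative[OF open_\<Omega> K zP(2) dQ cP(2)[of \<i>]]
  have "flux j h = (LINT w:\<Omega>|lborel. P w 1 - Q w \<i>)"
    unfolding flux_def P_def Q_def
    by (rule set_lebesgue_integral_cong) (auto simp: algebra_simps open_\<Omega> borel_open simp del: Re_f Im_f)
  also have "\<dots> = 0" using set_integral_diff(2)[OF 1(1) 2(1)] 1(2) 2(2) by simp
  finally show ?thesis .
qed

lemma flux_linear:
  assumes "continuous_on UNIV h" "continuous_on UNIV k" "t1 \<in> I" "t2 \<in> I"
    and "\<And>t. t \<notin> {t1..t2} \<Longrightarrow> h t = 0" "\<And>t. t \<notin> {t1..t2} \<Longrightarrow> k t = 0"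
  shows "flux j (\<lambda>t. a * h t - b * k t) = a * flux j h - b * flux j k"
proof -
  have c: "continuous_on \<Omega> (\<lambda>w. Re (f j w * cnj (f 3 w)))"
    by (intro continuous_intros cont_f)
  note i = integrable_height[OF assms(1,3,4,5) c] integrable_height[OF assms(2,3,4,6) c]
  have "flux j (\<lambda>t. a * h t - b * k t) = (LINT w:\<Omega>|lborel. a * (h (u 3 w) * Re (f j w * cnj (f 3 w)))
      - b * (k (u 3 w) * Re (f j w * cnj (f 3 w))))"
    unfolding flux_def by (rule set_lebesgue_integral_cong) (auto simp: algebra_simps open_\<Omega> borel_open)
  also have "\<dots> = a * flux j h - b * flux j k"
    unfolding flux_def using i by (subst set_integral_diff) auto
  finally show ?thesis .
qed

text \<open>Conservation of flux in tested form: the combination of \<open>h\<close> and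
  \<open>k\<close> with vanishing integral has no flux.\<close>

lemma flux_proportional:
  assumes "continuous_on UNIV h" "continuous_on UNIV k" "t1 \<in> I" "t2 \<in> I"
    and "\<And>t. t \<notin> {t1..t2} \<Longrightarrow> h t = 0" "\<And>t. t \<notin> {t1..t2} \<Longrightarrow> k t = 0"
  shows "integral {t1..t2} k * flux j h = integral {t1..t2} h * flux j k"
proof -
  have "h integrable_on {t1..t2}" "k integrable_on {t1..t2}"
    by (rule integrable_continuous_interval, rule continuous_on_subset[OF assms(1)], simp)
      (rule integrable_continuous_interval, rule continuous_on_subset[OF assms(2)], simp)
  then have i: "(h has_integral integral {t1..t2} h) {t1..t2}" "(k has_integral integral {t1..t2} k) {t1..t2}"
    by (auto simp: has_integral_iff)
  let ?h = "\<lambda>t. integral {t1..t2} k * h t - integral {t1..t2} h * k t"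
  have "integral {t1..t2} ?h = 0"
    using has_integral_diff[OF has_integral_mult_right[OF i(1), of "integral {t1..t2} k"]
        has_integral_mult_right[OF i(2), of "integral {t1..t2} h"]]
    by (simp add: integral_unique mult.commute)
  moreover have "continuous_on UNIV ?h" by (intro continuous_intros assms)
  ultimately have "flux j ?h = 0"
    using assms(5,6) by (intro flux_zero[OF _ assms(3,4)]) auto
  then show ?thesis using flux_linear[OF assms, of j] by simp
qed

text \<open>Up to sign the integrand is the density of the exact form d(u_j h(u_3) du_3); the part
  with h' drops out because du_3 is wedged with itself. The open set is allowed to be smaller than
  \<Omega> so that the lemma applies separately to the regions of upward and of downward
  normals.\<close>

lemma bracket_integral_zero:
  assumes h: "continuous_on UNIV h'" "\<And>t. (h has_real_derivative h' t) (at t)"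
    and \<Omega>': "open \<Omega>'" "\<Omega>' \<subseteq> \<Omega>" "compact K" "K \<subseteq> \<Omega>'" and h0: "\<And>w. w \<in> \<Omega>' - K \<Longrightarrow> h (u 3 w) = 0"
  shows "(LINT w:\<Omega>'|lborel. h (u 3 w) * Im (cnj (f j w) * f 3 w)) = 0"
proof -
  have ch: "continuous_on UNIV h" using h(2) by (auto intro!: continuous_at_imp_continuous_on DERIV_isCont)
  have dh: "((\<lambda>w. h (u 3 w)) has_derivative (\<lambda>k. h' (u 3 w) * Re (f 3 w * k))) (at w)" if "w \<in> \<Omega>'" for w
    using has_derivative_compose[OF u_deriv h(2)[unfolded has_field_derivative_def]] that \<Omega>'(2) by blast
  have dRe: "((\<lambda>w. Re (f j w)) has_derivative (\<lambda>k. Re (deriv (f j) w * k))) (at w)"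
    and dIm: "((\<lambda>w. Im (f j w)) has_derivative (\<lambda>k. Im (deriv (f j) w * k))) (at w)" if "w \<in> \<Omega>'" for w j
    using bounded_linear.has_derivative[OF bounded_linear_Re f_deriv[unfolded has_field_derivative_def]]
      bounded_linear.has_derivative[OF bounded_linear_Im f_deriv[unfolded has_field_derivative_def]] that \<Omega>'(2) by blast+
  have du: "(u j has_derivative (\<lambda>k. Re (f j w * k))) (at w)" if "w \<in> \<Omega>'" for w
    using u_deriv that \<Omega>'(2) by blast
  have c: "continuous_on \<Omega>' (\<lambda>w. h (u 3 w))" "continuous_on \<Omega>' (\<lambda>w. h' (u 3 w))"
     "continuous_on \<Omega>' (u j)" "continuous_on \<Omega>' (f j)" "continuous_on \<Omega>' (deriv (f j))" for j
    using continuous_on_compose2[OF ch cont_u] continuous_on_compose2[OF h(1) cont_u] cont_u cont_f cont_f'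
    by (auto intro: continuous_on_subset[OF _ \<Omega>'(2)])
  define P Q where "P w k = u j w * h (u 3 w) * Im (deriv (f 3) w * k)
        + (u j w * (h' (u 3 w) * Re (f 3 w * k)) + Re (f j w * k) * h (u 3 w)) * Im (f 3 w)"
    and "Q w k = u j w * h (u 3 w) * Re (deriv (f 3) w * k)
        + (u j w * (h' (u 3 w) * Re (f 3 w * k)) + Re (f j w * k) * h (u 3 w)) * Re (f 3 w)" for w k
  have dP: "((\<lambda>w. u j w * h (u 3 w) * Im (f 3 w)) has_derivative P w) (at w)" if "w \<in> \<Omega>'" for w
    unfolding P_def[abs_def] by (rule has_derivative_mult[OF has_derivative_mult[OF du[OF that] dh[OF that]] dIm[OF that]])
  have dQ: "((\<lambda>w. u j w * h (u 3 w) * Re (f 3 w)) has_derivative Q w) (at w)" if "w \<in> \<Omega>'" for w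
    unfolding Q_def[abs_def] by (rule has_derivative_mult[OF has_derivative_mult[OF du[OF that] dh[OF that]] dRe[OF that]])
  have cP: "continuous_on \<Omega>' (\<lambda>w. P w k)" "continuous_on \<Omega>' (\<lambda>w. Q w k)" for k
    unfolding P_def Q_def by (intro continuous_intros c)+
  have zP: "u j w * h (u 3 w) * Im (f 3 w) = 0" "u j w * h (u 3 w) * Re (f 3 w) = 0" if "w \<in> \<Omega>' - K" for w
    by (simp_all only: h0[OF that] mult_zero_left mult_zero_right)
  note 1 = set_integral_directional_derivative[OF \<Omega>'(1,3,4) zP(1) dP cP(1)[of 1]]
  note 2 = set_integral_directional_derivative[OF \<Omega>'(1,3,4) zP(2) dQ cP(2)[of \<i>]]
  have "(LINT w:\<Omega>'|lborel. h (u 3 w) * Im (cnj (f j w) * f 3 w)) = (LINT w:\<Omega>'|lborel. P w 1 + Q w \<i>)"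
    unfolding P_def Q_def
    by (rule set_lebesgue_integral_cong) (auto simp: algebra_simps \<Omega>'(1) borel_open simp del: Re_f Im_f)
  also have "\<dots> = 0" using set_integral_add(2)[OF 1(1) 2(1)] 1(2) 2(2) by simp
  finally show ?thesis .
qed

end

section \<open>The horizontal flux over a slab where the normals are nearly vertical\<close>

context conformal_tube
begin

text \<open>\<open>N w $ 3 \<noteq> 0\<close> makes the parts of the slab with upward and with
  downward normal compact. Test functions supported in the slab can therefore be integrated by parts
  over each part alone, without boundary terms where the sign of N_3 changes.\<close>

lemma flux_le:
  assumes h: "continuous_on UNIV h'" "\<And>t. (h has_real_derivative h' t) (at t)" "\<And>t. h t \<ge> 0"
    and I: "t1 \<in> I" "t2 \<in> I" "\<And>t. t \<notin> {t1..t2} \<Longrightarrow> h t = 0"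
    and N3: "\<And>w. w \<in> slab t1 t2 \<Longrightarrow> N w $ 3 \<noteq> 0"
    and j: "j = 1 \<or> j = 2" and \<epsilon>: "\<And>w. w \<in> slab t1 t2 \<Longrightarrow> \<bar>N w $ j\<bar> \<le> \<epsilon>"
  shows "\<bar>flux j h\<bar> \<le> \<epsilon> * flux 3 h"
proof -
  let ?l = "\<lambda>w. E w \<bullet> E w"
  let ?L = "\<lambda>g. LINT w:\<Omega>|lborel. h (u 3 w) * g w"
  have ch: "continuous_on UNIV h" using h(2) by (auto intro!: continuous_at_imp_continuous_on DERIV_isCont)
  have cl: "continuous_on \<Omega> ?l"
    unfolding inner_vec_def by (intro continuous_intros cont_E)
  have cN: "continuous_on \<Omega> (\<lambda>w. N w $ i)" for i by (intro continuous_intros cont_N)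
  have h0: "h (u 3 w) = 0" if "w \<in> \<Omega> - slab t1 t2" for w using that I(3) by (auto simp: slab_def)
  have int: "set_integrable lborel \<Omega> (\<lambda>w. h (u 3 w) * g w)" if "continuous_on \<Omega> g" for g
    by (rule integrable_height[OF ch I that])
  define P where "P = {w \<in> \<Omega>. N w $ 3 > 0}"
  define M where "M = {w \<in> \<Omega>. N w $ 3 < 0}"
  have PM: "open P" "open M" "P \<subseteq> \<Omega>" "M \<subseteq> \<Omega>" "P \<inter> M = {}"
  proof -
    have "P = \<Omega> \<inter> (\<lambda>w. N w $ 3) -` {0<..}" "M = \<Omega> \<inter> (\<lambda>w. N w $ 3) -` {..<0}" by (auto simp: P_def M_def)
    then show "open P" "open M" using continuous_open_preimage[OF cN open_\<Omega>, of _ 3] by auto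
  qed (auto simp: P_def M_def)
  have cK: "compact (slab t1 t2 \<inter> P)" "compact (slab t1 t2 \<inter> M)"
  proof -
    have cs: "closed (slab t1 t2)" using slab(1)[OF I(1,2)] by (rule compact_imp_closed)
    have cNs: "continuous_on (slab t1 t2) (\<lambda>w. N w $ 3)" by (rule continuous_on_subset[OF cN slab(2)])
    have eq: "slab t1 t2 \<inter> P = slab t1 t2 \<inter> (slab t1 t2 \<inter> (\<lambda>w. N w $ 3) -` {0..})"
      "slab t1 t2 \<inter> M = slab t1 t2 \<inter> (slab t1 t2 \<inter> (\<lambda>w. N w $ 3) -` {..0})"
      using N3 slab(2) by (force simp: P_def M_def)+
    have "\<forall>B. closed B \<longrightarrow> closed (slab t1 t2 \<inter> (\<lambda>w. N w $ 3) -` B)"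
      using continuous_on_closed_vimage[OF cs, THEN iffD1, OF cNs] by (simp only: Int_commute)
    then have cl: "closed (slab t1 t2 \<inter> (\<lambda>w. N w $ 3) -` {0..})" "closed (slab t1 t2 \<inter> (\<lambda>w. N w $ 3) -` {..0})"
      by simp_all
    show "compact (slab t1 t2 \<inter> P)" "compact (slab t1 t2 \<inter> M)"
      unfolding eq by (rule compact_Int_closed[OF slab(1)[OF I(1,2)] cl(1)]) (rule compact_Int_closed[OF slab(1)[OF I(1,2)] cl(2)])
  qed
  have zero: "(LINT w:Q|lborel. h (u 3 w) * (?l w * N w $ j)) = 0"
    if Q: "open Q" "Q \<subseteq> \<Omega>" "compact (slab t1 t2 \<inter> Q)" for Q
  proof -
    have hQ: "h (u 3 w) = 0" if "w \<in> Q - slab t1 t2 \<inter> Q" for w using h0 that Q by auto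
    have "(LINT w:Q|lborel. h (u 3 w) * Im (cnj (f i w) * f 3 w)) = 0" for i
      by (rule bracket_integral_zero[OF h(1,2) Q _ hQ]) auto
    note b = this
    obtain c :: real and i where ci: "\<And>w. w \<in> \<Omega> \<Longrightarrow> ?l w * N w $ j = c * Im (cnj (f i w) * f 3 w)"
      using j
    proof
      assume "j = 1"
      then show thesis using Im_f_f(1) by (intro that[of "-1" 2]) (simp del: Re_f Im_f times_complex.sel)
    next
      assume "j = 2"
      moreover have "Im (cnj (f 1 w) * f 3 w) = - Im (cnj (f 3 w) * f 1 w)" for w by (simp add: algebra_simps)
      ultimately show thesis using Im_f_f(2) by (intro that[of 1 1]) (simp del: Re_f Im_f times_complex.sel)
    qed
    have "(LINT w:Q|lborel. h (u 3 w) * (?l w * N w $ j)) = (LINT w:Q|lborel. c * (h (u 3 w) * Im (cnj (f i w) * f 3 w)))"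
      by (rule set_lebesgue_integral_cong) (use Q ci in \<open>auto simp: borel_open subset_iff simp del: Re_f Im_f times_complex.sel\<close>)
    then show ?thesis using b[of i] by simp
  qed
  have sub: "set_integrable lborel Q (\<lambda>w. h (u 3 w) * g w)" if "continuous_on \<Omega> g" "open Q" "Q \<subseteq> \<Omega>" for g Q
    by (rule set_integrable_subset[OF int[OF that(1)]]) (use that in auto)
  have split: "?L g = (LINT w:P|lborel. h (u 3 w) * g w) + (LINT w:M|lborel. h (u 3 w) * g w)"
    if g: "continuous_on \<Omega> g" for g
  proof -
    have "?L g = (LINT w:P \<union> M|lborel. h (u 3 w) * g w)"
      unfolding set_lebesgue_integral_def
    proof (rule Bochner_Integration.integral_cong)
      fix w
      have "w \<in> P \<union> M \<or> w \<notin> \<Omega> \<or> h (u 3 w) = 0"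
        using N3[of w] h0[of w] unfolding P_def M_def by (cases "w \<in> slab t1 t2") auto
      then show "indicat_real \<Omega> w *\<^sub>R (h (u 3 w) * g w) = indicat_real (P \<union> M) w *\<^sub>R (h (u 3 w) * g w)"
        using PM(3,4) by (auto simp: indicator_def)
    qed simp
    also have "\<dots> = (LINT w:P|lborel. h (u 3 w) * g w) + (LINT w:M|lborel. h (u 3 w) * g w)"
      by (rule set_integral_Un[OF PM(5)]) (use sub g PM in auto)
    finally show ?thesis .
  qed
  let ?a = "\<lambda>w. ?l w * N w $ j" and ?b = "\<lambda>w. - (?l w * N w $ j * N w $ 3)"
  let ?e = "\<lambda>w. \<epsilon> * (?l w * (1 - N w $ 3 * N w $ 3))"
  have ca: "continuous_on \<Omega> ?a" and cb: "continuous_on \<Omega> ?b" and ce: "continuous_on \<Omega> ?e"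
    by (intro continuous_intros cl cN)+
  have R: "Re (f j w * cnj (f 3 w)) = ?b w" if "w \<in> \<Omega>" for w
    using Re_f_f[OF that, of j 3] j by (auto simp del: Re_f Im_f times_complex.sel)
  have fj: "flux j h = ?L ?b"
    unfolding flux_def
    by (rule set_lebesgue_integral_cong) (use R in \<open>auto simp: open_\<Omega> borel_open simp del: Re_f Im_f times_complex.sel\<close>)
  have f3: "\<epsilon> * flux 3 h = ?L ?e"
  proof -
    have "?L ?e = (LINT w:\<Omega>|lborel. \<epsilon> * (h (u 3 w) * Re (f 3 w * cnj (f 3 w))))"
      by (rule set_lebesgue_integral_cong) (use Re_f_f[of _ 3 3] in \<open>auto simp: open_\<Omega> borel_open simp del: Re_f Im_f times_complex.sel\<close>)
    then show ?thesis unfolding flux_def by simp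
  qed
  \<comment> \<open>Multiplied by |E|^2, the bound 1 - N_3^2 for |s - N_3| is exactly the integrand
    of the vertical flux, by \<open>Re_f_f\<close>.\<close>
  have pt: "?a w * s + ?b w \<le> ?e w \<and> - ?e w \<le> ?a w * s + ?b w"
    if w: "w \<in> slab t1 t2" and s: "s = sgn (N w $ 3)" for w s
  proof -
    have wO: "w \<in> \<Omega>" using w slab(2) by blast
    let ?n = "N w $ 3"
    have n1: "\<bar>?n\<bar> \<le> 1" using norm_N[OF wO] component_le_norm_cart[of "N w" 3] by simp
    have "\<bar>s - ?n\<bar> = 1 - \<bar>?n\<bar>" using n1 N3[OF w] by (auto simp: s sgn_if)
    also have "\<dots> \<le> 1 - ?n * ?n"
      using mult_left_le[OF n1 abs_ge_zero[of ?n]] by (simp add: abs_mult_self_eq)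
    finally have sn: "\<bar>s - ?n\<bar> \<le> 1 - ?n * ?n" .
    have "\<bar>N w $ j * (s - ?n)\<bar> \<le> \<epsilon> * (1 - ?n * ?n)"
      unfolding abs_mult by (rule mult_mono[OF \<epsilon>[OF w] sn]) (use \<epsilon>[OF w] in auto)
    then have "\<bar>?l w * (N w $ j * (s - ?n))\<bar> \<le> ?l w * (\<epsilon> * (1 - ?n * ?n))"
      unfolding abs_mult[of "?l w"] by (simp add: mult_left_mono)
    moreover have "?l w * (N w $ j * (s - ?n)) = ?a w * s + ?b w" "?l w * (\<epsilon> * (1 - ?n * ?n)) = ?e w"
      by (simp_all add: algebra_simps)
    ultimately show ?thesis by linarith
  qed
  have bd: "\<bar>LINT w:Q|lborel. h (u 3 w) * ?b w\<bar> \<le> (LINT w:Q|lborel. h (u 3 w) * ?e w)"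
    if Q: "open Q" "Q \<subseteq> \<Omega>" "compact (slab t1 t2 \<inter> Q)" and s: "\<And>w. w \<in> Q \<Longrightarrow> sgn (N w $ 3) = s" for Q s
  proof -
    have cab: "continuous_on \<Omega> (\<lambda>w. ?a w * s + ?b w)" by (intro continuous_intros cl cN)
    have "(LINT w:Q|lborel. h (u 3 w) * (?a w * s + ?b w)) = (LINT w:Q|lborel. s * (h (u 3 w) * ?a w) + h (u 3 w) * ?b w)"
      by (rule set_lebesgue_integral_cong) (use Q in \<open>auto simp: borel_open algebra_simps\<close>)
    also have "\<dots> = s * (LINT w:Q|lborel. h (u 3 w) * ?a w) + (LINT w:Q|lborel. h (u 3 w) * ?b w)"
      using sub[OF ca Q(1,2)] sub[OF cb Q(1,2)] by (subst set_integral_add) auto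
    finally have eq: "(LINT w:Q|lborel. h (u 3 w) * ?b w) = (LINT w:Q|lborel. h (u 3 w) * (?a w * s + ?b w))"
      using zero[OF Q] by simp
    have hs: "h (u 3 w) = 0 \<or> w \<in> slab t1 t2" if "w \<in> Q" for w using h0[of w] Q(2) that by blast
    have up: "h (u 3 w) * (?a w * s + ?b w) \<le> h (u 3 w) * ?e w"
      and low: "- (h (u 3 w) * ?e w) \<le> h (u 3 w) * (?a w * s + ?b w)" if w: "w \<in> Q" for w
    proof -
      consider "h (u 3 w) = 0" | "w \<in> slab t1 t2" using hs[OF w] by blast
      then have "h (u 3 w) * (?a w * s + ?b w) \<le> h (u 3 w) * ?e w \<and> h (u 3 w) * - ?e w \<le> h (u 3 w) * (?a w * s + ?b w)"
      proof cases
        case 2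
        from pt[OF 2 s[OF w, symmetric]] show ?thesis using h(3) by (intro conjI mult_left_mono) blast+
      qed simp
      then show "h (u 3 w) * (?a w * s + ?b w) \<le> h (u 3 w) * ?e w"
        and "- (h (u 3 w) * ?e w) \<le> h (u 3 w) * (?a w * s + ?b w)" by simp_all
    qed
    have ie: "set_integrable lborel Q (\<lambda>w. - (h (u 3 w) * ?e w))"
      using sub[OF ce Q(1,2)] by (simp add: set_integrable_def)
    have "(LINT w:Q|lborel. h (u 3 w) * (?a w * s + ?b w)) \<le> (LINT w:Q|lborel. h (u 3 w) * ?e w)"
      by (rule set_integral_mono[OF sub[OF cab Q(1,2)] sub[OF ce Q(1,2)] up])
    moreover have "(LINT w:Q|lborel. - (h (u 3 w) * ?e w)) \<le> (LINT w:Q|lborel. h (u 3 w) * (?a w * s + ?b w))"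
      by (rule set_integral_mono[OF ie sub[OF cab Q(1,2)] low])
    moreover have "(LINT w:Q|lborel. - (h (u 3 w) * ?e w)) = - (LINT w:Q|lborel. h (u 3 w) * ?e w)"
      by (simp add: set_lebesgue_integral_def)
    ultimately show ?thesis unfolding eq by linarith
  qed
  have "\<bar>LINT w:P|lborel. h (u 3 w) * ?b w\<bar> \<le> (LINT w:P|lborel. h (u 3 w) * ?e w)"
    by (rule bd[OF PM(1,3) cK(1), of 1]) (simp add: P_def)
  moreover have "\<bar>LINT w:M|lborel. h (u 3 w) * ?b w\<bar> \<le> (LINT w:M|lborel. h (u 3 w) * ?e w)"
    by (rule bd[OF PM(2,4) cK(2), of "-1"]) (simp add: M_def)
  ultimately show ?thesis unfolding fj f3 split[OF cb] split[OF ce] by linarith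
qed

end

section \<open>Level curves and the length-area estimate\<close>

context conformal_tube
begin

text \<open>Test functions supported around distant heights are compared over a common interval;
  this is how information at a good level is carried to a fixed reference bump.\<close>

lemma flux_proportional':
  assumes h: "continuous_on UNIV h" "t1 \<in> I" "t2 \<in> I" "t1 \<le> t2" "\<And>t. t \<notin> {t1..t2} \<Longrightarrow> h t = 0"
    and k: "continuous_on UNIV k" "s1 \<in> I" "s2 \<in> I" "s1 \<le> s2" "\<And>t. t \<notin> {s1..s2} \<Longrightarrow> k t = 0"
  shows "integral {s1..s2} k * flux j h = integral {t1..t2} h * flux j k"
proof -
  define a b where "a = min t1 s1" and "b = max t2 s2"
  have ab: "a \<in> I" "b \<in> I" using h k by (auto simp: a_def b_def min_def max_def)
  have "h integrable_on {t1..t2}" "k integrable_on {s1..s2}"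
    by (rule integrable_continuous_interval, rule continuous_on_subset[OF h(1)], simp)
      (rule integrable_continuous_interval, rule continuous_on_subset[OF k(1)], simp)
  then have H: "(h has_integral integral {t1..t2} h) {t1..t2}" "(k has_integral integral {s1..s2} k) {s1..s2}"
    by (auto simp: has_integral_iff)
  have "(h has_integral integral {t1..t2} h) {a..b}"
    by (rule has_integral_on_superset[OF H(1)]) (use h(5) in \<open>auto simp: a_def b_def\<close>)
  moreover have "(k has_integral integral {s1..s2} k) {a..b}"
    by (rule has_integral_on_superset[OF H(2)]) (use k(5) in \<open>auto simp: a_def b_def\<close>)
  ultimately have i: "integral {a..b} h = integral {t1..t2} h" "integral {a..b} k = integral {s1..s2} k"
    by (auto simp: integral_unique)
  have z: "h t = 0" "k t = 0" if "t \<notin> {a..b}" for t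
  proof -
    have "t \<notin> {t1..t2}" "t \<notin> {s1..s2}" using that by (auto simp: a_def b_def min_le_iff_disj le_max_iff_disj)
    then show "h t = 0" "k t = 0" using h(5) k(5) by blast+
  qed
  show ?thesis
    using flux_proportional[OF h(1) k(1) ab z, of j] unfolding i .
qed

text \<open>If \<open>(u\<^sub>i, u\<^sub>3)\<close> were a local coordinate system at the maximum point, then \<open>u\<^sub>i\<close> could be
  increased along the level curve.\<close>

lemma level_maximum:
  assumes w0: "w0 \<in> slab t t" and C: "C = connected_component_set (slab t t) w0"
    and z: "z \<in> C" and max: "\<And>w. w \<in> C \<Longrightarrow> u i w \<le> u i z"
  shows "E z $ i * (N z \<times> E z) $ 3 - E z $ 3 * (N z \<times> E z) $ i = 0"
proof (rule ccontr)
  assume ne: "\<not> ?thesis"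
  have zs: "z \<in> slab t t" using z connected_component_subset unfolding C by blast
  then have zO: "z \<in> \<Omega>" and zt: "u 3 z = t" by (auto simp: slab_def)
  define \<phi> where "\<phi> w = Complex (u i w) (u 3 w)" for w
  define \<alpha> \<beta> where "\<alpha> w = Complex (E w $ i) (E w $ 3)" and "\<beta> w = Complex ((N w \<times> E w) $ i) ((N w \<times> E w) $ 3)" for w
  have d: "(\<phi> has_derivative (\<lambda>h. Re h *\<^sub>R \<alpha> w + Im h *\<^sub>R \<beta> w)) (at w)" if "w \<in> \<Omega>" for w
  proof -
    have "((\<lambda>w. of_real (u i w) + \<i> * of_real (u 3 w)) has_derivative
        (\<lambda>h. of_real (Re (f i w * h)) + \<i> * of_real (Re (f 3 w * h)))) (at w)"
      by (intro derivative_intros u_deriv[OF that])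
    then show ?thesis
      unfolding \<phi>_def Complex_eq by (rule has_derivative_eq_rhs) (simp add: \<alpha>_def \<beta>_def fun_eq_iff complex_eq_iff)
  qed
  have c: "continuous_on \<Omega> \<alpha>" "continuous_on \<Omega> \<beta>"
    unfolding \<alpha>_def \<beta>_def Complex_eq by (intro continuous_intros cont_E cont_NE)+
  have det: "Re (\<alpha> z) * Im (\<beta> z) - Im (\<alpha> z) * Re (\<beta> z) \<noteq> 0" using ne by (simp add: \<alpha>_def \<beta>_def)
  show False
  proof (rule planar_local_inverse[OF open_\<Omega> zO d c det])
    fix U' V g assume U': "U' \<subseteq> \<Omega>" "z \<in> U'" and V: "open V" "\<phi> z \<in> V" and hom: "homeomorphism U' V \<phi> g"
    obtain r where r: "r > 0" "ball (\<phi> z) r \<subseteq> V" using V openE by blast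
    define J where "J = (\<lambda>s. g (\<phi> z + of_real s)) ` {0..r/2}"
    have inV: "\<phi> z + of_real s \<in> V" if "s \<in> {0..r/2}" for s
      using that r by (intro subsetD[OF r(2)]) (auto simp: dist_norm)
    have gV: "g y \<in> U'" "\<phi> (g y) = y" if "y \<in> V" for y using hom that by (auto simp: homeomorphism_def)
    have "continuous_on V g" using hom by (simp add: homeomorphism_def)
    then have "continuous_on {0..r/2} (\<lambda>s. g (\<phi> z + of_real s))"
      by (rule continuous_on_compose2) (use inV in \<open>auto intro!: continuous_intros\<close>)
    then have "connected J" unfolding J_def by (rule connected_continuous_image) simp
    moreover have "J \<subseteq> slab t t"
    proof
      fix w assume "w \<in> J"
      then obtain s where s: "s \<in> {0..r/2}" "w = g (\<phi> z + of_real s)" by (auto simp: J_def)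
      have "Im (\<phi> w) = t" unfolding s(2) gV(2)[OF inV[OF s(1)]] by (simp add: \<phi>_def zt)
      then show "w \<in> slab t t" using gV(1)[OF inV[OF s(1)]] U' s(2) by (auto simp: slab_def \<phi>_def)
    qed
    moreover have "z \<in> J"
      unfolding J_def using hom U' r(1) by (intro image_eqI[of _ _ 0]) (auto simp: homeomorphism_def)
    ultimately have "J \<subseteq> connected_component_set (slab t t) z"
      by (intro connected_component_maximal)
    also have "\<dots> = C" using z connected_component_eq unfolding C by blast
    finally have "J \<subseteq> C" .
    moreover have "g (\<phi> z + of_real (r/2)) \<in> J" unfolding J_def using r by (intro imageI) auto
    ultimately have "u i (g (\<phi> z + of_real (r/2))) \<le> u i z" using max by blast
    moreover have "Re (\<phi> (g (\<phi> z + of_real (r/2)))) = Re (\<phi> z) + r/2"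
      using r by (subst gV(2)[OF inV]) auto
    ultimately show False using r(1) by (simp add: \<phi>_def)
  qed
qed

text \<open>N_j vanishes at a point of the component of \<open>w\<close> in its level, so by
  connectedness it takes on that component every value between 0 and its value at
  \<open>w\<close>.\<close>

lemma level_oscillation:
  assumes t: "t \<in> I" and w: "w \<in> slab t t" and j: "j = 1 \<or> j = 2"
  shows "ennreal \<bar>N w $ j\<bar> \<le> emeasure lborel ((\<lambda>w. N w $ j) ` slab t t)"
proof -
  let ?C = "connected_component_set (slab t t) w"
  let ?n = "\<lambda>w. N w $ j"
  \<comment> \<open>The other horizontal index: a vanishing Jacobian of (u_i, u_3) means N_j =
    0.\<close>
  define i :: 3 where "i = (if j = 1 then 2 else 1)"
  have sub: "?C \<subseteq> slab t t" by (rule connected_component_subset)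
  have "closed ?C" using slab(1)[OF t t] by (intro closed_connected_component compact_imp_closed)
  then have "compact (slab t t \<inter> ?C)" by (rule compact_Int_closed[OF slab(1)[OF t t]])
  moreover have "slab t t \<inter> ?C = ?C" using sub by blast
  ultimately have "compact ?C" by simp
  moreover have wC: "w \<in> ?C" using w by simp
  moreover have CO: "?C \<subseteq> \<Omega>" using sub slab(2) by blast
  moreover from CO have "continuous_on ?C (u i)" using cont_u by (rule continuous_on_subset[rotated])
  ultimately obtain z where z: "z \<in> ?C" "\<And>y. y \<in> ?C \<Longrightarrow> u i y \<le> u i z"
    using continuous_attains_sup[of ?C "u i"] by blast
  have zO: "z \<in> \<Omega>" using z CO by blast
  have 0: "E z $ i * (N z \<times> E z) $ 3 - E z $ 3 * (N z \<times> E z) $ i = 0"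
    by (rule level_maximum[OF w refl z])
  have nz: "?n z = 0"
  proof (cases "j = 1")
    case True
    then have "(E z \<bullet> E z) * N z $ 1 = 0" using 0 Im_f_f(1)[OF zO] by (simp add: i_def algebra_simps)
    then show ?thesis using E_ne[OF zO] True by simp
  next
    case False
    then have j2: "j = 2" using j by simp
    then have "(E z \<bullet> E z) * N z $ 2 = 0" using 0 Im_f_f(2)[OF zO] by (simp add: i_def algebra_simps)
    then show ?thesis using E_ne[OF zO] j2 by simp
  qed
  have "continuous_on ?C ?n" by (intro continuous_intros continuous_on_subset[OF cont_N CO])
  then have "connected (?n ` ?C)" using connected_connected_component by (rule connected_continuous_image)
  then have iv: "is_interval (?n ` ?C)" by (simp add: is_interval_connected_1)
  have "0 \<in> ?n ` ?C" using nz z(1) by (force simp: image_iff)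
  then have "closed_segment 0 (?n w) \<subseteq> ?n ` ?C"
    using wC by (intro closed_segment_subset is_interval_convex[OF iv] imageI)
  also have "\<dots> \<subseteq> ?n ` slab t t" using sub by blast
  finally have seg: "closed_segment 0 (?n w) \<subseteq> ?n ` slab t t" .
  have "compact (?n ` slab t t)"
    using slab[of t t] t by (intro compact_continuous_image continuous_intros continuous_on_subset[OF cont_N]) auto
  then have m: "?n ` slab t t \<in> sets lborel" by (simp add: borel_compact)
  have "ennreal \<bar>?n w\<bar> = emeasure lborel (closed_segment 0 (?n w))"
    by (simp add: closed_segment_eq_real_ivl)
  also have "\<dots> \<le> emeasure lborel (?n ` slab t t)" by (rule emeasure_mono[OF seg m])
  finally show ?thesis .
qed

text \<open>A quarter of the area of the unit sphere. The integral extends over the whole plane and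
  so serves for every domain \<Omega>.\<close>

definition gauss_area :: real where
  "gauss_area = (\<integral>w. 1 / (1 + (cmod w)\<^sup>2)\<^sup>2 \<partial>lborel)"

lemma gauss_area_nonneg: "gauss_area \<ge> 0"
  unfolding gauss_area_def by (rule Bochner_Integration.integral_nonneg) simp

text \<open>The map \<open>F\<close> = (N_j, u_3) has a Jacobian that is bilinear in the derivatives
  of N_j and of u_3; the weighted inequality between the means splits it into the area density of
  the sphere and the energy of the height. The slice measure of the image of \<open>F\<close> is the
  majorant \<open>G\<close>, measurable by Fubini.\<close>

lemma level_area_bound:
  assumes T: "T1 \<in> I" "T2 \<in> I" and s: "s > 0"
    and h: "continuous_on UNIV h" "t1 \<in> I" "t2 \<in> I" "\<And>t. t \<notin> {t1..t2} \<Longrightarrow> h t = 0" "\<And>t. h t \<ge> 0"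
      "\<And>t. t \<in> {T1..T2} \<Longrightarrow> h t \<ge> 1"
  obtains G where "G \<in> borel_measurable lborel"
    "\<And>t. t \<in> {T1..T2} \<Longrightarrow> emeasure lborel ((\<lambda>w. N w $ j) ` slab t t) \<le> G t"
    "integral\<^sup>N lborel G \<le> ennreal (100 * s * gauss_area + flux 3 h / (2 * s))"
proof -
  let ?K = "slab T1 T2"
  let ?V = "\<lambda>w. N w \<times> E w"
  define \<alpha> \<beta> where "\<alpha> w = Complex (N1 w $ j) (E w $ 3)" and "\<beta> w = Complex (N2 w $ j) (?V w $ 3)" for w
  define F where "F w = Complex (N w $ j) (u 3 w)" for w
  have dF: "(F has_derivative (\<lambda>h. Re h *\<^sub>R \<alpha> w + Im h *\<^sub>R \<beta> w)) (at w)" if "w \<in> \<Omega>" for w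
  proof -
    have "((\<lambda>w. of_real (N w $ j) + \<i> * of_real (u 3 w)) has_derivative
        (\<lambda>h. of_real ((Re h *\<^sub>R N1 w + Im h *\<^sub>R N2 w) $ j) + \<i> * of_real (Re (f 3 w * h)))) (at w)"
      by (intro derivative_intros u_deriv[OF that] bounded_linear.has_derivative[OF bounded_linear_vec_nth dN[OF that]])
    then show ?thesis
      unfolding F_def Complex_eq by (rule has_derivative_eq_rhs) (simp add: \<alpha>_def \<beta>_def fun_eq_iff complex_eq_iff)
  qed
  note K = slab(1)[OF T] slab(2)[of T1 T2]
  have c: "continuous_on ?K \<alpha>" "continuous_on ?K \<beta>"
    unfolding \<alpha>_def \<beta>_def Complex_eq
    by (intro continuous_intros continuous_on_subset[OF cont_E K(2)] continuous_on_subset[OF cont_NE K(2)]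
        continuous_on_subset[OF cont_dN(1) K(2)] continuous_on_subset[OF cont_dN(2) K(2)])+
  let ?d = "\<lambda>w. \<bar>Re (\<alpha> w) * Im (\<beta> w) - Im (\<alpha> w) * Re (\<beta> w)\<bar>"
  let ?\<rho> = "\<lambda>w. 1 / (1 + (cmod w)\<^sup>2)\<^sup>2"
  let ?e = "\<lambda>w. h (u 3 w) * Re (f 3 w * cnj (f 3 w))"
  have area: "emeasure lborel (F ` ?K) \<le> ennreal (LINT w:?K|lborel. ?d w)"
    by (rule emeasure_image_le_integral[OF K(1) dF c]) (use K in auto)
  have pt: "?d w \<le> 100 * s * ?\<rho> w + ?e w / (2 * s)" if w: "w \<in> ?K" for w
  proof -
    have wO: "w \<in> \<Omega>" using w K by blast
    have amgm: "\<bar>a * b\<bar> \<le> (s * a\<^sup>2 + b\<^sup>2 / s) / 2" for a b :: real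
    proof -
      have "0 \<le> (s * \<bar>a\<bar> - \<bar>b\<bar>)\<^sup>2" by simp
      then have "2 * s * \<bar>a * b\<bar> \<le> s * s * a\<^sup>2 + b\<^sup>2"
        by (simp add: power2_diff abs_mult power_mult_distrib power2_eq_square[of s] algebra_simps)
      then show ?thesis using s by (simp add: field_simps power2_eq_square)
    qed
    have nb: "(N1 w $ j)\<^sup>2 \<le> 100 * ?\<rho> w" "(N2 w $ j)\<^sup>2 \<le> 100 * ?\<rho> w"
    proof -
      have "\<bar>N1 w $ j\<bar> \<le> 10 / (1 + (cmod w)\<^sup>2)" "\<bar>N2 w $ j\<bar> \<le> 10 / (1 + (cmod w)\<^sup>2)"
        using component_le_norm_cart[of "N1 w" j] component_le_norm_cart[of "N2 w" j] bound_dN[OF wO] by linarith+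
      from this[THEN power_mono, of 2] show "(N1 w $ j)\<^sup>2 \<le> 100 * ?\<rho> w" "(N2 w $ j)\<^sup>2 \<le> 100 * ?\<rho> w"
        by (simp_all add: power_divide)
    qed
    have "?d w = \<bar>N1 w $ j * ?V w $ 3 - N2 w $ j * E w $ 3\<bar>" by (simp add: \<alpha>_def \<beta>_def mult.commute)
    also have "\<dots> \<le> \<bar>N1 w $ j * ?V w $ 3\<bar> + \<bar>N2 w $ j * E w $ 3\<bar>" by (rule abs_triangle_ineq4)
    also have "\<dots> \<le> (s * (N1 w $ j)\<^sup>2 + (?V w $ 3)\<^sup>2 / s) / 2 + (s * (N2 w $ j)\<^sup>2 + (E w $ 3)\<^sup>2 / s) / 2"
      by (intro add_mono amgm)
    also have "\<dots> = s * ((N1 w $ j)\<^sup>2 + (N2 w $ j)\<^sup>2) / 2 + ((?V w $ 3)\<^sup>2 + (E w $ 3)\<^sup>2) / (2 * s)"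
      by (simp add: add_divide_distrib algebra_simps)
    \<comment> \<open>100 is the square of the constant in \<open>bound_dN\<close>. Since
      \<open>h\<close> is at least 1 on the slab, the energy of u_3 is absorbed in the flux
      integrand.\<close>
    also have "\<dots> \<le> s * (100 * ?\<rho> w + 100 * ?\<rho> w) / 2 + ?e w / (2 * s)"
    proof (intro add_mono divide_right_mono mult_left_mono)
      have "h (u 3 w) \<ge> 1" using w h(6) by (auto simp: slab_def)
      then have "1 * Re (f 3 w * cnj (f 3 w)) \<le> ?e w" by (intro mult_right_mono) (auto simp: power2_eq_square[symmetric])
      then show "(?V w $ 3)\<^sup>2 + (E w $ 3)\<^sup>2 \<le> ?e w" by (simp add: power2_eq_square)
    qed (use nb s in auto)
    finally show ?thesis by (simp add: algebra_simps)
  qed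
  have ed: "set_integrable lborel ?K ?d"
    by (rule set_integrable_compact_support[OF _ K(1)]) (auto intro!: continuous_intros c)
  have er: "integrable lborel ?\<rho>" by (rule integrable_spherical_density)
  have ee: "set_integrable lborel \<Omega> ?e"
  proof (rule integrable_height[OF h(1-3)])
    show "continuous_on \<Omega> (\<lambda>w. Re (f 3 w * cnj (f 3 w)))" by (intro continuous_intros cont_f)
  qed (rule h(4))
  have enn: "0 \<le> ?e w" for w using h(5)[of "u 3 w"] by (auto simp: power2_eq_square[symmetric])
  have i1: "integrable lborel (\<lambda>w. 100 * s * ?\<rho> w)" by (rule integrable_mult_right[OF er])
  have i2: "integrable lborel (\<lambda>w. (indicator \<Omega> w *\<^sub>R ?e w) / (2 * s))"
    by (rule integrable_divide[OF ee[unfolded set_integrable_def]])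
  have "(LINT w:?K|lborel. ?d w) \<le> (\<integral>w. 100 * s * ?\<rho> w + (indicator \<Omega> w *\<^sub>R ?e w) / (2 * s) \<partial>lborel)"
    unfolding set_lebesgue_integral_def
  proof (rule integral_mono)
    show "integrable lborel (\<lambda>w. indicator ?K w *\<^sub>R ?d w)" using ed by (simp add: set_integrable_def)
    show "integrable lborel (\<lambda>w. 100 * s * ?\<rho> w + (indicator \<Omega> w *\<^sub>R ?e w) / (2 * s))"
      by (rule Bochner_Integration.integrable_add[OF i1 i2])
    fix w
    show "indicator ?K w *\<^sub>R ?d w \<le> 100 * s * ?\<rho> w + (indicator \<Omega> w *\<^sub>R ?e w) / (2 * s)"
    proof (cases "w \<in> ?K")
      case True
      then have "w \<in> \<Omega>" using K by blast
      then show ?thesis using pt[OF True] True by simp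
    next
      case False
      then show ?thesis using enn[of w] s by (simp add: indicator_def del: Re_f Im_f times_complex.sel)
    qed
  qed
  also have "\<dots> = 100 * s * gauss_area + flux 3 h / (2 * s)"
    unfolding Bochner_Integration.integral_add[OF i1 i2] gauss_area_def flux_def set_lebesgue_integral_def
    by (simp only: integral_mult_right_zero integral_divide_zero)
  finally have bound: "(LINT w:?K|lborel. ?d w) \<le> 100 * s * gauss_area + flux 3 h / (2 * s)" .
  have "continuous_on ?K F"
    using dF K by (auto intro!: continuous_at_imp_continuous_on has_derivative_continuous)
  then have "compact (F ` ?K)" using K(1) by (rule compact_continuous_image)
  then have FK: "F ` ?K \<in> sets borel" by (rule borel_compact)
  define G where "G t = emeasure lborel {x. Complex x t \<in> F ` ?K}" for t
  show thesis
  proof (rule that[of G])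
    show mG: "G \<in> borel_measurable lborel" unfolding G_def by (rule measurable_complex_slices[OF FK])
    fix t assume t: "t \<in> {T1..T2}"
    have "(\<lambda>w. N w $ j) ` slab t t \<subseteq> {x. Complex x t \<in> F ` ?K}"
    proof safe
      fix w assume "w \<in> slab t t"
      then show "Complex (N w $ j) t \<in> F ` ?K"
        using t by (intro image_eqI[of _ _ w]) (auto simp: slab_def F_def)
    qed
    moreover have "{x. Complex x t \<in> F ` ?K} \<in> sets lborel"
    proof -
      have "(\<lambda>x. Complex x t) \<in> borel_measurable lborel"
        unfolding Complex_eq by (auto intro!: borel_measurable_continuous_onI continuous_intros)
      from measurable_sets[OF this FK] show ?thesis by (simp add: vimage_def)
    qed
    ultimately show "emeasure lborel ((\<lambda>w. N w $ j) ` slab t t) \<le> G t"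
      unfolding G_def by (rule emeasure_mono)
  next
    have "integral\<^sup>N lborel G = emeasure lborel (F ` ?K)"
      unfolding G_def by (rule emeasure_complex_slices[OF FK, symmetric])
    also have "\<dots> \<le> ennreal (100 * s * gauss_area + flux 3 h / (2 * s))"
      using area ennreal_leI[OF bound] by (rule order_trans)
    finally show "integral\<^sup>N lborel G \<le> ennreal (100 * s * gauss_area + flux 3 h / (2 * s))" .
  qed
qed

end

section \<open>Test functions of the height\<close>

definition trapezoid :: "real \<Rightarrow> real \<Rightarrow> real \<Rightarrow> real" where
  "trapezoid a b t = max 0 (min 1 (min (t - a + 1) (b + 1 - t)))"

lemma trapezoid:
  "continuous_on UNIV (trapezoid a b)" "0 \<le> trapezoid a b t" "trapezoid a b t \<le> 1"
  "t \<notin> {a - 1..b + 1} \<Longrightarrow> trapezoid a b t = 0" "t \<in> {a..b} \<Longrightarrow> trapezoid a b t = 1"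
  by (auto simp: trapezoid_def intro!: continuous_intros)

lemma trapezoid_integral:
  assumes "a \<le> b"
  shows "integral {a - 1..b + 1} (trapezoid a b) \<le> b - a + 2" "0 < integral {a - 1..b + 1} (trapezoid a b)"
proof -
  have i: "trapezoid a b integrable_on {c..d}" for c d
    by (rule integrable_continuous_interval, rule continuous_on_subset[OF trapezoid(1)]) simp
  have "integral {a - 1..b + 1} (trapezoid a b) \<le> integral {a - 1..b + 1} (\<lambda>_. 1)"
    by (rule integral_le[OF i]) (auto simp: trapezoid)
  then show "integral {a - 1..b + 1} (trapezoid a b) \<le> b - a + 2" using assms by simp
  have "1 / 2 = integral {a - 1/2..a + 1/2} (\<lambda>_. 1/2 :: real)" by simp
  also have "\<dots> \<le> integral {a - 1/2..a + 1/2} (trapezoid a b)"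
    by (rule integral_le[OF _ i]) (use assms in \<open>auto simp: trapezoid_def\<close>)
  also have "\<dots> \<le> integral {a - 1..b + 1} (trapezoid a b)"
    by (rule integral_subset_le[OF _ i i]) (use assms in \<open>auto simp: trapezoid\<close>)
  finally show "0 < integral {a - 1..b + 1} (trapezoid a b)" by simp
qed

text \<open>The squared positive part is continuously differentiable; it supplies bumps where
  integration by parts also differentiates the test function, for which a trapezoid is not smooth
  enough.\<close>

lemma has_derivative_max_square: "((\<lambda>y::real. (max 0 y)\<^sup>2) has_real_derivative 2 * max 0 y) (at y)"
proof (cases "y = 0")
  case False
  then consider "y > 0" | "y < 0" by linarith
  then show ?thesis
  proof cases
    case 1
    have "((\<lambda>y::real. y\<^sup>2) has_real_derivative 2 * y) (at y)" by (auto intro!: derivative_eq_intros)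
    then have "((\<lambda>y::real. (max 0 y)\<^sup>2) has_real_derivative 2 * y) (at y)"
      by (rule has_field_derivative_transform_within_open[of _ _ _ "{0<..}"]) (use 1 in auto)
    then show ?thesis using 1 by simp
  next
    case 2
    have "((\<lambda>_. 0) has_real_derivative 0) (at y)" by simp
    then have "((\<lambda>y::real. (max 0 y)\<^sup>2) has_real_derivative 0) (at y)"
      by (rule has_field_derivative_transform_within_open[of _ _ _ "{..<0}"]) (use 2 in auto)
    then show ?thesis using 2 by simp
  qed
next
  case True
  have "((\<lambda>h::real. (max 0 h)\<^sup>2 / h) \<longlongrightarrow> 0) (at 0)"
  proof (rule Lim_null_comparison)
    show "\<forall>\<^sub>F h::real in at 0. norm ((max 0 h)\<^sup>2 / h) \<le> \<bar>h\<bar>"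
      by (rule always_eventually) (auto simp: max_def power2_eq_square)
    show "((\<lambda>h::real. \<bar>h\<bar>) \<longlongrightarrow> 0) (at 0)" by (intro tendsto_rabs_zero tendsto_ident_at)
  qed
  then show ?thesis using True by (simp add: has_field_derivative_iff)
qed

section \<open>Levels with nearly vertical normals, and the horizontal flux\<close>

context conformal_tube
begin

text \<open>If every level had a point with |N_1| or |N_2| above \<delta>, the sets of values of N_1
  and N_2 on each level would have total length at least \<delta>, hence sweep total area at least
  \<delta> L over heights of length \<open>L\<close>. The upper bound for this area grows at most
  with slope c/s in \<open>L\<close>, which the choice of \<open>s\<close> makes at most
  \<delta>/2.\<close>

lemma good_level:
  assumes long: "\<And>L. \<exists>T. {T..T + L} \<subseteq> I" and \<delta>: "\<delta> > 0"
  shows "\<exists>t\<in>I. \<forall>w\<in>slab t t. \<bar>N w $ 1\<bar> \<le> \<delta> \<and> \<bar>N w $ 2\<bar> \<le> \<delta>"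
proof (rule ccontr)
  assume "\<not> ?thesis"
  then have bad: "\<exists>w\<in>slab t t. \<bar>N w $ 1\<bar> > \<delta> \<or> \<bar>N w $ 2\<bar> > \<delta>" if "t \<in> I" for t
    using that by (force simp: not_le)
  let ?m = "\<lambda>j t. emeasure lborel ((\<lambda>w. N w $ j) ` slab t t)"
  have m: "ennreal \<delta> \<le> ?m 1 t + ?m 2 t" if t: "t \<in> I" for t
  proof -
    obtain w j where w: "w \<in> slab t t" and j: "j = 1 \<or> j = 2" "\<bar>N w $ j\<bar> > \<delta>" using bad[OF t] by blast
    have "ennreal \<delta> \<le> ennreal \<bar>N w $ j\<bar>" using j by (intro ennreal_leI) simp
    also have "\<dots> \<le> ?m j t" by (rule level_oscillation[OF t w j(1)])
    also have "\<dots> \<le> ?m 1 t + ?m 2 t" using j(1) by (auto simp: add_increasing add_increasing2)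
    finally show ?thesis .
  qed
  obtain T0 where T0: "{T0..T0 + 2} \<subseteq> I" using long by blast
  let ?r = "trapezoid (T0 + 1) (T0 + 1)"
  define \<kappa> where "\<kappa> = integral {T0..T0 + 2} ?r"
  have \<kappa>: "\<kappa> > 0" using trapezoid_integral(2)[of "T0 + 1" "T0 + 1"] by (simp add: \<kappa>_def algebra_simps)
  \<comment> \<open>The vertical flux per unit height, measured with a reference bump; by
    proportionality it governs the flux of every other test function.\<close>
  define c where "c = flux 3 ?r / \<kappa>"
  have r0: "?r t = 0" if "t \<notin> {T0..T0 + 2}" for t using trapezoid(4)[of t "T0 + 1" "T0 + 1"] that by (simp add: add.commute[of _ 2])
  have c0: "c \<ge> 0"
  proof -
    have "flux 3 ?r \<ge> 0"
      unfolding flux_def set_lebesgue_integral_def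
      by (rule Bochner_Integration.integral_nonneg) (auto simp: trapezoid indicator_def)
    then show ?thesis using \<kappa> by (simp add: c_def)
  qed
  \<comment> \<open>Large enough for c/s to be at most \<delta>/2; the summand 1 keeps
    \<open>s\<close> positive when \<open>c\<close> is zero.\<close>
  define s where "s = 2 * c / \<delta> + 1"
  have s: "s > 0" using c0 \<delta> by (simp add: s_def add_nonneg_pos)
  \<comment> \<open>With slope at most \<delta>/2 on the upper side, half of \<delta> L remains to
    exceed the constant terms 200 s A + \<delta>, where A is \<open>gauss_area\<close>.\<close>
  define L where "L = (200 * s * gauss_area + 2 * \<delta>) / (\<delta> / 2) + 1"
  have L: "L > 0" "\<delta> / 2 * L > 200 * s * gauss_area + 2 * \<delta>"
    using s \<delta> gauss_area_nonneg by (auto simp: L_def field_simps add_pos_nonneg)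
  obtain T where T: "{T..T + (L + 2)} \<subseteq> I" using long by blast
  let ?h = "trapezoid (T + 1) (T + 1 + L)"
  have TI: "T \<in> I" "T + L + 2 \<in> I" "T + 1 \<in> I" "T + 1 + L \<in> I" using T L by auto
  have hI: "integral {T..T + L + 2} ?h \<le> L + 2" using trapezoid_integral(1)[of "T + 1" "T + 1 + L"] L
    by (simp add: algebra_simps)
  have h0: "?h t = 0" if "t \<notin> {T..T + L + 2}" for t
    using trapezoid(4)[of t "T + 1" "T + 1 + L"] that by (simp add: algebra_simps)
  have "\<kappa> * flux 3 ?h = integral {T..T + L + 2} ?h * flux 3 ?r"
    unfolding \<kappa>_def
    by (rule flux_proportional'[OF trapezoid(1) TI(1,2) _ h0 trapezoid(1) _ _ _ r0]) (use T0 L in auto)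
  then have "flux 3 ?h = integral {T..T + L + 2} ?h * c" using \<kappa> by (simp add: c_def field_simps)
  also have "\<dots> \<le> (L + 2) * c" by (rule mult_right_mono[OF hI c0])
  finally have F: "flux 3 ?h \<le> (L + 2) * c" .
  let ?J = "{T + 1..T + 1 + L}"
  let ?b = "100 * s * gauss_area + (L + 2) * c / (2 * s)"
  have A: "\<exists>G. G \<in> borel_measurable lborel \<and> (\<forall>t\<in>?J. ?m j t \<le> G t) \<and> integral\<^sup>N lborel G \<le> ennreal ?b" for j
  proof (rule level_area_bound[OF TI(3,4) s trapezoid(1) TI(1,2) h0 trapezoid(2)])
    fix G assume G: "G \<in> borel_measurable lborel"
      "\<And>t. t \<in> ?J \<Longrightarrow> ?m j t \<le> G t"
      "integral\<^sup>N lborel G \<le> ennreal (100 * s * gauss_area + flux 3 ?h / (2 * s))"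
    have "ennreal (100 * s * gauss_area + flux 3 ?h / (2 * s)) \<le> ennreal ?b"
      using F s by (intro ennreal_leI add_left_mono divide_right_mono) auto
    then show ?thesis using G order_trans[OF G(3)] by blast
  qed (auto simp: trapezoid)
  obtain G1 where G1: "G1 \<in> borel_measurable lborel" "\<And>t. t \<in> ?J \<Longrightarrow> ?m 1 t \<le> G1 t" "integral\<^sup>N lborel G1 \<le> ennreal ?b"
    using A[of 1] by blast
  obtain G2 where G2: "G2 \<in> borel_measurable lborel" "\<And>t. t \<in> ?J \<Longrightarrow> ?m 2 t \<le> G2 t" "integral\<^sup>N lborel G2 \<le> ennreal ?b"
    using A[of 2] by blast
  have "ennreal (\<delta> * L) = (\<integral>\<^sup>+ t. ennreal \<delta> * indicator ?J t \<partial>lborel)"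
    using L \<delta> by (simp add: nn_integral_cmult_indicator ennreal_mult)
  also have "\<dots> \<le> (\<integral>\<^sup>+ t. G1 t + G2 t \<partial>lborel)"
  proof (rule nn_integral_mono)
    fix t
    show "ennreal \<delta> * indicator ?J t \<le> G1 t + G2 t"
    proof (cases "t \<in> ?J")
      case True
      then have "t \<in> I" using T by auto
      from m[OF this] show ?thesis using add_mono[OF G1(2)[OF True] G2(2)[OF True]] True by simp
    qed simp
  qed
  also have "\<dots> = integral\<^sup>N lborel G1 + integral\<^sup>N lborel G2" by (rule nn_integral_add[OF G1(1) G2(1)])
  also have "\<dots> \<le> ennreal ?b + ennreal ?b" by (rule add_mono[OF G1(3) G2(3)])
  also have "\<dots> = ennreal (200 * s * gauss_area + (L + 2) * (c / s))"
    using s c0 L gauss_area_nonneg by (subst ennreal_plus[symmetric]) (auto simp: field_simps)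
  finally have "\<delta> * L \<le> 200 * s * gauss_area + (L + 2) * (c / s)"
    using s c0 L gauss_area_nonneg by (subst (asm) ennreal_le_iff) auto
  also have "c / s \<le> \<delta> / 2"
  proof -
    have "c * 2 \<le> \<delta> * s" using \<delta> by (simp add: s_def field_simps)
    then show ?thesis using s \<delta> by (simp add: field_simps)
  qed
  then have "(L + 2) * (c / s) \<le> (L + 2) * (\<delta> / 2)" using L by (intro mult_left_mono) auto
  finally show False using L \<delta> by (simp add: field_simps)
qed

text \<open>The points of a compact slab where N_1 or N_2 reaches 2 \<delta> in absolute value form
  a compact set; its heights form a compact set that misses \<open>t\<close>, hence a neighbourhood
  of \<open>t\<close>.\<close>

lemma thin_slab:
  assumes t: "t \<in> I" and \<delta>: "\<delta> > 0" and lev: "\<And>w. w \<in> slab t t \<Longrightarrow> \<bar>N w $ 1\<bar> \<le> \<delta> \<and> \<bar>N w $ 2\<bar> \<le> \<delta>"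
  obtains \<eta> where "\<eta> > 0" "t - \<eta> \<in> I" "t + \<eta> \<in> I"
    "\<And>w. w \<in> slab (t - \<eta>) (t + \<eta>) \<Longrightarrow> \<bar>N w $ 1\<bar> \<le> 2 * \<delta> \<and> \<bar>N w $ 2\<bar> \<le> 2 * \<delta>"
proof -
  obtain r where r: "r > 0" "cball t r \<subseteq> I" using open_I(1) t open_contains_cball by blast
  have rI: "t - r \<in> I" "t + r \<in> I" using r by (auto simp: dist_real_def subset_iff)
  let ?K = "slab (t - r) (t + r)"
  note K = slab(1)[OF rI] slab(2)[of "t - r" "t + r"]
  have cN: "continuous_on ?K (\<lambda>w. N w $ j)" for j by (intro continuous_intros continuous_on_subset[OF cont_N K(2)])
  define B where "B = ?K \<inter> (\<lambda>w. max \<bar>N w $ 1\<bar> \<bar>N w $ 2\<bar>) -` {2 * \<delta>..}"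
  have "closed B"
    unfolding B_def by (rule continuous_closed_preimage) (auto intro!: continuous_intros cN compact_imp_closed[OF K(1)])
  then have "compact B" using compact_Int_closed[OF K(1), of B] by (simp add: B_def Int_absorb1 inf_assoc[symmetric])
  then have "compact (u 3 ` B)"
    by (rule compact_continuous_image[rotated]) (rule continuous_on_subset[OF cont_u], use K(2) in \<open>auto simp: B_def\<close>)
  then have "open (- u 3 ` B)" by (simp add: compact_imp_closed open_Compl)
  moreover have "t \<in> - u 3 ` B"
  proof
    assume "t \<in> u 3 ` B"
    then obtain w where w: "w \<in> B" "u 3 w = t" by auto
    then have "w \<in> slab t t" by (auto simp: B_def slab_def)
    then have "max \<bar>N w $ 1\<bar> \<bar>N w $ 2\<bar> \<le> \<delta>" using lev by simp
    then show False using w \<delta> by (auto simp: B_def)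
  qed
  ultimately obtain e where e: "e > 0" "ball t e \<subseteq> - u 3 ` B" using openE by blast
  define \<eta> where "\<eta> = min r (e / 2)"
  have \<eta>: "\<eta> > 0" "\<eta> \<le> r" "\<eta> < e" using r e by (auto simp: \<eta>_def)
  show thesis
  proof (rule that[of \<eta>])
    show "t - \<eta> \<in> I" "t + \<eta> \<in> I" using r \<eta> by (auto simp: dist_real_def subset_iff)
    fix w assume w: "w \<in> slab (t - \<eta>) (t + \<eta>)"
    then have "u 3 w \<in> ball t e" "w \<in> ?K" using \<eta> by (auto simp: slab_def dist_real_def)
    then have "w \<notin> B" using e(2) by blast
    then have "max \<bar>N w $ 1\<bar> \<bar>N w $ 2\<bar> < 2 * \<delta>" using \<open>w \<in> ?K\<close> by (auto simp: B_def)
    then show "\<bar>N w $ 1\<bar> \<le> 2 * \<delta> \<and> \<bar>N w $ 2\<bar> \<le> 2 * \<delta>" by simp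
  qed (use \<eta> in auto)
qed

text \<open>A good level varies with \<epsilon>, so its estimate is transported by proportionality
  to the fixed bump \<open>?r\<close>, where \<epsilon> can tend to zero.\<close>

lemma flux_horizontal_zero:
  assumes long: "\<And>L. \<exists>T. {T..T + L} \<subseteq> I" and j: "j = 1 \<or> j = 2"
    and h: "continuous_on UNIV h" "t1 \<in> I" "t2 \<in> I" "t1 \<le> t2" "\<And>t. t \<notin> {t1..t2} \<Longrightarrow> h t = 0"
  shows "flux j h = 0"
proof -
  obtain T where T: "{T..T + 2} \<subseteq> I" using long by blast
  let ?r = "trapezoid (T + 1) (T + 1)"
  define \<kappa> where "\<kappa> = integral {T..T + 2} ?r"
  have \<kappa>: "\<kappa> > 0" using trapezoid_integral(2)[of "T + 1" "T + 1"] by (simp add: \<kappa>_def algebra_simps)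
  have r0: "?r t = 0" if "t \<notin> {T..T + 2}" for t using trapezoid(4)[of t "T + 1" "T + 1"] that by (simp add: add.commute[of _ 2])
  have TI: "T \<in> I" "T + 2 \<in> I" using T by auto
  have small: "\<bar>flux j ?r\<bar> \<le> \<epsilon> * flux 3 ?r" if \<epsilon>: "0 < \<epsilon>" "\<epsilon> < 1 / 2" for \<epsilon>
  proof -
    obtain t where t: "t \<in> I" "\<And>w. w \<in> slab t t \<Longrightarrow> \<bar>N w $ 1\<bar> \<le> \<epsilon> / 2 \<and> \<bar>N w $ 2\<bar> \<le> \<epsilon> / 2"
      using good_level[OF long, of "\<epsilon> / 2"] \<epsilon> by auto
    obtain \<eta> where \<eta>: "\<eta> > 0" "t - \<eta> \<in> I" "t + \<eta> \<in> I"
      and lev: "\<And>w. w \<in> slab (t - \<eta>) (t + \<eta>) \<Longrightarrow> \<bar>N w $ 1\<bar> \<le> \<epsilon> \<and> \<bar>N w $ 2\<bar> \<le> \<epsilon>"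
      using thin_slab[OF t(1) _ t(2)] \<epsilon> by auto
    \<comment> \<open>With N_3 = 0 the horizontal components would have square sum 1, but for
      \<epsilon> below 1/2 it is at most 1/2.\<close>
    have N3: "N w $ 3 \<noteq> 0" if w: "w \<in> slab (t - \<eta>) (t + \<eta>)" for w
    proof
      assume "N w $ 3 = 0"
      moreover have "w \<in> \<Omega>" using w slab(2) by blast
      ultimately have "(N w $ 1)\<^sup>2 + (N w $ 2)\<^sup>2 = 1"
        using norm_N[of w] by (simp add: norm_eq_1 inner_vec_def sum_3 power2_eq_square)
      moreover have "(N w $ 1)\<^sup>2 \<le> (1/2)\<^sup>2" "(N w $ 2)\<^sup>2 \<le> (1/2)\<^sup>2"
        using lev[OF w] \<epsilon> by (auto simp: abs_le_square_iff[symmetric])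
      ultimately show False by (simp add: power2_eq_square)
    qed
    \<comment> \<open>A continuously differentiable bump on the interval of half-width \<eta> around
      \<open>t\<close>: the squared positive part of a parabola.\<close>
    define k where "k x = (max 0 (\<eta>\<^sup>2 - (x - t)\<^sup>2))\<^sup>2" for x
    define k' where "k' x = 2 * max 0 (\<eta>\<^sup>2 - (x - t)\<^sup>2) * (- (2 * (x - t)))" for x
    have dk: "(k has_real_derivative k' x) (at x)" for x
    proof -
      have "((\<lambda>x. \<eta>\<^sup>2 - (x - t)\<^sup>2) has_real_derivative - (2 * (x - t))) (at x)"
        by (auto intro!: derivative_eq_intros)
      from DERIV_chain2[OF has_derivative_max_square this] show ?thesis
        unfolding k_def[abs_def] k'_def .
    qed
    have ck': "continuous_on UNIV k'" unfolding k'_def by (intro continuous_intros)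
    have ck: "continuous_on UNIV k" unfolding k_def by (intro continuous_intros)
    have k0: "k x = 0" if "x \<notin> {t - \<eta>..t + \<eta>}" for x
    proof -
      have "\<eta> \<le> \<bar>x - t\<bar>" using that by (auto simp: abs_if)
      then have "\<eta>\<^sup>2 \<le> (x - t)\<^sup>2" using \<eta>(1) by (simp add: abs_le_square_iff[symmetric])
      then show ?thesis by (simp add: k_def)
    qed
    have ki: "integral {t - \<eta>..t + \<eta>} k > 0"
    proof -
      have i: "k integrable_on {c..d}" for c d
        by (rule integrable_continuous_interval, rule continuous_on_subset[OF ck]) simp
      have "0 < \<eta> * (3/4 * \<eta>\<^sup>2)\<^sup>2" using \<eta>(1) by simp
      also have "\<dots> = integral {t - \<eta>/2..t + \<eta>/2} (\<lambda>_. (3/4 * \<eta>\<^sup>2)\<^sup>2)" using \<eta>(1) by simp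
      also have "\<dots> \<le> integral {t - \<eta>/2..t + \<eta>/2} k"
      proof (rule integral_le[OF _ i])
        fix x assume "x \<in> {t - \<eta>/2..t + \<eta>/2}"
        then have "\<bar>x - t\<bar> \<le> \<bar>\<eta> / 2\<bar>" by (auto simp: abs_if)
        then have "(x - t)\<^sup>2 \<le> (\<eta> / 2)\<^sup>2" by (simp only: abs_le_square_iff)
        then have "3/4 * \<eta>\<^sup>2 \<le> \<eta>\<^sup>2 - (x - t)\<^sup>2" by (simp add: power_divide)
        then have "3/4 * \<eta>\<^sup>2 \<le> max 0 (\<eta>\<^sup>2 - (x - t)\<^sup>2)" by (rule max.coboundedI2)
        then show "(3/4 * \<eta>\<^sup>2)\<^sup>2 \<le> k x" unfolding k_def by (rule power_mono) simp
      qed auto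
      also have "\<dots> \<le> integral {t - \<eta>..t + \<eta>} k"
        by (rule integral_subset_le[OF _ i i]) (use \<eta> in \<open>auto simp: k_def\<close>)
      finally show ?thesis .
    qed
    have le: "\<bar>flux j k\<bar> \<le> \<epsilon> * flux 3 k"
      by (rule flux_le[OF ck' dk _ \<eta>(2,3) k0 N3 j]) (use lev j in \<open>auto simp: k_def\<close>)
    have pr: "integral {t - \<eta>..t + \<eta>} k * flux i ?r = \<kappa> * flux i k" for i
      unfolding \<kappa>_def
      by (rule flux_proportional'[OF trapezoid(1) TI _ r0 ck \<eta>(2,3) _ k0]) (use \<eta> in auto)
    have "integral {t - \<eta>..t + \<eta>} k * \<bar>flux j ?r\<bar> = \<bar>integral {t - \<eta>..t + \<eta>} k * flux j ?r\<bar>"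
      using ki by (simp add: abs_mult)
    also have "\<dots> = \<kappa> * \<bar>flux j k\<bar>" unfolding pr using \<kappa> by (simp add: abs_mult)
    also have "\<dots> \<le> \<kappa> * (\<epsilon> * flux 3 k)" using le \<kappa> by (intro mult_left_mono) auto
    also have "\<dots> = integral {t - \<eta>..t + \<eta>} k * (\<epsilon> * flux 3 ?r)"
      using arg_cong[OF pr[of 3], of "\<lambda>x. \<epsilon> * x"] by (simp only: mult.left_commute)
    finally show ?thesis using ki by (simp add: mult_le_cancel_left_pos)
  qed
  have "\<bar>flux j ?r\<bar> \<le> 0"
  proof (rule field_le_epsilon)
    fix e :: real assume e: "e > 0"
    define \<epsilon> where "\<epsilon> = min (1 / 4) (e / (\<bar>flux 3 ?r\<bar> + 1))"
    have \<epsilon>: "0 < \<epsilon>" "\<epsilon> < 1 / 2" using e by (auto simp: \<epsilon>_def add_nonneg_pos)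
    have "\<bar>flux j ?r\<bar> \<le> \<epsilon> * flux 3 ?r" by (rule small[OF \<epsilon>])
    also have "\<dots> \<le> \<epsilon> * (\<bar>flux 3 ?r\<bar> + 1)" using \<epsilon> by (intro mult_left_mono) auto
    also have "\<dots> \<le> (e / (\<bar>flux 3 ?r\<bar> + 1)) * (\<bar>flux 3 ?r\<bar> + 1)" by (intro mult_right_mono) (auto simp: \<epsilon>_def)
    also have "\<dots> = 0 + e" by simp
    finally show "\<bar>flux j ?r\<bar> \<le> 0 + e" .
  qed
  then have "flux j ?r = 0" by simp
  moreover have "\<kappa> * flux j h = integral {t1..t2} h * flux j ?r"
    unfolding \<kappa>_def by (rule flux_proportional'[OF h(1-4) _ trapezoid(1) TI _ r0]) (use h(5) in auto)
  ultimately show ?thesis using \<kappa> by simp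
qed

end

section \<open>The flux through a regular level\<close>

lemma integral_plane_point:
  fixes G :: "real^2 \<Rightarrow> real"
  assumes "G \<in> borel_measurable borel"
  shows "integrable lborel G \<longleftrightarrow> integrable lborel (\<lambda>z. G (plane_point z))"
    "integral\<^sup>L lborel G = (\<integral>z. G (plane_point z) \<partial>lborel)"
proof -
  have "integrable (distr lborel borel plane_point) G \<longleftrightarrow> integrable lborel (\<lambda>z. G (plane_point z))"
    using assms by (intro integrable_distr_eq) auto
  then show "integrable lborel G \<longleftrightarrow> integrable lborel (\<lambda>z. G (plane_point z))" by (simp add: distr_plane_point)
  have "integral\<^sup>L (distr lborel borel plane_point) G = (\<integral>z. G (plane_point z) \<partial>lborel)"
    using assms by (intro integral_distr) auto
  then show "integral\<^sup>L lborel G = (\<integral>z. G (plane_point z) \<partial>lborel)" by (simp add: distr_plane_point)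
qed

lemma holomorphic_change_of_variables:
  fixes F :: "complex \<Rightarrow> real"
  assumes \<kappa>: "\<kappa> holomorphic_on V" "open V" "inj_on \<kappa> V" and A: "A \<subseteq> V" "A \<in> sets borel"
    and F: "set_integrable lborel (\<kappa> ` A) F"
    and m: "(\<lambda>z. indicator A z *\<^sub>R ((cmod (deriv \<kappa> z))\<^sup>2 * F (\<kappa> z))) \<in> borel_measurable borel"
  shows "set_integrable lborel A (\<lambda>z. (cmod (deriv \<kappa> z))\<^sup>2 * F (\<kappa> z))"
    and "(LINT z:A|lborel. (cmod (deriv \<kappa> z))\<^sup>2 * F (\<kappa> z)) = (LINT w:\<kappa> ` A|lborel. F w)"
proof -
  define \<iota> where "\<iota> v = Complex (v $ 1) (v $ 2)" for v :: "real^2"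
  have \<iota>p: "\<iota> (plane_point w) = w" and p\<iota>: "plane_point (\<iota> v) = v" for w v
    by (simp_all add: \<iota>_def plane_point_surj)
  have lin\<iota>: "bounded_linear \<iota>"
    by (intro linear_conv_bounded_linear[THEN iffD1] linearI) (auto simp: \<iota>_def complex_eq_iff)
  have [measurable]: "\<iota> \<in> borel_measurable borel"
    by (intro borel_measurable_continuous_onI linear_continuous_on lin\<iota>)
  have mem: "v \<in> plane_point ` B \<longleftrightarrow> \<iota> v \<in> B" for v B using \<iota>p p\<iota> by (metis image_iff)
  have ind: "indicator (plane_point ` B) v = (indicator B (\<iota> v) :: real)" for B v by (simp add: indicator_def mem)
  let ?d = "\<lambda>z. (cmod (deriv \<kappa> z))\<^sup>2"
  define S where "S = plane_point ` A"
  define g where "g v = plane_point (\<kappa> (\<iota> v))" for v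
  define g' where "g' v h = plane_point (deriv \<kappa> (\<iota> v) * \<iota> h)" for v h
  have gS: "g ` S = plane_point ` \<kappa> ` A" unfolding S_def g_def by (simp add: image_image \<iota>p)
  have det: "\<bar>det (matrix (g' v))\<bar> = ?d (\<iota> v)" for v
    unfolding cmod_power2 by (simp add: det_2 matrix_def g'_def \<iota>_def axis_def power2_eq_square)
  have dg: "(g has_derivative g' v) (at v within S)" if "v \<in> S" for v
  proof -
    have "\<iota> v \<in> V" using that A mem by (auto simp: S_def)
    then have "(\<kappa> has_derivative (\<lambda>h. deriv \<kappa> (\<iota> v) * h)) (at (\<iota> v))"
      using holomorphic_derivI[OF \<kappa>(1,2)] by (simp add: has_field_derivative_def)
    from has_derivative_compose[OF bounded_linear_imp_has_derivative[OF lin\<iota>] this]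
    have "((\<lambda>v. \<kappa> (\<iota> v)) has_derivative (\<lambda>h. deriv \<kappa> (\<iota> v) * \<iota> h)) (at v)" .
    from bounded_linear.has_derivative[OF bounded_linear_plane_point this]
    show ?thesis unfolding g_def[abs_def] g'_def[abs_def] by (rule has_derivative_at_withinI)
  qed
  have inj: "inj_on g S"
  proof (rule inj_onI)
    fix v v' assume "v \<in> S" "v' \<in> S" "g v = g v'"
    then have "\<iota> v \<in> V" "\<iota> v' \<in> V" "\<kappa> (\<iota> v) = \<kappa> (\<iota> v')"
      using A mem plane_point_inj by (auto simp: S_def g_def inj_def)
    then have "\<iota> v = \<iota> v'" using \<kappa>(3) by (auto dest: inj_onD)
    then show "v = v'" by (metis p\<iota>)
  qed
  have Sb: "S \<in> sets borel"
  proof -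
    have "\<iota> -` A \<inter> space borel \<in> sets borel" using A(2) by measurable
    moreover have "\<iota> -` A \<inter> space borel = S" using mem by (auto simp: S_def)
    ultimately show ?thesis by simp
  qed
  have mF: "(\<lambda>w. indicator (\<kappa> ` A) w *\<^sub>R F w) \<in> borel_measurable borel"
    using F unfolding set_integrable_def by (auto dest: borel_measurable_integrable)
  have mG1: "(\<lambda>v. indicator (g ` S) v *\<^sub>R F (\<iota> v)) \<in> borel_measurable borel"
    using measurable_compose[OF _ mF, of \<iota> borel] by (simp add: gS ind)
  have mG2: "(\<lambda>v. indicator S v *\<^sub>R (?d (\<iota> v) * F (\<kappa> (\<iota> v)))) \<in> borel_measurable borel"
    using measurable_compose[OF _ m, of \<iota> borel] by (simp add: S_def ind)
  have i1: "set_integrable lborel (g ` S) (\<lambda>v. F (\<iota> v))"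
    using F unfolding set_integrable_def integral_plane_point(1)[OF mG1] by (simp add: gS ind \<iota>p)
  have e1: "(LINT v:g ` S|lborel. F (\<iota> v)) = (LINT w:\<kappa> ` A|lborel. F w)"
    unfolding set_lebesgue_integral_def integral_plane_point(2)[OF mG1] by (simp add: gS ind \<iota>p)
  \<comment> \<open>The integrand is wrapped as a function into \<open>real^1\<close>, the
    vector-valued form in which the change of variables is applied.\<close>
  define fv where "fv v = (vec (F (\<iota> v)) :: real^1)" for v
  have abs1: "(\<lambda>v. F (\<iota> v)) absolutely_integrable_on g ` S"
    using i1 mG1 unfolding set_integrable_def by (simp add: integrable_completion)
  then have "fv absolutely_integrable_on g ` S"
    by (simp add: absolutely_integrable_on_1_iff fv_def)
  then have cov: "(\<lambda>v. \<bar>det (matrix (g' v))\<bar> *\<^sub>R fv (g v)) absolutely_integrable_on S \<and>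
      integral S (\<lambda>v. \<bar>det (matrix (g' v))\<bar> *\<^sub>R fv (g v)) = integral (g ` S) fv"
    by (subst has_absolute_integral_change_of_variables[OF _ dg inj]) (use Sb in auto)
  have fg: "(\<bar>det (matrix (g' v))\<bar> *\<^sub>R fv (g v)) $ 1 = ?d (\<iota> v) * F (\<kappa> (\<iota> v))" for v
    by (simp add: det fv_def g_def \<iota>p)
  have abs2: "(\<lambda>v. ?d (\<iota> v) * F (\<kappa> (\<iota> v))) absolutely_integrable_on S"
    using cov fg by (simp add: absolutely_integrable_on_1_iff)
  have "vec (integral S (\<lambda>v. ?d (\<iota> v) * F (\<kappa> (\<iota> v)))) = (vec (integral (g ` S) (\<lambda>v. F (\<iota> v))) :: real^1)"
    using cov unfolding integral_on_1_eq fg by (simp add: fv_def)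
  then have int: "integral S (\<lambda>v. ?d (\<iota> v) * F (\<kappa> (\<iota> v))) = integral (g ` S) (\<lambda>v. F (\<iota> v))"
    by (simp add: vec_eq_iff)
  have i2: "set_integrable lborel S (\<lambda>v. ?d (\<iota> v) * F (\<kappa> (\<iota> v)))"
    using abs2 mG2 unfolding set_integrable_def by (simp add: integrable_completion)
  show "set_integrable lborel A (\<lambda>z. ?d z * F (\<kappa> z))"
    using i2 unfolding set_integrable_def integral_plane_point(1)[OF mG2] by (simp add: S_def ind \<iota>p)
  have "(LINT z:A|lborel. ?d z * F (\<kappa> z)) = (LINT v:S|lborel. ?d (\<iota> v) * F (\<kappa> (\<iota> v)))"
    unfolding set_lebesgue_integral_def integral_plane_point(2)[OF mG2] by (simp add: S_def ind \<iota>p)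
  also have "\<dots> = (LINT v:g ` S|lborel. F (\<iota> v))"
    using set_borel_integral_eq_integral(2)[OF i1] set_borel_integral_eq_integral(2)[OF i2] int by simp
  finally show "(LINT z:A|lborel. ?d z * F (\<kappa> z)) = (LINT w:\<kappa> ` A|lborel. F w)" using e1 by simp
qed

text \<open>Centred at the real point \<open>t\<close>, because in a flow box the real part is the
  height and the imaginary part runs along the level.\<close>

definition square :: "real \<Rightarrow> real \<Rightarrow> complex set" where
  "square t \<delta> = {z. \<bar>Re z - t\<bar> < \<delta> \<and> \<bar>Im z\<bar> < \<delta>}"

definition closed_square :: "real \<Rightarrow> real \<Rightarrow> complex set" where
  "closed_square t \<delta> = {z. \<bar>Re z - t\<bar> \<le> \<delta> \<and> \<bar>Im z\<bar> \<le> \<delta>}"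

lemma square: "open (square t \<delta>)" "compact (closed_square t \<delta>)" "square t \<delta> \<subseteq> closed_square t \<delta>"
proof -
  have "square t \<delta> = box (Complex (t - \<delta>) (- \<delta>)) (Complex (t + \<delta>) \<delta>)"
    by (auto simp: square_def box_def Basis_complex_def)
  then show "open (square t \<delta>)" by (simp add: open_box)
  have "closed_square t \<delta> = cbox (Complex (t - \<delta>) (- \<delta>)) (Complex (t + \<delta>) \<delta>)"
    by (auto simp: closed_square_def cbox_def Basis_complex_def)
  then show "compact (closed_square t \<delta>)" by simp
qed (auto simp: square_def closed_square_def)

section \<open>Flow boxes around a regular level\<close>

locale conformal_tube_section = conformal_tube +
  fixes t0 :: real
  assumes t0: "t0 \<in> I"
    and regular: "\<And>w. w \<in> slab t0 t0 \<Longrightarrow> f 3 w \<noteq> 0"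
begin

text \<open>\<kappa> inverts a local holomorphic function whose real part is the height, so lines of
  constant real part are mapped to level curves. The open set \<open>V\<close> contains the closed
  square, which makes the functions in play bounded on the open one.\<close>

definition flow_box :: "(complex \<Rightarrow> complex) \<Rightarrow> real \<Rightarrow> complex set \<Rightarrow> bool" where
  "flow_box \<kappa> \<delta> V \<longleftrightarrow> 0 < \<delta> \<and> open V \<and> closed_square t0 \<delta> \<subseteq> V \<and> \<kappa> holomorphic_on V \<and> inj_on \<kappa> V \<and> \<kappa> ` V \<subseteq> \<Omega> \<and>
     (\<forall>z\<in>V. u 3 (\<kappa> z) = Re z \<and> deriv \<kappa> z * f 3 (\<kappa> z) = 1)"

text \<open>A primitive of \<open>f 3\<close> on a disc has real part \<open>u 3\<close> up to a
  constant. Its derivative does not vanish at a point of a regular level, so it is locally injective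
  with holomorphic inverse.\<close>

lemma flow_box_exists:
  assumes w0: "w0 \<in> slab t0 t0"
  obtains \<kappa> \<delta> V where "flow_box \<kappa> \<delta> V" "w0 \<in> \<kappa> ` square t0 \<delta>"
proof -
  have wO: "w0 \<in> \<Omega>" and u0: "u 3 w0 = t0" using w0 by (auto simp: slab_def)
  obtain r where r: "r > 0" "ball w0 r \<subseteq> \<Omega>" using open_\<Omega> wO openE by blast
  have "f 3 holomorphic_on ball w0 r" using f_holomorphic r(2) by (rule holomorphic_on_subset)
  then obtain G where G': "\<And>w. w \<in> ball w0 r \<Longrightarrow> (G has_field_derivative f 3 w) (at w within ball w0 r)"
    using holomorphic_convex_primitive'[of "ball w0 r" "f 3"] by auto
  have G: "(G has_field_derivative f 3 w) (at w)" if "w \<in> ball w0 r" for w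
    using G'[OF that] by (simp only: at_within_open[OF that open_ball])
  \<comment> \<open>The additive constant sends \<open>w0\<close> to the real number
    \<open>t0\<close>, the centre of the square.\<close>
  define \<Phi> where "\<Phi> w = G w - G w0 + of_real t0" for w
  have d\<Phi>: "(\<Phi> has_field_derivative f 3 w) (at w)" if "w \<in> ball w0 r" for w
    unfolding \<Phi>_def by (auto intro!: derivative_eq_intros G[OF that])
  have Re\<Phi>: "Re (\<Phi> w) = u 3 w" if w: "w \<in> ball w0 r" for w
  proof -
    have "\<exists>c. \<forall>x\<in>ball w0 r. Re (\<Phi> x) - u 3 x = c"
    proof (rule has_derivative_zero_constant[OF convex_ball])
      fix x assume x: "x \<in> ball w0 r"
      have "((\<lambda>x. Re (\<Phi> x) - u 3 x) has_derivative (\<lambda>h. Re (f 3 x * h) - Re (f 3 x * h))) (at x)"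
        using bounded_linear.has_derivative[OF bounded_linear_Re d\<Phi>[OF x, unfolded has_field_derivative_def]]
          u_deriv[of x 3] x r(2) by (intro has_derivative_diff) auto
      then have "((\<lambda>x. Re (\<Phi> x) - u 3 x) has_derivative (\<lambda>h. 0)) (at x)"
        by (rule has_derivative_eq_rhs) (simp only: diff_self)
      then show "((\<lambda>x. Re (\<Phi> x) - u 3 x) has_derivative (\<lambda>h. 0)) (at x within ball w0 r)"
        by (rule has_derivative_at_withinI)
    qed
    then obtain c where c: "\<And>x. x \<in> ball w0 r \<Longrightarrow> Re (\<Phi> x) - u 3 x = c" by blast
    have "c = 0" using c[of w0] r(1) u0 by (simp add: \<Phi>_def)
    then show ?thesis using c[OF w] by simp
  qed
  have hol\<Phi>: "\<Phi> holomorphic_on ball w0 r" unfolding holomorphic_on_open[OF open_ball] using d\<Phi> by blast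
  have "deriv \<Phi> w0 \<noteq> 0" using DERIV_imp_deriv[OF d\<Phi>[of w0]] regular[OF w0] r by simp
  then obtain r' where r': "r' > 0" "ball w0 r' \<subseteq> ball w0 r" "inj_on \<Phi> (ball w0 r')"
    using has_complex_derivative_locally_injective[OF hol\<Phi> _ open_ball, of w0] r(1) by auto
  let ?B = "ball w0 r'"
  have hol': "\<Phi> holomorphic_on ?B" using hol\<Phi> r'(2) by (rule holomorphic_on_subset)
  obtain \<kappa> where \<kappa>: "\<kappa> holomorphic_on \<Phi> ` ?B" "\<And>z. z \<in> ?B \<Longrightarrow> deriv \<Phi> z * deriv \<kappa> (\<Phi> z) = 1"
      "\<And>z. z \<in> ?B \<Longrightarrow> \<kappa> (\<Phi> z) = z"
    using holomorphic_has_inverse[OF hol' open_ball r'(3)] by metis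
  have Vo: "open (\<Phi> ` ?B)" by (rule open_mapping_thm3[OF hol' open_ball r'(3)])
  have \<Phi>0: "\<Phi> w0 = of_real t0" by (simp add: \<Phi>_def)
  have "of_real t0 \<in> \<Phi> ` ?B" using r'(1) by (intro image_eqI[of _ _ w0]) (auto simp: \<Phi>0)
  then obtain e where e: "e > 0" "ball (of_real t0) e \<subseteq> \<Phi> ` ?B" using Vo openE by blast
  define \<delta> where "\<delta> = e / 3"
  have \<delta>: "\<delta> > 0" using e by (simp add: \<delta>_def)
  have sq: "closed_square t0 \<delta> \<subseteq> \<Phi> ` ?B"
  proof
    fix z assume z: "z \<in> closed_square t0 \<delta>"
    have "cmod (of_real t0 - z) \<le> \<bar>Re (of_real t0 - z)\<bar> + \<bar>Im (of_real t0 - z)\<bar>" by (rule cmod_le)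
    also have "\<dots> \<le> \<delta> + \<delta>" using z by (auto simp: closed_square_def)
    also have "\<dots> < e" using e(1) by (simp add: \<delta>_def)
    finally show "z \<in> \<Phi> ` ?B" using e(2) by (auto simp: dist_norm)
  qed
  show thesis
  proof (rule that[of \<kappa> \<delta> "\<Phi> ` ?B"])
    have "inj_on \<kappa> (\<Phi> ` ?B)" using \<kappa>(3) by (auto intro!: inj_onI)
    moreover have "\<kappa> ` \<Phi> ` ?B \<subseteq> \<Omega>" using \<kappa>(3) r'(2) r(2) by (auto simp: image_image)
    moreover have "u 3 (\<kappa> z) = Re z \<and> deriv \<kappa> z * f 3 (\<kappa> z) = 1" if z: "z \<in> \<Phi> ` ?B" for z
    proof -
      obtain w where w: "w \<in> ?B" "z = \<Phi> w" using z by auto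
      have wr: "w \<in> ball w0 r" using w r'(2) by blast
      have "deriv \<Phi> w = f 3 w" by (rule DERIV_imp_deriv[OF d\<Phi>[OF wr]])
      then show ?thesis using \<kappa>(2,3)[OF w(1)] Re\<Phi>[OF wr] by (simp add: w(2) mult.commute)
    qed
    ultimately show "flow_box \<kappa> \<delta> (\<Phi> ` ?B)"
      unfolding flow_box_def using \<delta> Vo sq \<kappa>(1) by blast
    have "\<kappa> (\<Phi> w0) = w0" using \<kappa>(3) r'(1) by simp
    then show "w0 \<in> \<kappa> ` square t0 \<delta>"
      using \<delta> by (intro image_eqI[of _ _ "of_real t0"]) (auto simp: \<Phi>0 square_def)
  qed
qed

text \<open>The level is compact, so finitely many boxes cover it, and by compactness they still
  cover a thin slab around it. The partition of unity is taken on their union, where the boxes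
  overlap without control.\<close>

lemma flow_box_partition:
  obtains \<C> :: "complex set set" and \<kappa> \<delta> V \<rho> \<eta> where
    "finite \<C>" "\<And>U. U \<in> \<C> \<Longrightarrow> flow_box (\<kappa> U) (\<delta> U) (V U) \<and> U = \<kappa> U ` square t0 (\<delta> U)"
    "\<And>U. U \<in> \<C> \<Longrightarrow> open U"
    "\<And>U. U \<in> \<C> \<Longrightarrow> continuous_on (\<Union>\<C>) (\<rho> U)" "\<And>U w. U \<in> \<C> \<Longrightarrow> w \<in> \<Union>\<C> \<Longrightarrow> 0 \<le> \<rho> U w \<and> \<rho> U w \<le> (1::real)"
    "\<And>U w. U \<in> \<C> \<Longrightarrow> w \<in> \<Union>\<C> \<Longrightarrow> w \<notin> U \<Longrightarrow> \<rho> U w = 0"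
    "\<And>w. w \<in> \<Union>\<C> \<Longrightarrow> (\<Sum>U\<in>\<C>. \<rho> U w) = 1"
    "\<eta> > 0" "t0 - \<eta> \<in> I" "t0 + \<eta> \<in> I" "slab (t0 - \<eta>) (t0 + \<eta>) \<subseteq> \<Union>\<C>" "\<And>U. U \<in> \<C> \<Longrightarrow> \<eta> < \<delta> U"
proof -
  define \<B> where "\<B> = {U. \<exists>\<kappa> \<delta> V. flow_box \<kappa> \<delta> V \<and> U = \<kappa> ` square t0 \<delta>}"
  have op: "open U" if U: "U \<in> \<B>" for U
  proof -
    obtain \<kappa> \<delta> V where b: "flow_box \<kappa> \<delta> V" "U = \<kappa> ` square t0 \<delta>"
      using U unfolding \<B>_def by blast
    have "square t0 \<delta> \<subseteq> V" using b(1) square(3) by (auto simp: flow_box_def)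
    then show ?thesis
      unfolding b(2) using b(1) holomorphic_on_subset inj_on_subset square(1)
      by (intro open_mapping_thm3[of \<kappa>]) (auto simp: flow_box_def)
  qed
  have "slab t0 t0 \<subseteq> \<Union>\<B>"
  proof
    fix w assume "w \<in> slab t0 t0"
    then obtain \<kappa> \<delta> V where "flow_box \<kappa> \<delta> V" "w \<in> \<kappa> ` square t0 \<delta>" by (rule flow_box_exists)
    then show "w \<in> \<Union>\<B>" by (auto simp: \<B>_def)
  qed
  then obtain \<C> where \<C>: "\<C> \<subseteq> \<B>" "finite \<C>" "slab t0 t0 \<subseteq> \<Union>\<C>"
    using compactE[OF slab(1)[OF t0 t0], of \<B>] op by metis
  have "\<forall>U\<in>\<C>. \<exists>\<kappa> \<delta> V. flow_box \<kappa> \<delta> V \<and> U = \<kappa> ` square t0 \<delta>" using \<C>(1) by (auto simp: \<B>_def)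
  then obtain \<kappa> \<delta> V where box: "\<And>U. U \<in> \<C> \<Longrightarrow> flow_box (\<kappa> U) (\<delta> U) (V U) \<and> U = \<kappa> U ` square t0 (\<delta> U)"
    by metis
  have op\<C>: "open U" if "U \<in> \<C>" for U using \<C>(1) op that by blast
  have "\<exists>\<rho> :: complex set \<Rightarrow> complex \<Rightarrow> real. (\<forall>U\<in>\<C>. continuous_on (\<Union>\<C>) (\<rho> U) \<and> (\<forall>x\<in>\<Union>\<C>. 0 \<le> \<rho> U x))
    \<and> (\<forall>U\<in>\<C>. \<forall>x\<in>\<Union>\<C>. x \<notin> U \<longrightarrow> \<rho> U x = 0) \<and> (\<forall>x\<in>\<Union>\<C>. supp_sum (\<lambda>W. \<rho> W x) \<C> = 1)"
  proof (rule subordinate_partition_of_unity[OF subset_refl op\<C>])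
    show "\<exists>V. open V \<and> x \<in> V \<and> finite {U \<in> \<C>. U \<inter> V \<noteq> {}}" for x
      using \<C>(2) by (intro exI[of _ UNIV]) auto
  next
    fix F :: "complex set \<Rightarrow> complex \<Rightarrow> real"
    assume F: "\<And>U. U \<in> \<C> \<Longrightarrow> continuous_on (\<Union>\<C>) (F U) \<and> (\<forall>x\<in>\<Union>\<C>. 0 \<le> F U x)"
      "\<And>x U. \<lbrakk>U \<in> \<C>; x \<in> \<Union>\<C>; x \<notin> U\<rbrakk> \<Longrightarrow> F U x = 0"
      "\<And>x. x \<in> \<Union>\<C> \<Longrightarrow> supp_sum (\<lambda>W. F W x) \<C> = 1"
    show ?thesis using F by (intro exI[of _ F]) blast
  qed
  then obtain \<rho> :: "complex set \<Rightarrow> complex \<Rightarrow> real" where \<rho>0: "(\<forall>U\<in>\<C>. continuous_on (\<Union>\<C>) (\<rho> U) \<and> (\<forall>x\<in>\<Union>\<C>. 0 \<le> \<rho> U x))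
    \<and> (\<forall>U\<in>\<C>. \<forall>x\<in>\<Union>\<C>. x \<notin> U \<longrightarrow> \<rho> U x = 0) \<and> (\<forall>x\<in>\<Union>\<C>. supp_sum (\<lambda>W. \<rho> W x) \<C> = 1)" ..
  have \<rho>: "\<And>U. U \<in> \<C> \<Longrightarrow> continuous_on (\<Union>\<C>) (\<rho> U) \<and> (\<forall>x\<in>\<Union>\<C>. 0 \<le> \<rho> U x)"
    using \<rho>0 by blast
  have \<rho>': "\<And>x U. \<lbrakk>U \<in> \<C>; x \<in> \<Union>\<C>; x \<notin> U\<rbrakk> \<Longrightarrow> \<rho> U x = 0"
    using \<rho>0 by blast
  have \<rho>'': "\<And>x. x \<in> \<Union>\<C> \<Longrightarrow> supp_sum (\<lambda>W. \<rho> W x) \<C> = 1"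
    using \<rho>0 by blast
  have sum1: "(\<Sum>U\<in>\<C>. \<rho> U x) = 1" if "x \<in> \<Union>\<C>" for x
  proof -
    have "supp_sum (\<lambda>W. \<rho> W x) \<C> = (\<Sum>U\<in>\<C>. \<rho> U x)"
      unfolding supp_sum_def support_on_def by (rule sum.mono_neutral_left[OF \<C>(2)]) auto
    then show ?thesis using \<rho>''[OF that] by simp
  qed
  have le1: "\<rho> U x \<le> 1" if "U \<in> \<C>" "x \<in> \<Union>\<C>" for U x
  proof -
    have "\<rho> U x \<le> (\<Sum>U\<in>\<C>. \<rho> U x)"
      using \<rho> \<C>(2) that by (intro member_le_sum) blast+
    then show ?thesis using sum1[OF that(2)] by simp
  qed
  obtain r where r: "r > 0" "cball t0 r \<subseteq> I" using open_I(1) t0 open_contains_cball by blast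
  have rI: "t0 - r \<in> I" "t0 + r \<in> I" using r by (auto simp: dist_real_def subset_iff)
  let ?K = "slab (t0 - r) (t0 + r)"
  note K = slab(1)[OF rI] slab(2)[of "t0 - r" "t0 + r"]
  have "open (\<Union>\<C>)" using op\<C> by blast
  then have "compact (?K - \<Union>\<C>)" using K(1) by (rule compact_diff[rotated])
  then have "compact (u 3 ` (?K - \<Union>\<C>))"
    by (rule compact_continuous_image[rotated]) (rule continuous_on_subset[OF cont_u], use K(2) in auto)
  then have "open (- u 3 ` (?K - \<Union>\<C>))" by (simp add: compact_imp_closed open_Compl)
  moreover have "t0 \<in> - u 3 ` (?K - \<Union>\<C>)" using \<C>(3) by (auto simp: slab_def)
  ultimately obtain e where e: "e > 0" "ball t0 e \<subseteq> - u 3 ` (?K - \<Union>\<C>)" using openE by blast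
  have \<delta>pos: "0 < \<delta> U" if "U \<in> \<C>" for U using box[OF that] by (simp add: flow_box_def)
  \<comment> \<open>Halving e and each \<delta> leaves room for strict inequalities.\<close>
  define \<eta> where "\<eta> = Min (insert r (insert (e / 2) ((\<lambda>U. \<delta> U / 2) ` \<C>)))"
  have fin: "finite (insert r (insert (e / 2) ((\<lambda>U. \<delta> U / 2) ` \<C>)))" using \<C>(2) by simp
  have \<eta>0: "\<eta> > 0" unfolding \<eta>_def using fin r(1) e(1) \<delta>pos by (subst Min_gr_iff) auto
  have \<eta>r: "\<eta> \<le> r" "\<eta> \<le> e / 2" unfolding \<eta>_def by (rule Min_le[OF fin], simp)+
  have \<eta>\<delta>: "\<eta> < \<delta> U" if U: "U \<in> \<C>" for U
  proof -
    have "\<eta> \<le> \<delta> U / 2" unfolding \<eta>_def using fin U by (intro Min_le) auto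
    then show ?thesis using \<delta>pos[OF U] by simp
  qed
  show thesis
  proof (rule that[OF \<C>(2) box op\<C>])
    show "continuous_on (\<Union>\<C>) (\<rho> U)" if "U \<in> \<C>" for U using \<rho>[OF that] by blast
    show "0 \<le> \<rho> U w \<and> \<rho> U w \<le> 1" if "U \<in> \<C>" "w \<in> \<Union>\<C>" for U w using \<rho>[OF that(1)] that(2) le1[OF that] by blast
    show "t0 - \<eta> \<in> I" "t0 + \<eta> \<in> I" using r \<eta>0 \<eta>r by (auto simp: dist_real_def subset_iff)
    show "slab (t0 - \<eta>) (t0 + \<eta>) \<subseteq> \<Union>\<C>"
    proof (rule ccontr)
      assume "\<not> slab (t0 - \<eta>) (t0 + \<eta>) \<subseteq> \<Union>\<C>"
      then obtain w where w: "w \<in> slab (t0 - \<eta>) (t0 + \<eta>)" "w \<notin> \<Union>\<C>" by blast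
      then have "w \<in> ?K - \<Union>\<C>" "u 3 w \<in> ball t0 e" using \<eta>r e(1) by (auto simp: slab_def dist_real_def)
      then show False using e(2) by blast
    qed
  qed (use \<rho>' sum1 \<eta>0 \<eta>\<delta> in auto)
qed

end

lemma set_integrable_bounded_continuous:
  fixes g :: "'a::euclidean_space \<Rightarrow> real"
  assumes "open A" "bounded A" "continuous_on A g" "\<And>x. x \<in> A \<Longrightarrow> \<bar>g x\<bar> \<le> M"
  shows "set_integrable lborel A g"
  unfolding set_integrable_def
proof (rule Bochner_Integration.integrable_bound[of _ "\<lambda>x. indicator A x *\<^sub>R M"])
  have "emeasure lborel A < \<infinity>" using assms(1,2) emeasure_bounded_finite by blast
  then show "integrable lborel (\<lambda>x. indicator A x *\<^sub>R M)"
    using assms(1) by (intro integrable_scaleR_left) (simp add: borel_open)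
  show "(\<lambda>x. indicator A x *\<^sub>R g x) \<in> borel_measurable lborel"
    using borel_measurable_continuous_on_indicator[OF _ assms(3)] assms(1) by (simp add: borel_open)
  show "AE x in lborel. norm (indicator A x *\<^sub>R g x) \<le> norm (indicator A x *\<^sub>R M)"
    using assms(4) by (intro AE_I2) (force simp: indicator_def)
qed

lemma integral_complex_Fubini:
  fixes H :: "complex \<Rightarrow> real"
  assumes "integrable lborel H"
  shows "integrable lborel (\<lambda>t. \<integral>s. H (Complex t s) \<partial>lborel)"
    "integral\<^sup>L lborel H = (\<integral>t. (\<integral>s. H (Complex t s) \<partial>lborel) \<partial>lborel)"
proof -
  let ?T = "\<lambda>(x, y). Complex x y"
  have m: "H \<in> borel_measurable borel" using assms by (auto dest: borel_measurable_integrable)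
  have "integrable (distr (lborel \<Otimes>\<^sub>M lborel) borel ?T) H" using assms distr_Complex by (simp add: lborel_prod)
  then have i: "integrable (lborel \<Otimes>\<^sub>M lborel) (\<lambda>p. H (?T p))"
    by (subst (asm) integrable_distr_eq) (use m in auto)
  have "integral\<^sup>L lborel H = integral\<^sup>L (distr (lborel \<Otimes>\<^sub>M lborel) borel ?T) H"
    using distr_Complex by (simp add: lborel_prod)
  also have "\<dots> = (\<integral>p. H (?T p) \<partial>(lborel \<Otimes>\<^sub>M lborel))" by (rule integral_distr) (use m in auto)
  finally have e: "integral\<^sup>L lborel H = (\<integral>p. H (?T p) \<partial>(lborel \<Otimes>\<^sub>M lborel))" .
  show "integrable lborel (\<lambda>t. \<integral>s. H (Complex t s) \<partial>lborel)"
    using lborel_pair.integrable_fst'[OF i] by simp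
  show "integral\<^sup>L lborel H = (\<integral>t. (\<integral>s. H (Complex t s) \<partial>lborel) \<partial>lborel)"
    unfolding e using lborel_pair.integral_fst'[OF i] by simp
qed

section \<open>The tested flux as an integral over levels\<close>

locale section_partition = conformal_tube_section +
  fixes \<C> :: "complex set set" and \<kappa> \<delta> V \<rho> \<eta>
  assumes finite_\<C>: "finite \<C>"
    and box: "\<And>U. U \<in> \<C> \<Longrightarrow> flow_box (\<kappa> U) (\<delta> U) (V U)" and U_eq: "\<And>U. U \<in> \<C> \<Longrightarrow> \<kappa> U ` square t0 (\<delta> U) = U"
    and open_U: "\<And>U. U \<in> \<C> \<Longrightarrow> open U"
    and cont_\<rho>: "\<And>U. U \<in> \<C> \<Longrightarrow> continuous_on (\<Union>\<C>) (\<rho> U)"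
    and \<rho>_bounds: "\<And>U w. U \<in> \<C> \<Longrightarrow> w \<in> \<Union>\<C> \<Longrightarrow> 0 \<le> \<rho> U w \<and> \<rho> U w \<le> (1::real)"
    and \<rho>_zero: "\<And>U w. U \<in> \<C> \<Longrightarrow> w \<in> \<Union>\<C> \<Longrightarrow> w \<notin> U \<Longrightarrow> \<rho> U w = 0"
    and \<rho>_sum: "\<And>w. w \<in> \<Union>\<C> \<Longrightarrow> (\<Sum>U\<in>\<C>. \<rho> U w) = 1"
    and \<eta>: "\<eta> > 0" "t0 - \<eta> \<in> I" "t0 + \<eta> \<in> I" "slab (t0 - \<eta>) (t0 + \<eta>) \<subseteq> \<Union>\<C>"
    and \<eta>_less: "\<And>U. U \<in> \<C> \<Longrightarrow> \<eta> < \<delta> U"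
begin

abbreviation "Q U \<equiv> square t0 (\<delta> U)"

lemma boxD:
  assumes "U \<in> \<C>"
  shows "0 < \<delta> U" "open (V U)" "closed_square t0 (\<delta> U) \<subseteq> V U" "Q U \<subseteq> V U" "\<kappa> U holomorphic_on V U" "inj_on (\<kappa> U) (V U)"
    "z \<in> V U \<Longrightarrow> \<kappa> U z \<in> \<Omega>" "z \<in> V U \<Longrightarrow> u 3 (\<kappa> U z) = Re z" "z \<in> V U \<Longrightarrow> deriv (\<kappa> U) z * f 3 (\<kappa> U z) = 1"
    "U \<subseteq> \<Omega>" "z \<in> Q U \<Longrightarrow> \<kappa> U z \<in> U"
proof -
  note b = box[OF assms, unfolded flow_box_def]
  show "0 < \<delta> U" "open (V U)" "closed_square t0 (\<delta> U) \<subseteq> V U" "\<kappa> U holomorphic_on V U" "inj_on (\<kappa> U) (V U)"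
    using b by (simp_all only:)
  show QV: "Q U \<subseteq> V U" using b square(3)[of t0 "\<delta> U"] by (blast intro: order_trans)
  have im: "\<kappa> U ` V U \<subseteq> \<Omega>" using b by (elim conjE)
  have eq: "\<forall>z\<in>V U. u 3 (\<kappa> U z) = Re z \<and> deriv (\<kappa> U) z * f 3 (\<kappa> U z) = 1"
    using b by (elim conjE)
  show "z \<in> V U \<Longrightarrow> \<kappa> U z \<in> \<Omega>" using im by blast
  show "z \<in> V U \<Longrightarrow> u 3 (\<kappa> U z) = Re z" "z \<in> V U \<Longrightarrow> deriv (\<kappa> U) z * f 3 (\<kappa> U z) = 1"
    using eq by (simp_all only:)
  have "\<kappa> U ` Q U \<subseteq> \<Omega>" using QV im by blast
  then show "U \<subseteq> \<Omega>" unfolding U_eq[OF assms] .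
  have "z \<in> Q U \<Longrightarrow> \<kappa> U z \<in> \<kappa> U ` Q U" by (rule imageI)
  then show "z \<in> Q U \<Longrightarrow> \<kappa> U z \<in> U" unfolding U_eq[OF assms] .
qed

text \<open>In a flow box the level parameter is \<open>t = Re z\<close>, and \<open>velocity j\<close> is \<open>\<partial>x\<^sub>j/\<partial>t\<close>.\<close>

definition velocity :: "3 \<Rightarrow> complex set \<Rightarrow> complex \<Rightarrow> real" where
  "velocity j U z = Re (f j (\<kappa> U z) / f 3 (\<kappa> U z))"

definition G :: "3 \<Rightarrow> complex set \<Rightarrow> complex \<Rightarrow> real" where
  "G j U z = indicator (Q U) z *\<^sub>R (\<rho> U (\<kappa> U z) * velocity j U z)"

text \<open>The j-th flux component through the level t near t0, as a sum of line integrals in the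
  flow boxes. By conformality the conormal times the arc-length element is \<partial>x/\<partial>t
  ds, which is why only \<open>velocity\<close> appears.\<close>

definition \<Phi> :: "3 \<Rightarrow> real \<Rightarrow> real" where
  "\<Phi> j t = (\<Sum>U\<in>\<C>. \<integral>s. G j U (Complex t s) \<partial>lborel)"

lemma f3_ne: "U \<in> \<C> \<Longrightarrow> z \<in> V U \<Longrightarrow> f 3 (\<kappa> U z) \<noteq> 0"
  using boxD(9)[of U z] by auto

lemma cont_\<kappa>: "U \<in> \<C> \<Longrightarrow> continuous_on (V U) (\<kappa> U)"
  using boxD(5) by (rule holomorphic_on_imp_continuous_on)

lemma cont_f_\<kappa>: "U \<in> \<C> \<Longrightarrow> continuous_on (V U) (\<lambda>z. f j (\<kappa> U z))"
  by (rule continuous_on_compose2[OF cont_f cont_\<kappa>]) (use boxD(7) in auto)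

lemma cont_velocity: "U \<in> \<C> \<Longrightarrow> continuous_on (V U) (velocity j U)"
  unfolding velocity_def by (intro continuous_intros cont_f_\<kappa>) (use f3_ne in auto)

lemma cont_\<rho>_\<kappa>: "U \<in> \<C> \<Longrightarrow> continuous_on (Q U) (\<lambda>z. \<rho> U (\<kappa> U z))"
  by (rule continuous_on_compose2[OF cont_\<rho> continuous_on_subset[OF cont_\<kappa> boxD(4)]]) (use boxD(11) in auto)

lemma \<rho>_\<kappa>_bounds: "U \<in> \<C> \<Longrightarrow> z \<in> Q U \<Longrightarrow> 0 \<le> \<rho> U (\<kappa> U z) \<and> \<rho> U (\<kappa> U z) \<le> 1"
  using \<rho>_bounds[of U "\<kappa> U z"] boxD(11)[of U z] by blast

lemma velocity_bounded:
  assumes "U \<in> \<C>"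
  obtains M where "M \<ge> 0" "\<And>z. z \<in> Q U \<Longrightarrow> \<bar>velocity j U z\<bar> \<le> M"
proof -
  have "compact (velocity j U ` closed_square t0 (\<delta> U))"
    using continuous_on_subset[OF cont_velocity boxD(3)] assms square(2) by (intro compact_continuous_image) auto
  then have "bounded (velocity j U ` closed_square t0 (\<delta> U))" by (rule compact_imp_bounded)
  then obtain M where "M > 0" "\<forall>x\<in>velocity j U ` closed_square t0 (\<delta> U). norm x \<le> M" by (auto simp: bounded_pos)
  then show thesis using square(3)[of t0 "\<delta> U"] by (intro that[of M]) auto
qed

lemma G_bounded:
  assumes "U \<in> \<C>"
  obtains M where "M \<ge> 0" "\<And>z. \<bar>G j U z\<bar> \<le> M"
proof -
  obtain M where M: "M \<ge> 0" "\<And>z. z \<in> Q U \<Longrightarrow> \<bar>velocity j U z\<bar> \<le> M" using velocity_bounded[OF assms] by blast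
  have "\<bar>G j U z\<bar> \<le> M" for z
  proof (cases "z \<in> Q U")
    case True
    have "\<bar>\<rho> U (\<kappa> U z)\<bar> * \<bar>velocity j U z\<bar> \<le> 1 * M"
      using \<rho>_\<kappa>_bounds[OF assms True] M(2)[OF True] by (intro mult_mono) auto
    then show ?thesis using True by (simp add: G_def abs_mult)
  qed (simp add: G_def M)
  then show thesis using M(1) by (rule that[rotated])
qed

lemma cont_G: "U \<in> \<C> \<Longrightarrow> continuous_on (Q U) (\<lambda>z. \<rho> U (\<kappa> U z) * velocity j U z)"
  by (intro continuous_intros cont_\<rho>_\<kappa> continuous_on_subset[OF cont_velocity boxD(4)])

lemma measurable_G: "U \<in> \<C> \<Longrightarrow> G j U \<in> borel_measurable borel"
  unfolding G_def[abs_def]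
  using borel_measurable_continuous_on_indicator[OF _ cont_G] square(1) by (simp add: borel_open)

text \<open>The coarea formula near \<open>t0\<close>: the partition of unity splits the integral
  among the boxes, each box is straightened by \<kappa>, and Fubini separates the height from the
  parameter along the level.\<close>

lemma flux_eq_integral:
  assumes h: "continuous_on UNIV h" "\<And>t. t \<notin> {t0 - \<eta>..t0 + \<eta>} \<Longrightarrow> h t = 0"
  shows "integrable lborel (\<lambda>t. h t * \<Phi> j t)" "flux j h = (\<integral>t. h t * \<Phi> j t \<partial>lborel)"
proof -
  let ?g = "\<lambda>w. Re (f j w * cnj (f 3 w))"
  let ?F = "\<lambda>U w. \<rho> U w * (h (u 3 w) * ?g w)"
  have cg: "continuous_on \<Omega> (\<lambda>w. h (u 3 w) * ?g w)"
    by (intro continuous_intros continuous_on_compose2[OF h(1) cont_u] cont_f) auto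
  have intU: "set_integrable lborel U (?F U)" if U: "U \<in> \<C>" for U
  proof -
    have K: "compact (\<kappa> U ` closed_square t0 (\<delta> U))"
      using continuous_on_subset[OF cont_\<kappa> boxD(3)] U square(2) by (intro compact_continuous_image) auto
    have KO: "\<kappa> U ` closed_square t0 (\<delta> U) \<subseteq> \<Omega>" using boxD(3,7)[OF U] by blast
    have UK: "U \<subseteq> \<kappa> U ` closed_square t0 (\<delta> U)" using U_eq[OF U] square(3) by blast
    have "bounded ((\<lambda>w. h (u 3 w) * ?g w) ` \<kappa> U ` closed_square t0 (\<delta> U))"
      using K continuous_on_subset[OF cg KO] compact_continuous_image compact_imp_bounded by blast
    then obtain M where M: "M > 0" "\<forall>x\<in>(\<lambda>w. h (u 3 w) * ?g w) ` \<kappa> U ` closed_square t0 (\<delta> U). norm x \<le> M"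
      unfolding bounded_pos by blast
    show ?thesis
    proof (rule set_integrable_bounded_continuous[OF open_U[OF U]])
      show "bounded U" using UK K compact_imp_bounded bounded_subset by blast
      show "continuous_on U (?F U)"
        by (rule continuous_on_mult[OF continuous_on_subset[OF cont_\<rho>[OF U]] continuous_on_subset[OF cg boxD(10)[OF U]]])
          (use U in blast)
      fix w assume w: "w \<in> U"
      have "\<bar>h (u 3 w) * ?g w\<bar> \<le> M" using M(2) UK w by (force simp del: Re_f Im_f times_complex.sel)
      moreover have "0 \<le> \<rho> U w \<and> \<rho> U w \<le> 1" by (rule \<rho>_bounds[OF U]) (use U w in blast)
      ultimately have "\<bar>\<rho> U w\<bar> * \<bar>h (u 3 w) * ?g w\<bar> \<le> 1 * M" by (intro mult_mono) auto
      then show "\<bar>?F U w\<bar> \<le> M" by (simp only: abs_mult mult_1)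
    qed
  qed
  have "flux j h = (\<integral>w. (\<Sum>U\<in>\<C>. indicator U w *\<^sub>R ?F U w) \<partial>lborel)"
    unfolding flux_def set_lebesgue_integral_def
  proof (rule Bochner_Integration.integral_cong[OF refl])
    fix w
    show "indicator \<Omega> w *\<^sub>R (h (u 3 w) * ?g w) = (\<Sum>U\<in>\<C>. indicator U w *\<^sub>R ?F U w)"
    proof (cases "w \<in> \<Union>\<C>")
      case True
      then have wO: "w \<in> \<Omega>" using boxD(10) by blast
      have "(\<Sum>U\<in>\<C>. indicator U w *\<^sub>R ?F U w) = (\<Sum>U\<in>\<C>. \<rho> U w * (h (u 3 w) * ?g w))"
      proof (rule sum.cong[OF refl])
        fix U assume "U \<in> \<C>"
        then show "indicator U w *\<^sub>R ?F U w = \<rho> U w * (h (u 3 w) * ?g w)"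
          using \<rho>_zero[of U w] True by (cases "w \<in> U") (auto simp del: Re_f Im_f times_complex.sel)
      qed
      also have "\<dots> = h (u 3 w) * ?g w" unfolding sum_distrib_right[symmetric] \<rho>_sum[OF True] by (rule mult_1)
      finally show ?thesis using wO by (simp del: Re_f Im_f times_complex.sel)
    next
      case False
      have "indicator \<Omega> w *\<^sub>R (h (u 3 w) * ?g w) = 0"
      proof (cases "w \<in> \<Omega>")
        case True
        then have "u 3 w \<notin> {t0 - \<eta>..t0 + \<eta>}" using \<eta>(4) False by (auto simp: slab_def)
        then show ?thesis using h(2) by simp
      qed simp
      moreover have "(\<Sum>U\<in>\<C>. indicator U w *\<^sub>R ?F U w) = 0"
        using False by (intro sum.neutral) (auto simp: indicator_def)
      ultimately show ?thesis by simp
    qed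
  qed
  also have "\<dots> = (\<Sum>U\<in>\<C>. LINT w:U|lborel. ?F U w)"
    unfolding set_lebesgue_integral_def using intU by (intro Bochner_Integration.integral_sum) (simp add: set_integrable_def)
  finally have fl: "flux j h = (\<Sum>U\<in>\<C>. LINT w:U|lborel. ?F U w)" .
  have each: "integrable lborel (\<lambda>t. h t * (\<integral>s. G j U (Complex t s) \<partial>lborel)) \<and>
      (LINT w:U|lborel. ?F U w) = (\<integral>t. h t * (\<integral>s. G j U (Complex t s) \<partial>lborel) \<partial>lborel)" if U: "U \<in> \<C>" for U
  proof -
    \<comment> \<open>The Jacobian of \<kappa> is 1/|f_3|^2, and Re (f_j cnj f_3)/|f_3|^2 is the
      real part of f_j/f_3.\<close>
    have eq: "(cmod (deriv (\<kappa> U) z))\<^sup>2 * ?F U (\<kappa> U z) = h (Re z) * (\<rho> U (\<kappa> U z) * velocity j U z)"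
      if z: "z \<in> Q U" for z
    proof -
      have zV: "z \<in> V U" using z boxD(4)[OF U] by blast
      let ?a = "f 3 (\<kappa> U z)" and ?b = "f j (\<kappa> U z)"
      have a: "?a \<noteq> 0" by (rule f3_ne[OF U zV])
      have "deriv (\<kappa> U) z = 1 / ?a" using boxD(9)[OF U zV] a by (simp add: field_simps)
      then have "(cmod (deriv (\<kappa> U) z))\<^sup>2 * Re (?b * cnj ?a) = Re (?b * cnj ?a) / (cmod ?a)\<^sup>2"
        by (simp add: norm_divide power_divide)
      also have "\<dots> = velocity j U z"
        unfolding velocity_def by (subst complex_div_cnj) (simp only: Re_divide_of_real of_real_power[symmetric])
      finally have 1: "(cmod (deriv (\<kappa> U) z))\<^sup>2 * Re (?b * cnj ?a) = velocity j U z" .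
      have "(cmod (deriv (\<kappa> U) z))\<^sup>2 * ?F U (\<kappa> U z) = h (u 3 (\<kappa> U z)) * (\<rho> U (\<kappa> U z) * ((cmod (deriv (\<kappa> U) z))\<^sup>2 * Re (?b * cnj ?a)))"
        by (simp only: mult.assoc mult.commute mult.left_commute)
      then show ?thesis unfolding 1 boxD(8)[OF U zV] .
    qed
    have cH: "continuous_on (Q U) (\<lambda>z. h (Re z) * (\<rho> U (\<kappa> U z) * velocity j U z))"
      by (intro continuous_intros cont_G[OF U] continuous_on_compose2[OF h(1)]) auto
    have Qb: "Q U \<in> sets borel" using square(1) by (rule borel_open)
    have ind: "(\<lambda>z. indicator (Q U) z *\<^sub>R ((cmod (deriv (\<kappa> U) z))\<^sup>2 * ?F U (\<kappa> U z))) = (\<lambda>z. h (Re z) * G j U z)"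
    proof
      fix z
      show "indicator (Q U) z *\<^sub>R ((cmod (deriv (\<kappa> U) z))\<^sup>2 * ?F U (\<kappa> U z)) = h (Re z) * G j U z"
        using eq[of z] by (cases "z \<in> Q U") (simp_all add: G_def del: Re_f Im_f times_complex.sel)
    qed
    have "(\<lambda>z. h (Re z) * G j U z) \<in> borel_measurable borel"
      using measurable_G[OF U] by (intro borel_measurable_times) (auto intro!: borel_measurable_continuous_onI continuous_on_compose2[OF h(1)] continuous_intros)
    then have m: "(\<lambda>z. indicator (Q U) z *\<^sub>R ((cmod (deriv (\<kappa> U) z))\<^sup>2 * ?F U (\<kappa> U z))) \<in> borel_measurable borel"
      unfolding ind .
    have intU': "set_integrable lborel (\<kappa> U ` Q U) (?F U)" using intU[OF U] U_eq[OF U] by simp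
    note cov = holomorphic_change_of_variables[OF boxD(5,2,6)[OF U] boxD(4)[OF U] Qb intU' m]
    have iH: "integrable lborel (\<lambda>z. h (Re z) * G j U z)" using cov(1) unfolding set_integrable_def ind .
    have "(LINT w:U|lborel. ?F U w) = (\<integral>z. h (Re z) * G j U z \<partial>lborel)"
      using cov(2) U_eq[OF U] unfolding set_lebesgue_integral_def[of _ "Q U"] ind by simp
    then show ?thesis using integral_complex_Fubini[OF iH] by simp
  qed
  have \<Phi>: "(\<lambda>t. h t * \<Phi> j t) = (\<lambda>t. \<Sum>U\<in>\<C>. h t * (\<integral>s. G j U (Complex t s) \<partial>lborel))"
    by (simp add: \<Phi>_def sum_distrib_left)
  show "integrable lborel (\<lambda>t. h t * \<Phi> j t)" unfolding \<Phi> by (intro Bochner_Integration.integrable_sum) (use each in blast)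
  show "flux j h = (\<integral>t. h t * \<Phi> j t \<partial>lborel)"
    unfolding \<Phi> fl using each by (subst Bochner_Integration.integral_sum) auto
qed

text \<open>Dominated convergence. The real part of the points considered tends to the centre of the
  squares, so the sharp cut-off in \<open>G\<close> produces no jump at \<open>t0\<close>.\<close>

lemma cont_\<Phi>: "isCont (\<Phi> j) t0"
  unfolding continuous_at_sequentially
proof (intro allI impI)
  fix x :: "nat \<Rightarrow> real" assume x: "x \<longlonglongrightarrow> t0"
  have "(\<lambda>n. \<integral>s. G j U (Complex (x n) s) \<partial>lborel) \<longlonglongrightarrow> (\<integral>s. G j U (Complex t0 s) \<partial>lborel)" if U: "U \<in> \<C>" for U
  proof -
    obtain M where M: "M \<ge> 0" "\<And>z. \<bar>G j U z\<bar> \<le> M" using G_bounded[OF U] by blast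
    have [measurable]: "(\<lambda>s. G j U (Complex t s)) \<in> borel_measurable lborel" for t
      using measurable_compose[OF _ measurable_G[OF U], of "\<lambda>s. Complex t s" lborel]
      unfolding Complex_eq by (auto intro!: borel_measurable_continuous_onI continuous_intros)
    show ?thesis
    proof (rule integral_dominated_convergence[where w="\<lambda>s. indicator {- \<delta> U..\<delta> U} s *\<^sub>R M"])
      show "integrable lborel (\<lambda>s. indicator {- \<delta> U..\<delta> U} s *\<^sub>R M)"
        by (intro integrable_scaleR_left integrable_real_indicator) (auto simp: emeasure_lborel_Icc_eq)
      show "AE s in lborel. (\<lambda>n. G j U (Complex (x n) s)) \<longlonglongrightarrow> G j U (Complex t0 s)"
      proof (rule AE_I2)
        fix s
        show "(\<lambda>n. G j U (Complex (x n) s)) \<longlonglongrightarrow> G j U (Complex t0 s)"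
        proof (cases "\<bar>s\<bar> < \<delta> U")
          case True
          let ?g = "\<lambda>z. \<rho> U (\<kappa> U z) * velocity j U z"
          have z0: "Complex t0 s \<in> Q U" using True boxD(1)[OF U] by (simp add: square_def)
          have lim: "(\<lambda>n. Complex (x n) s) \<longlonglongrightarrow> Complex t0 s" using x by (intro tendsto_intros) auto
          have "isCont ?g (Complex t0 s)" using cont_G[OF U] square(1) z0 by (simp add: continuous_on_eq_continuous_at)
          then have "(\<lambda>n. ?g (Complex (x n) s)) \<longlonglongrightarrow> ?g (Complex t0 s)" using lim by (rule isCont_tendsto_compose)
          then have "(\<lambda>n. ?g (Complex (x n) s)) \<longlonglongrightarrow> G j U (Complex t0 s)" using z0 by (simp add: G_def)
          moreover have "\<forall>\<^sub>F n in sequentially. ?g (Complex (x n) s) = G j U (Complex (x n) s)"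
          proof -
            have "\<forall>\<^sub>F n in sequentially. Complex (x n) s \<in> Q U" using lim square(1) z0 by (rule topological_tendstoD)
            then show ?thesis by (rule eventually_mono) (simp add: G_def)
          qed
          ultimately show ?thesis by (rule Lim_transform_eventually)
        next
          case False
          then show ?thesis by (simp add: G_def square_def)
        qed
      qed
      show "AE s in lborel. norm (G j U (Complex (x n) s)) \<le> indicator {- \<delta> U..\<delta> U} s *\<^sub>R M" for n
      proof (rule AE_I2)
        fix s
        show "norm (G j U (Complex (x n) s)) \<le> indicator {- \<delta> U..\<delta> U} s *\<^sub>R M"
          using M by (cases "s \<in> {- \<delta> U..\<delta> U}") (auto simp: G_def square_def)
      qed
    qed measurable
  qed
  then show "(\<Phi> j \<circ> x) \<longlonglongrightarrow> \<Phi> j t0"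
    unfolding \<Phi>_def comp_def by (intro tendsto_sum) auto
qed

text \<open>The tested flux determines the level flux only in the mean; continuity at
  \<open>t0\<close> makes the value there accessible through a narrow tent function.\<close>

lemma \<Phi>_zero:
  assumes flux0: "\<And>h t1 t2. continuous_on UNIV h \<Longrightarrow> t1 \<in> I \<Longrightarrow> t2 \<in> I \<Longrightarrow> t1 \<le> t2 \<Longrightarrow>
      (\<And>t. t \<notin> {t1..t2} \<Longrightarrow> h t = 0) \<Longrightarrow> flux j h = 0"
  shows "\<Phi> j t0 = 0"
proof (rule ccontr)
  assume c: "\<Phi> j t0 \<noteq> 0"
  \<comment> \<open>Multiplying by this value treats both signs at once: c \<Phi> stays above c^2/2
    near \<open>t0\<close>.\<close>
  define c where "c = \<Phi> j t0"
  have c0: "c\<^sup>2 > 0" using c by (simp add: c_def)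
  have "isCont (\<lambda>t. c * \<Phi> j t) t0" using cont_\<Phi> by (intro continuous_intros)
  then obtain d where d: "d > 0" "\<And>t. dist t t0 < d \<Longrightarrow> dist (c * \<Phi> j t) (c * \<Phi> j t0) < c\<^sup>2 / 2"
    using c0 unfolding continuous_at_eps_delta by (metis half_gt_zero)
  define e where "e = min (d / 2) \<eta>"
  have e: "e > 0" "e < d" "e \<le> \<eta>" using d(1) \<eta>(1) by (auto simp: e_def)
  define k where "k t = max 0 (e - \<bar>t - t0\<bar>)" for t
  have ck: "continuous_on UNIV k" unfolding k_def by (intro continuous_intros)
  have k0: "k t = 0" if "t \<notin> {t0 - \<eta>..t0 + \<eta>}" for t using that e by (auto simp: k_def)
  have "flux j k = 0" using flux0[OF ck \<eta>(2,3) _ k0] \<eta>(1) by simp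
  then have z: "(\<integral>t. k t * \<Phi> j t \<partial>lborel) = 0" using flux_eq_integral(2)[OF ck k0] by simp
  have ik: "integrable lborel (\<lambda>t. c * (k t * \<Phi> j t))" using flux_eq_integral(1)[OF ck k0] by (rule integrable_mult_right)
  have "0 < (c\<^sup>2 / 2) * (e / 2) * e" using c0 e by simp
  also have "\<dots> = (\<integral>t. indicator {t0 - e/2..t0 + e/2} t *\<^sub>R ((c\<^sup>2 / 2) * (e / 2)) \<partial>lborel)" using e by simp
  also have "\<dots> \<le> (\<integral>t. c * (k t * \<Phi> j t) \<partial>lborel)"
  proof (rule integral_mono[OF _ ik])
    fix t
    show "indicator {t0 - e/2..t0 + e/2} t *\<^sub>R ((c\<^sup>2 / 2) * (e / 2)) \<le> c * (k t * \<Phi> j t)"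
    proof (cases "\<bar>t - t0\<bar> < e")
      case True
      then have "dist (c * \<Phi> j t) (c * c) < c\<^sup>2 / 2" using d(2)[of t] e by (simp add: dist_real_def c_def)
      then have p: "c\<^sup>2 / 2 \<le> c * \<Phi> j t" by (simp add: dist_real_def power2_eq_square abs_if split: if_splits)
      have kn: "0 \<le> k t" by (simp add: k_def)
      have ki: "indicator {t0 - e/2..t0 + e/2} t * (e / 2) \<le> k t"
      proof (cases "t \<in> {t0 - e/2..t0 + e/2}")
        case True
        then have "t - t0 \<le> e / 2" "- (t - t0) \<le> e / 2" by auto
        then have "\<bar>t - t0\<bar> \<le> e / 2" by (rule abs_leI)
        then have "e / 2 \<le> e - \<bar>t - t0\<bar>" by linarith
        then show ?thesis using True by (simp add: k_def le_max_iff_disj)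
      qed (simp add: kn)
      have "(c\<^sup>2 / 2) * (indicator {t0 - e/2..t0 + e/2} t * (e / 2)) \<le> (c * \<Phi> j t) * k t"
        by (rule mult_mono[OF p ki]) (use p c0 e in \<open>linarith, simp\<close>)
      then show ?thesis by (simp add: mult.commute mult.left_commute)
    next
      case False
      then have "t \<notin> {t0 - e/2..t0 + e/2}" using e by auto
      then show ?thesis using False by (simp add: k_def)
    qed
  qed (intro integrable_scaleR_left integrable_real_indicator, auto simp: emeasure_lborel_Icc_eq)
  also have "\<dots> = 0" using z by simp
  finally show False by simp
qed

end

section \<open>Arc length on a regular section\<close>

text \<open>For any competitor \<open>m\<close> the difference of \<open>m\<close> and the multiple
  of \<open>T\<close> with the same height is tangent and horizontal, hence orthogonal to
  \<open>m\<close> and to \<open>T\<close>, hence to itself. Thus \<open>m\<close> is a positive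
  multiple of \<open>T\<close>.\<close>

lemma conormal_eq:
  fixes n T :: "real^3"
  assumes tan: "tangent_space S p = {v. n \<bullet> v = 0}" and T: "n \<bullet> T = 0" "T $ 3 > 0"
    and hor: "\<And>v. n \<bullet> v = 0 \<Longrightarrow> v $ 3 = 0 \<Longrightarrow> T \<bullet> v = 0"
  shows "conormal S p = sgn T"
  unfolding conormal_def
proof (rule the_equality)
  have T0: "T \<noteq> 0" using T by auto
  have e3: "v \<bullet> e3 = v $ 3" for v by (simp add: e3_def inner_axis)
  show "sgn T \<in> tangent_space S p \<and> norm (sgn T) = 1 \<and>
      (\<forall>v\<in>tangent_space S p. v $ 3 = 0 \<longrightarrow> sgn T \<bullet> v = 0) \<and> sgn T \<bullet> e3 > 0"
    using T T0 hor by (auto simp: tan e3 norm_sgn sgn_div_norm)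
  fix m
  assume m: "m \<in> tangent_space S p \<and> norm m = 1 \<and> (\<forall>v\<in>tangent_space S p. v $ 3 = 0 \<longrightarrow> m \<bullet> v = 0) \<and> m \<bullet> e3 > 0"
  define c where "c = m $ 3 / T $ 3"
  have c: "c > 0" using m T by (simp add: c_def e3)
  define d where "d = m - c *\<^sub>R T"
  have nd: "n \<bullet> d = 0" using m T by (simp add: d_def tan inner_diff_right)
  have d3: "d $ 3 = 0" using T by (simp add: d_def c_def)
  have "m \<bullet> d = 0" "T \<bullet> d = 0" using m nd d3 hor by (auto simp: tan)
  then have "d \<bullet> d = 0" by (simp add: d_def inner_diff_left inner_diff_right inner_commute)
  then have mc: "m = c *\<^sub>R T" by (simp add: d_def)
  have "norm m = 1" using m by blast
  then have "c * norm T = 1" using c unfolding mc by simp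
  then have "c = 1 / norm T" using T0 by (simp add: field_simps)
  then show "m = sgn T" by (simp add: mc sgn_div_norm divide_inverse)
qed

text \<open>Here \<tau> is only known to be continuous, and its differentiability is a conclusion.
  Caratheodory's slope functions give P (x - s) = R(\<tau> x) (\<tau> x - \<tau> s) with R(\<tau> s)
  = q', which is not zero, so the quotient can be solved for.\<close>

lemma DERIV_of_composition:
  fixes p q \<tau> :: "real \<Rightarrow> real"
  assumes \<tau>: "isCont \<tau> s" and p: "(p has_real_derivative p') (at s)" and q: "(q has_real_derivative q') (at (\<tau> s))" "q' \<noteq> 0"
    and A: "open A" "s \<in> A" "\<And>x. x \<in> A \<Longrightarrow> q (\<tau> x) = p x"
  shows "(\<tau> has_real_derivative p' / q') (at s)"
proof -
  obtain P where P: "\<And>x. p x - p s = P x * (x - s)" "isCont P s" "P s = p'"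
    using p CARAT_DERIV by metis
  obtain R where R: "\<And>y. q y - q (\<tau> s) = R y * (y - \<tau> s)" "isCont R (\<tau> s)" "R (\<tau> s) = q'"
    using q(1) CARAT_DERIV by metis
  have cR: "isCont (\<lambda>x. R (\<tau> x)) s" using \<tau> R(2) by (rule isCont_o2)
  have "R (\<tau> s) \<noteq> 0" using R(3) q(2) by simp
  then obtain e where e: "e > 0" "\<And>x. dist s x < e \<Longrightarrow> R (\<tau> x) \<noteq> 0"
    using continuous_at_avoid[OF cR] by blast
  define B where "B = ball s e"
  have B: "open B" "s \<in> B" "\<And>x. x \<in> B \<Longrightarrow> R (\<tau> x) \<noteq> 0" using e by (auto simp: B_def)
  have "((\<lambda>x. (\<tau> x - \<tau> s) / (x - s)) \<longlongrightarrow> p' / q') (at s)"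
  proof (rule Lim_transform_within_open[of "\<lambda>x. P x / R (\<tau> x)" _ _ _ "A \<inter> B"])
    have "isCont (\<lambda>x. P x / R (\<tau> x)) s" using P(2) cR R(3) q(2) by (intro continuous_intros) auto
    then show "((\<lambda>x. P x / R (\<tau> x)) \<longlongrightarrow> p' / q') (at s)" by (simp add: isCont_def P(3) R(3))
    show "open (A \<inter> B)" "s \<in> A \<inter> B" using A B by auto
    fix x assume x: "x \<in> A \<inter> B" "x \<noteq> s"
    have "P x * (x - s) = R (\<tau> x) * (\<tau> x - \<tau> s)"
      using P(1)[of x] R(1)[of "\<tau> x"] A(3)[of x] A(3)[OF A(2)] x by simp
    moreover have "R (\<tau> x) \<noteq> 0" using B(3) x by blast
    ultimately show "P x / R (\<tau> x) = (\<tau> x - \<tau> s) / (x - s)" using x(2) by (simp add: field_simps)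
  qed
  then show ?thesis by (simp add: has_field_derivative_iff)
qed

lemma nn_integral_change_of_variables_1:
  fixes g \<tau> \<tau>' :: "real \<Rightarrow> real"
  assumes D: "D \<in> sets borel" "\<tau> ` D \<in> sets borel" "inj_on \<tau> D"
    and d: "\<And>s. s \<in> D \<Longrightarrow> (\<tau> has_real_derivative \<tau>' s) (at s)"
    and g: "set_integrable lborel (\<tau> ` D) g" "\<And>x. x \<in> \<tau> ` D \<Longrightarrow> 0 \<le> g x"
    and m: "(\<lambda>s. indicator D s *\<^sub>R (\<bar>\<tau>' s\<bar> * g (\<tau> s))) \<in> borel_measurable borel"
  shows "(\<integral>\<^sup>+ x. ennreal (indicator (\<tau> ` D) x *\<^sub>R g x) \<partial>lborel) = (\<integral>\<^sup>+ s. ennreal (indicator D s *\<^sub>R (\<bar>\<tau>' s\<bar> * g (\<tau> s))) \<partial>lborel)"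
proof -
  have mg: "(\<lambda>x. indicator (\<tau> ` D) x *\<^sub>R g x) \<in> borel_measurable borel"
    using g(1) unfolding set_integrable_def by (auto dest: borel_measurable_integrable)
  have a1: "g absolutely_integrable_on \<tau> ` D"
    using g(1) mg unfolding set_integrable_def by (simp add: integrable_completion)
  have dw: "\<And>s. s \<in> D \<Longrightarrow> (\<tau> has_field_derivative \<tau>' s) (at s within D)"
    using d has_field_derivative_at_within by blast
  have "(\<lambda>s. \<bar>\<tau>' s\<bar> * g (\<tau> s)) absolutely_integrable_on D \<and>
      integral D (\<lambda>s. \<bar>\<tau>' s\<bar> * g (\<tau> s)) = integral (\<tau> ` D) g"
    using has_absolute_integral_change_of_variables_1'[OF _ dw D(3), of g "integral (\<tau> ` D) g"] a1 D(1) by simp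
  then have a2: "(\<lambda>s. \<bar>\<tau>' s\<bar> * g (\<tau> s)) absolutely_integrable_on D"
    and e: "integral D (\<lambda>s. \<bar>\<tau>' s\<bar> * g (\<tau> s)) = integral (\<tau> ` D) g" by auto
  have i2: "set_integrable lborel D (\<lambda>s. \<bar>\<tau>' s\<bar> * g (\<tau> s))"
    using a2 m unfolding set_integrable_def by (simp add: integrable_completion)
  have "(\<integral>\<^sup>+ x. ennreal (indicator (\<tau> ` D) x *\<^sub>R g x) \<partial>lborel) = ennreal (LINT x:\<tau> ` D|lborel. g x)"
    unfolding set_lebesgue_integral_def using g
    by (intro nn_integral_eq_integral) (auto simp: set_integrable_def indicator_def)
  also have "(LINT x:\<tau> ` D|lborel. g x) = (LINT s:D|lborel. \<bar>\<tau>' s\<bar> * g (\<tau> s))"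
    using set_borel_integral_eq_integral(2)[OF g(1)] set_borel_integral_eq_integral(2)[OF i2] e by simp
  also have "ennreal \<dots> = (\<integral>\<^sup>+ s. ennreal (indicator D s *\<^sub>R (\<bar>\<tau>' s\<bar> * g (\<tau> s))) \<partial>lborel)"
    unfolding set_lebesgue_integral_def using i2 g(2)
    by (intro nn_integral_eq_integral[symmetric]) (auto simp: set_integrable_def indicator_def)
  finally show ?thesis .
qed

text \<open>The cover may overlap; in the induction each new member contributes only its part
  outside the previous ones.\<close>

lemma measure_eqI_finite_cover:
  assumes sets: "sets M = sets N" and C: "finite C" "\<Union>C = space M" "C \<subseteq> sets M"
    and eq: "\<And>B D. D \<in> C \<Longrightarrow> B \<in> sets M \<Longrightarrow> B \<subseteq> D \<Longrightarrow> emeasure M B = emeasure N B"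
  shows "M = N"
proof (rule measure_eqI[OF sets])
  fix A assume A: "A \<in> sets M"
  have "emeasure M (A \<inter> \<Union>F) = emeasure N (A \<inter> \<Union>F)" if "finite F" "F \<subseteq> C" for F
    using that
  proof (induction F rule: finite_induct)
    case (insert D F)
    have F: "\<Union>F \<in> sets M" using insert C by (intro sets.finite_Union) auto
    have D: "D \<in> sets M" "D \<in> C" using insert C by auto
    have s: "A \<inter> \<Union>F \<in> sets M" "A \<inter> D - \<Union>F \<in> sets M" using A F D by auto
    have u: "A \<inter> \<Union>(insert D F) = (A \<inter> \<Union>F) \<union> (A \<inter> D - \<Union>F)" by auto
    have "emeasure M (A \<inter> \<Union>(insert D F)) = emeasure M (A \<inter> \<Union>F) + emeasure M (A \<inter> D - \<Union>F)"
      unfolding u using s by (intro plus_emeasure[symmetric]) auto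
    also have "\<dots> = emeasure N (A \<inter> \<Union>F) + emeasure N (A \<inter> D - \<Union>F)"
      using insert eq[OF D(2) s(2)] by auto
    also have "\<dots> = emeasure N (A \<inter> \<Union>(insert D F))"
      unfolding u using s sets by (intro plus_emeasure) auto
    finally show ?case .
  qed simp
  from this[OF C(1) subset_refl] show "emeasure M A = emeasure N A"
    using sets.sets_into_space[OF A] C(2) by (simp add: Int_absorb2)
qed

section \<open>The section as a finite union of regular arcs\<close>

locale surface_section = section_partition +
  fixes S :: "(real^3) set" and \<gamma> :: "real^3 \<Rightarrow> real^3" and \<sigma> :: "real^3 \<Rightarrow> complex"
  assumes hom: "homeomorphism \<Omega> S X \<sigma>"
    and tangent: "\<And>p. p \<in> S \<Longrightarrow> tangent_space S p = {v. \<gamma> p \<bullet> v = 0}"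
    and \<gamma>_X: "\<And>w. w \<in> \<Omega> \<Longrightarrow> \<gamma> (X w) = N w"
    and cont_\<gamma>: "continuous_on S \<gamma>"
    and section_ne: "slab t0 t0 \<noteq> {}"
begin

lemma homD: "w \<in> \<Omega> \<Longrightarrow> X w \<in> S" "w \<in> \<Omega> \<Longrightarrow> \<sigma> (X w) = w" "p \<in> S \<Longrightarrow> \<sigma> p \<in> \<Omega>" "p \<in> S \<Longrightarrow> X (\<sigma> p) = p"
    "continuous_on \<Omega> X" "continuous_on S \<sigma>"
proof -
  show "w \<in> \<Omega> \<Longrightarrow> X w \<in> S" using homeomorphism_image1[OF hom] by blast
  show "w \<in> \<Omega> \<Longrightarrow> \<sigma> (X w) = w" by (rule homeomorphism_apply1[OF hom])
  show "p \<in> S \<Longrightarrow> \<sigma> p \<in> \<Omega>" using homeomorphism_image2[OF hom] by blast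
  show "p \<in> S \<Longrightarrow> X (\<sigma> p) = p" by (rule homeomorphism_apply2[OF hom])
  show "continuous_on \<Omega> X" "continuous_on S \<sigma>"
    using homeomorphism_cont1[OF hom] homeomorphism_cont2[OF hom] .
qed

definition \<Sigma> :: "(real^3) set" where "\<Sigma> = cross_section S t0"

lemma \<Sigma>: "p \<in> \<Sigma> \<longleftrightarrow> p \<in> S \<and> \<sigma> p \<in> slab t0 t0" "\<Sigma> \<subseteq> S" "w \<in> slab t0 t0 \<Longrightarrow> X w \<in> \<Sigma>" "compact \<Sigma>"
proof -
  have 1: "p \<in> \<Sigma> \<longleftrightarrow> p \<in> S \<and> \<sigma> p \<in> slab t0 t0" for p
    using homD(3)[of p] homD(4)[of p]
    by (auto simp: \<Sigma>_def cross_section_def height_plane_def slab_def u_def)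
  then show "p \<in> \<Sigma> \<longleftrightarrow> p \<in> S \<and> \<sigma> p \<in> slab t0 t0" .
  show "\<Sigma> \<subseteq> S" using 1 by blast
  have 2: "X w \<in> \<Sigma>" if "w \<in> slab t0 t0" for w
  proof -
    have "w \<in> \<Omega>" using that slab(2) by blast
    then show ?thesis using homD(1,2) that by (simp add: 1)
  qed
  then show "w \<in> slab t0 t0 \<Longrightarrow> X w \<in> \<Sigma>" .
  have "\<Sigma> = X ` slab t0 t0"
  proof
    show "\<Sigma> \<subseteq> X ` slab t0 t0"
    proof
      fix p assume "p \<in> \<Sigma>"
      then show "p \<in> X ` slab t0 t0" using homD(4)[of p] 1[of p] by (metis imageI)
    qed
  qed (use 2 in blast)
  moreover have "compact (X ` slab t0 t0)"
    by (rule compact_continuous_image[OF continuous_on_subset[OF homD(5) slab(2)] slab(1)[OF t0 t0]])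
  ultimately show "compact \<Sigma>" by simp
qed

lemma \<Sigma>_cover: "p \<in> \<Sigma> \<Longrightarrow> \<sigma> p \<in> \<Union>\<C>"
proof -
  assume "p \<in> \<Sigma>"
  then have "\<sigma> p \<in> slab t0 t0" using \<Sigma>(1) by blast
  then have "\<sigma> p \<in> slab (t0 - \<eta>) (t0 + \<eta>)" using \<eta>(1) by (auto simp: slab_def)
  then show ?thesis using \<eta>(4) by blast
qed

abbreviation "J U \<equiv> {- \<delta> U<..<\<delta> U}"

definition arc :: "complex set \<Rightarrow> real \<Rightarrow> real^3" where "arc U s = X (\<kappa> U (Complex t0 s))"

text \<open>The derivative of the surface across the levels. Its rotation \<open>T'\<close> by the
  normal turns out to be the velocity of \<open>arc\<close>; that both have the same length links
  the conormal with arc length.\<close>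

definition T :: "complex set \<Rightarrow> real \<Rightarrow> real^3" where "T U s = (\<chi> j. velocity j U (Complex t0 s))"

definition T' :: "complex set \<Rightarrow> real \<Rightarrow> real^3" where "T' U s = N (\<kappa> U (Complex t0 s)) \<times> T U s"

lemma J_Q: "U \<in> \<C> \<Longrightarrow> s \<in> J U \<Longrightarrow> Complex t0 s \<in> Q U"
  using boxD(1)[of U] by (auto simp: square_def)

text \<open>With \<open>d\<close> the derivative of \<kappa>, the two vectors are the images of d
  and i d under the differential of \<open>X\<close>. Since f_3 d = 1, the first rises at unit rate
  and the second is horizontal.\<close>

lemma T_eq:
  assumes U: "U \<in> \<C>" and s: "s \<in> J U"
  defines "w \<equiv> \<kappa> U (Complex t0 s)" and "d \<equiv> deriv (\<kappa> U) (Complex t0 s)"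
  shows "T U s = Re d *\<^sub>R E w + Im d *\<^sub>R (N w \<times> E w)" "T' U s = Re d *\<^sub>R (N w \<times> E w) - Im d *\<^sub>R E w"
    "N w \<bullet> T U s = 0" "T U s $ 3 = 1" "T' U s $ 3 = 0" "norm (T' U s) = norm (T U s)" "T U s \<noteq> 0"
proof -
  have zV: "Complex t0 s \<in> V U" using J_Q[OF U s] boxD(4)[OF U] by blast
  have wO: "w \<in> \<Omega>" unfolding w_def by (rule boxD(7)[OF U zV])
  have f3: "f 3 w \<noteq> 0" unfolding w_def by (rule f3_ne[OF U zV])
  have d: "d = 1 / f 3 w" using boxD(9)[OF U zV] f3 by (simp add: d_def w_def field_simps)
  have vel: "velocity j U (Complex t0 s) = Re (f j w * d)" for j
    by (simp add: velocity_def w_def[symmetric] d del: Re_f Im_f)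
  show T: "T U s = Re d *\<^sub>R E w + Im d *\<^sub>R (N w \<times> E w)"
    by (simp add: vec_eq_iff T_def vel algebra_simps)
  note o = cross3_orthogonal_frame[OF norm_N[OF wO] N_orth[OF wO]]
  show T': "T' U s = Re d *\<^sub>R (N w \<times> E w) - Im d *\<^sub>R E w"
    unfolding T'_def w_def[symmetric] T by (simp add: cross_add_right cross_mult_right o(2))
  show NT: "N w \<bullet> T U s = 0" unfolding T using N_orth[OF wO] by (simp add: inner_add_right dot_cross_self)
  have dd: "f 3 w * d = 1" using f3 by (simp add: d)
  have "T U s $ 3 = Re (f 3 w * d)" by (simp add: T_def vel)
  then show T3: "T U s $ 3 = 1" unfolding dd by simp
  have "T' U s $ 3 = - Im (f 3 w * d)" unfolding T' by (simp add: algebra_simps)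
  then show "T' U s $ 3 = 0" unfolding dd by simp
  show "norm (T' U s) = norm (T U s)"
    unfolding T'_def w_def[symmetric] by (rule cross3_orthogonal_frame(3)[OF norm_N[OF wO] NT])
  show "T U s \<noteq> 0" using T3 by auto
qed

lemma arc_deriv:
  assumes U: "U \<in> \<C>" and s: "s \<in> J U"
  shows "(arc U has_vector_derivative T' U s) (at s)"
proof -
  have zV: "Complex t0 s \<in> V U" using J_Q[OF U s] boxD(4)[OF U] by blast
  have "((\<lambda>s. Complex t0 s) has_derivative (\<lambda>h. \<i> * of_real h)) (at s)"
    unfolding Complex_eq by (auto intro!: derivative_eq_intros)
  from has_derivative_compose[OF this holomorphic_derivI[OF boxD(5,2)[OF U] zV, unfolded has_field_derivative_def]]
  have "((\<lambda>s. \<kappa> U (Complex t0 s)) has_derivative (\<lambda>h. deriv (\<kappa> U) (Complex t0 s) * (\<i> * of_real h))) (at s)" .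
  from has_derivative_compose[OF this dX[OF boxD(7)[OF U zV]]]
  show ?thesis
    unfolding has_vector_derivative_def arc_def[abs_def]
    by (rule has_derivative_eq_rhs) (simp add: T_eq(2)[OF U s] fun_eq_iff algebra_simps)
qed

lemma arc_facts:
  assumes U: "U \<in> \<C>"
  shows "s \<in> J U \<Longrightarrow> arc U s \<in> \<Sigma>" "s \<in> J U \<Longrightarrow> \<sigma> (arc U s) = \<kappa> U (Complex t0 s)" "s \<in> J U \<Longrightarrow> \<sigma> (arc U s) \<in> U"
    "inj_on (arc U) (J U)" "continuous_on (J U) (arc U)" "continuous_on (J U) (T U)" "continuous_on (J U) (T' U)"
    "continuous_on (J U) (\<lambda>s. \<rho> U (\<kappa> U (Complex t0 s)))"
proof -
  have zV: "Complex t0 s \<in> V U" if "s \<in> J U" for s using J_Q[OF U that] boxD(4)[OF U] by blast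
  have wO: "\<kappa> U (Complex t0 s) \<in> \<Omega>" if "s \<in> J U" for s by (rule boxD(7)[OF U zV[OF that]])
  show \<sigma>: "s \<in> J U \<Longrightarrow> \<sigma> (arc U s) = \<kappa> U (Complex t0 s)" for s unfolding arc_def by (rule homD(2)[OF wO])
  have "\<kappa> U (Complex t0 s) \<in> slab t0 t0" if "s \<in> J U" for s
    using wO[OF that] boxD(8)[OF U zV[OF that]] by (simp add: slab_def)
  then show "s \<in> J U \<Longrightarrow> arc U s \<in> \<Sigma>" unfolding arc_def by (rule \<Sigma>(3))
  show "s \<in> J U \<Longrightarrow> \<sigma> (arc U s) \<in> U" using \<sigma>[of s] boxD(11)[OF U J_Q[OF U]] by simp
  show "inj_on (arc U) (J U)"
  proof (rule inj_onI)
    fix s s' assume ss: "s \<in> J U" "s' \<in> J U" "arc U s = arc U s'"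
    then have "\<kappa> U (Complex t0 s) = \<kappa> U (Complex t0 s')" using \<sigma> by metis
    then have "Complex t0 s = Complex t0 s'" using boxD(6)[OF U] zV ss(1,2) by (auto dest: inj_onD)
    then show "s = s'" by simp
  qed
  show "continuous_on (J U) (arc U)"
    using arc_deriv[OF U] by (intro continuous_at_imp_continuous_on ballI) (rule has_vector_derivative_continuous)
  have cC: "continuous_on (J U) (\<lambda>s. Complex t0 s)" unfolding Complex_eq by (intro continuous_intros)
  have "continuous_on (J U) (\<lambda>s. velocity j U (Complex t0 s))" for j
    by (rule continuous_on_compose2[OF cont_velocity[OF U] cC]) (use zV in auto)
  then show cT: "continuous_on (J U) (T U)" unfolding T_def by (intro continuous_intros)
  have "continuous_on (J U) (\<lambda>s. N (\<kappa> U (Complex t0 s)))"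
    by (rule continuous_on_compose2[OF cont_N continuous_on_compose2[OF cont_\<kappa>[OF U] cC]]) (use zV wO in auto)
  then show "continuous_on (J U) (T' U)" unfolding T'_def using cT by (rule continuous_on_cross)
  show "continuous_on (J U) (\<lambda>s. \<rho> U (\<kappa> U (Complex t0 s)))"
    by (rule continuous_on_compose2[OF cont_\<rho>_\<kappa>[OF U] cC]) (use J_Q[OF U] in auto)
qed

lemma regular_arc_arc:
  assumes U: "U \<in> \<C>"
  shows "regular_arc (arc U) (- \<delta> U) (\<delta> U)" "s \<in> J U \<Longrightarrow> vector_derivative (arc U) (at s) = T' U s"
proof -
  have vd: "vector_derivative (arc U) (at s) = T' U s" if "s \<in> J U" for s
    using arc_deriv[OF U that] by (rule vector_derivative_at)
  then show "s \<in> J U \<Longrightarrow> vector_derivative (arc U) (at s) = T' U s" .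
  have "T' U s \<noteq> 0" if "s \<in> J U" for s using T_eq(6,7)[OF U that] by auto
  then show "regular_arc (arc U) (- \<delta> U) (\<delta> U)"
    unfolding regular_arc_def C1_differentiable_on_def
    using arc_deriv[OF U] arc_facts(4,7)[OF U] vd by metis
qed

text \<open>The inverse of \<open>arc\<close> on the part of the section inside a box, obtained as
  the imaginary part of the flow-box coordinate.\<close>

definition par :: "complex set \<Rightarrow> real^3 \<Rightarrow> real" where
  "par U p = Im (the_inv_into (V U) (\<kappa> U) (\<sigma> p))"

lemma par:
  assumes U: "U \<in> \<C>"
  shows "p \<in> \<Sigma> \<Longrightarrow> \<sigma> p \<in> U \<Longrightarrow> par U p \<in> J U" "p \<in> \<Sigma> \<Longrightarrow> \<sigma> p \<in> U \<Longrightarrow> arc U (par U p) = p"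
    "s \<in> J U \<Longrightarrow> par U (arc U s) = s" "continuous_on {p \<in> \<Sigma>. \<sigma> p \<in> U} (par U)"
proof -
  let ?k = "the_inv_into (V U) (\<kappa> U)"
  have kk: "?k (\<kappa> U z) = z" if "z \<in> V U" for z using boxD(6)[OF U] that by (rule the_inv_into_f_f)
  have 1: "?k (\<sigma> p) = Complex t0 (par U p) \<and> par U p \<in> J U \<and> arc U (par U p) = p" if p: "p \<in> \<Sigma>" "\<sigma> p \<in> U" for p
  proof -
    obtain z where z: "z \<in> Q U" "\<sigma> p = \<kappa> U z" using p(2) U_eq[OF U] by blast
    then have zV: "z \<in> V U" using boxD(4)[OF U] by blast
    have "Re z = t0" using boxD(8)[OF U zV] p(1) z(2) \<Sigma>(1)[of p] by (simp add: slab_def)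
    moreover have "par U p = Im z" unfolding par_def z(2) kk[OF zV] ..
    ultimately have zz: "z = Complex t0 (par U p)" by (simp add: complex_eq_iff)
    have "arc U (par U p) = p" using homD(4)[of p] p(1) \<Sigma>(2) unfolding arc_def zz[symmetric] z(2)[symmetric] by blast
    moreover have "par U p \<in> J U" using z(1) \<open>par U p = Im z\<close> by (auto simp: square_def)
    ultimately show ?thesis using kk[OF zV] z(2) zz by simp
  qed
  show "p \<in> \<Sigma> \<Longrightarrow> \<sigma> p \<in> U \<Longrightarrow> par U p \<in> J U" "p \<in> \<Sigma> \<Longrightarrow> \<sigma> p \<in> U \<Longrightarrow> arc U (par U p) = p" using 1 by blast+
  have zV: "Complex t0 s \<in> V U" if "s \<in> J U" for s using J_Q[OF U that] boxD(4)[OF U] by blast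
  show "par U (arc U s) = s" if "s \<in> J U" for s
    unfolding par_def arc_facts(2)[OF U that] kk[OF zV[OF that]] by simp
  have ck: "continuous_on (\<kappa> U ` V U) ?k"
  proof -
    obtain g where g: "g holomorphic_on \<kappa> U ` V U" "\<And>z. z \<in> V U \<Longrightarrow> g (\<kappa> U z) = z"
      by (rule holomorphic_has_inverse[OF boxD(5,2,6)[OF U]]) blast
    have "continuous_on (\<kappa> U ` V U) g" using g(1) by (rule holomorphic_on_imp_continuous_on)
    then show ?thesis by (rule continuous_on_eq) (use g(2) kk in auto)
  qed
  have "continuous_on {p \<in> \<Sigma>. \<sigma> p \<in> U} \<sigma>" by (rule continuous_on_subset[OF homD(6)]) (use \<Sigma>(2) in blast)
  moreover have "\<sigma> ` {p \<in> \<Sigma>. \<sigma> p \<in> U} \<subseteq> \<kappa> U ` V U" using U_eq[OF U] boxD(4)[OF U] by blast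
  ultimately have "continuous_on {p \<in> \<Sigma>. \<sigma> p \<in> U} (\<lambda>p. ?k (\<sigma> p))" by (rule continuous_on_compose2[OF ck])
  then show "continuous_on {p \<in> \<Sigma>. \<sigma> p \<in> U} (par U)" unfolding par_def by (intro continuous_intros)
qed

end

context surface_section
begin

definition inside :: "(real \<Rightarrow> real^3) \<Rightarrow> real \<Rightarrow> real \<Rightarrow> complex set \<Rightarrow> real set" where
  "inside c a b U = {s \<in> {a<..<b}. \<sigma> (c s) \<in> U}"

context
  fixes c :: "real \<Rightarrow> real^3" and a b :: real
  assumes reg: "regular_arc c a b" and c\<Sigma>: "c ` {a<..<b} \<subseteq> \<Sigma>"
begin

lemma regular_arc_deriv:
  "s \<in> {a<..<b} \<Longrightarrow> (c has_vector_derivative vector_derivative c (at s)) (at s)"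
  "continuous_on {a<..<b} (\<lambda>s. vector_derivative c (at s))" "continuous_on {a<..<b} c" "inj_on c {a<..<b}"
proof -
  obtain D where D: "\<And>x. x \<in> {a<..<b} \<Longrightarrow> (c has_vector_derivative D x) (at x)" "continuous_on {a<..<b} D"
    using reg unfolding regular_arc_def C1_differentiable_on_def by blast
  have vd: "vector_derivative c (at x) = D x" if "x \<in> {a<..<b}" for x using D(1)[OF that] by (rule vector_derivative_at)
  show "s \<in> {a<..<b} \<Longrightarrow> (c has_vector_derivative vector_derivative c (at s)) (at s)" using D(1)[of s] vd[of s] by simp
  show "continuous_on {a<..<b} (\<lambda>s. vector_derivative c (at s))"
    using D(2) by (rule continuous_on_eq) (simp add: vd)
  show "continuous_on {a<..<b} c"
    using D(1) by (intro continuous_at_imp_continuous_on ballI) (rule has_vector_derivative_continuous)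
  show "inj_on c {a<..<b}" using reg by (simp add: regular_arc_def)
qed

lemma cont_\<sigma>_c: "continuous_on {a<..<b} (\<lambda>s. \<sigma> (c s))"
  by (rule continuous_on_compose2[OF homD(6) regular_arc_deriv(3)]) (use c\<Sigma> \<Sigma>(2) in blast)

lemma inside:
  assumes U: "U \<in> \<C>"
  shows "open (inside c a b U)" "inside c a b U \<subseteq> {a<..<b}" "s \<in> inside c a b U \<Longrightarrow> par U (c s) \<in> J U"
    "s \<in> inside c a b U \<Longrightarrow> arc U (par U (c s)) = c s" "inj_on (\<lambda>s. par U (c s)) (inside c a b U)"
    "continuous_on (inside c a b U) (\<lambda>s. par U (c s))"
proof -
  have "inside c a b U = {a<..<b} \<inter> (\<lambda>s. \<sigma> (c s)) -` U" by (auto simp: inside_def)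
  then show "open (inside c a b U)" using continuous_open_preimage[OF cont_\<sigma>_c _ open_U[OF U]] by simp
  show sub: "inside c a b U \<subseteq> {a<..<b}" by (auto simp: inside_def)
  have c: "c s \<in> \<Sigma>" "\<sigma> (c s) \<in> U" if "s \<in> inside c a b U" for s using that c\<Sigma> by (auto simp: inside_def)
  show "s \<in> inside c a b U \<Longrightarrow> par U (c s) \<in> J U" using par(1)[OF U c] by blast
  show arc: "s \<in> inside c a b U \<Longrightarrow> arc U (par U (c s)) = c s" for s using par(2)[OF U c] by blast
  show "inj_on (\<lambda>s. par U (c s)) (inside c a b U)"
  proof (rule inj_onI)
    fix s s' assume ss: "s \<in> inside c a b U" "s' \<in> inside c a b U" "par U (c s) = par U (c s')"
    have "c s = arc U (par U (c s))" by (rule arc[OF ss(1), symmetric])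
    also have "\<dots> = arc U (par U (c s'))" by (simp only: ss(3))
    also have "\<dots> = c s'" by (rule arc[OF ss(2)])
    finally show "s = s'" using regular_arc_deriv(4) ss(1,2) sub by (auto dest: inj_onD)
  qed
  show "continuous_on (inside c a b U) (\<lambda>s. par U (c s))"
    by (rule continuous_on_compose2[OF par(4)[OF U] continuous_on_subset[OF regular_arc_deriv(3) sub]]) (use c in auto)
qed

text \<open>The parameter change from an arbitrary regular arc to \<open>arc\<close> is continuous;
  it becomes differentiable by comparison in a component where the velocity of \<open>arc\<close> is
  not zero. The chain rule then gives the relation of the speeds.\<close>

lemma par_c_deriv:
  assumes U: "U \<in> \<C>" and s: "s \<in> inside c a b U"
  shows "\<exists>\<tau>'. ((\<lambda>s. par U (c s)) has_real_derivative \<tau>') (at s) \<and> \<bar>\<tau>'\<bar> * norm (T U (par U (c s))) = norm (vector_derivative c (at s))"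
proof -
  let ?\<tau> = "\<lambda>s. par U (c s)"
  let ?c' = "vector_derivative c (at s)"
  note i = inside[OF U]
  have J: "?\<tau> s \<in> J U" by (rule i(3)[OF s])
  have "T' U (?\<tau> s) \<noteq> 0" using T_eq(6,7)[OF U J] by auto
  then obtain k where k: "T' U (?\<tau> s) $ k \<noteq> 0" by (auto simp: vec_eq_iff)
  have cs: "(c has_vector_derivative ?c') (at s)" using regular_arc_deriv(1) s i(2) by blast
  have comp: "((\<lambda>x. g x $ k) has_real_derivative g' $ k) (at x)" if "(g has_vector_derivative g') (at x)"
    for g :: "real \<Rightarrow> real^3" and g' x
    using bounded_linear.has_vector_derivative[OF bounded_linear_vec_nth that]
    by (simp add: has_real_derivative_iff_has_vector_derivative)
  have "isCont ?\<tau> s" using i(6) i(1) s by (simp add: continuous_on_eq_continuous_at)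
  then have d: "(?\<tau> has_real_derivative ?c' $ k / T' U (?\<tau> s) $ k) (at s)"
    by (rule DERIV_of_composition[where p="\<lambda>x. c x $ k" and q="\<lambda>x. arc U x $ k" and \<tau>="?\<tau>", OF _ comp[OF cs] comp[OF arc_deriv[OF U J]] k i(1) s])
      (simp add: i(4))
  let ?t = "?c' $ k / T' U (?\<tau> s) $ k"
  have "(?\<tau> has_vector_derivative ?t) (at s)"
    using d by (simp add: has_real_derivative_iff_has_vector_derivative)
  from vector_diff_chain_at[OF this arc_deriv[OF U J]]
  have "(arc U \<circ> ?\<tau> has_vector_derivative ?t *\<^sub>R T' U (?\<tau> s)) (at s)" .
  then have "(c has_vector_derivative ?t *\<^sub>R T' U (?\<tau> s)) (at s)"
    by (rule has_vector_derivative_transform_within_open[OF _ i(1) s]) (simp add: i(4))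
  then have "?c' = ?t *\<^sub>R T' U (?\<tau> s)" by (rule vector_derivative_at)
  then have "norm ?c' = norm (?t *\<^sub>R T' U (?\<tau> s))" by (rule arg_cong)
  then have "norm ?c' = \<bar>?t\<bar> * norm (T' U (?\<tau> s))" unfolding norm_scaleR .
  then show ?thesis using d T_eq(6)[OF U J] by (intro exI[of _ ?t]) simp
qed

lemma openin_arc_image:
  assumes U: "U \<in> \<C>" and W: "open W" "W \<subseteq> J U"
  shows "openin (top_of_set \<Sigma>) (arc U ` W)"
proof -
  have eq: "arc U ` W = {p \<in> \<Sigma>. \<sigma> p \<in> U} \<inter> par U -` W"
  proof
    show "arc U ` W \<subseteq> {p \<in> \<Sigma>. \<sigma> p \<in> U} \<inter> par U -` W"
    proof
      fix p assume "p \<in> arc U ` W"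
      then obtain s where s: "s \<in> W" "p = arc U s" by auto
      then have "s \<in> J U" using W by blast
      then show "p \<in> {p \<in> \<Sigma>. \<sigma> p \<in> U} \<inter> par U -` W"
        using s arc_facts(1,3)[OF U] par(3)[OF U] by simp
    qed
    show "{p \<in> \<Sigma>. \<sigma> p \<in> U} \<inter> par U -` W \<subseteq> arc U ` W"
    proof
      fix p assume p: "p \<in> {p \<in> \<Sigma>. \<sigma> p \<in> U} \<inter> par U -` W"
      then have "arc U (par U p) = p" using par(2)[OF U] by blast
      moreover have "par U p \<in> W" using p by blast
      ultimately show "p \<in> arc U ` W" using imageI[of "par U p" W "arc U"] by simp
    qed
  qed
  have "{p \<in> \<Sigma>. \<sigma> p \<in> U} = \<Sigma> \<inter> \<sigma> -` U" by auto
  moreover have "openin (top_of_set \<Sigma>) (\<Sigma> \<inter> \<sigma> -` U)"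
    by (rule continuous_openin_preimage_gen[OF continuous_on_subset[OF homD(6) \<Sigma>(2)] open_U[OF U]])
  ultimately have 1: "openin (top_of_set \<Sigma>) {p \<in> \<Sigma>. \<sigma> p \<in> U}" by simp
  have "openin (top_of_set {p \<in> \<Sigma>. \<sigma> p \<in> U}) (arc U ` W)"
    unfolding eq by (rule continuous_openin_preimage_gen[OF par(4)[OF U] W(1)])
  then show ?thesis using 1 by (rule openin_trans)
qed

text \<open>In each box the parameter change is a continuous injection between open subsets of the
  line, so invariance of domain shows that it is open; \<open>arc\<close> carries this to the
  section.\<close>

lemma openin_regular_arc_image:
  assumes W: "open W" "W \<subseteq> {a<..<b}"
  shows "openin (top_of_set \<Sigma>) (c ` W)"
proof -
  have eq: "c ` W = (\<Union>U\<in>\<C>. arc U ` (\<lambda>s. par U (c s)) ` (W \<inter> inside c a b U))"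
  proof
    show "c ` W \<subseteq> (\<Union>U\<in>\<C>. arc U ` (\<lambda>s. par U (c s)) ` (W \<inter> inside c a b U))"
    proof
      fix p assume "p \<in> c ` W"
      then obtain s where s: "s \<in> W" "p = c s" by auto
      then have "c s \<in> \<Sigma>" using c\<Sigma> W by blast
      then obtain U where U: "U \<in> \<C>" "\<sigma> (c s) \<in> U" using \<Sigma>_cover by blast
      then have si: "s \<in> inside c a b U" using s W by (auto simp: inside_def)
      have "p = arc U (par U (c s))" using inside(4)[OF U(1) si] s(2) by simp
      then show "p \<in> (\<Union>U\<in>\<C>. arc U ` (\<lambda>s. par U (c s)) ` (W \<inter> inside c a b U))"
        using U s si by blast
    qed
    show "(\<Union>U\<in>\<C>. arc U ` (\<lambda>s. par U (c s)) ` (W \<inter> inside c a b U)) \<subseteq> c ` W"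
    proof
      fix p assume "p \<in> (\<Union>U\<in>\<C>. arc U ` (\<lambda>s. par U (c s)) ` (W \<inter> inside c a b U))"
      then obtain U s where "U \<in> \<C>" "s \<in> W" "s \<in> inside c a b U" "p = arc U (par U (c s))" by blast
      then show "p \<in> c ` W" using inside(4)[of U s] by simp
    qed
  qed
  show ?thesis unfolding eq
  proof (rule openin_Union, clarify)
    fix U assume U: "U \<in> \<C>"
    note i = inside[OF U]
    have o: "open (W \<inter> inside c a b U)" using W(1) i(1) by (rule open_Int)
    have "open ((\<lambda>s. par U (c s)) ` (W \<inter> inside c a b U))"
      by (rule invariance_of_domain[OF continuous_on_subset[OF i(6)] o inj_on_subset[OF i(5)]]) auto
    moreover have "(\<lambda>s. par U (c s)) ` (W \<inter> inside c a b U) \<subseteq> J U" using i(3) by blast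
    ultimately show "openin (top_of_set \<Sigma>) (arc U ` (\<lambda>s. par U (c s)) ` (W \<inter> inside c a b U))"
      by (rule openin_arc_image[OF U])
  qed
qed

lemma \<Sigma>_borel: "\<Sigma> \<in> sets borel" using \<Sigma>(4) by (rule borel_compact)

text \<open>The arc is an open map onto its image, so its inverse is continuous there, and the image
  of a Borel set is a preimage under that inverse.\<close>

lemma regular_arc_image_borel:
  assumes A: "A \<in> sets borel" "A \<subseteq> {a<..<b}"
  shows "c ` A \<in> sets (restrict_space borel \<Sigma>)"
proof -
  let ?T = "c ` {a<..<b}"
  define g where "g = the_inv_into {a<..<b} c"
  have g: "g (c s) = s" if "s \<in> {a<..<b}" for s
    unfolding g_def using regular_arc_deriv(4) that by (rule the_inv_into_f_f)
  have oT: "openin (top_of_set \<Sigma>) ?T" by (rule openin_regular_arc_image) auto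
  have "continuous_on ?T g"
  proof (rule continuous_on_inverse_open_map[OF regular_arc_deriv(3) refl g])
    fix W assume "openin (top_of_set {a<..<b}) W"
    then have "open W" "W \<subseteq> {a<..<b}" using openin_open_eq[of "{a<..<b}"] by auto
    then have "openin (top_of_set \<Sigma>) (c ` W)" by (rule openin_regular_arc_image)
    then show "openin (top_of_set ?T) (c ` W)"
      by (rule openin_subset_trans[OF _ _ c\<Sigma>]) (use \<open>W \<subseteq> {a<..<b}\<close> in blast)
  qed
  then have gm: "g \<in> borel_measurable (restrict_space borel ?T)" by (rule borel_measurable_continuous_on_restrict)
  obtain O' where "open O'" "?T = \<Sigma> \<inter> O'" using oT openin_open by blast
  then have Tb: "?T \<in> sets borel" using \<Sigma>_borel by (simp add: borel_open)
  have "g -` A \<inter> space (restrict_space borel ?T) \<in> sets (restrict_space borel ?T)"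
    using gm A(1) by (rule measurable_sets)
  moreover have "g -` A \<inter> space (restrict_space borel ?T) = c ` A"
  proof
    show "g -` A \<inter> space (restrict_space borel ?T) \<subseteq> c ` A" using g by (auto simp: space_restrict_space)
    show "c ` A \<subseteq> g -` A \<inter> space (restrict_space borel ?T)" using g A(2) by (auto simp: space_restrict_space subset_iff)
  qed
  ultimately have "c ` A \<in> sets borel" using Tb by (simp add: sets_restrict_space_iff)
  then show ?thesis using \<Sigma>_borel A(2) c\<Sigma> by (auto simp: sets_restrict_space_iff)
qed

end

definition base_point :: "real^3" where "base_point = (SOME p. p \<in> \<Sigma>)"

text \<open>Extends the arcs to all parameters with values in the section; the default point
  receives no mass because \<open>speed\<close> vanishes off the parameter interval.\<close>

definition arcm :: "complex set \<times> real \<Rightarrow> real^3" where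
  "arcm = (\<lambda>(U, s). if s \<in> J U then arc U s else base_point)"

definition speed :: "complex set \<Rightarrow> real \<Rightarrow> real" where
  "speed U s = indicator (J U) s *\<^sub>R (\<rho> U (\<kappa> U (Complex t0 s)) * norm (T U s))"

definition pieces :: "(complex set \<times> real) measure" where
  "pieces = count_space \<C> \<Otimes>\<^sub>M lborel"

text \<open>Arc length by explicit construction: the line elements of all the arcs, weighted by the
  partition of unity so that overlaps count once, pushed forward to the section.\<close>

definition section_measure :: "(real^3) measure" where
  "section_measure = distr (density pieces (\<lambda>(U, s). ennreal (speed U s))) (restrict_space borel \<Sigma>) arcm"

lemma base_point: "base_point \<in> \<Sigma>"
proof -
  obtain w where "w \<in> slab t0 t0" using section_ne by blast
  then have "X w \<in> \<Sigma>" by (rule \<Sigma>(3))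
  then show ?thesis unfolding base_point_def by (rule someI)
qed

lemma arcm_in: "U \<in> \<C> \<Longrightarrow> arcm (U, s) \<in> \<Sigma>"
  using arc_facts(1)[of U s] base_point by (auto simp: arcm_def)

lemma measurable_arcm_U:
  assumes U: "U \<in> \<C>"
  shows "(\<lambda>s. arcm (U, s)) \<in> measurable lborel (restrict_space borel \<Sigma>)"
proof (rule measurable_restrict_space2)
  have "(\<lambda>s. if s \<in> J U then arc U s else base_point) \<in> borel_measurable borel"
    by (rule borel_measurable_continuous_on_if) (auto intro: arc_facts(5)[OF U])
  then show "(\<lambda>s. arcm (U, s)) \<in> borel_measurable lborel" by (simp add: arcm_def)
qed (use arcm_in[OF U] in auto)

lemma measurable_arcm: "arcm \<in> measurable pieces (restrict_space borel \<Sigma>)"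
  unfolding pieces_def
  by (rule measurable_pair_measure_countable1[OF countable_finite[OF finite_\<C>] measurable_arcm_U])

lemma cont_speed: "U \<in> \<C> \<Longrightarrow> continuous_on (J U) (\<lambda>s. \<rho> U (\<kappa> U (Complex t0 s)) * norm (T U s))"
  by (intro continuous_intros arc_facts)

lemma measurable_speed_U: "U \<in> \<C> \<Longrightarrow> speed U \<in> borel_measurable lborel"
  unfolding speed_def[abs_def]
  using borel_measurable_continuous_on_indicator[OF _ cont_speed, of U] by simp

lemma measurable_speed: "(\<lambda>(U, s). ennreal (speed U s)) \<in> borel_measurable pieces"
  unfolding pieces_def
  by (rule measurable_pair_measure_countable1[OF countable_finite[OF finite_\<C>]]) (simp only: prod.case, rule measurable_compose[OF measurable_speed_U measurable_ennreal])

lemma speed_nonneg: "U \<in> \<C> \<Longrightarrow> 0 \<le> speed U s"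
  using \<rho>_\<kappa>_bounds[OF _ J_Q, of U s] by (auto simp: speed_def indicator_def)

lemma T_bounded:
  assumes U: "U \<in> \<C>"
  obtains M where "M \<ge> 0" "\<And>s. s \<in> J U \<Longrightarrow> norm (T U s) \<le> M"
proof -
  have "\<exists>M. M \<ge> 0 \<and> (\<forall>z\<in>Q U. \<bar>velocity j U z\<bar> \<le> M)" for j
    by (rule velocity_bounded[OF U, of j]) blast
  then obtain M where M: "\<And>j. M j \<ge> 0" "\<And>j z. z \<in> Q U \<Longrightarrow> \<bar>velocity j U z\<bar> \<le> M j" by metis
  show thesis
  proof (rule that[of "\<Sum>j\<in>UNIV. M j"])
    show "(\<Sum>j\<in>UNIV. M j) \<ge> 0" by (rule sum_nonneg) (rule M(1))
    fix s assume s: "s \<in> J U"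
    have "norm (T U s) \<le> (\<Sum>j\<in>UNIV. \<bar>T U s $ j\<bar>)" by (rule norm_le_l1_cart)
    also have "\<dots> \<le> (\<Sum>j\<in>UNIV. M j)" by (rule sum_mono) (simp add: T_def M(2)[OF J_Q[OF U s]])
    finally show "norm (T U s) \<le> (\<Sum>j\<in>UNIV. M j)" .
  qed
qed

lemma speed_integrable:
  assumes U: "U \<in> \<C>"
  shows "set_integrable lborel (J U) (\<lambda>s. \<rho> U (\<kappa> U (Complex t0 s)) * norm (T U s))"
proof -
  obtain M where M: "M \<ge> 0" "\<And>s. s \<in> J U \<Longrightarrow> norm (T U s) \<le> M" using T_bounded[OF U] by blast
  show ?thesis
  proof (rule set_integrable_bounded_continuous[OF _ _ cont_speed[OF U]])
    fix s assume s: "s \<in> J U"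
    have "\<bar>\<rho> U (\<kappa> U (Complex t0 s))\<bar> * norm (T U s) \<le> 1 * M"
      using \<rho>_\<kappa>_bounds[OF U J_Q[OF U s]] M(2)[OF s] by (intro mult_mono) auto
    then show "\<bar>\<rho> U (\<kappa> U (Complex t0 s)) * norm (T U s)\<bar> \<le> M" by (simp add: abs_mult)
  qed auto
qed

lemma nn_integral_pieces:
  assumes "g \<in> borel_measurable pieces"
  shows "(\<integral>\<^sup>+ x. g x \<partial>pieces) = (\<Sum>U\<in>\<C>. \<integral>\<^sup>+ s. g (U, s) \<partial>lborel)"
proof -
  have "(\<integral>\<^sup>+ x. g x \<partial>pieces) = (\<integral>\<^sup>+ U. \<integral>\<^sup>+ s. g (U, s) \<partial>lborel \<partial>count_space \<C>)"
    using lborel.nn_integral_fst[of g "count_space \<C>"] assms by (simp add: pieces_def)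
  also have "\<dots> = (\<Sum>U\<in>\<C>. \<integral>\<^sup>+ s. g (U, s) \<partial>lborel)" by (rule nn_integral_count_space_finite[OF finite_\<C>])
  finally show ?thesis .
qed

lemma emeasure_section_measure:
  assumes B: "B \<in> sets (restrict_space borel \<Sigma>)"
  shows "emeasure section_measure B = (\<Sum>U\<in>\<C>. \<integral>\<^sup>+ s. ennreal (speed U s) * indicator B (arcm (U, s)) \<partial>lborel)"
proof -
  let ?D = "density pieces (\<lambda>(U, s). ennreal (speed U s))"
  have pre: "arcm -` B \<inter> space pieces \<in> sets pieces" using measurable_arcm B by (rule measurable_sets)
  have "emeasure section_measure B = emeasure ?D (arcm -` B \<inter> space ?D)"
    unfolding section_measure_def using measurable_arcm B by (intro emeasure_distr) (auto simp: measurable_density_eq1)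
  also have "\<dots> = (\<integral>\<^sup>+ x. (case x of (U, s) \<Rightarrow> ennreal (speed U s)) * indicator (arcm -` B \<inter> space pieces) x \<partial>pieces)"
    using measurable_speed pre by (simp add: emeasure_density)
  also have "\<dots> = (\<Sum>U\<in>\<C>. \<integral>\<^sup>+ s. ennreal (speed U s) * indicator (arcm -` B \<inter> space pieces) (U, s) \<partial>lborel)"
    using measurable_speed pre by (subst nn_integral_pieces) auto
  also have "\<dots> = (\<Sum>U\<in>\<C>. \<integral>\<^sup>+ s. ennreal (speed U s) * indicator B (arcm (U, s)) \<partial>lborel)"
    by (intro sum.cong refl nn_integral_cong) (auto simp: pieces_def space_pair_measure indicator_def)
  finally show ?thesis .
qed

text \<open>Box by box, the substitution by the parameter change turns \<rho> |T| ds into \<rho>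
  |c'| ds on the part of the arc inside the box. The weights add up to 1 along the arc.\<close>

lemma section_measure_regular_arc:
  assumes reg: "regular_arc c a b" and c\<Sigma>: "c ` {a<..<b} \<subseteq> \<Sigma>" and A: "A \<in> sets borel" "A \<subseteq> {a<..<b}"
  shows "emeasure section_measure (c ` A) = (\<integral>\<^sup>+ s. ennreal (norm (vector_derivative c (at s))) * indicator A s \<partial>lborel)"
proof -
  note B = regular_arc_image_borel[OF reg c\<Sigma> A]
  let ?c' = "\<lambda>s. norm (vector_derivative c (at s))"
  let ?g = "\<lambda>U s. indicator (inside c a b U) s * (\<rho> U (\<sigma> (c s)) * ?c' s) :: real"
  have mg: "(\<lambda>s. indicator A s * ?g U s) \<in> borel_measurable borel" if U: "U \<in> \<C>" for U
  proof -
    note i = inside[OF reg c\<Sigma> U]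
    have "continuous_on (inside c a b U) (\<lambda>s. \<rho> U (\<sigma> (c s)) * ?c' s)"
    proof (intro continuous_intros)
      show "continuous_on (inside c a b U) (\<lambda>s. \<rho> U (\<sigma> (c s)))"
        by (rule continuous_on_compose2[OF cont_\<rho>[OF U] continuous_on_subset[OF cont_\<sigma>_c[OF reg c\<Sigma>] i(2)]])
          (use U in \<open>auto simp: inside_def\<close>)
      show "continuous_on (inside c a b U) (\<lambda>s. vector_derivative c (at s))"
        by (rule continuous_on_subset[OF regular_arc_deriv(2)[OF reg c\<Sigma>] i(2)])
    qed
    from borel_measurable_continuous_on_indicator[OF _ this] i(1)
    have m: "?g U \<in> borel_measurable borel" by (simp add: borel_open)
    have "(indicator A :: real \<Rightarrow> real) \<in> borel_measurable borel" using A(1) by simp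
    then show ?thesis using m by (rule borel_measurable_times)
  qed
  have each: "(\<integral>\<^sup>+ s. ennreal (speed U s) * indicator (c ` A) (arcm (U, s)) \<partial>lborel) = (\<integral>\<^sup>+ s. ennreal (indicator A s * ?g U s) \<partial>lborel)"
    if U: "U \<in> \<C>" for U
  proof -
    note i = inside[OF reg c\<Sigma> U]
    let ?\<tau> = "\<lambda>s. par U (c s)"
    define D where "D = A \<inter> inside c a b U"
    let ?h = "\<lambda>s. \<rho> U (\<kappa> U (Complex t0 s)) * norm (T U s)"
    have "\<forall>s\<in>inside c a b U. \<exists>t. (?\<tau> has_real_derivative t) (at s) \<and> \<bar>t\<bar> * norm (T U (?\<tau> s)) = ?c' s"
      using par_c_deriv[OF reg c\<Sigma> U] by blast
    from bchoice[OF this] obtain \<tau>' where \<tau>': "\<And>s. s \<in> inside c a b U \<Longrightarrow> (?\<tau> has_real_derivative \<tau>' s) (at s) \<and> \<bar>\<tau>' s\<bar> * norm (T U (?\<tau> s)) = ?c' s"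
      by blast
    have Db: "D \<in> sets borel" using A(1) i(1) by (simp add: D_def borel_open)
    have im: "?\<tau> ` D = {s \<in> J U. arcm (U, s) \<in> c ` A}"
    proof
      show "?\<tau> ` D \<subseteq> {s \<in> J U. arcm (U, s) \<in> c ` A}"
      proof
        fix s assume "s \<in> ?\<tau> ` D"
        then obtain x where x: "x \<in> A" "x \<in> inside c a b U" "s = ?\<tau> x" by (auto simp: D_def)
        then show "s \<in> {s \<in> J U. arcm (U, s) \<in> c ` A}" using i(3)[OF x(2)] i(4)[OF x(2)] by (simp add: arcm_def)
      qed
      show "{s \<in> J U. arcm (U, s) \<in> c ` A} \<subseteq> ?\<tau> ` D"
      proof
        fix s assume "s \<in> {s \<in> J U. arcm (U, s) \<in> c ` A}"
        then obtain x where x: "s \<in> J U" "x \<in> A" "arc U s = c x" by (auto simp: arcm_def)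
        have "\<sigma> (c x) \<in> U" using arc_facts(3)[OF U x(1)] x(3) by simp
        then have "x \<in> D" using x(2) A(2) by (auto simp: D_def inside_def)
        moreover have "s = ?\<tau> x" using par(3)[OF U x(1)] x(3) by simp
        ultimately show "s \<in> ?\<tau> ` D" by blast
      qed
    qed
    have \<tau>Db: "?\<tau> ` D \<in> sets borel"
    proof -
      have "(\<lambda>s. arcm (U, s)) -` (c ` A) \<inter> space lborel \<in> sets lborel"
        using measurable_arcm_U[OF U] B by (rule measurable_sets)
      moreover have "?\<tau> ` D = J U \<inter> ((\<lambda>s. arcm (U, s)) -` (c ` A) \<inter> space lborel)" unfolding im by auto
      ultimately show ?thesis by simp
    qed
    have "\<tau>D \<subseteq> J U" if "\<tau>D = ?\<tau> ` D" for \<tau>D using im that by blast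
    then have \<tau>DJ: "?\<tau> ` D \<subseteq> J U" by blast
    have int: "set_integrable lborel (?\<tau> ` D) ?h"
      by (rule set_integrable_subset[OF speed_integrable[OF U] _ \<tau>DJ]) (use \<tau>Db in simp)
    have nn: "0 \<le> ?h x" if "x \<in> ?\<tau> ` D" for x
      using \<rho>_\<kappa>_bounds[OF U J_Q[OF U]] \<tau>DJ that by (simp add: subset_iff)
    have eq: "indicator D s *\<^sub>R (\<bar>\<tau>' s\<bar> * ?h (?\<tau> s)) = indicator A s * ?g U s" for s
    proof (cases "s \<in> inside c a b U")
      case True
      have "\<kappa> U (Complex t0 (?\<tau> s)) = \<sigma> (c s)" using arc_facts(2)[OF U i(3)[OF True]] i(4)[OF True] by simp
      then have "\<bar>\<tau>' s\<bar> * ?h (?\<tau> s) = \<rho> U (\<sigma> (c s)) * (\<bar>\<tau>' s\<bar> * norm (T U (?\<tau> s)))" by simp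
      also have "\<dots> = \<rho> U (\<sigma> (c s)) * ?c' s" using \<tau>'[OF True] by simp
      finally show ?thesis using True by (simp add: D_def indicator_def)
    next
      case False
      then show ?thesis by (simp add: D_def)
    qed
    have "(\<integral>\<^sup>+ s. ennreal (speed U s) * indicator (c ` A) (arcm (U, s)) \<partial>lborel) = (\<integral>\<^sup>+ s. ennreal (indicator (?\<tau> ` D) s *\<^sub>R ?h s) \<partial>lborel)"
      by (intro nn_integral_cong) (auto simp: im speed_def indicator_def)
    also have "\<dots> = (\<integral>\<^sup>+ s. ennreal (indicator D s *\<^sub>R (\<bar>\<tau>' s\<bar> * ?h (?\<tau> s))) \<partial>lborel)"
    proof (rule nn_integral_change_of_variables_1[OF Db \<tau>Db _ _ int nn])
      show "inj_on ?\<tau> D" by (rule inj_on_subset[OF i(5)]) (simp add: D_def)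
      show "(?\<tau> has_real_derivative \<tau>' s) (at s)" if "s \<in> D" for s using \<tau>' that by (simp add: D_def)
      show "(\<lambda>s. indicator D s *\<^sub>R (\<bar>\<tau>' s\<bar> * ?h (?\<tau> s))) \<in> borel_measurable borel"
        unfolding eq by (rule mg[OF U])
    qed
    finally show ?thesis unfolding eq .
  qed
  have "emeasure section_measure (c ` A) = (\<Sum>U\<in>\<C>. \<integral>\<^sup>+ s. ennreal (indicator A s * ?g U s) \<partial>lborel)"
    unfolding emeasure_section_measure[OF B] by (intro sum.cong refl each)
  also have "\<dots> = (\<integral>\<^sup>+ s. (\<Sum>U\<in>\<C>. ennreal (indicator A s * ?g U s)) \<partial>lborel)"
    using mg by (intro nn_integral_sum[symmetric]) simp
  also have "\<dots> = (\<integral>\<^sup>+ s. ennreal (?c' s) * indicator A s \<partial>lborel)"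
  proof (rule nn_integral_cong)
    fix s
    show "(\<Sum>U\<in>\<C>. ennreal (indicator A s * ?g U s)) = ennreal (?c' s) * indicator A s"
    proof (cases "s \<in> A")
      case True
      then have sab: "s \<in> {a<..<b}" using A(2) by blast
      then have cov: "\<sigma> (c s) \<in> \<Union>\<C>" using \<Sigma>_cover c\<Sigma> by blast
      have g: "?g U s = \<rho> U (\<sigma> (c s)) * ?c' s" if "U \<in> \<C>" for U
        using \<rho>_zero[OF that cov] sab by (auto simp: inside_def indicator_def)
      have "(\<Sum>U\<in>\<C>. ennreal (indicator A s * ?g U s)) = (\<Sum>U\<in>\<C>. ennreal (\<rho> U (\<sigma> (c s)) * ?c' s))"
      proof (rule sum.cong[OF refl])
        fix U assume "U \<in> \<C>"
        then show "ennreal (indicator A s * ?g U s) = ennreal (\<rho> U (\<sigma> (c s)) * ?c' s)"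
          using True by (simp only: g indicator_simps mult_1)
      qed
      also have "\<dots> = ennreal (\<Sum>U\<in>\<C>. \<rho> U (\<sigma> (c s)) * ?c' s)"
        using \<rho>_bounds[OF _ cov] by (intro sum_ennreal) auto
      also have "(\<Sum>U\<in>\<C>. \<rho> U (\<sigma> (c s)) * ?c' s) = ?c' s"
        unfolding sum_distrib_right[symmetric] \<rho>_sum[OF cov] by simp
      finally show ?thesis using True by simp
    qed simp
  qed
  finally show ?thesis .
qed

end

section \<open>The flow vector of the section\<close>

context surface_section
begin

text \<open>Justifies the definite description: the explicit measure has the prescribed values.
  Conversely these determine a measure, because a Borel subset of one arc is the image of a Borel
  set of parameters and finitely many arcs cover the section.\<close>

lemma arc_length_measure_eq: "arc_length_measure \<Sigma> = section_measure"
  unfolding arc_length_measure_def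
proof (rule the_equality)
  have sets: "sets section_measure = sets (restrict_space borel \<Sigma>)" by (simp add: section_measure_def)
  show "sets section_measure = sets (restrict_space borel \<Sigma>) \<and>
      (\<forall>c a b A. regular_arc c a b \<and> c ` {a<..<b} \<subseteq> \<Sigma> \<and> A \<in> sets borel \<and> A \<subseteq> {a<..<b} \<longrightarrow>
         emeasure section_measure (c ` A) =
           (\<integral>\<^sup>+ s. ennreal (norm (vector_derivative c (at s))) * indicator A s \<partial>lborel))"
    using sets section_measure_regular_arc by blast
  fix \<mu> :: "(real^3) measure"
  assume \<mu>: "sets \<mu> = sets (restrict_space borel \<Sigma>) \<and>
      (\<forall>c a b A. regular_arc c a b \<and> c ` {a<..<b} \<subseteq> \<Sigma> \<and> A \<in> sets borel \<and> A \<subseteq> {a<..<b} \<longrightarrow>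
         emeasure \<mu> (c ` A) =
           (\<integral>\<^sup>+ s. ennreal (norm (vector_derivative c (at s))) * indicator A s \<partial>lborel))"
  have sp: "space \<mu> = \<Sigma>" using \<mu> sets_eq_imp_space_eq[of \<mu> "restrict_space borel \<Sigma>"] by (simp add: space_restrict_space)
  have arcJ: "arc U ` J U \<subseteq> \<Sigma>" if "U \<in> \<C>" for U using arc_facts(1)[OF that] by blast
  show "\<mu> = section_measure"
  proof (rule measure_eqI_finite_cover[where C="(\<lambda>U. arc U ` J U) ` \<C>"])
    show "sets \<mu> = sets section_measure" using \<mu> sets by simp
    show "finite ((\<lambda>U. arc U ` J U) ` \<C>)" using finite_\<C> by simp
    show "\<Union> ((\<lambda>U. arc U ` J U) ` \<C>) = space \<mu>"
      unfolding sp
    proof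
      show "\<Sigma> \<subseteq> \<Union> ((\<lambda>U. arc U ` J U) ` \<C>)"
      proof
        fix p assume p: "p \<in> \<Sigma>"
        then obtain U where U: "U \<in> \<C>" "\<sigma> p \<in> U" using \<Sigma>_cover by blast
        have "p = arc U (par U p)" "par U p \<in> J U" using par(1,2)[OF U(1) p U(2)] by simp_all
        then show "p \<in> \<Union> ((\<lambda>U. arc U ` J U) ` \<C>)" using U(1) by blast
      qed
    qed (use arcJ in blast)
    show "(\<lambda>U. arc U ` J U) ` \<C> \<subseteq> sets \<mu>"
    proof clarify
      fix U assume U: "U \<in> \<C>"
      show "arc U ` J U \<in> sets \<mu>"
        using regular_arc_image_borel[OF regular_arc_arc(1)[OF U] arcJ[OF U], of "J U"] \<mu> by simp
    qed
    fix B D assume D: "D \<in> (\<lambda>U. arc U ` J U) ` \<C>" and B: "B \<in> sets \<mu>" "B \<subseteq> D"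
    then obtain U where U: "U \<in> \<C>" "D = arc U ` J U" by blast
    define A where "A = {s \<in> J U. arc U s \<in> B}"
    have "(\<lambda>s. arcm (U, s)) -` B \<inter> space lborel \<in> sets lborel"
      using measurable_arcm_U[OF U(1)] B(1) \<mu> by (intro measurable_sets) auto
    moreover have "A = J U \<inter> ((\<lambda>s. arcm (U, s)) -` B \<inter> space lborel)" by (auto simp: A_def arcm_def)
    ultimately have Ab: "A \<in> sets borel" by simp
    have AJ: "A \<subseteq> J U" by (auto simp: A_def)
    have "B = arc U ` A" using B(2) U(2) by (auto simp: A_def)
    then show "emeasure \<mu> B = emeasure section_measure B"
      using \<mu> section_measure_regular_arc[OF regular_arc_arc(1)[OF U(1)] arcJ[OF U(1)] Ab AJ]
        regular_arc_arc(1)[OF U(1)] arcJ[OF U(1)] Ab AJ by simp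
  qed
qed

lemma N3_less_1:
  assumes w: "w \<in> slab t0 t0"
  shows "0 < 1 - N w $ 3 * N w $ 3"
proof -
  have wO: "w \<in> \<Omega>" using w slab(2) by blast
  have "Re (f 3 w * cnj (f 3 w)) > 0"
    using regular[OF w] by (subst complex_mult_cnj) (auto simp: complex_eq_iff sum_power2_gt_zero_iff simp del: Re_f Im_f)
  then have "(E w \<bullet> E w) * (1 - N w $ 3 * N w $ 3) > 0" using Re_f_f[OF wO, of 3 3] by simp
  then show ?thesis using inner_ge_zero[of "E w"] by (simp add: zero_less_mult_iff)
qed

text \<open>The conormal is the normalized projection of \<open>e3\<close> to the tangent plane.
  This global expression is continuous on the section, which yields measurability.\<close>

lemma conormal_\<Sigma>:
  assumes p: "p \<in> \<Sigma>"
  shows "e3 - \<gamma> p $ 3 *\<^sub>R \<gamma> p \<noteq> 0" "conormal S p = sgn (e3 - \<gamma> p $ 3 *\<^sub>R \<gamma> p)"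
proof -
  have pS: "p \<in> S" and w: "\<sigma> p \<in> slab t0 t0" using p \<Sigma>(1) by blast+
  have g: "\<gamma> p = N (\<sigma> p)" using \<gamma>_X[OF homD(3)[OF pS]] homD(4)[OF pS] by simp
  let ?m = "e3 - \<gamma> p $ 3 *\<^sub>R \<gamma> p"
  have e3: "v \<bullet> e3 = v $ 3" "e3 \<bullet> v = v $ 3" for v :: "real^3" by (simp_all add: e3_def inner_axis inner_axis')
  have n1: "\<gamma> p \<bullet> \<gamma> p = 1" using norm_N[OF homD(3)[OF pS]] by (simp add: g norm_eq_1)
  have m3: "?m $ 3 = 1 - N (\<sigma> p) $ 3 * N (\<sigma> p) $ 3" by (simp add: g e3_def)
  then have m3': "?m $ 3 > 0" using N3_less_1[OF w] by simp
  show "?m \<noteq> 0"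
  proof
    assume z: "?m = 0"
    have "?m $ 3 = 0" unfolding z by simp
    with m3' show False by (simp only: less_irrefl)
  qed
  show "conormal S p = sgn ?m"
  proof (rule conormal_eq[OF tangent[OF pS] _ m3'])
    show "\<gamma> p \<bullet> ?m = 0" by (simp add: inner_diff_right e3 n1)
    show "?m \<bullet> v = 0" if "\<gamma> p \<bullet> v = 0" "v $ 3 = 0" for v :: "real^3" using that by (simp add: inner_diff_left e3)
  qed
qed

text \<open>\<open>T\<close> and its rotation span the tangent plane, and the rotation is horizontal
  while \<open>T\<close> is not. So the horizontal tangent vectors are the multiples of the
  rotation, all orthogonal to \<open>T\<close>.\<close>

lemma conormal_arc:
  assumes U: "U \<in> \<C>" and s: "s \<in> J U"
  shows "conormal S (arc U s) = sgn (T U s)"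
proof -
  let ?w = "\<kappa> U (Complex t0 s)"
  note t = T_eq[OF U s]
  have zV: "Complex t0 s \<in> V U" using J_Q[OF U s] boxD(4)[OF U] by blast
  have wO: "?w \<in> \<Omega>" by (rule boxD(7)[OF U zV])
  have pS: "arc U s \<in> S" using arc_facts(1)[OF U s] \<Sigma>(2) by blast
  have g: "\<gamma> (arc U s) = N ?w" unfolding arc_def by (rule \<gamma>_X[OF wO])
  show ?thesis
  proof (rule conormal_eq[OF tangent[OF pS]])
    show "\<gamma> (arc U s) \<bullet> T U s = 0" unfolding g by (rule t(3))
    show "T U s $ 3 > 0" by (simp add: t(4))
    fix v :: "real^3"
    assume v: "\<gamma> (arc U s) \<bullet> v = 0" "v $ 3 = 0"
    obtain x y where xy: "v = x *\<^sub>R T U s + y *\<^sub>R (N ?w \<times> T U s)"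
      using orthogonal_plane_decomposition[OF norm_N[OF wO] t(3) _ t(7)] v(1) g by metis
    have "x = 0" using v(2) t(4,5) unfolding xy T'_def by simp
    then show "T U s \<bullet> v = 0" unfolding xy by (simp add: dot_cross_self)
  qed
qed

lemma measurable_conormal: "conormal S \<in> borel_measurable (restrict_space borel \<Sigma>)"
proof -
  have "continuous_on \<Sigma> (\<lambda>p. sgn (e3 - \<gamma> p $ 3 *\<^sub>R \<gamma> p))"
    using conormal_\<Sigma>(1) by (intro continuous_intros continuous_on_subset[OF cont_\<gamma> \<Sigma>(2)]) auto
  then have "continuous_on \<Sigma> (conormal S)" by (rule continuous_on_eq) (simp add: conormal_\<Sigma>(2))
  then show ?thesis by (rule borel_measurable_continuous_on_restrict)
qed

lemma integral_pieces:
  fixes g :: "complex set \<times> real \<Rightarrow> real"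
  assumes "integrable pieces g"
  shows "(\<integral>x. g x \<partial>pieces) = (\<Sum>U\<in>\<C>. \<integral>s. g (U, s) \<partial>lborel)"
proof -
  interpret C: sigma_finite_measure "count_space \<C>" by (rule sigma_finite_measure_count_space_finite[OF finite_\<C>])
  interpret P: pair_sigma_finite "count_space \<C>" "lborel :: real measure" ..
  have "(\<integral>x. g x \<partial>pieces) = (\<integral>U. \<integral>s. g (U, s) \<partial>lborel \<partial>count_space \<C>)"
    using P.integral_fst'[of g] assms by (simp add: pieces_def)
  also have "\<dots> = (\<Sum>U\<in>\<C>. \<integral>s. g (U, s) \<partial>lborel)" by (rule lebesgue_integral_count_space_finite[OF finite_\<C>])
  finally show ?thesis .
qed

text \<open>The arc-length density |T| cancels the normalization of the conormal, which leaves
  \<rho> T, the integrand of \<Phi>.\<close>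

theorem section_flow_eq: "section_flow S t0 $ j = \<Phi> j t0"
proof -
  let ?sp = "\<lambda>x. case x of (U, s) \<Rightarrow> speed U s"
  define H where "H x = ?sp x *\<^sub>R conormal S (arcm x)" for x
  have mc: "(\<lambda>x. conormal S (arcm x)) \<in> borel_measurable pieces"
    using measurable_arcm measurable_conormal by (rule measurable_compose)
  have ms: "?sp \<in> borel_measurable pieces"
    unfolding pieces_def
    by (rule measurable_pair_measure_countable1[OF countable_finite[OF finite_\<C>]]) (simp only: prod.case, rule measurable_speed_U)
  have mH: "H \<in> borel_measurable pieces" unfolding H_def using ms mc by (rule borel_measurable_scaleR)
  have dens: "density pieces (\<lambda>(U, s). ennreal (speed U s)) = density pieces (\<lambda>x. ennreal (?sp x))"
    by (intro arg_cong[of _ _ "density pieces"]) (auto simp: fun_eq_iff)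
  have pos: "AE x in pieces. 0 \<le> ?sp x"
    by (rule AE_I2) (auto simp: pieces_def space_pair_measure speed_nonneg)
  have "section_flow S t0 = (\<integral>p. conormal S p \<partial>section_measure)"
    by (simp add: section_flow_def arc_length_measure_eq[unfolded \<Sigma>_def])
  also have "\<dots> = (\<integral>x. conormal S (arcm x) \<partial>density pieces (\<lambda>x. ennreal (?sp x)))"
    unfolding section_measure_def dens
    by (rule integral_distr[OF _ measurable_conormal]) (use measurable_arcm in \<open>simp add: measurable_density_eq1\<close>)
  also have "\<dots> = (\<integral>x. H x \<partial>pieces)"
    unfolding H_def by (rule integral_density[OF mc ms pos])
  finally have flow: "section_flow S t0 = (\<integral>x. H x \<partial>pieces)" .
  \<comment> \<open>Integrability is what permits passing from the vector integral to its
    components.\<close>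
  have iH: "integrable pieces H"
  proof (rule integrableI_bounded[OF mH])
    have "(\<integral>\<^sup>+ x. ennreal (norm (H x)) \<partial>pieces) = (\<Sum>U\<in>\<C>. \<integral>\<^sup>+ s. ennreal (norm (H (U, s))) \<partial>lborel)"
      using mH by (intro nn_integral_pieces) measurable
    also have "\<dots> < \<infinity>"
    proof -
      have "(\<integral>\<^sup>+ s. ennreal (norm (H (U, s))) \<partial>lborel) < \<infinity>" if U: "U \<in> \<C>" for U
      proof -
        have "(\<integral>\<^sup>+ s. ennreal (norm (H (U, s))) \<partial>lborel) \<le> (\<integral>\<^sup>+ s. ennreal (norm (speed U s)) \<partial>lborel)"
        proof (intro nn_integral_mono ennreal_leI)
          fix s
          have "norm (conormal S (arcm (U, s))) \<le> 1"
            using conormal_\<Sigma>(2)[OF arcm_in[OF U]] by (simp add: norm_sgn)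
          then show "norm (H (U, s)) \<le> norm (speed U s)" by (simp add: H_def mult_left_le)
        qed
        also have "\<dots> < \<infinity>"
          using speed_integrable[OF U] unfolding set_integrable_def integrable_iff_bounded
          by (simp only: speed_def)
        finally show ?thesis .
      qed
      then show ?thesis using finite_\<C> by (simp add: less_top)
    qed
    finally show "(\<integral>\<^sup>+ x. ennreal (norm (H x)) \<partial>pieces) < \<infinity>" .
  qed
  have "section_flow S t0 $ j = (\<integral>x. H x $ j \<partial>pieces)"
    unfolding flow using integral_bounded_linear[OF bounded_linear_vec_nth iH, of j] by simp
  also have "\<dots> = (\<Sum>U\<in>\<C>. \<integral>s. H (U, s) $ j \<partial>lborel)"
    by (rule integral_pieces) (rule integrable_bounded_linear[OF bounded_linear_vec_nth iH])
  also have "\<dots> = \<Phi> j t0"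
    unfolding \<Phi>_def
  proof (intro sum.cong refl Bochner_Integration.integral_cong)
    fix U s assume U: "U \<in> \<C>"
    show "H (U, s) $ j = G j U (Complex t0 s)"
    proof (cases "s \<in> J U")
      case True
      have "norm (T U s) * (sgn (T U s) $ j) = T U s $ j" using T_eq(7)[OF U True] by (simp add: sgn_div_norm)
      then show ?thesis
        using True J_Q[OF U True] conormal_arc[OF U True] by (simp add: H_def speed_def arcm_def G_def T_def)
    next
      case False
      then have "Complex t0 s \<notin> Q U" by (auto simp: square_def)
      then show ?thesis using False by (simp add: H_def speed_def G_def)
    qed
  qed
  finally show ?thesis .
qed

text \<open>The vertical component of \<open>velocity\<close> is 1, so the flux is a sum of
  integrals of the weights \<rho> along the arcs, and one weight is positive near some point of the
  section.\<close>

lemma \<Phi>3_pos: "\<Phi> 3 t0 > 0"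
proof -
  obtain w where w: "w \<in> slab t0 t0" using section_ne by blast
  then have "X w \<in> \<Sigma>" by (rule \<Sigma>(3))
  then have wC: "w \<in> \<Union>\<C>" using \<Sigma>_cover homD(2)[of w] w slab(2) by force
  have "(\<Sum>U\<in>\<C>. \<rho> U w) \<noteq> 0" using \<rho>_sum[OF wC] by simp
  then obtain U where U: "U \<in> \<C>" "\<rho> U w \<noteq> 0" by (elim sum.not_neutral_contains_not_neutral) blast
  have wU: "w \<in> U" using \<rho>_zero[OF U(1) wC] U(2) by blast
  then obtain z where z: "z \<in> Q U" "w = \<kappa> U z" using U_eq[OF U(1)] by blast
  have "Re z = t0" using boxD(8)[OF U(1)] boxD(4)[OF U(1)] z w by (auto simp: slab_def)
  then have zt: "z = Complex t0 (Im z)" by (simp add: complex_eq_iff)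
  let ?s = "Im z"
  have sJ: "?s \<in> J U" using z by (auto simp: square_def)
  define r where "r s = \<rho> U (\<kappa> U (Complex t0 s))" for s
  have r0: "r ?s > 0" using U(2) \<rho>_bounds[OF U(1) wC] zt z(2) by (simp add: r_def)
  have G3: "G 3 V' (Complex t0 s) = indicator (J V') s * \<rho> V' (\<kappa> V' (Complex t0 s))" if V': "V' \<in> \<C>" for V' s
  proof (cases "s \<in> J V'")
    case True
    have "velocity 3 V' (Complex t0 s) = 1" using T_eq(4)[OF V' True] by (simp add: T_def)
    then show ?thesis using True J_Q[OF V' True] by (simp add: G_def)
  next
    case False
    then have "Complex t0 s \<notin> Q V'" by (auto simp: square_def)
    then show ?thesis using False by (simp add: G_def)
  qed
  have Gnn: "G 3 V' (Complex t0 s) \<ge> 0" if "V' \<in> \<C>" for V' s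
    unfolding G3[OF that] using \<rho>_\<kappa>_bounds[OF that J_Q[OF that]] by (simp add: indicator_def)
  have int: "integrable lborel (\<lambda>s. G 3 U (Complex t0 s))"
  proof -
    have "set_integrable lborel (J U) (\<lambda>s. \<rho> U (\<kappa> U (Complex t0 s)))"
    proof (rule set_integrable_bounded_continuous[OF _ _ arc_facts(8)[OF U(1)]])
      show "\<bar>\<rho> U (\<kappa> U (Complex t0 s))\<bar> \<le> 1" if "s \<in> J U" for s using \<rho>_\<kappa>_bounds[OF U(1) J_Q[OF U(1) that]] by simp
    qed auto
    then show ?thesis unfolding set_integrable_def G3[OF U(1)] by simp
  qed
  have "isCont r ?s" using arc_facts(8)[OF U(1)] sJ unfolding r_def[symmetric] by (simp add: continuous_on_eq_continuous_at)
  then obtain d where d: "d > 0" "\<And>s. dist s ?s < d \<Longrightarrow> dist (r s) (r ?s) < r ?s / 2"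
    using r0 unfolding continuous_at_eps_delta by (meson half_gt_zero)
  obtain e where e: "e > 0" "ball ?s e \<subseteq> J U" using openE[OF _ sJ] by auto
  define \<epsilon> where "\<epsilon> = min d e / 2"
  have \<epsilon>: "\<epsilon> > 0" "\<epsilon> < d" "\<epsilon> < e" using d(1) e(1) by (auto simp: \<epsilon>_def)
  have "0 < r ?s * \<epsilon>" using r0 \<epsilon> by simp
  also have "\<dots> = (\<integral>s. indicator {?s - \<epsilon>..?s + \<epsilon>} s *\<^sub>R (r ?s / 2) \<partial>lborel)" using \<epsilon>(1) by simp
  also have "\<dots> \<le> (\<integral>s. G 3 U (Complex t0 s) \<partial>lborel)"
  proof (rule integral_mono[OF _ int])
    fix s
    show "indicator {?s - \<epsilon>..?s + \<epsilon>} s *\<^sub>R (r ?s / 2) \<le> G 3 U (Complex t0 s)"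
    proof (cases "s \<in> {?s - \<epsilon>..?s + \<epsilon>}")
      case True
      have ds: "dist s ?s \<le> \<epsilon>" unfolding dist_real_def by (rule abs_leI) (use True in auto)
      then have "s \<in> J U" using e(2) \<epsilon>(3) by (auto simp: dist_commute subset_iff)
      moreover have "dist (r s) (r ?s) < r ?s / 2" using d(2)[of s] ds \<epsilon>(2) by simp
      then have "r ?s / 2 \<le> r s" unfolding dist_real_def abs_less_iff by linarith
      ultimately show ?thesis unfolding G3[OF U(1)] r_def[symmetric] using True by simp
    next
      case False
      then show ?thesis using Gnn[OF U(1)] by simp
    qed
  qed (intro integrable_scaleR_left integrable_real_indicator, auto simp: emeasure_lborel_Icc_eq)
  also have "\<dots> \<le> \<Phi> 3 t0"
    unfolding \<Phi>_def using U(1) finite_\<C> Gnn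
    by (intro member_le_sum) (auto intro!: Bochner_Integration.integral_nonneg)
  finally show ?thesis .
qed

end

section \<open>Flow vectors of minimal tubes\<close>

text \<open>The tangent space is defined through all charts at once. The Gauss map bounds it from
  above, and the two derivatives of a single chart already span the orthogonal plane.\<close>

lemma tangent_space_eq:
  assumes S: "embedded_surface S" and gauss: "gauss_map S \<gamma>" and p: "p \<in> S"
  shows "tangent_space S p = {v. \<gamma> p \<bullet> v = 0}"
proof
  show "tangent_space S p \<subseteq> {v. \<gamma> p \<bullet> v = 0}" using gauss p by (auto simp: gauss_map_def)
  obtain \<phi> W where lp: "local_param S \<phi> W" and "p \<in> \<phi> ` W"
    using S p unfolding embedded_surface_def by blast
  then obtain w where w: "w \<in> W" "\<phi> w = p" by blast
  let ?p = "pd 1 \<phi> w" and ?q = "pd 2 \<phi> w"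
  have span: "x *\<^sub>R ?p + y *\<^sub>R ?q \<in> tangent_space S p" for x y
  proof -
    have "x *\<^sub>R ?p + y *\<^sub>R ?q = frechet_derivative \<phi> (at w) (vector [x, y])"
      by (simp add: frechet_derivative_pd[OF local_param_facts(1)[OF lp w(1)]])
    then show ?thesis unfolding tangent_space_def using lp w by blast
  qed
  have n: "norm (\<gamma> p) = 1" "\<gamma> p \<bullet> ?p = 0" "\<gamma> p \<bullet> ?q = 0"
    using gauss p span[of 1 0] span[of 0 1] by (simp_all add: gauss_map_def)
  have pq: "?p \<times> ?q \<noteq> 0" by (rule local_param_facts(5)[OF lp w(1)])
  then have p0: "?p \<noteq> 0" by auto
  obtain a b where ab: "?q = a *\<^sub>R ?p + b *\<^sub>R (\<gamma> p \<times> ?p)"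
    by (rule orthogonal_plane_decomposition[OF n p0])
  have b: "b \<noteq> 0"
  proof
    assume "b = 0"
    with ab have "?q = a *\<^sub>R ?p" by simp
    then have "?p \<times> ?q = 0" by (simp only: cross_mult_right cross_refl scaleR_zero_right)
    with pq show False by simp
  qed
  have np: "\<gamma> p \<times> ?p = (1 / b) *\<^sub>R (?q - a *\<^sub>R ?p)" using ab b by simp
  show "{v. \<gamma> p \<bullet> v = 0} \<subseteq> tangent_space S p"
  proof clarify
    fix v assume v: "\<gamma> p \<bullet> v = 0"
    obtain x y where xy: "v = x *\<^sub>R ?p + y *\<^sub>R (\<gamma> p \<times> ?p)"
      by (rule orthogonal_plane_decomposition[OF n(1,2) v p0])
    have "v = (x - y * a / b) *\<^sub>R ?p + (y / b) *\<^sub>R ?q"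
      unfolding xy np by (simp add: algebra_simps)
    then show "v \<in> tangent_space S p" using span by simp
  qed
qed

text \<open>The partial derivative of \<open>inv_stereo\<close> along one coordinate
  \<open>x\<close> of the plane, with \<open>d\<close> the matching frame vector: the pairs used are
  (a, Re) and (b, Im).\<close>

definition inv_stereo_pd :: "real^3 \<Rightarrow> real^3 \<Rightarrow> real^3 \<Rightarrow> real^3 \<Rightarrow> (complex \<Rightarrow> real) \<Rightarrow> complex \<Rightarrow> real^3" where
  "inv_stereo_pd a b c d x w = (2 / (1 + (cmod w)\<^sup>2)) *\<^sub>R d
     - (4 * x w / (1 + (cmod w)\<^sup>2)\<^sup>2) *\<^sub>R (Re w *\<^sub>R a + Im w *\<^sub>R b - c)"

lemma one_plus_cmod: "1 + (cmod w)\<^sup>2 > 0"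
  by (simp add: add_pos_nonneg)

lemma inv_stereo_has_derivative:
  "(inv_stereo a b c has_derivative
     (\<lambda>h. Re h *\<^sub>R inv_stereo_pd a b c a Re w + Im h *\<^sub>R inv_stereo_pd a b c b Im w)) (at w)"
proof -
  define D where "D = 1 + (cmod w)\<^sup>2"
  have D: "D > 0" "D = 1 + ((Re w)\<^sup>2 + (Im w)\<^sup>2)" unfolding D_def using one_plus_cmod by (auto simp: cmod_power2)
  let ?M = "\<lambda>w. Re w *\<^sub>R a + Im w *\<^sub>R b - c"
  have k: "((\<lambda>w. 2 / (1 + (cmod w)\<^sup>2)) has_derivative (\<lambda>h. - (4 * (Re w * Re h + Im w * Im h) / D\<^sup>2))) (at w)"
    unfolding cmod_power2 using D
    by (auto intro!: derivative_eq_intros simp: fun_eq_iff field_simps power2_eq_square; simp add: minus_divide_left)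
  have M: "(?M has_derivative (\<lambda>h. Re h *\<^sub>R a + Im h *\<^sub>R b)) (at w)"
    by (auto intro!: derivative_eq_intros)
  have "((\<lambda>w. c + (2 / (1 + (cmod w)\<^sup>2)) *\<^sub>R ?M w) has_derivative
      (\<lambda>h. 0 + ((2 / (1 + (cmod w)\<^sup>2)) *\<^sub>R (Re h *\<^sub>R a + Im h *\<^sub>R b) + (- (4 * (Re w * Re h + Im w * Im h) / D\<^sup>2)) *\<^sub>R ?M w))) (at w)"
    by (intro has_derivative_add has_derivative_const has_derivative_scaleR k M)
  moreover have "(\<lambda>h. 0 + ((2 / (1 + (cmod w)\<^sup>2)) *\<^sub>R (Re h *\<^sub>R a + Im h *\<^sub>R b) + (- (4 * (Re w * Re h + Im w * Im h) / D\<^sup>2)) *\<^sub>R ?M w))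
      = (\<lambda>h. Re h *\<^sub>R inv_stereo_pd a b c a Re w + Im h *\<^sub>R inv_stereo_pd a b c b Im w)"
  proof
    fix h
    define x y k m where "x = Re h" and "y = Im h" and "k = 2 / D" and "m = ?M w"
    have *: "- (4 * (Re w * x + Im w * y) / D\<^sup>2) = - x * (4 * Re w / D\<^sup>2) - y * (4 * Im w / D\<^sup>2)"
      by (simp add: add_divide_distrib algebra_simps)
    have "0 + (k *\<^sub>R (x *\<^sub>R a + y *\<^sub>R b) + (- x * (4 * Re w / D\<^sup>2) - y * (4 * Im w / D\<^sup>2)) *\<^sub>R m)
       = x *\<^sub>R (k *\<^sub>R a - (4 * Re w / D\<^sup>2) *\<^sub>R m) + y *\<^sub>R (k *\<^sub>R b - (4 * Im w / D\<^sup>2) *\<^sub>R m)"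
      by (simp add: scaleR_add_right scaleR_diff_right scaleR_add_left scaleR_diff_left mult.commute)
    then show "0 + ((2 / (1 + (cmod w)\<^sup>2)) *\<^sub>R (Re h *\<^sub>R a + Im h *\<^sub>R b) + (- (4 * (Re w * Re h + Im w * Im h) / D\<^sup>2)) *\<^sub>R ?M w)
      = Re h *\<^sub>R inv_stereo_pd a b c a Re w + Im h *\<^sub>R inv_stereo_pd a b c b Im w"
      unfolding inv_stereo_pd_def D_def[symmetric] x_def[symmetric] y_def[symmetric] k_def[symmetric] m_def[symmetric] * .
  qed
  ultimately show ?thesis unfolding inv_stereo_def[abs_def] by simp
qed

text \<open>With D = 1+|w|^2 the vector in the second term has length sqrt D, and |x w| is at most
  sqrt D, so the terms contribute at most 2/D and 4/D. The constant 10 is generous.\<close>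

lemma inv_stereo_pd_bound:
  assumes fr: "oriented_frame a b c" and d: "norm d = 1" and x: "\<bar>x w\<bar> \<le> cmod w"
  shows "norm (inv_stereo_pd a b c d x w) \<le> 10 / (1 + (cmod w)\<^sup>2)"
proof -
  note i = oriented_frame_inner[OF fr]
  define D where "D = 1 + (cmod w)\<^sup>2"
  have D: "D > 0" unfolding D_def by (rule one_plus_cmod)
  let ?M = "Re w *\<^sub>R a + Im w *\<^sub>R b - c"
  have "(norm ?M)\<^sup>2 = D"
    unfolding power2_norm_eq_inner[of ?M] D_def cmod_power2
    by (simp add: inner_diff_left inner_diff_right inner_add_left inner_add_right i power2_eq_square)
  then have M: "norm ?M = sqrt D" using norm_ge_zero real_sqrt_unique by metis
  have "cmod w \<le> sqrt D" unfolding D_def by (rule real_le_rsqrt) simp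
  then have xM: "\<bar>x w\<bar> * norm ?M \<le> D" unfolding M using x D mult_mono[of "\<bar>x w\<bar>" "sqrt D" "sqrt D" "sqrt D"] by simp
  have "norm (inv_stereo_pd a b c d x w) \<le> norm ((2 / D) *\<^sub>R d) + norm ((4 * x w / D\<^sup>2) *\<^sub>R ?M)"
    unfolding inv_stereo_pd_def D_def[symmetric] by (rule norm_triangle_ineq4)
  also have "\<dots> = 2 / D + 4 * (\<bar>x w\<bar> * norm ?M) / D\<^sup>2" using D d by (simp add: abs_mult)
  also have "\<dots> \<le> 2 / D + 4 * D / D\<^sup>2" using xM by (intro add_left_mono divide_right_mono mult_left_mono) auto
  also have "\<dots> \<le> 10 / D" using D by (simp add: power2_eq_square field_simps)
  finally show ?thesis unfolding D_def .
qed

lemma continuous_on_inv_stereo_pd: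
  assumes "continuous_on A x"
  shows "continuous_on A (inv_stereo_pd a b c d x)"
  unfolding inv_stereo_pd_def[abs_def] using one_plus_cmod
  by (intro continuous_intros assms) (auto simp: order_less_imp_not_eq2)

lemma minimal_tube_gauss_chart:
  assumes tube: "tube S I" and min: "minimal_surface S" and gauss: "gauss_map S \<gamma>" and inj: "inj_on \<gamma> S"
    and nc: "\<not> compact S"
  obtains \<Omega> X N E N1 N2 \<sigma> where "conformal_tube \<Omega> X N E N1 N2 I" "homeomorphism \<Omega> S X \<sigma>"
    "\<And>w. w \<in> \<Omega> \<Longrightarrow> \<gamma> (X w) = N w"
proof -
  obtain c where c: "norm c = 1" "c \<notin> \<gamma> ` S" by (rule gauss_map_not_onto[OF min gauss inj nc])
  obtain a b where fr: "oriented_frame a b c" by (rule oriented_frame_exists[OF c(1)])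
  have ab: "norm a = 1" "norm b = 1" using fr by (auto simp: oriented_frame_def)
  define \<sigma> where "\<sigma> s = stereo a b c (\<gamma> s)" for s
  define \<Omega> where "\<Omega> = \<sigma> ` S"
  let ?N = "inv_stereo a b c"
  \<comment> \<open>The pole is a value that the Gauss map omits, so the coordinate covers the whole
    surface.\<close>
  have S': "{s \<in> S. \<gamma> s \<noteq> c} = S" using c(2) by auto
  obtain X E where XE: "open \<Omega>" "homeomorphism \<Omega> S X \<sigma>" "\<And>w. w \<in> \<Omega> \<Longrightarrow> \<gamma> (X w) = ?N w"
    "\<And>w. w \<in> \<Omega> \<Longrightarrow> (X has_derivative (\<lambda>h. Re h *\<^sub>R E w + Im h *\<^sub>R (?N w \<times> E w))) (at w)"
    "\<And>w. w \<in> \<Omega> \<Longrightarrow> ?N w \<bullet> E w = 0" "\<And>w. w \<in> \<Omega> \<Longrightarrow> E w \<noteq> 0"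
    "\<And>j. (\<lambda>w. Complex (E w $ j) (- ((?N w \<times> E w) $ j))) holomorphic_on \<Omega>"
    by (rule gauss_coordinate[OF min gauss inj fr, unfolded S', folded \<sigma>_def[abs_def], folded \<Omega>_def]) (rule that; assumption)
  have "conformal_tube \<Omega> X ?N E (inv_stereo_pd a b c a Re) (inv_stereo_pd a b c b Im) I"
  proof
    show "open \<Omega>" "\<And>j. (\<lambda>w. Complex (E w $ j) (- ((?N w \<times> E w) $ j))) holomorphic_on \<Omega>" by fact+
    show "open I" "is_interval I" using tube by (auto simp: tube_def)
    show "continuous_on \<Omega> (inv_stereo_pd a b c a Re)" "continuous_on \<Omega> (inv_stereo_pd a b c b Im)"
      by (intro continuous_on_inv_stereo_pd continuous_intros)+
    fix w assume w: "w \<in> \<Omega>"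
    show "(X has_derivative (\<lambda>h. Re h *\<^sub>R E w + Im h *\<^sub>R (?N w \<times> E w))) (at w)" "?N w \<bullet> E w = 0" "E w \<noteq> 0"
      using XE w by auto
    show "norm (?N w) = 1" by (rule inv_stereo_facts(1)[OF fr])
    show "(?N has_derivative (\<lambda>h. Re h *\<^sub>R inv_stereo_pd a b c a Re w + Im h *\<^sub>R inv_stereo_pd a b c b Im w)) (at w)"
      by (rule inv_stereo_has_derivative)
    show "norm (inv_stereo_pd a b c a Re w) \<le> 10 / (1 + (cmod w)\<^sup>2)"
      by (rule inv_stereo_pd_bound[OF fr ab(1) abs_Re_le_cmod])
    show "norm (inv_stereo_pd a b c b Im w) \<le> 10 / (1 + (cmod w)\<^sup>2)"
      by (rule inv_stereo_pd_bound[OF fr ab(2) abs_Im_le_cmod])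
  next
    fix t1 t2 assume t: "t1 \<in> I" "t2 \<in> I"
    let ?P = "S \<inter> {p. t1 \<le> p $ 3 \<and> p $ 3 \<le> t2}"
    have "continuous_on ?P \<sigma>" using XE(2) by (rule continuous_on_subset[OF homeomorphism_cont2]) blast
    moreover have "compact ?P" using tube t by (simp add: tube_def)
    ultimately have "compact (\<sigma> ` ?P)" by (rule compact_continuous_image)
    moreover have "\<sigma> ` ?P = {w \<in> \<Omega>. t1 \<le> X w $ 3 \<and> X w $ 3 \<le> t2}"
      using homeomorphism_apply2[OF XE(2)] by (auto simp: \<Omega>_def)
    ultimately show "compact {w \<in> \<Omega>. t1 \<le> X w $ 3 \<and> X w $ 3 \<le> t2}" by simp
  qed
  then show thesis using XE(2,3) by (rule that)
qed

lemma unit_nth_3_squared_eq_1: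
  fixes n :: "real^3"
  assumes n: "norm n = 1" "n $ 3 * n $ 3 = 1"
  shows "n = e3 \<or> n = - e3"
proof -
  have e: "norm e3 = 1" "n \<bullet> e3 = n $ 3" by (simp_all add: e3_def inner_axis norm_axis_1)
  have "n $ 3 = 1 \<or> n $ 3 = - 1" using n(2) by (simp add: square_eq_1_iff)
  then show ?thesis
  proof
    assume "n $ 3 = 1"
    then show ?thesis using unit_inner_eq_1[OF n(1) e(1)] e(2) by simp
  next
    assume m: "n $ 3 = - 1"
    have "- n = e3" by (rule unit_inner_eq_1) (use n e m in simp_all)
    then show ?thesis by (metis minus_minus)
  qed
qed

text \<open>At a critical point of the height the normal is \<open>e3\<close> or its opposite. By
  injectivity there are at most two such points, so at most two heights are excluded from the
  infinite set \<open>I\<close>.\<close>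

lemma tube_regular_value_exists:
  assumes tube: "tube S I" and gauss: "gauss_map S \<gamma>" and inj: "inj_on \<gamma> S"
  obtains t where "t \<in> I" "regular_value S t"
proof -
  have S: "embedded_surface S" and I: "open I" "I \<noteq> {}" using tube by (auto simp: tube_def)
  have "finite (S \<inter> \<gamma> -` {e3, - e3})" using inj by (intro finite_vimage_IntI[of "{e3, - e3}" \<gamma> S, simplified Int_commute]) auto
  then have "finite ((\<lambda>p. p $ 3) ` (S \<inter> \<gamma> -` {e3, - e3}))" by simp
  moreover have "infinite I" using I finite_imp_not_open by blast
  ultimately obtain t where t: "t \<in> I" "t \<notin> (\<lambda>p. p $ 3) ` (S \<inter> \<gamma> -` {e3, - e3})"
    by (meson finite_subset subsetI)
  have "regular_value S t"
    unfolding regular_value_def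
  proof
    fix p assume p: "p \<in> cross_section S t"
    then have pS: "p \<in> S" and p3: "p $ 3 = t" by (auto simp: cross_section_def height_plane_def)
    have n: "norm (\<gamma> p) = 1" using gauss pS by (simp add: gauss_map_def)
    have "\<gamma> p \<noteq> e3 \<and> \<gamma> p \<noteq> - e3" using t(2) pS p3 by auto
    then have "\<gamma> p $ 3 * \<gamma> p $ 3 \<noteq> 1" using unit_nth_3_squared_eq_1[OF n] by blast
    moreover have "(e3 - \<gamma> p $ 3 *\<^sub>R \<gamma> p) $ 3 = 1 - \<gamma> p $ 3 * \<gamma> p $ 3" by (simp add: e3_def)
    moreover have "\<gamma> p \<bullet> (e3 - \<gamma> p $ 3 *\<^sub>R \<gamma> p) = 0"
      using n by (simp add: inner_diff_right norm_eq_1) (simp add: e3_def inner_axis)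
    ultimately show "\<exists>v\<in>tangent_space S p. v $ 3 \<noteq> 0"
      unfolding tangent_space_eq[OF S gauss pS] by (intro bexI[of _ "e3 - \<gamma> p $ 3 *\<^sub>R \<gamma> p"]) auto
  qed
  with t(1) show thesis by (rule that)
qed

lemma long_tube_section_flow:
  assumes tube: "tube S I" and min: "minimal_surface S" and gauss: "gauss_map S \<gamma>" and inj: "inj_on \<gamma> S"
    and nc: "\<not> compact S" and t0: "t0 \<in> I" and reg: "regular_value S t0"
    and long: "\<And>L. \<exists>T. {T..T + L} \<subseteq> I"
  shows "section_flow S t0 $ 1 = 0" "section_flow S t0 $ 2 = 0" "section_flow S t0 $ 3 > 0"
proof -
  have S: "embedded_surface S" using tube by (simp add: tube_def)
  obtain \<Omega> X N E N1 N2 \<sigma> where ct: "conformal_tube \<Omega> X N E N1 N2 I" and hom: "homeomorphism \<Omega> S X \<sigma>"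
    and \<gamma>X: "\<And>w. w \<in> \<Omega> \<Longrightarrow> \<gamma> (X w) = N w"
    by (rule minimal_tube_gauss_chart[OF tube min gauss inj nc]) (rule that; assumption)
  have XS: "X w \<in> S" if "w \<in> \<Omega>" for w using homeomorphism_image1[OF hom] that by blast
  interpret conformal_tube \<Omega> X N E N1 N2 I by (rule ct)
  \<comment> \<open>If \<open>f 3\<close> vanished, both \<open>E\<close> and its rotation would be
    horizontal, and with them the whole tangent plane.\<close>
  have regular: "f 3 w \<noteq> 0" if w: "w \<in> slab t0 t0" for w
  proof
    assume f0: "f 3 w = 0"
    have wO: "w \<in> \<Omega>" and w3: "X w $ 3 = t0" using w by (auto simp: slab_def u_def)
    have E3: "E w $ 3 = 0" "(N w \<times> E w) $ 3 = 0" using f0 by (simp_all add: f_def complex_eq_iff)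
    have "X w \<in> cross_section S t0" using XS[OF wO] w3 by (simp add: cross_section_def height_plane_def)
    then obtain v :: "real^3" where v: "v \<in> tangent_space S (X w)" "v $ 3 \<noteq> 0" using reg unfolding regular_value_def by blast
    have "N w \<bullet> v = 0" using v(1) \<gamma>X[OF wO] by (simp add: tangent_space_eq[OF S gauss XS[OF wO]])
    then obtain x y where "v = x *\<^sub>R E w + y *\<^sub>R (N w \<times> E w)"
      by (rule orthogonal_plane_decomposition[OF norm_N[OF wO] N_orth[OF wO] _ E_ne[OF wO]])
    then have "v $ 3 = 0" by (simp add: E3)
    with v(2) show False by simp
  qed
  interpret conformal_tube_section \<Omega> X N E N1 N2 I t0
    by (rule conformal_tube_section.intro[OF ct], rule conformal_tube_section_axioms.intro) (rule t0, rule regular)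
  obtain \<C> :: "complex set set" and \<kappa> \<delta> V \<rho> \<eta> where part:
    "finite \<C>" "\<And>U. U \<in> \<C> \<Longrightarrow> flow_box (\<kappa> U) (\<delta> U) (V U) \<and> U = \<kappa> U ` square t0 (\<delta> U)"
    "\<And>U. U \<in> \<C> \<Longrightarrow> open U"
    "\<And>U. U \<in> \<C> \<Longrightarrow> continuous_on (\<Union>\<C>) (\<rho> U)" "\<And>U w. U \<in> \<C> \<Longrightarrow> w \<in> \<Union>\<C> \<Longrightarrow> 0 \<le> \<rho> U w \<and> \<rho> U w \<le> (1::real)"
    "\<And>U w. U \<in> \<C> \<Longrightarrow> w \<in> \<Union>\<C> \<Longrightarrow> w \<notin> U \<Longrightarrow> \<rho> U w = 0"
    "\<And>w. w \<in> \<Union>\<C> \<Longrightarrow> (\<Sum>U\<in>\<C>. \<rho> U w) = 1"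
    "\<eta> > 0" "t0 - \<eta> \<in> I" "t0 + \<eta> \<in> I" "slab (t0 - \<eta>) (t0 + \<eta>) \<subseteq> \<Union>\<C>" "\<And>U. U \<in> \<C> \<Longrightarrow> \<eta> < \<delta> U"
    by (rule flow_box_partition) (rule that; assumption)
  have "section_partition_axioms \<Omega> X N E I t0 \<C> \<kappa> \<delta> V \<rho> \<eta>"
  proof (rule section_partition_axioms.intro)
    show "flow_box (\<kappa> U) (\<delta> U) (V U)" "\<kappa> U ` square t0 (\<delta> U) = U" if "U \<in> \<C>" for U
      using part(2)[OF that] by (simp_all only: simp_thms)
  qed (fact part)+
  then interpret section_partition \<Omega> X N E N1 N2 I t0 \<C> \<kappa> \<delta> V \<rho> \<eta>
    by (rule section_partition.intro[OF conformal_tube_section_axioms])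
  have "surface_section_axioms \<Omega> X N t0 S \<gamma> \<sigma>"
  proof (rule surface_section_axioms.intro)
    show "tangent_space S p = {v. \<gamma> p \<bullet> v = 0}" if "p \<in> S" for p by (rule tangent_space_eq[OF S gauss that])
    show "continuous_on S \<gamma>" using gauss by (simp add: gauss_map_def)
    have "cross_section S t0 \<noteq> {}" using tube t0 by (simp add: tube_def)
    then obtain p :: "real^3" where "p \<in> S" "p $ 3 = t0" by (auto simp: cross_section_def height_plane_def)
    then have "\<sigma> p \<in> slab t0 t0"
      using homeomorphism_apply2[OF hom] homeomorphism_image2[OF hom] by (auto simp: slab_def u_def)
    then show "slab t0 t0 \<noteq> {}" by blast
  qed (fact hom, fact \<gamma>X)
  then interpret surface_section \<Omega> X N E N1 N2 I t0 \<C> \<kappa> \<delta> V \<rho> \<eta> S \<gamma> \<sigma>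
    by (rule surface_section.intro[OF section_partition_axioms])
  have "\<Phi> j t0 = 0" if "j = 1 \<or> j = 2" for j
    by (rule \<Phi>_zero) (rule flux_horizontal_zero[OF long that])
  then show "section_flow S t0 $ 1 = 0" "section_flow S t0 $ 2 = 0" by (simp_all add: section_flow_eq)
  show "section_flow S t0 $ 3 > 0" unfolding section_flow_eq by (rule \<Phi>3_pos)
qed

lemma interval_infinite_length:
  fixes I :: "real set"
  assumes I: "is_interval I" and inf: "emeasure lborel I = \<infinity>"
  shows "\<exists>T. {T..T + L} \<subseteq> I"
proof -
  have ub: "\<not> bounded I" using emeasure_bounded_finite[of I] inf by auto
  then have ne: "I \<noteq> {}" by auto
  then obtain x0 where x0: "x0 \<in> I" by blast
  have between: "z \<in> I" if "x \<in> I" "y \<in> I" "x \<le> z" "z \<le> y" for x y z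
    using I that unfolding is_interval_1 by blast
  have "\<not> (\<forall>x\<in>I. \<bar>x\<bar> \<le> \<bar>x0\<bar> + \<bar>L\<bar>)" using ub by (auto simp: bounded_iff)
  then obtain x where x: "x \<in> I" "\<bar>x0\<bar> + \<bar>L\<bar> < \<bar>x\<bar>" by (auto simp: not_le)
  show ?thesis
  proof (cases "x0 \<le> x")
    case True
    then have "x0 + L \<le> x" using x(2) by linarith
    then have "{x0..x0 + L} \<subseteq> I" using between[OF x0 x(1)] by auto
    then show ?thesis by blast
  next
    case False
    then have "x + L \<le> x0" using x(2) by linarith
    then have "{x..x + L} \<subseteq> I" using between[OF x(1) x0] by auto
    then show ?thesis by blast
  qed
qed

theorem corollary1:
  fixes S :: "(real^3) set" and I :: "real set" and \<gamma> :: "real^3 \<Rightarrow> real^3"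
  assumes "tube S I"
    and "minimal_surface S"
    and "gauss_map S \<gamma>"
    and "inj_on \<gamma> S"
    and "angle_between (flow_vector S I) e3 > 0"
  shows "life_time I < \<infinity>"
proof (rule ccontr)
  assume "\<not> life_time I < \<infinity>"
  then have inf: "emeasure lborel I = \<infinity>" by (simp add: life_time_def flip: top.not_eq_extremum)
  have I: "is_interval I" and ne: "\<And>t. t \<in> I \<Longrightarrow> cross_section S t \<noteq> {}" using assms(1) by (auto simp: tube_def)
  note long = interval_infinite_length[OF I inf]
  have nc: "\<not> compact S"
  proof
    assume "compact S"
    then have "bounded ((\<lambda>p. p $ 3) ` S)"
      by (intro compact_imp_bounded compact_continuous_image continuous_intros)
    moreover have "I \<subseteq> (\<lambda>p. p $ 3) ` S"
      using ne by (fastforce simp: cross_section_def height_plane_def)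
    ultimately have "bounded I" by (rule bounded_subset)
    then show False using emeasure_bounded_finite[of I] inf by simp
  qed
  \<comment> \<open>The very level selected by \<open>flow_vector\<close>. Since the result on
    sections holds for every regular level, independence of the choice need not be shown
    separately.\<close>
  define t0 where "t0 = (SOME t. t \<in> I \<and> regular_value S t)"
  have "t0 \<in> I \<and> regular_value S t0"
    unfolding t0_def by (rule someI_ex) (rule tube_regular_value_exists[OF assms(1,3,4)], blast)
  then have t0: "t0 \<in> I" "regular_value S t0" by blast+
  define F where "F = flow_vector S I"
  note flow = long_tube_section_flow[OF assms(1-4) nc t0 long,
      folded flow_vector_def[of S I, folded t0_def], folded F_def]
  \<comment> \<open>The vertical component must be positive, not just the horizontal ones zero: for
    the zero vector \<open>angle_between\<close> would be arccos 0, which is positive.\<close>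
  have "F = F $ 3 *\<^sub>R e3" using flow by (simp add: vec_eq_iff forall_3 e3_def axis_def)
  then obtain c where c: "c > 0" "F = c *\<^sub>R e3" using flow(3) by blast
  have "e3 \<bullet> e3 = 1" "norm e3 = 1" by (simp_all add: e3_def inner_axis norm_axis_1)
  then have "angle_between F e3 = 0" using c by (simp add: angle_between_def)
  with assms(5) show False by (simp add: F_def)
qed

end
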